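(* Let $G$ be a prosoluble group with PIG. Then $G$ is virtually pronilpotent-by-metabelian; that is, $G$ has an open normal subgroup $H$ which has a closed normal pronilpotent subgroup $K$ such that $H/K$ is metabelian.
   Context: A prosoluble (resp. pronilpotent) group is an inverse limit of finite soluble (resp. finite nilpotent) groups. A profinite group $G$ has PIG if there is a constant $\alpha$ such that for every continuous finite quotient $\overline{G}$ of $G$ one has $|\overline{G}/\overline{G}^{\,n}|\le n^{\alpha}$ for all $n\in\mathbb{N}$, where $\overline{G}^{\,n}$ denotes the subgroup generated by all $n$-th powers. *)

theory Defs
  imports
    "HOL-Analysis.Function_Topology"
    "HOL-Analysis.Product_Topology"
    "HOL-Algebra.Product_Groups"
    "HOL-Algebra.Solvable_Groups"
begin

definition topological_group :: "('a, 'm) monoid_scheme \<Rightarrow> 'a topology \<Rightarrow> bool" where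
  "topological_group G T \<longleftrightarrow>
     group G \<and> topspace T = carrier G \<and>
     continuous_map (prod_topology T T) T (\<lambda>(x, y). x \<otimes>\<^bsub>G\<^esub> y) \<and>
     continuous_map T T (\<lambda>x. inv\<^bsub>G\<^esub> x)"

(* (i, j) \<in> r means i \<le> j; the transition map \<phi> i j then goes from F j to F i. *)
locale inverse_system =
  fixes I :: "'i set" and r :: "'i rel"
    and F :: "'i \<Rightarrow> ('b, 'm) monoid_scheme"
    and \<phi> :: "'i \<Rightarrow> 'i \<Rightarrow> 'b \<Rightarrow> 'b"
  assumes nonempty: "I \<noteq> {}"
    and partial_order: "partial_order_on I r"
    and directed: "\<And>i j. \<lbrakk>i \<in> I; j \<in> I\<rbrakk> \<Longrightarrow> \<exists>k\<in>I. (i, k) \<in> r \<and> (j, k) \<in> r"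
    and groups: "\<And>i. i \<in> I \<Longrightarrow> group (F i)"
    and homs: "\<And>i j. (i, j) \<in> r \<Longrightarrow> \<phi> i j \<in> hom (F j) (F i)"
    and transition_id: "\<And>i x. \<lbrakk>i \<in> I; x \<in> carrier (F i)\<rbrakk> \<Longrightarrow> \<phi> i i x = x"
    and transition_comp:
      "\<And>i j k x. \<lbrakk>(i, j) \<in> r; (j, k) \<in> r; x \<in> carrier (F k)\<rbrakk> \<Longrightarrow> \<phi> i j (\<phi> j k x) = \<phi> i k x"

definition inverse_limit ::
  "'i set \<Rightarrow> 'i rel \<Rightarrow> ('i \<Rightarrow> ('b, 'm) monoid_scheme) \<Rightarrow> ('i \<Rightarrow> 'i \<Rightarrow> 'b \<Rightarrow> 'b) \<Rightarrow> ('i \<Rightarrow> 'b) monoid" where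
  "inverse_limit I r F \<phi> =
     (product_group I F)\<lparr>carrier :=
        {x \<in> carrier (product_group I F). \<forall>(i, j)\<in>r. \<phi> i j (x j) = x i}\<rparr>"

(* The limit topology of discrete groups, as a subspace of their product. *)
definition inverse_limit_topology ::
  "'i set \<Rightarrow> 'i rel \<Rightarrow> ('i \<Rightarrow> ('b, 'm) monoid_scheme) \<Rightarrow> ('i \<Rightarrow> 'i \<Rightarrow> 'b \<Rightarrow> 'b) \<Rightarrow> ('i \<Rightarrow> 'b) topology" where
  "inverse_limit_topology I r F \<phi> =
     subtopology (product_topology (\<lambda>i. discrete_topology (carrier (F i))) I)
       (carrier (inverse_limit I r F \<phi>))"

(* Inverse limits of finite C-groups, for a class C of groups closed under isomorphism and subgroups.
   Fixing the two types loses nothing.  Every finite group is isomorphic to one with carrier in nat.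
   If G is the inverse limit of finite C-groups over any directed poset, then it is also the inverse
   limit of its quotients by the kernels of the projections to the members of the system; these
   kernels are sets of elements of G, directed by reverse inclusion, and the quotients embed into the
   members. *)
definition pro :: "(nat monoid \<Rightarrow> bool) \<Rightarrow> ('a, 'm) monoid_scheme \<Rightarrow> 'a topology \<Rightarrow> bool" where
  "pro C G T \<longleftrightarrow>
     topological_group G T \<and>
     (\<exists>(I :: 'a set set) r (F :: 'a set \<Rightarrow> nat monoid) \<phi>.
        inverse_system I r F \<phi> \<and>
        (\<forall>i\<in>I. finite (carrier (F i)) \<and> C (F i)) \<and>
        (\<exists>f \<in> iso G (inverse_limit I r F \<phi>).
           homeomorphic_map T (inverse_limit_topology I r F \<phi>) f))"

primrec lower_central_series :: "('a, 'm) monoid_scheme \<Rightarrow> nat \<Rightarrow> 'a set" where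
  "lower_central_series G 0 = carrier G"
| "lower_central_series G (Suc n) =
     generate G (\<Union>x \<in> lower_central_series G n. \<Union>y \<in> carrier G.
       {x \<otimes>\<^bsub>G\<^esub> y \<otimes>\<^bsub>G\<^esub> inv\<^bsub>G\<^esub> x \<otimes>\<^bsub>G\<^esub> inv\<^bsub>G\<^esub> y})"

definition nilpotent_group :: "('a, 'm) monoid_scheme \<Rightarrow> bool" where
  "nilpotent_group G \<longleftrightarrow> group G \<and> (\<exists>n. lower_central_series G n = {\<one>\<^bsub>G\<^esub>})"

definition metabelian :: "('a, 'm) monoid_scheme \<Rightarrow> bool" where
  "metabelian G \<longleftrightarrow> group G \<and> comm_group (G\<lparr>carrier := derived G (carrier G)\<rparr>)"

abbreviation prosoluble :: "('a, 'm) monoid_scheme \<Rightarrow> 'a topology \<Rightarrow> bool" where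
  "prosoluble \<equiv> pro solvable"

abbreviation pronilpotent :: "('a, 'm) monoid_scheme \<Rightarrow> 'a topology \<Rightarrow> bool" where
  "pronilpotent \<equiv> pro nilpotent_group"

definition power_subgroup :: "('a, 'm) monoid_scheme \<Rightarrow> nat \<Rightarrow> 'a set" where
  "power_subgroup G n = generate G ((\<lambda>x. x [^]\<^bsub>G\<^esub> n) ` carrier G)"

(* Continuous finite quotients are the finite quotients by open normal subgroups.  The exponent n
   ranges over the positive integers. *)
definition has_PIG :: "('a, 'm) monoid_scheme \<Rightarrow> 'a topology \<Rightarrow> bool" where
  "has_PIG G T \<longleftrightarrow>
     (\<exists>\<alpha> :: real. \<forall>N. N \<lhd> G \<and> openin T N \<and> finite (carrier (G Mod N)) \<longrightarrow>
        (\<forall>n :: nat. 1 \<le> n \<longrightarrow>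
           real (card (carrier ((G Mod N) Mod power_subgroup (G Mod N) n))) \<le> real n powr \<alpha>))"

end

theory Submission
  imports Defs
    "HOL-Algebra.Multiplicative_Group"
    "HOL-Algebra.Zassenhaus"
    "HOL-Algebra.SndIsomorphismGrp"
    "HOL-Algebra.Sylow"
    "HOL-Algebra.Subrings"
    "HOL-Library.Discrete_Functions"
    "HOL-Computational_Algebra.Primes"
    "HOL-Real_Asymp.Real_Asymp"
    "HOL-Analysis.T1_Spaces"
begin

text \<open>
  Let \<open>\<alpha>\<close> be the constant of polynomial index growth.  The heart of the matter is an exponent \<open>N\<close>,
  depending on \<open>\<alpha>\<close> only, such that in every finite continuous quotient \<open>Q\<close> of \<open>G\<close> the second derived
  subgroup of \<open>Q\<^sup>N\<close> centralizes all chief factors of \<open>Q\<close> (\<open>chief_factors_centralized\<close>).  Given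
  \<open>N\<close>, the indices of the subgroups \<open>Q\<^sup>N\<close> are bounded by \<open>N\<^sup>\<alpha>\<close>, so the closure \<open>H\<close> of \<open>G\<^sup>N\<close> is
  open.  Let \<open>K\<close> consist of the elements of \<open>H\<close> that centralize all chief factors of \<open>G\<close> between open
  normal subgroups.  It is closed and normal, and it contains the second derived subgroup of \<open>H\<close>, so
  \<open>H / K\<close> is metabelian.  As \<open>K\<close> centralizes the factors of a chief series of each finite quotient,
  it is pronilpotent.

  To find \<open>N\<close>, consider a finite quotient \<open>Q\<close> in which the second derived subgroup \<open>D\<close> of \<open>Q\<^sup>N\<close>
  centralizes all chief factors except a minimal normal subgroup \<open>V\<close>.  Then \<open>V\<close> is an elementary
  abelian \<open>p\<close>-group and its own centralizer (\<open>self_centralizing_if_not_centralized\<close>), so \<open>Q / V\<close> is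
  an irreducible soluble linear group on \<open>V\<close>.  If \<open>Q / V\<close> has exponent \<open>n\<close>, then \<open>Q\<close> has exponent
  dividing \<open>n p\<close>, and polynomial index growth gives \<open>\<bar>V\<bar> \<le> \<bar>Q\<bar> \<le> (n p)\<^sup>\<alpha>\<close>.  On the other hand,
  \<open>solvable_linear_bound\<close> writes \<open>\<bar>V\<bar> = q\<^sup>M\<close> with \<open>p \<le> q\<close> and bounds \<open>n\<close> by \<open>q\<^sup>2 f(M)\<close>, where
  \<open>f\<close> grows more slowly than any exponential function.  So \<open>q\<^sup>M \<le> (q\<^sup>3 f(M))\<^sup>\<alpha>\<close>, which bounds \<open>M\<close>
  in terms of \<open>\<alpha>\<close> (\<open>dimension_bound\<close>).  The same theorem gives a \<open>w\<close>, bounded in terms of \<open>M\<close>, for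
  which the second derived subgroup of \<open>Q\<^sup>w\<close> centralizes \<open>V\<close>.  A common multiple \<open>N\<close> of the finitely
  many possible \<open>w\<close> therefore makes \<open>D\<close> centralize \<open>V\<close> as well.

  The linear theorem is proved by induction on \<open>\<bar>V\<bar>\<close>.  Let \<open>A\<close> be a maximal abelian normal subgroup of
  the linear group \<open>S\<close>, and \<open>R\<close> the double commutant of its operators, a commutative ring normalized by
  \<open>S\<close>.  A nonzero idempotent of \<open>R\<close> with smallest image has pairwise orthogonal conjugates, whose images
  are blocks of imprimitivity.  If there are several blocks, say \<open>k\<close>, the induction hypothesis applies to the
  stabilizer of one of them, and \<open>solvable_index_exponent\<close> shows that the permutations of the blocks
  cost a factor of at most \<open>k\<^bsup>1 + log k\<^esup>\<close> in the exponents.  Otherwise \<open>R\<close> is a field; let \<open>q\<close> be its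
  order and \<open>m\<close> the dimension of \<open>V\<close> over \<open>R\<close>.  The centralizer \<open>C\<close> of \<open>A\<close> acts linearly over \<open>R\<close>, and
  \<open>S / C\<close> and \<open>A\<close> have order at most \<open>q\<close>.  Choose \<open>D\<close> in \<open>C\<close> maximal among the normal subgroups of
  \<open>S\<close> with \<open>D / A\<close> abelian.  Representatives of \<open>D / A\<close> are linearly independent over \<open>R\<close>, so there are at
  most \<open>m\<^sup>2\<close> of them, and \<open>C / A\<close> acts faithfully on \<open>D\<close>, which bounds \<open>\<bar>C / A\<bar>\<close> in terms of \<open>m\<close>.
\<close>

section \<open>Commutators, centralizers modulo subgroups, and indices\<close>

context group
begin

lemma inv_mult_cancel:
  assumes "x \<in> carrier G" "y \<in> carrier G"
  shows "inv x \<otimes> (x \<otimes> y) = y" and "x \<otimes> (inv x \<otimes> y) = y"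
  using assms by (simp_all flip: m_assoc)

lemmas word_simps = m_assoc inv_mult_group inv_mult_cancel

definition commutator :: "'a \<Rightarrow> 'a \<Rightarrow> 'a" where
  "commutator x y = x \<otimes> y \<otimes> inv x \<otimes> inv y"

definition centralizer_mod :: "'a set \<Rightarrow> 'a set \<Rightarrow> 'a set" where
  "centralizer_mod N X = {g \<in> carrier G. \<forall>x\<in>X. commutator g x \<in> N}"

lemma commutator_closed [simp]:
  "x \<in> carrier G \<Longrightarrow> y \<in> carrier G \<Longrightarrow> commutator x y \<in> carrier G"
  by (simp add: commutator_def)

lemma inv_commutator:
  "x \<in> carrier G \<Longrightarrow> y \<in> carrier G \<Longrightarrow> inv (commutator x y) = commutator y x"
  by (simp add: commutator_def word_simps)

lemma commutator_mult_left:
  assumes "x \<in> carrier G" "y \<in> carrier G" "z \<in> carrier G"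
  shows "commutator (x \<otimes> y) z = (x \<otimes> commutator y z \<otimes> inv x) \<otimes> commutator x z"
  using assms by (simp add: commutator_def word_simps)

lemma commutator_mult_right:
  assumes "x \<in> carrier G" "y \<in> carrier G" "z \<in> carrier G"
  shows "commutator x (y \<otimes> z) = commutator x y \<otimes> (y \<otimes> commutator x z \<otimes> inv y)"
  using assms by (simp add: commutator_def word_simps)

lemma commutator_inv_left:
  assumes "x \<in> carrier G" "z \<in> carrier G"
  shows "commutator (inv x) z = inv x \<otimes> inv (commutator x z) \<otimes> x"
  using assms by (simp add: commutator_def word_simps)

lemma commutator_eq_conj_mult:
  assumes "x \<in> carrier G" "y \<in> carrier G"
  shows "commutator x y \<otimes> y = x \<otimes> y \<otimes> inv x"
  using assms by (simp add: commutator_def word_simps)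

lemma commutator_one [simp]:
  "x \<in> carrier G \<Longrightarrow> commutator \<one> x = \<one>" "x \<in> carrier G \<Longrightarrow> commutator x \<one> = \<one>"
  by (simp_all add: commutator_def)

lemma normal_conj:
  assumes "N \<lhd> G" "g \<in> carrier G" "x \<in> N"
  shows "g \<otimes> x \<otimes> inv g \<in> N" and "inv g \<otimes> x \<otimes> g \<in> N"
  using normal.inv_op_closed2[OF assms] normal.inv_op_closed1[OF assms] by auto

lemma normal_subset: "N \<lhd> G \<Longrightarrow> N \<subseteq> carrier G"
  using normal_imp_subgroup subgroup.subset by blast

lemma commutator_in_normal:
  assumes "N \<lhd> G" "x \<in> carrier G" "y \<in> carrier G" "x \<in> N \<or> y \<in> N"
  shows "commutator x y \<in> N"
proof -
  interpret N: normal N G by fact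
  from assms(4) show ?thesis
  proof
    assume "x \<in> N"
    then have "x \<otimes> (y \<otimes> inv x \<otimes> inv y) \<in> N"
      using normal_conj[OF assms(1,3)] by blast
    then show ?thesis using assms by (simp add: commutator_def word_simps)
  next
    assume "y \<in> N"
    then have "(x \<otimes> y \<otimes> inv x) \<otimes> inv y \<in> N"
      using normal_conj[OF assms(1,2)] by blast
    then show ?thesis using assms by (simp add: commutator_def word_simps)
  qed
qed

lemma centralizer_mod_subset: "centralizer_mod N X \<subseteq> carrier G"
  by (auto simp: centralizer_mod_def)

text \<open>The version relative to a subgroup \<open>H\<close> serves stabilizers of points and blocks, whose normal
  subgroups are rarely normal in the whole group.\<close>

lemma centralizer_mod_subgroup_rel:
  assumes H: "subgroup H G" and N: "subgroup N G" "\<And>h n. h \<in> H \<Longrightarrow> n \<in> N \<Longrightarrow> h \<otimes> n \<otimes> inv h \<in> N"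
    and X: "X \<subseteq> carrier G"
  shows "subgroup (H \<inter> centralizer_mod N X) G"
proof -
  interpret H: subgroup H G by fact
  interpret N: subgroup N G by fact
  show ?thesis
  proof (rule subgroupI)
    show "H \<inter> centralizer_mod N X \<subseteq> carrier G" using H.subset by blast
    show "H \<inter> centralizer_mod N X \<noteq> {}"
    proof -
      have "\<one> \<in> H \<inter> centralizer_mod N X" using X by (auto simp: centralizer_mod_def subset_iff)
      then show ?thesis by blast
    qed
  next
    fix a assume a: "a \<in> H \<inter> centralizer_mod N X"
    show "inv a \<in> H \<inter> centralizer_mod N X"
    proof (auto simp: centralizer_mod_def)
      show "inv a \<in> H" "inv a \<in> carrier G" using a by auto
      fix x assume x: "x \<in> X"
      have "inv a \<otimes> inv (commutator a x) \<otimes> inv (inv a) \<in> N"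
        using a x by (intro N(2)) (auto simp: centralizer_mod_def)
      then show "commutator (inv a) x \<in> N"
        using a x X by (auto simp: commutator_inv_left)
    qed
  next
    fix a b assume a: "a \<in> H \<inter> centralizer_mod N X" and b: "b \<in> H \<inter> centralizer_mod N X"
    show "a \<otimes> b \<in> H \<inter> centralizer_mod N X"
    proof (auto simp: centralizer_mod_def)
      show "a \<otimes> b \<in> H" "a \<otimes> b \<in> carrier G" using a b by auto
      fix x assume x: "x \<in> X"
      have "a \<otimes> commutator b x \<otimes> inv a \<in> N" "commutator a x \<in> N"
        using a b x N(2) by (auto simp: centralizer_mod_def)
      moreover have "a \<in> carrier G" "b \<in> carrier G" "x \<in> carrier G" using a b x X by auto
      ultimately show "commutator (a \<otimes> b) x \<in> N"
        using N.m_closed by (simp add: commutator_mult_left)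
    qed
  qed
qed

lemma centralizer_mod_subgroup:
  assumes "N \<lhd> G" "X \<subseteq> carrier G"
  shows "subgroup (centralizer_mod N X) G"
  using centralizer_mod_subgroup_rel[OF subgroup_self, of N X] assms normal_conj(1)[OF assms(1)]
    normal_imp_subgroup[OF assms(1)]
  by (simp add: centralizer_mod_subset Int_absorb1)

lemma centralizer_mod_conj_rel:
  assumes H: "subgroup H G" and N: "N \<subseteq> carrier G" "\<And>h n. h \<in> H \<Longrightarrow> n \<in> N \<Longrightarrow> h \<otimes> n \<otimes> inv h \<in> N"
    and X: "X \<subseteq> carrier G" "\<And>h x. h \<in> H \<Longrightarrow> x \<in> X \<Longrightarrow> h \<otimes> x \<otimes> inv h \<in> X"
    and g: "g \<in> H" and h: "h \<in> centralizer_mod N X"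
  shows "g \<otimes> h \<otimes> inv g \<in> centralizer_mod N X"
proof -
  interpret H: subgroup H G by fact
  have hc: "h \<in> carrier G" using h by (simp add: centralizer_mod_def)
  have gc: "g \<in> carrier G" using g H.subset by blast
  show ?thesis
    unfolding centralizer_mod_def
  proof (intro CollectI conjI ballI)
    show "g \<otimes> h \<otimes> inv g \<in> carrier G" using gc hc by simp
    fix x assume x: "x \<in> X"
    then have xc: "x \<in> carrier G" using X by blast
    have "inv g \<otimes> x \<otimes> inv (inv g) \<in> X" using X(2)[of "inv g"] g x by blast
    then have "g \<otimes> commutator h (inv g \<otimes> x \<otimes> g) \<otimes> inv g \<in> N"
      using gc h N(2)[OF g] by (simp add: centralizer_mod_def)
    moreover have "g \<otimes> commutator h (inv g \<otimes> x \<otimes> g) \<otimes> inv g = commutator (g \<otimes> h \<otimes> inv g) x"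
      using gc hc xc by (simp add: commutator_def word_simps)
    ultimately show "commutator (g \<otimes> h \<otimes> inv g) x \<in> N" by simp
  qed
qed

lemma centralizer_mod_normal:
  assumes N: "N \<lhd> G" and X: "X \<subseteq> carrier G"
    and conj: "\<And>g x. g \<in> carrier G \<Longrightarrow> x \<in> X \<Longrightarrow> g \<otimes> x \<otimes> inv g \<in> X"
  shows "centralizer_mod N X \<lhd> G"
  unfolding normal_inv_iff
  using centralizer_mod_subgroup[OF N X] normal_subset[OF N] normal_conj(1)[OF N] conj X
  by (auto intro!: centralizer_mod_conj_rel[OF subgroup_self])

lemma centralizer_mod_sym:
  assumes "subgroup N G" "X \<subseteq> carrier G" "Y \<subseteq> carrier G" "X \<subseteq> centralizer_mod N Y"
  shows "Y \<subseteq> centralizer_mod N X"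
proof -
  have "commutator y x \<in> N" if "x \<in> X" "y \<in> Y" for x y
    using assms that subgroup.m_inv_closed[OF assms(1), of "commutator x y"]
    by (auto simp: centralizer_mod_def inv_commutator subset_iff)
  then show ?thesis using assms by (auto simp: centralizer_mod_def)
qed

lemma centralizer_mod_antimono: "X \<subseteq> Y \<Longrightarrow> centralizer_mod N Y \<subseteq> centralizer_mod N X"
  by (auto simp: centralizer_mod_def)

lemma centralizer_mod_mono: "M \<subseteq> N \<Longrightarrow> centralizer_mod M X \<subseteq> centralizer_mod N X"
  by (auto simp: centralizer_mod_def)

lemma derived_subset_iff:
  assumes "subgroup N G" "H \<subseteq> carrier G"
  shows "derived G H \<subseteq> N \<longleftrightarrow> H \<subseteq> centralizer_mod N H"
proof
  assume "derived G H \<subseteq> N"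
  then have "derived_set G H \<subseteq> N"
    unfolding derived_def using generate.incl[of _ "derived_set G H" G] by blast
  then show "H \<subseteq> centralizer_mod N H"
    using assms(2) by (fastforce simp: centralizer_mod_def commutator_def)
next
  assume "H \<subseteq> centralizer_mod N H"
  then have "derived_set G H \<subseteq> N"
    by (auto simp: centralizer_mod_def commutator_def)
  then show "derived G H \<subseteq> N"
    unfolding derived_def by (rule generate_subgroup_incl[OF _ assms(1)])
qed

lemma normal_set_mult:
  assumes "M \<lhd> G" "N \<lhd> G"
  shows "M <#> N \<lhd> G" and "M \<subseteq> M <#> N" and "N \<subseteq> M <#> N"
proof -
  interpret M: normal M G by fact
  interpret N: normal N G by fact
  show "M <#> N \<lhd> G"
    unfolding normal_inv_iff
  proof (intro conjI ballI)
    show "subgroup (M <#> N) G" by (rule mult_norm_subgroup[OF assms(1) N.subgroup_axioms])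
    fix g h assume g: "g \<in> carrier G" and "h \<in> M <#> N"
    then obtain a b where h: "a \<in> M" "b \<in> N" "h = a \<otimes> b" by (auto simp: set_mult_def)
    then have "g \<otimes> h \<otimes> inv g = (g \<otimes> a \<otimes> inv g) \<otimes> (g \<otimes> b \<otimes> inv g)"
      using g by (simp add: word_simps)
    moreover have "g \<otimes> a \<otimes> inv g \<in> M" "g \<otimes> b \<otimes> inv g \<in> N"
      using h g M.inv_op_closed2 N.inv_op_closed2 by auto
    ultimately show "g \<otimes> h \<otimes> inv g \<in> M <#> N"
      by (auto simp: set_mult_def)
  qed
  show "M \<subseteq> M <#> N"
  proof
    fix x assume x: "x \<in> M"
    then have "x \<otimes> \<one> \<in> M <#> N" using N.one_closed unfolding set_mult_def by blast
    then show "x \<in> M <#> N" using x M.subset by auto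
  qed
  show "N \<subseteq> M <#> N"
  proof
    fix x assume x: "x \<in> N"
    then have "\<one> \<otimes> x \<in> M <#> N" using M.one_closed unfolding set_mult_def by blast
    then show "x \<in> M <#> N" using x N.subset by auto
  qed
qed

lemma set_mult_subset:
  assumes "subgroup K G" "M \<subseteq> K" "N \<subseteq> K"
  shows "M <#> N \<subseteq> K"
  using assms subgroup.m_closed[OF assms(1)] by (auto simp: set_mult_def)

lemma normal_Int: "M \<lhd> G \<Longrightarrow> N \<lhd> G \<Longrightarrow> M \<inter> N \<lhd> G"
  by (rule normal_subgroup_intersect)

text \<open>If \<open>B\<close> has a normal series with abelian factors, the last term of its derived series not
  contained in \<open>A\<close> is abelian modulo \<open>A\<close>.\<close>

lemma solvable_abelian_normal_step:
  assumes sol: "solvable G" and A: "A \<lhd> G" and B: "B \<lhd> G" and AB: "A \<subset> B"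
  obtains E where "E \<lhd> G" "A \<subset> E" "E \<subseteq> B" "E \<subseteq> centralizer_mod A E"
proof -
  define d where "d = (\<lambda>i. (derived G ^^ i) B)"
  have dn: "d i \<lhd> G \<and> d i \<subseteq> B" for i
  proof (induction i)
    case (Suc i)
    then show ?case
      using derived_is_normal derived_incl[of "d i" "d i"] normal_imp_subgroup unfolding d_def by fastforce
  qed (use B in \<open>simp add: d_def\<close>)
  have "solvable_seq G B"
    by (rule solvable_subgroup[OF normal_imp_subgroup[OF B] sol])
  then obtain n where "d n = {\<one>}" using solvable_imp_trivial_derived_seq unfolding d_def by blast
  then have ex: "\<exists>n. d n \<subseteq> A" using subgroup.one_closed[OF normal_imp_subgroup[OF A]]
    by (intro exI[of _ n]) auto
  define k where "k = (LEAST n. d n \<subseteq> A)"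
  have k: "d k \<subseteq> A" unfolding k_def by (rule LeastI_ex[OF ex])
  have "k \<noteq> 0" using k AB by (metis d_def eq_id_iff funpow_0 psubset_eq subset_antisym)
  then obtain i where i: "k = Suc i" using not0_implies_Suc by blast
  have ni: "\<not> d i \<subseteq> A" using not_less_Least[of i "\<lambda>n. d n \<subseteq> A"] i unfolding k_def by simp
  have der: "derived G (d i) \<subseteq> A" using k i by (simp add: d_def)
  let ?E = "A <#> d i"
  note nm = normal_set_mult[OF A conjunct1[OF dn[of i]]]
  have sub: "A \<subseteq> carrier G" "d i \<subseteq> carrier G" "?E \<subseteq> carrier G"
    using A dn[of i] nm(1) normal_subset by auto
  have sA: "subgroup A G" by (rule normal_imp_subgroup[OF A])
  have cE: "?E \<subseteq> centralizer_mod A X" if "X \<subseteq> carrier G" "d i \<subseteq> centralizer_mod A X" for X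
  proof (rule set_mult_subset[OF centralizer_mod_subgroup[OF A that(1)]])
    show "A \<subseteq> centralizer_mod A X"
      using that(1) sub(1) commutator_in_normal[OF A] by (auto simp: centralizer_mod_def subset_iff)
  qed (rule that)
  have "d i \<subseteq> centralizer_mod A (d i)"
    using der derived_subset_iff[OF sA sub(2)] by simp
  then have "?E \<subseteq> centralizer_mod A (d i)" by (rule cE[OF sub(2)])
  then have "d i \<subseteq> centralizer_mod A ?E" by (rule centralizer_mod_sym[OF sA sub(3) sub(2)])
  then have "?E \<subseteq> centralizer_mod A ?E" by (rule cE[OF sub(3)])
  moreover have "?E \<subseteq> B"
    using set_mult_subset[OF normal_imp_subgroup[OF B]] AB dn[of i] by blast
  moreover have "A \<subset> ?E" using nm(2,3) ni by blast
  ultimately show thesis using that nm(1) by blast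
qed

lemma card_subgroup_double:
  assumes fin: "finite (carrier G)" and W: "subgroup W G" and W': "subgroup W' G" and "W \<subset> W'"
  shows "2 * card W \<le> card W'"
proof -
  interpret G': group "G\<lparr>carrier := W'\<rparr>" by (rule subgroup_imp_group[OF W'])
  have "subgroup W (G\<lparr>carrier := W'\<rparr>)" using assms by (simp add: subgroup_incl psubset_eq)
  from G'.lagrange[OF this] have e: "card W' = card (rcosets\<^bsub>G\<lparr>carrier := W'\<rparr>\<^esub> W) * card W"
    by (simp add: order_def)
  have fW': "finite W'" using fin W' finite_subset subgroup.subset by blast
  have "card W < card W'" using \<open>W \<subset> W'\<close> fW' psubset_card_mono by blast
  then have "card (rcosets\<^bsub>G\<lparr>carrier := W'\<rparr>\<^esub> W) \<ge> 2"
    using e by (cases "card (rcosets\<^bsub>G\<lparr>carrier := W'\<rparr>\<^esub> W)") (auto simp: Suc_le_eq)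
  then show ?thesis using e by simp
qed

text \<open>Adjoin elements one at a time: by Lagrange, each new one at least doubles the order of the subgroup
  generated so far.\<close>

lemma small_generating_set:
  assumes fin: "finite (carrier G)" and D: "subgroup D G" and W: "subgroup W G" "W \<subseteq> D"
  obtains X where "X \<subseteq> D" "finite X" "card W * 2 ^ card X \<le> card D"
    "\<And>Y. subgroup Y G \<Longrightarrow> W \<subseteq> Y \<Longrightarrow> X \<subseteq> Y \<Longrightarrow> D \<subseteq> Y"
proof -
  have "\<exists>X. X \<subseteq> D \<and> finite X \<and> card W * 2 ^ card X \<le> card D \<and>
          (\<forall>Y. subgroup Y G \<longrightarrow> W \<subseteq> Y \<longrightarrow> X \<subseteq> Y \<longrightarrow> D \<subseteq> Y)"
    using W
  proof (induction "card D - card W" arbitrary: W rule: less_induct)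
    case less
    have fD: "finite D" using fin D finite_subset subgroup.subset by blast
    show ?case
    proof (cases "W = D")
      case True
      then show ?thesis by (intro exI[of _ "{}"]) auto
    next
      case False
      then obtain v where v: "v \<in> D" "v \<notin> W" using less.prems by blast
      let ?W = "generate G (insert v W)"
      have sub: "insert v W \<subseteq> carrier G" using v less.prems D subgroup.subset by blast
      have W': "subgroup ?W G" by (rule generate_is_subgroup[OF sub])
      have W'D: "?W \<subseteq> D" using generate_subgroup_incl[of "insert v W" D] v less.prems D by blast
      have inc: "insert v W \<subseteq> ?W" using generate.incl[of _ "insert v W" G] by blast
      then have WW': "W \<subset> ?W" using v by blast
      have dbl: "2 * card W \<le> card ?W" by (rule card_subgroup_double[OF fin less.prems(1) W' WW'])
      have "card W < card ?W" using WW' fD W'D psubset_card_mono finite_subset by blast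
      moreover have "card ?W \<le> card D" using fD W'D card_mono by blast
      ultimately have "card D - card ?W < card D - card W" by linarith
      from less.hyps[OF this W' W'D]
      obtain X where X: "X \<subseteq> D" "finite X" "card ?W * 2 ^ card X \<le> card D"
          "\<forall>Y. subgroup Y G \<longrightarrow> ?W \<subseteq> Y \<longrightarrow> X \<subseteq> Y \<longrightarrow> D \<subseteq> Y"
        by blast
      show ?thesis
      proof (intro exI[of _ "insert v X"] conjI allI impI)
        show "insert v X \<subseteq> D" "finite (insert v X)" using X v by auto
        have "card (insert v X) \<le> Suc (card X)" by (simp add: card_insert_if X(2))
        then have "card W * 2 ^ card (insert v X) \<le> card W * 2 ^ Suc (card X)"
          by (intro mult_left_mono power_increasing) auto
        also have "\<dots> \<le> card ?W * 2 ^ card X" using mult_right_mono[OF dbl, of "2 ^ card X"] by simp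
        finally show "card W * 2 ^ card (insert v X) \<le> card D" using X(3) by simp
        fix Y assume Y: "subgroup Y G" "W \<subseteq> Y" "insert v X \<subseteq> Y"
        then have "?W \<subseteq> Y" using generate_subgroup_incl[of "insert v W" Y] by blast
        then show "D \<subseteq> Y" using X(4) Y by blast
      qed
    qed
  qed
  then show thesis using that by blast
qed

lemma card_le_card_image_mult:
  assumes fin: "finite H" and H: "subgroup H G" and W: "subgroup W G" "W \<subseteq> H"
    and F: "\<And>g h. g \<in> H \<Longrightarrow> h \<in> H \<Longrightarrow> F g = F h \<Longrightarrow> inv g \<otimes> h \<in> W"
  shows "card H \<le> card (F ` H) * card W"
proof -
  have fW: "finite W" using fin W finite_subset by blast
  have "card {h \<in> H. F h = y} \<le> card W" if "y \<in> F ` H" for y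
  proof -
    from that obtain g where g: "g \<in> H" "y = F g" by blast
    show ?thesis
    proof (rule card_inj_on_le[OF _ _ fW, of "\<lambda>h. inv g \<otimes> h"])
      show "inj_on ((\<otimes>) (inv g)) {h \<in> H. F h = y}"
        using g subgroup.subset[OF H] by (intro inj_onI) (auto simp: subset_iff)
      show "(\<otimes>) (inv g) ` {h \<in> H. F h = y} \<subseteq> W" using g F by auto
    qed
  qed
  then have "(\<Sum>y\<in>F ` H. card {h \<in> H. F h = y}) \<le> card (F ` H) * card W"
    using sum_bounded_above[of "F ` H" "\<lambda>y. card {h \<in> H. F h = y}" "card W"] by simp
  moreover have "card H = (\<Sum>y\<in>F ` H. card {h \<in> H. F h = y})"
    using sum.image_gen[OF fin, of "\<lambda>_. 1::nat" F] by simp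
  ultimately show ?thesis by simp
qed

lemma card_subgroup_dvd:
  assumes H: "subgroup H G" and W: "subgroup W G" "W \<subseteq> H"
  shows "card H = (card H div card W) * card W"
proof -
  interpret GH: group "G\<lparr>carrier := H\<rparr>" by (rule subgroup_imp_group[OF H])
  have "subgroup W (G\<lparr>carrier := H\<rparr>)" using assms by (simp add: subgroup_incl)
  then have "card (rcosets\<^bsub>G\<lparr>carrier := H\<rparr>\<^esub> W) * card W = card H"
    using GH.lagrange[of W] by (simp add: order_def)
  then have "card W dvd card H" using dvd_triv_right[of "card W"] by metis
  then show ?thesis by simp
qed

lemma pow_index_in_subgroup:
  assumes fin: "finite H" and H: "subgroup H G" and W: "subgroup W G" "W \<subseteq> H"
    and nor: "\<And>h w. h \<in> H \<Longrightarrow> w \<in> W \<Longrightarrow> h \<otimes> w \<otimes> inv h \<in> W" and g: "g \<in> H"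
  shows "g [^] (card H div card W) \<in> W"
proof -
  let ?G = "G\<lparr>carrier := H\<rparr>"
  interpret GH: group ?G by (rule subgroup_imp_group[OF H])
  have sW: "subgroup W ?G" using assms by (simp add: subgroup_incl)
  have inv_eq: "inv\<^bsub>?G\<^esub> x = inv x" if "x \<in> H" for x
    by (rule m_inv_consistent[OF H that])
  have "W \<lhd> ?G"
    unfolding GH.normal_inv_iff using sW nor by (auto simp: inv_eq)
  then interpret W: normal W ?G .
  interpret Q: group "?G Mod W" by (rule W.factorgroup_is_group)
  have e: "card (rcosets\<^bsub>?G\<^esub> W) * card W = card H"
    using GH.lagrange[OF sW] by (simp add: order_def)
  have "card W > 0" using W(2) fin finite_subset subgroup.one_closed[OF W(1)] card_gt_0_iff by blast
  then have idx: "card H div card W = order (?G Mod W)"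
    using e by (simp add: order_def FactGroup_def flip: e)
  have gc: "W #>\<^bsub>?G\<^esub> g \<in> carrier (?G Mod W)" using g by (auto simp: carrier_FactGroup)
  have "(W #>\<^bsub>?G\<^esub> g) [^]\<^bsub>?G Mod W\<^esub> order (?G Mod W) = W"
    using Q.pow_order_eq_1[OF gc] by simp
  then have "W #>\<^bsub>?G\<^esub> (g [^]\<^bsub>?G\<^esub> (card H div card W)) = W"
    using W.FactGroup_pow[of g "card H div card W"] g idx by simp
  then have "g [^]\<^bsub>?G\<^esub> (card H div card W) \<in> W"
    using GH.rcos_self[OF _ sW, of "g [^]\<^bsub>?G\<^esub> (card H div card W)"] GH.nat_pow_closed[of g "card H div card W"] g
    by simp
  then show ?thesis using nat_pow_consistent[of g "card H div card W" H] by simp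
qed

lemma card_coset_image:
  assumes H: "subgroup H G" and W: "subgroup W G" "W \<subseteq> H"
  shows "card ((\<lambda>h. W #> h) ` H) * card W = card H"
proof -
  interpret GH: group "G\<lparr>carrier := H\<rparr>" by (rule subgroup_imp_group[OF H])
  have "subgroup W (G\<lparr>carrier := H\<rparr>)" using assms by (simp add: subgroup_incl)
  then have "card (rcosets\<^bsub>G\<lparr>carrier := H\<rparr>\<^esub> W) * card W = card H"
    using GH.lagrange[of W] by (simp add: order_def)
  moreover have "rcosets\<^bsub>G\<lparr>carrier := H\<rparr>\<^esub> W = (\<lambda>h. W #> h) ` H"
    by (auto simp: RCOSETS_def)
  ultimately show ?thesis by simp
qed

lemma coset_eq_iff:
  assumes "subgroup W G" "x \<in> carrier G" "y \<in> carrier G"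
  shows "W #> x = W #> y \<longleftrightarrow> x \<otimes> inv y \<in> W"
proof
  assume "W #> x = W #> y"
  then have "x \<in> W #> y" using rcos_self[OF assms(2,1)] by simp
  then show "x \<otimes> inv y \<in> W" using subgroup.rcos_module_imp[OF assms(1) is_group assms(3)] by blast
next
  assume "x \<otimes> inv y \<in> W"
  then have "x \<in> W #> y" using subgroup.rcos_module_rev[OF assms(1) is_group assms(3,2)] by blast
  then show "W #> x = W #> y" using repr_independence[OF _ assms(3,1)] by simp
qed

lemma subgroup_pow_closed:
  assumes "subgroup H G" "x \<in> H"
  shows "x [^] (n::nat) \<in> H"
  using assms by (induction n) (auto simp: subgroup.one_closed subgroup.m_closed)

lemma conj_pow:
  assumes "g \<in> carrier G" "x \<in> carrier G"
  shows "g \<otimes> x [^] (n::nat) \<otimes> inv g = (g \<otimes> x \<otimes> inv g) [^] n"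
proof (induction n)
  case (Suc n)
  have "g \<otimes> x [^] Suc n \<otimes> inv g = (g \<otimes> x [^] n \<otimes> inv g) \<otimes> (g \<otimes> x \<otimes> inv g)"
    using assms by (simp add: word_simps)
  then show ?case using Suc by simp
qed (use assms in simp)

end

section \<open>Powers lying in a subgroup of a soluble group\<close>

text \<open>The exponent \<open>1 + log k\<close> makes this function supermultiplicative, so bounds of this shape survive
  the passage to a stabilizer, where degrees multiply.\<close>

definition quasipoly :: "nat \<Rightarrow> nat" where
  "quasipoly k = k ^ (1 + floor_log k)"

lemma floor_log_mult_le:
  assumes "a \<ge> 1" "b \<ge> 1"
  shows "floor_log a + floor_log b \<le> floor_log (a * b)"
proof -
  have "2 ^ (floor_log a + floor_log b) \<le> a * b"
    unfolding power_add using assms by (intro mult_mono floor_log_exp2_le) auto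
  then have "floor_log (2 ^ (floor_log a + floor_log b)) \<le> floor_log (a * b)"
    by (rule floor_log_le_iff)
  then show ?thesis by simp
qed

lemma quasipoly_mult_le:
  assumes "a \<ge> 1" "b \<ge> 1"
  shows "quasipoly a * quasipoly b \<le> quasipoly (a * b)"
proof -
  have "quasipoly a * quasipoly b \<le> a ^ (1 + floor_log (a * b)) * b ^ (1 + floor_log (a * b))"
    unfolding quasipoly_def using floor_log_mult_le[OF assms] assms
    by (intro mult_mono power_increasing) auto
  then show ?thesis by (simp add: quasipoly_def power_mult_distrib)
qed

lemma quasipoly_pos: "k \<ge> 1 \<Longrightarrow> quasipoly k \<ge> 1"
  by (simp add: quasipoly_def)

lemma quasipoly_mono: "a \<le> b \<Longrightarrow> quasipoly a \<le> quasipoly b"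
proof -
  assume ab: "a \<le> b"
  show ?thesis
  proof (cases "a = 0")
    case False
    have "a ^ (1 + floor_log a) \<le> b ^ (1 + floor_log a)" using ab by (intro power_mono) auto
    also have "\<dots> \<le> b ^ (1 + floor_log b)"
      using floor_log_le_iff[OF ab] ab False by (intro power_increasing) auto
    finally show ?thesis by (simp add: quasipoly_def)
  qed (simp add: quasipoly_def)
qed

lemma le_quasipoly: "a \<le> quasipoly a"
  by (cases "a = 0") (simp_all add: quasipoly_def)

lemma le_floor_log: "2 ^ c \<le> (s::nat) \<Longrightarrow> c \<le> floor_log s"
  using floor_log_le_iff[of "2 ^ c" s] by simp

context group
begin

text \<open>Since \<open>W\<close> centralizes \<open>E\<close> modulo \<open>Y\<close>, the factors \<open>e\<close> of \<open>(e u)\<^sup>n\<close> can be moved to the left at the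
  expense of elements of \<open>Y\<close>, and these lie in \<open>U\<close>.\<close>

lemma pow_separates_coset:
  assumes E: "subgroup E G" and U: "subgroup U G" and W: "subgroup W G"
    and comm: "\<And>w e. w \<in> W \<Longrightarrow> e \<in> E \<Longrightarrow> commutator w e \<in> Y"
    and Y: "Y \<subseteq> U" "\<And>e y. e \<in> E \<Longrightarrow> y \<in> Y \<Longrightarrow> inv e \<otimes> y \<otimes> e \<in> Y"
    and EW: "E \<subseteq> W" and e: "e \<in> E" and u: "u \<in> U" "e \<otimes> u \<in> W"
  shows "inv (e [^] n) \<otimes> (e \<otimes> u) [^] (n::nat) \<in> U"
proof (induction n)
  case 0
  then show ?case using subgroup.one_closed[OF U] by simp
next
  case (Suc n)
  have [simp]: "e \<in> carrier G" "u \<in> carrier G"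
    using e u subgroup.subset[OF E] subgroup.subset[OF U] by auto
  define v where "v = inv (e [^] n) \<otimes> (e \<otimes> u) [^] n"
  have v: "v \<in> U" using Suc by (simp add: v_def)
  have vc [simp]: "v \<in> carrier G" by (simp add: v_def)
  have "e [^] n \<in> W"
    using subgroup_pow_closed[OF W] EW e by blast
  moreover have "(e \<otimes> u) [^] n \<in> W" using subgroup_pow_closed[OF W u(2)] .
  ultimately have "v \<in> W" unfolding v_def using W by (simp add: subgroup.m_closed subgroup.m_inv_closed)
  then have "inv e \<otimes> commutator v e \<otimes> e \<in> U" using comm e Y by blast
  then have "(inv e \<otimes> commutator v e \<otimes> e) \<otimes> v \<otimes> u \<in> U"
    using v u U by (simp add: subgroup.m_closed)
  moreover have "(inv e \<otimes> commutator v e \<otimes> e) \<otimes> v \<otimes> u = inv e \<otimes> v \<otimes> e \<otimes> u"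
    by (simp add: commutator_def word_simps)
  moreover have "inv (e [^] Suc n) \<otimes> (e \<otimes> u) [^] Suc n = inv e \<otimes> v \<otimes> e \<otimes> u"
    by (simp add: v_def word_simps)
  ultimately show ?case by simp
qed

text \<open>The group \<open>E / Y\<close> of order \<open>s\<close> has a generating set of at most \<open>log s\<close> elements, and the action of an
  element of \<open>P\<close> on \<open>E / Y\<close> is determined by their images.\<close>

lemma index_centralizer_mod_le:
  assumes fin: "finite (carrier G)" and P: "subgroup P G" and Y: "subgroup Y G" and E: "subgroup E G"
    and YE: "Y \<subseteq> E" and EP: "E \<subseteq> P"
    and Ystab: "\<And>h y. h \<in> P \<Longrightarrow> y \<in> Y \<Longrightarrow> h \<otimes> y \<otimes> inv h \<in> Y"
    and Estab: "\<And>h y. h \<in> P \<Longrightarrow> y \<in> E \<Longrightarrow> h \<otimes> y \<otimes> inv h \<in> E"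
  shows "card P \<le> (card E div card Y) ^ floor_log (card E div card Y) * card (P \<inter> centralizer_mod Y E)"
proof -
  interpret E: subgroup E G by (rule E)
  interpret Y: subgroup Y G by (rule Y)
  define W where "W = P \<inter> centralizer_mod Y E"
  have W: "subgroup W G"
    unfolding W_def by (rule centralizer_mod_subgroup_rel[OF P Y Ystab E.subset])
  have WP: "W \<subseteq> P" by (simp add: W_def)
  define s where "s = card E div card Y"
  have finP: "finite P" and finE: "finite E"
    using fin P E.subset subgroup.subset finite_subset by metis+
  have cY: "card Y > 0" using finE YE finite_subset card_gt_0_iff Y.one_closed by blast
  have cE: "card E = s * card Y" unfolding s_def by (rule card_subgroup_dvd[OF E Y YE])
  have "card E > 0" using finE card_gt_0_iff E.one_closed by blast
  then have s1: "s \<ge> 1" using cE by (cases s) auto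
  obtain X where X: "X \<subseteq> E" "finite X" "card Y * 2 ^ card X \<le> card E"
      "\<And>K. subgroup K G \<Longrightarrow> Y \<subseteq> K \<Longrightarrow> X \<subseteq> K \<Longrightarrow> E \<subseteq> K"
    using small_generating_set[OF fin E Y YE] by metis
  have "2 ^ card X \<le> s" using X(3) cE cY by (simp add: mult.commute)
  then have Xs: "card X \<le> floor_log s" by (rule le_floor_log)
  define F where "F = (\<lambda>g. \<lambda>x\<in>X. Y #> (g \<otimes> x \<otimes> inv g))"
  have sep: "inv g \<otimes> h \<in> W" if g: "g \<in> P" and h: "h \<in> P" and FF: "F g = F h" for g h
  proof -
    let ?w = "inv g \<otimes> h"
    have c: "g \<in> carrier G" "h \<in> carrier G" using g h P subgroup.subset by blast+
    have wP: "?w \<in> P" using g h P by (simp add: subgroup.m_closed subgroup.m_inv_closed)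
    have wX: "commutator ?w x \<in> Y" if x: "x \<in> X" for x
    proof -
      have xc: "x \<in> carrier G" using x X(1) E.subset by blast
      have "F h x = F g x" using FF by simp
      then have "(h \<otimes> x \<otimes> inv h) \<otimes> inv (g \<otimes> x \<otimes> inv g) \<in> Y"
        using x c xc by (simp add: F_def coset_eq_iff[OF Y])
      then have "inv g \<otimes> ((h \<otimes> x \<otimes> inv h) \<otimes> inv (g \<otimes> x \<otimes> inv g)) \<otimes> inv (inv g) \<in> Y"
        using g P by (intro Ystab) (auto simp: subgroup.m_inv_closed)
      then show ?thesis using c xc by (simp add: commutator_def word_simps)
    qed
    have wc: "?w \<in> carrier G" using c by simp
    let ?K = "P \<inter> centralizer_mod Y {?w}"
    have "subgroup ?K G" using wc by (intro centralizer_mod_subgroup_rel[OF P Y Ystab]) auto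
    moreover have "commutator y ?w \<in> Y" if y: "y \<in> Y" for y
    proof -
      have "y \<otimes> (?w \<otimes> inv y \<otimes> inv ?w) \<in> Y" using y wP Ystab by simp
      then show ?thesis using y c by (simp add: commutator_def word_simps)
    qed
    then have "Y \<subseteq> ?K" using YE EP by (auto simp: centralizer_mod_def)
    moreover have "commutator x ?w \<in> Y" if "x \<in> X" for x
      using Y.m_inv_closed[OF wX[OF that]] that X(1) E.subset wc by (auto simp: inv_commutator subset_iff)
    then have "X \<subseteq> ?K" using X(1) E.subset EP by (auto simp: centralizer_mod_def subset_iff)
    ultimately have "E \<subseteq> ?K" by (rule X(4))
    then have "commutator ?w x \<in> Y" if "x \<in> E" for x
      using that Y.m_inv_closed[of "commutator x ?w"] E.subset wc
      by (auto simp: centralizer_mod_def inv_commutator subset_iff)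
    then show ?thesis using wP wc by (simp add: W_def centralizer_mod_def)
  qed
  have "card P \<le> card (F ` P) * card W" by (rule card_le_card_image_mult[OF finP P W WP sep])
  also have "card (F ` P) \<le> card (X \<rightarrow>\<^sub>E (\<lambda>h. Y #> h) ` E)"
  proof (rule card_mono)
    show "finite (X \<rightarrow>\<^sub>E (\<lambda>h. Y #> h) ` E)" using X(2) finE by (intro finite_PiE) auto
    show "F ` P \<subseteq> X \<rightarrow>\<^sub>E (\<lambda>h. Y #> h) ` E"
      using X(1) Estab by (auto simp: F_def subset_iff)
  qed
  also have "\<dots> = s ^ card X"
  proof -
    have "card ((\<lambda>h. Y #> h) ` E) = s"
      using card_coset_image[OF E Y YE] cE cY by simp
    then show ?thesis using X(2) by (simp add: card_PiE)
  qed
  also have "\<dots> \<le> s ^ floor_log s" using Xs s1 by (intro power_increasing) auto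
  finally show ?thesis by (simp add: W_def s_def)
qed

text \<open>By induction on the index of \<open>U\<close>.  Let \<open>Z\<close> be the core of \<open>U\<close> and \<open>E / Z\<close> a nontrivial abelian normal
  subgroup of \<open>G / Z\<close>.  The subgroup \<open>P = E U\<close> is larger than \<open>U\<close>, so a bounded power of each element lies
  in \<open>P\<close>.  It remains to get from \<open>P\<close> to \<open>U\<close>.  Put \<open>Y = E \<inter> U\<close> and \<open>s = \<bar>P : U\<bar> = \<bar>E : Y\<bar>\<close>.  A power
  with exponent at most \<open>s\<^bsup>log s\<^esup>\<close> centralizes \<open>E / Y\<close>, and the \<open>s\<close>-th power of such an element \<open>e u\<close> is
  \<open>e\<^sup>s u\<^sup>s\<close> up to elements of \<open>Y\<close>, hence in \<open>U\<close>.\<close>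

lemma solvable_index_exponent:
  assumes sol: "solvable G" and fin: "finite (carrier G)" and "subgroup U G"
  shows "\<exists>n\<ge>1. n \<le> quasipoly (order G div card U) \<and> (\<forall>g\<in>carrier G. g [^] n \<in> U)"
  using assms(3)
proof (induction "order G - card U" arbitrary: U rule: less_induct)
  case less
  note U = less.prems
  interpret U: subgroup U G by (rule U)
  show ?case
  proof (cases "U = carrier G")
    case True
    have "carrier G \<noteq> {}" by blast
    then have "order G div card U \<ge> 1" using True fin by (simp add: order_def card_gt_0_iff Suc_le_eq)
    then show ?thesis using True quasipoly_pos by (intro exI[of _ 1]) auto
  next
    case False
    have pos: "card U > 0" using fin U.subset U.one_closed card_gt_0_iff finite_subset by blast
    \<comment> \<open>The core of \<open>U\<close>, written without an intersection of conjugates.\<close>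
    define Z where "Z = {g \<in> carrier G. \<forall>h\<in>carrier G. h \<otimes> g \<otimes> inv h \<in> U}"
    have ZU: "Z \<subseteq> U"
    proof
      fix g assume "g \<in> Z"
      then have "\<one> \<otimes> g \<otimes> inv \<one> \<in> U" "g \<in> carrier G" unfolding Z_def by blast+
      then show "g \<in> U" by simp
    qed
    have "Z \<lhd> G"
      unfolding normal_inv_iff
    proof (intro conjI ballI)
      show "subgroup Z G"
      proof (rule subgroupI)
        show "Z \<subseteq> carrier G" by (auto simp: Z_def)
        have "\<one> \<in> Z" by (auto simp: Z_def)
        then show "Z \<noteq> {}" by blast
      next
        fix a assume a: "a \<in> Z"
        have "h \<otimes> inv a \<otimes> inv h = inv (h \<otimes> a \<otimes> inv h)" if "h \<in> carrier G" for h
          using a that by (simp add: Z_def word_simps)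
        then show "inv a \<in> Z" using a by (auto simp: Z_def)
      next
        fix a b assume a: "a \<in> Z" and b: "b \<in> Z"
        have "h \<otimes> (a \<otimes> b) \<otimes> inv h = (h \<otimes> a \<otimes> inv h) \<otimes> (h \<otimes> b \<otimes> inv h)" if "h \<in> carrier G" for h
          using a b that by (simp add: Z_def word_simps)
        then show "a \<otimes> b \<in> Z" using a b by (auto simp: Z_def)
      qed
      fix x h assume x: "x \<in> carrier G" and h: "h \<in> Z"
      have "k \<otimes> (x \<otimes> h \<otimes> inv x) \<otimes> inv k = (k \<otimes> x) \<otimes> h \<otimes> inv (k \<otimes> x)" if "k \<in> carrier G" for k
        using x h that by (simp add: Z_def word_simps)
      then show "x \<otimes> h \<otimes> inv x \<in> Z" using x h by (auto simp: Z_def)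
    qed
    moreover have "Z \<subset> carrier G" using ZU False U.subset by blast
    ultimately obtain E where E: "E \<lhd> G" "Z \<subset> E" "E \<subseteq> centralizer_mod Z E"
      using solvable_abelian_normal_step[OF sol _ normal_self] by metis
    interpret E: normal E G by (rule E(1))
    have "\<not> E \<subseteq> U"
    proof
      assume "E \<subseteq> U"
      then have "E \<subseteq> Z" using E.subset E.inv_op_closed2 by (auto simp: Z_def)
      then show False using E(2) by blast
    qed
    define P where "P = E <#> U"
    have P: "subgroup P G" unfolding P_def by (rule mult_norm_subgroup[OF E(1) U])
    have EP: "E \<subseteq> P" and UP: "U \<subseteq> P"
    proof -
      show "E \<subseteq> P"
      proof
        fix x assume x: "x \<in> E"
        then have "x \<otimes> \<one> \<in> P" unfolding P_def set_mult_def using U.one_closed by blast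
        then show "x \<in> P" using x E.subset by auto
      qed
      show "U \<subseteq> P"
      proof
        fix x assume x: "x \<in> U"
        then have "\<one> \<otimes> x \<in> P" unfolding P_def set_mult_def using E.one_closed by blast
        then show "x \<in> P" using x U.subset by auto
      qed
    qed
    have finP: "finite P" and finE: "finite E" and finU: "finite U"
      using fin P E.subset U.subset subgroup.subset finite_subset by metis+
    have "U \<subset> P" using EP UP \<open>\<not> E \<subseteq> U\<close> by blast
    then have "card U < card P" using finP psubset_card_mono by blast
    moreover have "card P \<le> order G" using P fin by (simp add: order_def card_mono subgroup.subset)
    ultimately have "order G - card P < order G - card U" by linarith
    from less.hyps[OF this P] obtain n' where n': "n' \<ge> 1" "n' \<le> quasipoly (order G div card P)"
      "\<forall>g\<in>carrier G. g [^] n' \<in> P" by blast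
    define Y where "Y = E \<inter> U"
    have Y: "subgroup Y G" unfolding Y_def by (rule subgroups_Inter_pair[OF E.subgroup_axioms U])
    interpret Y: subgroup Y G by (rule Y)
    have YE: "Y \<subseteq> E" and YU: "Y \<subseteq> U" by (auto simp: Y_def)
    have ZY: "Z \<subseteq> Y" using E(2) ZU by (auto simp: Y_def)
    have commE: "commutator e f \<in> Y" if "e \<in> E" "f \<in> E" for e f
      using that E(3) ZY by (auto simp: centralizer_mod_def)
    have Ystab: "h \<otimes> y \<otimes> inv h \<in> Y" if h: "h \<in> P" and y: "y \<in> Y" for h y
    proof -
      obtain e u where eu: "e \<in> E" "u \<in> U" "h = e \<otimes> u" using h by (auto simp: P_def set_mult_def)
      have c: "e \<in> carrier G" "u \<in> carrier G" "y \<in> carrier G" using eu y by auto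
      have uy: "u \<otimes> y \<otimes> inv u \<in> Y" using eu y c(2) E.inv_op_closed2[of u y] by (auto simp: Y_def)
      then have "commutator e (u \<otimes> y \<otimes> inv u) \<otimes> (u \<otimes> y \<otimes> inv u) \<in> Y"
        using commE eu(1) YE by blast
      then show ?thesis using c by (simp add: eu(3) commutator_def word_simps)
    qed
    define s where "s = card E div card Y"
    have cY: "card Y > 0" using finE YE finite_subset card_gt_0_iff Y.one_closed by blast
    have cE: "card E = s * card Y" unfolding s_def by (rule card_subgroup_dvd[OF E.subgroup_axioms Y YE])
    have "card E > 0" using finE card_gt_0_iff E.one_closed by blast
    then have s1: "s \<ge> 1" using cE by (cases s) auto
    have cP: "card P = s * card U"
    proof -
      interpret SI: second_isomorphism_grp E G U
        by unfold_locales
      have "(\<lambda>X. the_elem ((#>) E ` X)) \<in> iso (G\<lparr>carrier := U\<rparr> Mod E \<inter> U) (G\<lparr>carrier := P\<rparr> Mod E)"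
        using SI.normal_intersection_quotient_isom by (simp add: P_def)
      then have "card (carrier (G\<lparr>carrier := U\<rparr> Mod Y)) = card (carrier (G\<lparr>carrier := P\<rparr> Mod E))"
        unfolding Y_def iso_def by (auto intro: bij_betw_same_card)
      then have "card ((\<lambda>h. Y #> h) ` U) = card ((\<lambda>h. E #> h) ` P)"
        by (simp add: carrier_FactGroup)
      moreover have "card ((\<lambda>h. Y #> h) ` U) * card Y = card U" by (rule card_coset_image[OF U Y YU])
      moreover have "card ((\<lambda>h. E #> h) ` P) * card E = card P"
        by (rule card_coset_image[OF P E.subgroup_axioms EP])
      ultimately show ?thesis using cE by (metis mult.assoc mult.commute)
    qed
    define W where "W = P \<inter> centralizer_mod Y E"
    have W: "subgroup W G"
      unfolding W_def by (rule centralizer_mod_subgroup_rel[OF P Y Ystab E.subset])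
    have WP: "W \<subseteq> P" by (simp add: W_def)
    have Wnor: "h \<otimes> w \<otimes> inv h \<in> W" if "h \<in> P" "w \<in> W" for h w
    proof -
      have "h \<otimes> w \<otimes> inv h \<in> P" using that P WP
        by (meson subgroup.m_closed subgroup.m_inv_closed subsetD)
      moreover have "h \<otimes> w \<otimes> inv h \<in> centralizer_mod Y E"
        using that subgroup.subset[OF P] E.inv_op_closed2 unfolding W_def
        by (intro centralizer_mod_conj_rel[OF P Y.subset Ystab E.subset]) auto
      ultimately show ?thesis by (simp add: W_def)
    qed
    define j where "j = card P div card W"
    have cW: "card W > 0" using finP WP finite_subset card_gt_0_iff subgroup.one_closed[OF W] by blast
    have cj: "card P = j * card W" unfolding j_def by (rule card_subgroup_dvd[OF P W WP])
    have "card P > 0" using \<open>card U < card P\<close> by simp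
    then have j1: "j \<ge> 1" using cj by (cases j) auto
    have "card P \<le> s ^ floor_log s * card W"
      unfolding W_def s_def using subgroup.subset[OF P] E.inv_op_closed2
      by (intro index_centralizer_mod_le[OF fin P Y E.subgroup_axioms YE EP Ystab]) auto
    then have "j * card W \<le> s ^ floor_log s * card W" unfolding cj .
    then have "j \<le> s ^ floor_log s" using cW by simp
    then have js: "j * s \<le> quasipoly s" by (simp add: quasipoly_def)
    have WU: "w [^] s \<in> U" if w: "w \<in> W" for w
    proof -
      obtain e u where eu: "e \<in> E" "u \<in> U" "w = e \<otimes> u"
        using w WP by (auto simp: P_def set_mult_def)
      have "inv (e [^] s) \<otimes> (e \<otimes> u) [^] s \<in> U"
      proof (rule pow_separates_coset[OF E.subgroup_axioms U W _ YU _ _ eu(1,2)])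
        show "commutator v f \<in> Y" if "v \<in> W" "f \<in> E" for v f
          using that by (auto simp: W_def centralizer_mod_def)
        show "inv f \<otimes> y \<otimes> f \<in> Y" if "f \<in> E" "y \<in> Y" for f y
          using Ystab[of "inv f" y] that EP by auto
        show "E \<subseteq> W" using EP commE E.subset by (auto simp: W_def centralizer_mod_def)
        show "e \<otimes> u \<in> W" using w eu by simp
      qed
      moreover have "e [^] s \<in> Y"
        unfolding s_def using E.inv_op_closed2 eu(1) Ystab EP
        by (intro pow_index_in_subgroup[OF finE E.subgroup_axioms Y YE]) auto
      then have "e [^] s \<in> U" using YU by blast
      ultimately have "e [^] s \<otimes> (inv (e [^] s) \<otimes> (e \<otimes> u) [^] s) \<in> U" by (rule U.m_closed[rotated])
      then show ?thesis using eu by (simp add: word_simps)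
    qed
    show ?thesis
    proof (intro exI[of _ "n' * (j * s)"] conjI ballI)
      show "1 \<le> n' * (j * s)" using n'(1) j1 s1 by simp
      have "order G = (order G div card P) * card P"
        using card_subgroup_dvd[OF subgroup_self P subgroup.subset[OF P]] by (simp add: order_def)
      then have "order G = (order G div card P) * s * card U" using cP by simp
      then have idx: "order G div card U = (order G div card P) * s"
        using pos by (metis nonzero_mult_div_cancel_right less_numeral_extra(3))
      have "order G > 0" using fin by (simp add: order_gt_0_iff_finite)
      then have "order G div card P \<ge> 1"
        using \<open>order G = (order G div card P) * card P\<close> by (cases "order G div card P") auto
      then show "n' * (j * s) \<le> quasipoly (order G div card U)"
        unfolding idx using mult_mono[OF n'(2) js] quasipoly_mult_le[of "order G div card P" s] s1
        by linarith
      fix g assume g: "g \<in> carrier G"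
      then have "(g [^] n') [^] j \<in> W"
        unfolding j_def using n'(3) by (intro pow_index_in_subgroup[OF finP P W WP Wnor]) auto
      then show "g [^] (n' * (j * s)) \<in> U" using WU g by (simp flip: nat_pow_pow)
    qed
  qed
qed

end

section \<open>Endomorphism rings of abelian groups and linear actions\<close>

text \<open>Endomorphisms are kept undefined outside the carrier, so that equality of functions is equality on
  the group.\<close>

definition endo_ring :: "('v, 'm) monoid_scheme \<Rightarrow> ('v \<Rightarrow> 'v) ring" where
  "endo_ring V = \<lparr>carrier = extensional (carrier V) \<inter> hom V V,
     monoid.mult = (\<lambda>f g. \<lambda>v\<in>carrier V. f (g v)), one = (\<lambda>v\<in>carrier V. v),
     zero = (\<lambda>v\<in>carrier V. \<one>\<^bsub>V\<^esub>), add = (\<lambda>f g. \<lambda>v\<in>carrier V. f v \<otimes>\<^bsub>V\<^esub> g v)\<rparr>"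

lemma endo_ring_simps:
  "f \<in> carrier (endo_ring V) \<longleftrightarrow> f \<in> extensional (carrier V) \<and> f \<in> hom V V"
  "monoid.mult (endo_ring V) f g = (\<lambda>v\<in>carrier V. f (g v))"
  "one (endo_ring V) = (\<lambda>v\<in>carrier V. v)"
  "zero (endo_ring V) = (\<lambda>v\<in>carrier V. \<one>\<^bsub>V\<^esub>)"
  "add (endo_ring V) f g = (\<lambda>v\<in>carrier V. f v \<otimes>\<^bsub>V\<^esub> g v)"
  by (simp_all add: endo_ring_def)

lemma (in comm_group) endo_ring_ext:
  assumes "f \<in> carrier (endo_ring G)" "g \<in> carrier (endo_ring G)" "\<And>v. v \<in> carrier G \<Longrightarrow> f v = g v"
  shows "f = g"
  using assms by (auto simp: endo_ring_simps intro: extensionalityI)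

lemma (in comm_group) endo_closed:
  "f \<in> carrier (endo_ring G) \<Longrightarrow> v \<in> carrier G \<Longrightarrow> f v \<in> carrier G"
  by (auto simp: endo_ring_simps hom_def)

lemma (in comm_group) endo_mult:
  "f \<in> carrier (endo_ring G) \<Longrightarrow> v \<in> carrier G \<Longrightarrow> w \<in> carrier G \<Longrightarrow> f (v \<otimes> w) = f v \<otimes> f w"
  by (auto simp: endo_ring_simps hom_def)

lemma (in comm_group) endo_one: "f \<in> carrier (endo_ring G) \<Longrightarrow> f \<one> = \<one>"
  using hom_one[OF _ is_group is_group] by (auto simp: endo_ring_simps)

lemma (in comm_group) endo_inv:
  "f \<in> carrier (endo_ring G) \<Longrightarrow> v \<in> carrier G \<Longrightarrow> f (inv v) = inv (f v)"
  using group_hom.hom_inv[of G G f v] is_group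
  by (auto simp: endo_ring_simps group_hom_def group_hom_axioms_def)

lemma (in comm_group) ring_endo_ring: "ring (endo_ring G)"
proof (rule ringI)
  have cl: "x v \<in> carrier G" if "x \<in> hom G G" "v \<in> carrier G" for x v
    using that by (auto simp: hom_def)
  have ml: "x (v \<otimes> w) = x v \<otimes> x w" if "x \<in> hom G G" "v \<in> carrier G" "w \<in> carrier G" for x v w
    using that by (auto simp: hom_def)
  have one: "x \<one> = \<one>" if "x \<in> hom G G" for x
    using hom_one[OF that is_group is_group] .
  have ext: "x = y" if "x \<in> extensional (carrier G)" "y \<in> extensional (carrier G)"
      "\<And>v. v \<in> carrier G \<Longrightarrow> x v = y v" for x y :: "'a \<Rightarrow> 'a"
    using that by (rule extensionalityI)
  show "abelian_group (endo_ring G)"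
  proof (rule abelian_groupI)
    fix x y assume "x \<in> carrier (endo_ring G)" "y \<in> carrier (endo_ring G)"
    then have xy: "x \<in> hom G G" "y \<in> hom G G" by (auto simp: endo_ring_simps)
    note [simp] = cl[OF xy(1)] ml[OF xy(1)] one[OF xy(1)] cl[OF xy(2)] ml[OF xy(2)] one[OF xy(2)]
    show "x \<oplus>\<^bsub>endo_ring G\<^esub> y \<in> carrier (endo_ring G)"
      unfolding endo_ring_simps
      by (intro conjI restrict_extensional homI) (use xy in \<open>auto simp: m_ac\<close>)
    show "x \<oplus>\<^bsub>endo_ring G\<^esub> y = y \<oplus>\<^bsub>endo_ring G\<^esub> x"
      unfolding endo_ring_simps using xy by (intro restrict_ext) (simp add: m_comm)
  next
    show "\<zero>\<^bsub>endo_ring G\<^esub> \<in> carrier (endo_ring G)"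
      unfolding endo_ring_simps by (intro conjI restrict_extensional homI) auto
  next
    fix x y z assume "x \<in> carrier (endo_ring G)" "y \<in> carrier (endo_ring G)" "z \<in> carrier (endo_ring G)"
    then have xy: "x \<in> hom G G" "y \<in> hom G G" "z \<in> hom G G" by (auto simp: endo_ring_simps)
    note [simp] = cl[OF xy(1)] ml[OF xy(1)] one[OF xy(1)] cl[OF xy(2)] ml[OF xy(2)] one[OF xy(2)] cl[OF xy(3)] ml[OF xy(3)] one[OF xy(3)]
    from xy show "x \<oplus>\<^bsub>endo_ring G\<^esub> y \<oplus>\<^bsub>endo_ring G\<^esub> z = x \<oplus>\<^bsub>endo_ring G\<^esub> (y \<oplus>\<^bsub>endo_ring G\<^esub> z)"
      unfolding endo_ring_simps by (intro restrict_ext) (simp add: m_assoc)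
  next
    fix x assume "x \<in> carrier (endo_ring G)"
    then have xy: "x \<in> hom G G" "x \<in> extensional (carrier G)" by (auto simp: endo_ring_simps)
    note [simp] = cl[OF xy(1)] ml[OF xy(1)] one[OF xy(1)]
    from xy show "\<zero>\<^bsub>endo_ring G\<^esub> \<oplus>\<^bsub>endo_ring G\<^esub> x = x"
      unfolding endo_ring_simps by (intro ext) auto
    let ?y = "\<lambda>v\<in>carrier G. inv (x v)"
    have "?y \<in> carrier (endo_ring G)"
      unfolding endo_ring_simps
      by (intro conjI restrict_extensional homI) (use xy in \<open>auto simp: inv_mult\<close>)
    moreover have "?y \<oplus>\<^bsub>endo_ring G\<^esub> x = \<zero>\<^bsub>endo_ring G\<^esub>"
      unfolding endo_ring_simps using xy by (intro restrict_ext) auto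
    ultimately show "\<exists>y\<in>carrier (endo_ring G). y \<oplus>\<^bsub>endo_ring G\<^esub> x = \<zero>\<^bsub>endo_ring G\<^esub>" by blast
  qed
  show "monoid (endo_ring G)"
  proof (rule monoidI)
    fix x y assume "x \<in> carrier (endo_ring G)" "y \<in> carrier (endo_ring G)"
    then have xy: "x \<in> hom G G" "y \<in> hom G G" by (auto simp: endo_ring_simps)
    note [simp] = cl[OF xy(1)] ml[OF xy(1)] one[OF xy(1)] cl[OF xy(2)] ml[OF xy(2)] one[OF xy(2)]
    show "x \<otimes>\<^bsub>endo_ring G\<^esub> y \<in> carrier (endo_ring G)"
      unfolding endo_ring_simps
      by (intro conjI restrict_extensional homI) (use xy in auto)
  next
    show "\<one>\<^bsub>endo_ring G\<^esub> \<in> carrier (endo_ring G)"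
      unfolding endo_ring_simps by (intro conjI restrict_extensional homI) auto
  next
    fix x y z assume "x \<in> carrier (endo_ring G)" "y \<in> carrier (endo_ring G)" "z \<in> carrier (endo_ring G)"
    then have xy: "x \<in> hom G G" "y \<in> hom G G" "z \<in> hom G G" by (auto simp: endo_ring_simps)
    note [simp] = cl[OF xy(1)] ml[OF xy(1)] one[OF xy(1)] cl[OF xy(2)] ml[OF xy(2)] one[OF xy(2)] cl[OF xy(3)] ml[OF xy(3)] one[OF xy(3)]
    from xy show "x \<otimes>\<^bsub>endo_ring G\<^esub> y \<otimes>\<^bsub>endo_ring G\<^esub> z = x \<otimes>\<^bsub>endo_ring G\<^esub> (y \<otimes>\<^bsub>endo_ring G\<^esub> z)"
      unfolding endo_ring_simps by (intro restrict_ext) simp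
  next
    fix x assume "x \<in> carrier (endo_ring G)"
    then have xy: "x \<in> hom G G" "x \<in> extensional (carrier G)" by (auto simp: endo_ring_simps)
    note [simp] = cl[OF xy(1)] ml[OF xy(1)] one[OF xy(1)]
    from xy show "\<one>\<^bsub>endo_ring G\<^esub> \<otimes>\<^bsub>endo_ring G\<^esub> x = x" "x \<otimes>\<^bsub>endo_ring G\<^esub> \<one>\<^bsub>endo_ring G\<^esub> = x"
      unfolding endo_ring_simps by (auto intro!: ext)
  qed
  fix x y z assume "x \<in> carrier (endo_ring G)" "y \<in> carrier (endo_ring G)" "z \<in> carrier (endo_ring G)"
  then have xy: "x \<in> hom G G" "y \<in> hom G G" "z \<in> hom G G" by (auto simp: endo_ring_simps)
  note [simp] = cl[OF xy(1)] ml[OF xy(1)] one[OF xy(1)] cl[OF xy(2)] ml[OF xy(2)] one[OF xy(2)] cl[OF xy(3)] ml[OF xy(3)] one[OF xy(3)]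
  from xy show "(x \<oplus>\<^bsub>endo_ring G\<^esub> y) \<otimes>\<^bsub>endo_ring G\<^esub> z
      = x \<otimes>\<^bsub>endo_ring G\<^esub> z \<oplus>\<^bsub>endo_ring G\<^esub> y \<otimes>\<^bsub>endo_ring G\<^esub> z"
    and "z \<otimes>\<^bsub>endo_ring G\<^esub> (x \<oplus>\<^bsub>endo_ring G\<^esub> y)
      = z \<otimes>\<^bsub>endo_ring G\<^esub> x \<oplus>\<^bsub>endo_ring G\<^esub> z \<otimes>\<^bsub>endo_ring G\<^esub> y"
    unfolding endo_ring_simps by (intro restrict_ext, simp)+
qed

lemma (in comm_group) finite_endo_ring:
  assumes "finite (carrier G)"
  shows "finite (carrier (endo_ring G))"
proof (rule finite_subset)
  show "carrier (endo_ring G) \<subseteq> carrier G \<rightarrow>\<^sub>E carrier G"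
    by (auto simp: endo_ring_def hom_def PiE_def)
qed (use assms in \<open>simp add: finite_PiE\<close>)

lemma (in comm_group) endo_image_subgroup:
  assumes f: "f \<in> carrier (endo_ring G)"
  shows "subgroup (f ` carrier G) G"
proof -
  have "f \<in> hom G G" using f by (simp add: endo_ring_simps)
  then interpret group_hom G G f by unfold_locales
  show ?thesis by (rule img_is_subgroup)
qed

definition commutant :: "('e, 'm) monoid_scheme \<Rightarrow> 'e set \<Rightarrow> 'e set" where
  "commutant E X = {f \<in> carrier E. \<forall>x\<in>X. f \<otimes>\<^bsub>E\<^esub> x = x \<otimes>\<^bsub>E\<^esub> f}"

lemma (in ring) subring_commutant:
  assumes X: "X \<subseteq> carrier R"
  shows "subring (commutant R X) R"
proof (rule subringI)
  show "commutant R X \<subseteq> carrier R" "\<one> \<in> commutant R X"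
    using X by (auto simp: commutant_def subset_iff)
  fix h assume h: "h \<in> commutant R X"
  have "\<ominus> h \<otimes> x = x \<otimes> \<ominus> h" if "x \<in> X" for x
    using that h X by (simp add: commutant_def subset_iff l_minus r_minus)
  then show "\<ominus> h \<in> commutant R X" using h by (simp add: commutant_def)
next
  fix h1 h2 assume h: "h1 \<in> commutant R X" "h2 \<in> commutant R X"
  have "(h1 \<otimes> h2) \<otimes> x = x \<otimes> (h1 \<otimes> h2)" if "x \<in> X" for x
  proof -
    have c: "h1 \<in> carrier R" "h2 \<in> carrier R" "x \<in> carrier R" using that h X by (auto simp: commutant_def)
    have "(h1 \<otimes> h2) \<otimes> x = h1 \<otimes> (x \<otimes> h2)" using h that c by (simp add: commutant_def m_assoc)
    also have "\<dots> = x \<otimes> (h1 \<otimes> h2)" using h that c by (simp add: commutant_def flip: m_assoc)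
    finally show ?thesis .
  qed
  then show "h1 \<otimes> h2 \<in> commutant R X" using h by (simp add: commutant_def)
  have "(h1 \<oplus> h2) \<otimes> x = x \<otimes> (h1 \<oplus> h2)" if "x \<in> X" for x
    using that h X by (simp add: commutant_def subset_iff l_distr r_distr)
  then show "h1 \<oplus> h2 \<in> commutant R X" using h by (simp add: commutant_def)
qed

lemma (in monoid) finite_idempotent_power:
  assumes "finite (carrier G)" "x \<in> carrier G"
  shows "\<exists>n\<ge>1. x [^] (n::nat) \<otimes> x [^] n = x [^] n"
proof -
  have "\<not> inj_on (\<lambda>n::nat. x [^] n) {1..}"
  proof
    assume "inj_on (\<lambda>n::nat. x [^] n) {1..}"
    moreover have "(\<lambda>n::nat. x [^] n) ` {1..} \<subseteq> carrier G" using assms(2) by auto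
    then have "finite ((\<lambda>n::nat. x [^] n) ` {1..})" using assms(1) by (rule finite_subset)
    ultimately have "finite {1::nat..}" by (simp add: finite_image_iff)
    then show False by (simp add: infinite_Ici)
  qed
  then obtain i0 j0 :: nat where ij0: "1 \<le> i0" "1 \<le> j0" "i0 \<noteq> j0" "x [^] i0 = x [^] j0"
    unfolding inj_on_def by auto
  obtain i j :: nat where ij: "1 \<le> i" "i < j" "x [^] i = x [^] j"
    using ij0 that[of i0 j0] that[of j0 i0] by (cases "i0 < j0") auto
  define d where "d = j - i"
  have d: "x [^] (m + k * d) = x [^] m" if "m \<ge> i" for m k
  proof (induction k)
    case (Suc k)
    have "x [^] (m + d) = x [^] m"
    proof -
      have "x [^] (m + d) = x [^] (m - i) \<otimes> x [^] j"
        using that ij assms(2) by (simp add: nat_pow_mult d_def)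
      also have "\<dots> = x [^] m" using that ij assms(2) by (simp add: nat_pow_mult flip: ij(3))
      finally show ?thesis .
    qed
    moreover have "x [^] (m + Suc k * d) = x [^] (m + d) \<otimes> x [^] (k * d)"
      using assms(2) by (simp add: nat_pow_mult algebra_simps)
    ultimately show ?case using Suc assms(2) by (simp add: nat_pow_mult)
  qed simp
  have "i \<le> i * d" "1 \<le> i * d" using ij by (auto simp: d_def)
  then show ?thesis using d[of "i * d" i] assms(2) by (intro exI[of _ "i * d"]) (simp add: nat_pow_mult)
qed

locale linear_action = group S + V: comm_group V for S (structure) and V +
  fixes act :: "'a \<Rightarrow> 'c \<Rightarrow> 'c"
  assumes act_hom: "g \<in> carrier S \<Longrightarrow> act g \<in> hom V V"
    and act_mult: "g \<in> carrier S \<Longrightarrow> h \<in> carrier S \<Longrightarrow> v \<in> carrier V \<Longrightarrow> act (g \<otimes> h) v = act g (act h v)"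
    and act_one: "v \<in> carrier V \<Longrightarrow> act \<one> v = v"
    and finite_S: "finite (carrier S)"
    and finite_V: "finite (carrier V)"
begin

abbreviation E :: "('c \<Rightarrow> 'c) ring" where "E \<equiv> endo_ring V"

sublocale E: ring E by (rule V.ring_endo_ring)

definition rep :: "'a \<Rightarrow> 'c \<Rightarrow> 'c" where "rep g = restrict (act g) (carrier V)"

definition act_kernel :: "'a set" where
  "act_kernel = {g \<in> carrier S. \<forall>v\<in>carrier V. act g v = v}"

definition invariant :: "'c set \<Rightarrow> bool" where
  "invariant W \<longleftrightarrow> subgroup W V \<and> (\<forall>g\<in>carrier S. \<forall>w\<in>W. act g w \<in> W)"

lemma finite_E: "finite (carrier E)"
  by (rule V.finite_endo_ring[OF finite_V])

lemma act_closed [simp]: "g \<in> carrier S \<Longrightarrow> v \<in> carrier V \<Longrightarrow> act g v \<in> carrier V"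
  using act_hom by (auto simp: hom_def)

lemma act_inv [simp]:
  assumes "g \<in> carrier S" "v \<in> carrier V"
  shows "act (inv g) (act g v) = v" "act g (act (inv g) v) = v"
  using assms by (simp_all add: act_one flip: act_mult)

lemma rep_closed [simp]: "g \<in> carrier S \<Longrightarrow> rep g \<in> carrier E"
  using act_hom[of g] by (auto simp: rep_def endo_ring_simps hom_def)

lemma rep_mult: "g \<in> carrier S \<Longrightarrow> h \<in> carrier S \<Longrightarrow> rep (g \<otimes> h) = rep g \<otimes>\<^bsub>E\<^esub> rep h"
  by (auto simp: rep_def endo_ring_simps act_mult intro!: restrict_ext)

lemma rep_one [simp]: "rep \<one> = \<one>\<^bsub>E\<^esub>"
  by (auto simp: rep_def endo_ring_simps act_one intro!: restrict_ext)

lemma rep_inv [simp]: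
  "g \<in> carrier S \<Longrightarrow> rep g \<otimes>\<^bsub>E\<^esub> rep (inv g) = \<one>\<^bsub>E\<^esub>"
  "g \<in> carrier S \<Longrightarrow> rep (inv g) \<otimes>\<^bsub>E\<^esub> rep g = \<one>\<^bsub>E\<^esub>"
  by (simp_all flip: rep_mult)

lemma rep_inv_cancel [simp]:
  assumes "g \<in> carrier S" "x \<in> carrier E"
  shows "rep g \<otimes>\<^bsub>E\<^esub> (rep (inv g) \<otimes>\<^bsub>E\<^esub> x) = x"
    "rep (inv g) \<otimes>\<^bsub>E\<^esub> (rep g \<otimes>\<^bsub>E\<^esub> x) = x"
  using assms by (simp_all flip: E.m_assoc)

lemma rep_pow: "g \<in> carrier S \<Longrightarrow> rep (g [^] n) = rep g [^]\<^bsub>E\<^esub> (n::nat)"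
  by (induction n) (simp_all add: rep_mult)

lemma act_kernel_iff: "g \<in> act_kernel \<longleftrightarrow> g \<in> carrier S \<and> rep g = \<one>\<^bsub>E\<^esub>"
proof -
  have "rep g = \<one>\<^bsub>E\<^esub> \<longleftrightarrow> (\<forall>v\<in>carrier V. act g v = v)"
    unfolding rep_def endo_ring_simps
    by (metis (no_types, lifting) restrict_apply' restrict_ext)
  then show ?thesis by (auto simp: act_kernel_def)
qed

lemma rep_eq_iff:
  assumes "g \<in> carrier S" "h \<in> carrier S"
  shows "rep g = rep h \<longleftrightarrow> inv g \<otimes> h \<in> act_kernel"
proof
  assume "rep g = rep h"
  then show "inv g \<otimes> h \<in> act_kernel"
    using assms by (simp add: act_kernel_iff rep_mult flip: \<open>rep g = rep h\<close>)
next
  assume "inv g \<otimes> h \<in> act_kernel"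
  then have "rep g \<otimes>\<^bsub>E\<^esub> (rep (inv g) \<otimes>\<^bsub>E\<^esub> rep h) = rep g"
    using assms by (simp add: act_kernel_iff rep_mult)
  then show "rep g = rep h" using assms by simp
qed

lemma act_kernel_normal: "act_kernel \<lhd> S"
  unfolding normal_inv_iff
proof (intro conjI ballI)
  show "subgroup act_kernel S"
    by (rule subgroupI) (auto simp: act_kernel_def act_mult act_one dest: act_inv(1) intro!: exI[of _ \<one>])
  fix x h assume "x \<in> carrier S" "h \<in> act_kernel"
  then show "x \<otimes> h \<otimes> inv x \<in> act_kernel"
    by (simp add: act_kernel_iff rep_mult E.m_assoc)
qed

lemma commutator_in_kernel_iff:
  assumes "g \<in> carrier S" "h \<in> carrier S"
  shows "commutator g h \<in> act_kernel \<longleftrightarrow> rep g \<otimes>\<^bsub>E\<^esub> rep h = rep h \<otimes>\<^bsub>E\<^esub> rep g"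
proof -
  have "inv (h \<otimes> g) \<otimes> (g \<otimes> h) = inv g \<otimes> (inv h \<otimes> (g \<otimes> h \<otimes> inv g \<otimes> inv h) \<otimes> h) \<otimes> g"
    using assms by (simp add: word_simps)
  moreover have "commutator g h = h \<otimes> (g \<otimes> (inv (h \<otimes> g) \<otimes> (g \<otimes> h)) \<otimes> inv g) \<otimes> inv h"
    using assms by (simp add: commutator_def word_simps)
  ultimately have "commutator g h \<in> act_kernel \<longleftrightarrow> inv (h \<otimes> g) \<otimes> (g \<otimes> h) \<in> act_kernel"
    using assms normal_conj[OF act_kernel_normal] unfolding commutator_def by metis
  also have "\<dots> \<longleftrightarrow> rep (h \<otimes> g) = rep (g \<otimes> h)" using assms by (simp add: rep_eq_iff)
  finally show ?thesis using assms by (auto simp: rep_mult)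
qed

text \<open>Conjugation by the operators of \<open>S\<close>, an action by ring automorphisms.\<close>

definition cnj :: "'a \<Rightarrow> ('c \<Rightarrow> 'c) \<Rightarrow> 'c \<Rightarrow> 'c" where
  "cnj g x = rep g \<otimes>\<^bsub>E\<^esub> x \<otimes>\<^bsub>E\<^esub> rep (inv g)"

lemma cnj_closed [simp]: "g \<in> carrier S \<Longrightarrow> x \<in> carrier E \<Longrightarrow> cnj g x \<in> carrier E"
  by (simp add: cnj_def)

lemma cnj_mult:
  assumes "g \<in> carrier S" "x \<in> carrier E" "y \<in> carrier E"
  shows "cnj g (x \<otimes>\<^bsub>E\<^esub> y) = cnj g x \<otimes>\<^bsub>E\<^esub> cnj g y"
  using assms by (simp add: cnj_def E.m_assoc)

lemma cnj_cnj:
  assumes "g \<in> carrier S" "h \<in> carrier S" "x \<in> carrier E"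
  shows "cnj g (cnj h x) = cnj (g \<otimes> h) x"
  using assms by (simp add: cnj_def inv_mult_group rep_mult E.m_assoc)

lemma cnj_by_one [simp]: "x \<in> carrier E \<Longrightarrow> cnj \<one> x = x"
  by (simp add: cnj_def)

lemma cnj_one [simp]: "g \<in> carrier S \<Longrightarrow> cnj g \<one>\<^bsub>E\<^esub> = \<one>\<^bsub>E\<^esub>"
  by (simp add: cnj_def)

lemma cnj_zero [simp]: "g \<in> carrier S \<Longrightarrow> cnj g \<zero>\<^bsub>E\<^esub> = \<zero>\<^bsub>E\<^esub>"
  by (simp add: cnj_def)

lemma cnj_inv [simp]:
  assumes "g \<in> carrier S" "x \<in> carrier E"
  shows "cnj (inv g) (cnj g x) = x" "cnj g (cnj (inv g) x) = x"
  using assms by (simp_all add: cnj_cnj)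

lemma cnj_rep: "g \<in> carrier S \<Longrightarrow> h \<in> carrier S \<Longrightarrow> cnj g (rep h) = rep (g \<otimes> h \<otimes> inv g)"
  by (simp add: cnj_def rep_mult)

lemma cnj_eq_iff_commute:
  assumes "g \<in> carrier S" "x \<in> carrier E"
  shows "cnj g x = x \<longleftrightarrow> rep g \<otimes>\<^bsub>E\<^esub> x = x \<otimes>\<^bsub>E\<^esub> rep g"
proof
  assume "cnj g x = x"
  then have "cnj g x \<otimes>\<^bsub>E\<^esub> rep g = x \<otimes>\<^bsub>E\<^esub> rep g" by simp
  then show "rep g \<otimes>\<^bsub>E\<^esub> x = x \<otimes>\<^bsub>E\<^esub> rep g"
    using assms by (simp add: cnj_def E.m_assoc)
qed (use assms in \<open>simp add: cnj_def E.m_assoc\<close>)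

lemma cnj_apply: "g \<in> carrier S \<Longrightarrow> x \<in> carrier E \<Longrightarrow> v \<in> carrier V \<Longrightarrow>
    cnj g x v = act g (x (act (inv g) v))"
  by (simp add: cnj_def rep_def endo_ring_simps V.endo_closed)

lemma cnj_commutant:
  assumes X: "X \<subseteq> carrier E" "\<And>g x. g \<in> carrier S \<Longrightarrow> x \<in> X \<Longrightarrow> cnj g x \<in> X"
    and g: "g \<in> carrier S" and f: "f \<in> commutant E X"
  shows "cnj g f \<in> commutant E X"
proof -
  have fc: "f \<in> carrier E" using f by (simp add: commutant_def)
  have "cnj g f \<otimes>\<^bsub>E\<^esub> x = x \<otimes>\<^bsub>E\<^esub> cnj g f" if x: "x \<in> X" for x
  proof -
    have xc: "x \<in> carrier E" using x X by blast
    have "cnj (inv g) x \<in> X" using x g X(2) by simp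
    then have e: "f \<otimes>\<^bsub>E\<^esub> cnj (inv g) x = cnj (inv g) x \<otimes>\<^bsub>E\<^esub> f" using f by (simp add: commutant_def)
    have "cnj g f \<otimes>\<^bsub>E\<^esub> cnj g (cnj (inv g) x) = cnj g (cnj (inv g) x) \<otimes>\<^bsub>E\<^esub> cnj g f"
      using g fc xc e by (simp add: del: cnj_inv flip: cnj_mult)
    then show ?thesis using g xc by simp
  qed
  then show ?thesis using g fc by (simp add: commutant_def)
qed

end

section \<open>The double commutant of a maximal abelian normal subgroup\<close>

locale irreducible_action = linear_action +
  assumes nontrivial: "carrier V \<noteq> {\<one>\<^bsub>V\<^esub>}"
    and irreducible: "invariant W \<Longrightarrow> W = {\<one>\<^bsub>V\<^esub>} \<or> W = carrier V"
    and solvable_S: "solvable S"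

text \<open>All subgroups are taken modulo the kernel, so that the induction need not pass to quotients of \<open>S\<close>.\<close>

locale maximal_abelian_action = irreducible_action +
  fixes A
  assumes A_normal: "A \<lhd> S"
    and kernel_A: "act_kernel \<subseteq> A"
    and A_abelian: "A \<subseteq> centralizer_mod act_kernel A"
    and A_max: "\<And>B. B \<lhd> S \<Longrightarrow> A \<subseteq> B \<Longrightarrow> B \<subseteq> centralizer_mod act_kernel B \<Longrightarrow> B = A"
begin

lemma A_carrier [simp]: "a \<in> A \<Longrightarrow> a \<in> carrier S"
  using normal_subset[OF A_normal] by blast

text \<open>The double commutant is commutative because the operators of \<open>A\<close> commute, and invariant under
  conjugation because \<open>A\<close> is normal.\<close>

definition R :: "('c \<Rightarrow> 'c) set" where
  "R = commutant E (commutant E (rep ` A))"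

definition C :: "'a set" where "C = centralizer_mod act_kernel A"

lemma A_subset_C: "A \<subseteq> C"
  unfolding C_def by (rule A_abelian)

lemma C_normal: "C \<lhd> S"
  unfolding C_def using normal_conj(1)[OF A_normal]
  by (intro centralizer_mod_normal[OF act_kernel_normal]) auto

lemma C_carrier [simp]: "g \<in> C \<Longrightarrow> g \<in> carrier S"
  using normal_subset[OF C_normal] by blast

lemma rep_A_carrier: "rep ` A \<subseteq> carrier E"
  by auto

lemma R_carrier [simp]: "x \<in> R \<Longrightarrow> x \<in> carrier E"
  by (simp add: R_def commutant_def)

lemma rep_A_R: "a \<in> A \<Longrightarrow> rep a \<in> R"
  using rep_A_carrier unfolding R_def commutant_def by fastforce

lemma rep_A_subset_commutant: "rep ` A \<subseteq> commutant E (rep ` A)"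
proof -
  have "rep a \<otimes>\<^bsub>E\<^esub> rep b = rep b \<otimes>\<^bsub>E\<^esub> rep a" if "a \<in> A" "b \<in> A" for a b
    using that A_abelian commutator_in_kernel_iff[of a b] by (auto simp: centralizer_mod_def)
  then show ?thesis using rep_A_carrier unfolding commutant_def by fastforce
qed

lemma R_comm: "x \<in> R \<Longrightarrow> y \<in> R \<Longrightarrow> x \<otimes>\<^bsub>E\<^esub> y = y \<otimes>\<^bsub>E\<^esub> x"
proof -
  assume x: "x \<in> R" and y: "y \<in> R"
  have "y \<in> commutant E (rep ` A)"
    using y rep_A_subset_commutant unfolding R_def commutant_def by blast
  then show ?thesis using x unfolding R_def commutant_def by blast
qed

lemma R_subring: "subring R E"
  unfolding R_def by (intro E.subring_commutant) (auto simp: commutant_def)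

lemma R_closed:
  "x \<in> R \<Longrightarrow> y \<in> R \<Longrightarrow> x \<otimes>\<^bsub>E\<^esub> y \<in> R" "x \<in> R \<Longrightarrow> y \<in> R \<Longrightarrow> x \<oplus>\<^bsub>E\<^esub> y \<in> R"
  "x \<in> R \<Longrightarrow> \<ominus>\<^bsub>E\<^esub> x \<in> R" "\<one>\<^bsub>E\<^esub> \<in> R" "\<zero>\<^bsub>E\<^esub> \<in> R"
  using subringE[OF R_subring] by auto

lemma R_cnj: "g \<in> carrier S \<Longrightarrow> x \<in> R \<Longrightarrow> cnj g x \<in> R"
proof -
  have 1: "cnj g x \<in> rep ` A" if "g \<in> carrier S" "x \<in> rep ` A" for g x
    using that normal_conj(1)[OF A_normal] by (auto simp: cnj_rep)
  have 2: "cnj g x \<in> commutant E (rep ` A)" if "g \<in> carrier S" "x \<in> commutant E (rep ` A)" for g x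
    by (rule cnj_commutant[OF rep_A_carrier 1 that])
  show "g \<in> carrier S \<Longrightarrow> x \<in> R \<Longrightarrow> cnj g x \<in> R"
    unfolding R_def by (rule cnj_commutant[OF _ 2]) (auto simp: commutant_def)
qed

lemma C_commutes_R: "g \<in> C \<Longrightarrow> x \<in> R \<Longrightarrow> rep g \<otimes>\<^bsub>E\<^esub> x = x \<otimes>\<^bsub>E\<^esub> rep g"
proof -
  assume g: "g \<in> C" and x: "x \<in> R"
  have "rep g \<in> commutant E (rep ` A)"
    using g commutator_in_kernel_iff[of g] unfolding commutant_def C_def centralizer_mod_def by auto
  then show ?thesis using x unfolding R_def commutant_def by auto
qed

lemma mem_C_if_commutes_R:
  assumes "g \<in> carrier S" "\<And>x. x \<in> R \<Longrightarrow> rep g \<otimes>\<^bsub>E\<^esub> x = x \<otimes>\<^bsub>E\<^esub> rep g"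
  shows "g \<in> C"
  using assms rep_A_R commutator_in_kernel_iff[of g] unfolding C_def centralizer_mod_def by auto

lemma one_neq_zero_E: "\<one>\<^bsub>E\<^esub> \<noteq> \<zero>\<^bsub>E\<^esub>"
proof
  assume "\<one>\<^bsub>E\<^esub> = \<zero>\<^bsub>E\<^esub>"
  then have "v = \<one>\<^bsub>V\<^esub>" if "v \<in> carrier V" for v
    using that by (simp add: endo_ring_simps fun_eq_iff restrict_def) (metis (mono_tags))
  then show False using nontrivial V.one_closed by blast
qed

end

locale minimal_idempotent_action = maximal_abelian_action +
  fixes f
  assumes f_R: "f \<in> R" and f_idem: "f \<otimes>\<^bsub>E\<^esub> f = f" and f_nz: "f \<noteq> \<zero>\<^bsub>E\<^esub>"
    and f_min: "\<And>e. e \<in> R \<Longrightarrow> e \<otimes>\<^bsub>E\<^esub> e = e \<Longrightarrow> e \<noteq> \<zero>\<^bsub>E\<^esub> \<Longrightarrow> card (f ` carrier V) \<le> card (e ` carrier V)"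
begin

definition conjs :: "('c \<Rightarrow> 'c) set" where
  "conjs = (\<lambda>g. cnj g f) ` carrier S"

lemma f_carrier [simp]: "f \<in> carrier E" using f_R by simp

text \<open>The product \<open>e f\<close> is an idempotent with image inside that of \<open>f\<close>, so minimality makes the two images
  equal.\<close>

lemma idempotent_absorbs:
  assumes e: "e \<in> R" "e \<otimes>\<^bsub>E\<^esub> e = e" and nz: "e \<otimes>\<^bsub>E\<^esub> f \<noteq> \<zero>\<^bsub>E\<^esub>"
  shows "e \<otimes>\<^bsub>E\<^esub> f = f"
proof -
  have ec [simp]: "e \<in> carrier E" using e by simp
  have fe: "f \<otimes>\<^bsub>E\<^esub> e = e \<otimes>\<^bsub>E\<^esub> f" by (rule R_comm[OF f_R e(1)])
  have "(e \<otimes>\<^bsub>E\<^esub> f) \<otimes>\<^bsub>E\<^esub> (e \<otimes>\<^bsub>E\<^esub> f) = e \<otimes>\<^bsub>E\<^esub> (f \<otimes>\<^bsub>E\<^esub> e) \<otimes>\<^bsub>E\<^esub> f"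
    by (simp add: E.m_assoc)
  also have "\<dots> = (e \<otimes>\<^bsub>E\<^esub> e) \<otimes>\<^bsub>E\<^esub> (f \<otimes>\<^bsub>E\<^esub> f)" unfolding fe by (simp add: E.m_assoc)
  finally have "(e \<otimes>\<^bsub>E\<^esub> f) \<otimes>\<^bsub>E\<^esub> (e \<otimes>\<^bsub>E\<^esub> f) = e \<otimes>\<^bsub>E\<^esub> f" by (simp add: e f_idem)
  then have "card (f ` carrier V) \<le> card ((e \<otimes>\<^bsub>E\<^esub> f) ` carrier V)"
    using f_min[of "e \<otimes>\<^bsub>E\<^esub> f"] nz R_closed(1)[OF e(1) f_R] by simp
  moreover have "(f \<otimes>\<^bsub>E\<^esub> e) ` carrier V \<subseteq> f ` carrier V"
    using V.endo_closed[OF ec] by (auto simp: endo_ring_simps)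
  then have "(e \<otimes>\<^bsub>E\<^esub> f) ` carrier V \<subseteq> f ` carrier V" by (simp add: fe)
  ultimately have im: "(e \<otimes>\<^bsub>E\<^esub> f) ` carrier V = f ` carrier V"
    using finite_V by (intro card_seteq) auto
  show ?thesis
  proof (rule V.endo_ring_ext)
    fix v assume v: "v \<in> carrier V"
    then have "f v \<in> (e \<otimes>\<^bsub>E\<^esub> f) ` carrier V" using im by blast
    then obtain w where w: "w \<in> carrier V" "f v = e (f w)" by (auto simp: endo_ring_simps)
    have "e (f v) = (e \<otimes>\<^bsub>E\<^esub> e) (f w)" using w V.endo_closed[OF f_carrier w(1)] by (simp add: endo_ring_simps)
    then have "e (f v) = f v" using e(2) w(2) by simp
    then show "(e \<otimes>\<^bsub>E\<^esub> f) v = f v" using v by (simp add: endo_ring_simps)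
  qed auto
qed

lemma conjs_R: "e \<in> conjs \<Longrightarrow> e \<in> R"
  using R_cnj[OF _ f_R] by (auto simp: conjs_def)

lemma conjs_carrier [simp]: "e \<in> conjs \<Longrightarrow> e \<in> carrier E"
  using conjs_R by simp

lemma finite_conjs: "finite conjs"
  unfolding conjs_def using finite_S by simp

lemma f_conjs: "f \<in> conjs"
  unfolding conjs_def by (intro image_eqI[of _ _ \<one>]) auto

lemma conjs_idem: "e \<in> conjs \<Longrightarrow> e \<otimes>\<^bsub>E\<^esub> e = e"
  by (auto simp: conjs_def f_idem simp flip: cnj_mult)

lemma cnj_conjs: "g \<in> carrier S \<Longrightarrow> e \<in> conjs \<Longrightarrow> cnj g e \<in> conjs"
  by (auto simp: conjs_def cnj_cnj)

lemma conjs_absorb: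
  assumes e: "e \<in> conjs" and d: "d \<in> conjs" and nz: "e \<otimes>\<^bsub>E\<^esub> d \<noteq> \<zero>\<^bsub>E\<^esub>"
  shows "e \<otimes>\<^bsub>E\<^esub> d = d"
proof -
  obtain h where h: "h \<in> carrier S" "d = cnj h f" using d by (auto simp: conjs_def)
  let ?e = "cnj (inv h) e"
  have ec: "?e \<in> conjs" using e h cnj_conjs by simp
  have ed: "e \<otimes>\<^bsub>E\<^esub> d = cnj h (?e \<otimes>\<^bsub>E\<^esub> f)" using h e by (simp add: cnj_mult)
  then have "?e \<otimes>\<^bsub>E\<^esub> f \<noteq> \<zero>\<^bsub>E\<^esub>" using nz h(1) by auto
  then have "?e \<otimes>\<^bsub>E\<^esub> f = f" using idempotent_absorbs ec conjs_R conjs_idem by blast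
  then show ?thesis using ed h by simp
qed

lemma conjs_orthogonal:
  assumes "e \<in> conjs" "d \<in> conjs" "e \<noteq> d"
  shows "e \<otimes>\<^bsub>E\<^esub> d = \<zero>\<^bsub>E\<^esub>"
  using conjs_absorb[OF assms(1,2)] conjs_absorb[OF assms(2,1)] R_comm[of e d] conjs_R assms by metis

text \<open>The sum of orthogonal idempotents is an idempotent.  Its image is invariant, because \<open>S\<close> permutes the
  summands, and so it is all of \<open>V\<close>.\<close>

lemma sum_conjs: "finsum E (\<lambda>e. e) conjs = \<one>\<^bsub>E\<^esub>"
proof -
  define u where "u = finsum E (\<lambda>e. e) conjs"
  have cl: "(\<lambda>e. e) \<in> conjs \<rightarrow> carrier E" by auto
  have uc [simp]: "u \<in> carrier E" unfolding u_def by (rule E.finsum_closed[OF cl])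
  have ud: "u \<otimes>\<^bsub>E\<^esub> d = d" if d: "d \<in> conjs" for d
  proof -
    have "u \<otimes>\<^bsub>E\<^esub> d = finsum E (\<lambda>e. e \<otimes>\<^bsub>E\<^esub> d) conjs"
      unfolding u_def by (rule E.finsum_ldistr[OF finite_conjs _ cl]) (use d in simp)
    also have "\<dots> = finsum E (\<lambda>e. if d = e then e else \<zero>\<^bsub>E\<^esub>) conjs"
      by (rule E.finsum_cong') (use d conjs_idem conjs_orthogonal in auto)
    also have "\<dots> = d" by (rule E.finsum_singleton[OF d finite_conjs cl])
    finally show ?thesis .
  qed
  have "u \<otimes>\<^bsub>E\<^esub> u = finsum E (\<lambda>e. u \<otimes>\<^bsub>E\<^esub> e) conjs"
    by (subst (2) u_def) (rule E.finsum_rdistr[OF finite_conjs uc cl])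
  also have "\<dots> = u" unfolding u_def[symmetric]
    by (subst (2) u_def) (rule E.finsum_cong'; use ud in auto)
  finally have uu: "u \<otimes>\<^bsub>E\<^esub> u = u" .
  have cu: "cnj g u = u" if g: "g \<in> carrier S" for g
  proof -
    have "rep g \<otimes>\<^bsub>E\<^esub> u = finsum E (\<lambda>e. rep g \<otimes>\<^bsub>E\<^esub> e) conjs"
      unfolding u_def by (rule E.finsum_rdistr[OF finite_conjs _ cl]) (use g in simp)
    then have "cnj g u = finsum E (\<lambda>e. rep g \<otimes>\<^bsub>E\<^esub> e) conjs \<otimes>\<^bsub>E\<^esub> rep (inv g)"
      by (simp add: cnj_def)
    also have "\<dots> = finsum E (\<lambda>e. rep g \<otimes>\<^bsub>E\<^esub> e \<otimes>\<^bsub>E\<^esub> rep (inv g)) conjs"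
      by (rule E.finsum_ldistr[OF finite_conjs]) (use g in auto)
    also have "\<dots> = finsum E (\<lambda>e. (\<lambda>e. e) (cnj g e)) conjs" by (simp add: cnj_def)
    also have "\<dots> = finsum E (\<lambda>e. e) (cnj g ` conjs)"
    proof (rule E.finsum_reindex[symmetric])
      show "(\<lambda>e. e) \<in> cnj g ` conjs \<rightarrow> carrier E" using g by auto
      show "inj_on (cnj g) conjs"
        using g by (intro inj_on_inverseI[of _ "cnj (inv g)"]) simp
    qed
    also have "cnj g ` conjs = conjs"
    proof
      show "cnj g ` conjs \<subseteq> conjs" using g cnj_conjs by auto
      show "conjs \<subseteq> cnj g ` conjs"
      proof
        fix e assume e: "e \<in> conjs"
        then have "e = cnj g (cnj (inv g) e)" using g by simp
        then show "e \<in> cnj g ` conjs" using cnj_conjs[of "inv g" e] e g by blast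
      qed
    qed
    finally show ?thesis by (simp add: u_def)
  qed
  have "invariant (u ` carrier V)"
    unfolding invariant_def
  proof (intro conjI ballI)
    show "subgroup (u ` carrier V) V" by (rule V.endo_image_subgroup[OF uc])
    fix g w assume g: "g \<in> carrier S" and "w \<in> u ` carrier V"
    then obtain v where v: "v \<in> carrier V" "w = u v" by blast
    have "u (act g v) = act g (u v)" using cnj_apply[OF g uc, of "act g v"] cu[OF g] g v by simp
    then show "act g w \<in> u ` carrier V" using v g by (metis act_closed imageI)
  qed
  moreover have "u ` carrier V \<noteq> {\<one>\<^bsub>V\<^esub>}"
  proof
    assume triv: "u ` carrier V = {\<one>\<^bsub>V\<^esub>}"
    have "u = \<zero>\<^bsub>E\<^esub>"
    proof (rule V.endo_ring_ext)
      fix v assume "v \<in> carrier V"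
      then show "u v = \<zero>\<^bsub>E\<^esub> v" using triv by (auto simp: endo_ring_simps)
    qed auto
    then show False using ud[OF f_conjs] f_nz by simp
  qed
  ultimately have im: "u ` carrier V = carrier V" using irreducible by blast
  have "u = \<one>\<^bsub>E\<^esub>"
  proof (rule V.endo_ring_ext)
    fix v assume v: "v \<in> carrier V"
    then obtain w where w: "w \<in> carrier V" "v = u w" using im by blast
    have "u v = (u \<otimes>\<^bsub>E\<^esub> u) w" using w by (simp add: endo_ring_simps)
    then have "u v = v" unfolding uu using w by simp
    then show "u v = \<one>\<^bsub>E\<^esub> v" using v by (simp add: endo_ring_simps)
  qed auto
  then show ?thesis by (simp add: u_def)
qed

end

section \<open>Systems of blocks\<close>

lemma card_image_same_fibres:
  assumes fin: "finite A" and fib: "\<And>x y. x \<in> A \<Longrightarrow> y \<in> A \<Longrightarrow> F x = F y \<longleftrightarrow> G x = G y"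
  shows "card (F ` A) = card (G ` A)"
proof -
  have "card (F ` A) \<le> card (G ` A)"
  proof -
    have "F x = F (inv_into A G (G x))" if "x \<in> A" for x
      using fib[of x "inv_into A G (G x)"] that inv_into_into[of "G x" G A] f_inv_into_f[of "G x" G A] by simp
    then have "F ` A = (\<lambda>y. F (inv_into A G y)) ` G ` A" by (auto simp: image_image)
    then show ?thesis using fin card_image_le[of "G ` A"] by simp
  qed
  moreover have "card (G ` A) \<le> card (F ` A)"
  proof -
    have "G x = G (inv_into A F (F x))" if "x \<in> A" for x
      using fib[of x "inv_into A F (F x)"] that inv_into_into[of "F x" F A] f_inv_into_f[of "F x" F A] by simp
    then have "G ` A = (\<lambda>y. G (inv_into A F y)) ` F ` A" by (auto simp: image_image)
    then show ?thesis using fin card_image_le[of "F ` A"] by simp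
  qed
  ultimately show ?thesis by (rule le_antisym)
qed

context group
begin

lemma pow_set_carrier: "(\<lambda>x. x [^] (n::nat)) ` carrier G \<subseteq> carrier G"
  by auto

lemma power_subgroup_normal: "power_subgroup G n \<lhd> G"
  unfolding power_subgroup_def
proof (rule normal_generateI[OF pow_set_carrier])
  fix h g assume h: "h \<in> (\<lambda>x. x [^] n) ` carrier G" and g: "g \<in> carrier G"
  then obtain x where x: "x \<in> carrier G" "h = x [^] n" by blast
  then show "g \<otimes> h \<otimes> inv g \<in> (\<lambda>x. x [^] n) ` carrier G"
    using conj_pow[OF g x(1), of n] g by auto
qed

lemma pow_in_power_subgroup: "x \<in> carrier G \<Longrightarrow> x [^] n \<in> power_subgroup G n"
  unfolding power_subgroup_def by (rule generate.incl) auto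

lemma power_subgroup_subset:
  assumes "subgroup H G" "\<And>x. x \<in> carrier G \<Longrightarrow> x [^] n \<in> H"
  shows "power_subgroup G n \<subseteq> H"
  unfolding power_subgroup_def using assms by (intro generate_subgroup_incl) auto

lemma power_subgroup_restrict_mono:
  assumes U: "subgroup U G" and m: "\<And>x. x \<in> carrier G \<Longrightarrow> x [^] m \<in> U"
  shows "power_subgroup G (m * n) \<subseteq> power_subgroup (G\<lparr>carrier := U\<rparr>) n"
    and "power_subgroup (G\<lparr>carrier := U\<rparr>) n \<subseteq> U"
proof -
  interpret GU: group "G\<lparr>carrier := U\<rparr>" by (rule subgroup_imp_group[OF U])
  have s: "subgroup (power_subgroup (G\<lparr>carrier := U\<rparr>) n) (G\<lparr>carrier := U\<rparr>)"
    by (rule normal_imp_subgroup[OF GU.power_subgroup_normal])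
  show "power_subgroup (G\<lparr>carrier := U\<rparr>) n \<subseteq> U" using subgroup.subset[OF s] by simp
  show "power_subgroup G (m * n) \<subseteq> power_subgroup (G\<lparr>carrier := U\<rparr>) n"
  proof (rule power_subgroup_subset)
    show "subgroup (power_subgroup (G\<lparr>carrier := U\<rparr>) n) G"
      by (rule incl_subgroup[OF U s])
    fix x assume x: "x \<in> carrier G"
    have "(x [^] m) [^]\<^bsub>G\<lparr>carrier := U\<rparr>\<^esub> n \<in> power_subgroup (G\<lparr>carrier := U\<rparr>) n"
      by (rule GU.pow_in_power_subgroup) (simp add: m x)
    then show "x [^] (m * n) \<in> power_subgroup (G\<lparr>carrier := U\<rparr>) n"
      using x by (simp add: nat_pow_pow flip: nat_pow_consistent)
  qed
qed

lemma second_derived_normal: "N \<lhd> G \<Longrightarrow> derived G (derived G N) \<lhd> G"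
  by (intro derived_is_normal)

lemma solvable_restrict:
  assumes "subgroup U G" "solvable G"
  shows "solvable (G\<lparr>carrier := U\<rparr>)"
proof -
  interpret GU: group "G\<lparr>carrier := U\<rparr>" by (rule subgroup_imp_group[OF assms(1)])
  interpret h: group_hom "G\<lparr>carrier := U\<rparr>" G "\<lambda>x. x"
    using subgroup.subset[OF assms(1)] by unfold_locales (auto simp: hom_def)
  show ?thesis by (rule h.inj_hom_imp_solvable[OF _ assms(2)]) simp
qed

end

text \<open>The bounds on the image of \<open>S\<close> in the automorphism group of \<open>V\<close>.  Over a field of order \<open>q\<close> on which
  \<open>S\<close> acts semilinearly, \<open>M\<close> is the dimension; for an induced action, \<open>q\<close> comes from a block and \<open>M\<close> is
  multiplied by the number of blocks.  The exponent of the image divides \<open>n\<close>, and the \<open>w\<close>-th powers generate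
  a subgroup with metabelian image.  The bound on \<open>w\<close> is free of \<open>q\<close>, so that finitely many \<open>w\<close> serve all
  fields when the dimensions are bounded.\<close>

definition linear_bound :: "nat \<Rightarrow> ('a, 'm) monoid_scheme \<Rightarrow> ('c, 'n) monoid_scheme \<Rightarrow> ('a \<Rightarrow> 'c \<Rightarrow> 'c) \<Rightarrow> bool" where
  "linear_bound p S V act \<longleftrightarrow>
    (\<exists>q M n w. p \<le> q \<and> 1 \<le> M \<and> card (carrier V) = q ^ M \<and>
       1 \<le> n \<and> n \<le> q ^ 2 * quasipoly M ^ 8 \<and> (\<forall>g\<in>carrier S. \<forall>v\<in>carrier V. act (g [^]\<^bsub>S\<^esub> n) v = v) \<and>
       1 \<le> w \<and> w \<le> quasipoly (quasipoly M ^ 8) \<and>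
       (\<forall>g\<in>derived S (derived S (power_subgroup S w)). \<forall>v\<in>carrier V. act g v = v))"

context minimal_idempotent_action
begin

definition stab :: "'a set" where "stab = {g \<in> carrier S. cnj g f = f}"

definition block :: "'c set" where "block = f ` carrier V"

lemma stab_subgroup: "subgroup stab S"
proof (rule subgroupI)
  show "stab \<subseteq> carrier S" by (auto simp: stab_def)
  have "\<one> \<in> stab" by (simp add: stab_def)
  then show "stab \<noteq> {}" by blast
next
  fix g assume g: "g \<in> stab"
  then have "cnj (inv g) f = f" using cnj_inv(1)[of g f] by (simp add: stab_def)
  then show "inv g \<in> stab" using g by (simp add: stab_def)
next
  fix g h assume "g \<in> stab" "h \<in> stab"
  then show "g \<otimes> h \<in> stab" by (simp add: stab_def flip: cnj_cnj)
qed

lemma card_conjs: "order S div card stab = card conjs"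
proof -
  have "conjs = (\<lambda>g. cnj (inv g) f) ` carrier S"
  proof
    show "conjs \<subseteq> (\<lambda>g. cnj (inv g) f) ` carrier S"
    proof
      fix e assume "e \<in> conjs"
      then obtain h where "h \<in> carrier S" "e = cnj h f" by (auto simp: conjs_def)
      then show "e \<in> (\<lambda>g. cnj (inv g) f) ` carrier S" by (intro image_eqI[of _ _ "inv h"]) auto
    qed
  qed (auto simp: conjs_def)
  then have "card conjs = card ((\<lambda>g. cnj (inv g) f) ` carrier S)" by simp
  also have "\<dots> = card ((\<lambda>g. stab #> g) ` carrier S)"
  proof -
    have eq: "cnj (inv g) f = cnj (inv h) f \<longleftrightarrow> stab #> g = stab #> h"
      if g: "g \<in> carrier S" and h: "h \<in> carrier S" for g h
    proof -
      have "cnj (inv g) f = cnj (inv h) f \<longleftrightarrow> cnj g (cnj (inv g) f) = cnj g (cnj (inv h) f)"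
        using g h by (metis cnj_closed cnj_inv(1) f_carrier inv_closed)
      also have "\<dots> \<longleftrightarrow> g \<otimes> inv h \<in> stab" using g h by (auto simp: stab_def cnj_cnj)
      finally show ?thesis using coset_eq_iff[OF stab_subgroup g h] by simp
    qed
    show ?thesis
      by (rule card_image_same_fibres[OF finite_S eq])
  qed
  finally have "card conjs = card ((\<lambda>g. stab #> g) ` carrier S)" .
  moreover have "card ((\<lambda>g. stab #> g) ` carrier S) * card stab = card (carrier S)"
    by (rule card_coset_image[OF subgroup_self stab_subgroup subgroup.subset[OF stab_subgroup]])
  moreover have "card stab > 0"
    using finite_S subgroup.subset[OF stab_subgroup] finite_subset subgroup.one_closed[OF stab_subgroup] card_gt_0_iff
    by blast
  ultimately show ?thesis by (simp add: order_def flip: \<open>card ((\<lambda>g. stab #> g) ` carrier S) * card stab = card (carrier S)\<close>)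
qed

lemma block_subgroup: "subgroup block V"
  unfolding block_def by (rule V.endo_image_subgroup[OF f_carrier])

lemma block_subset: "block \<subseteq> carrier V"
  using subgroup.subset[OF block_subgroup] .

lemma mem_block_iff: "v \<in> block \<longleftrightarrow> v \<in> carrier V \<and> f v = v"
proof
  assume "v \<in> block"
  then obtain w where w: "w \<in> carrier V" "v = f w" by (auto simp: block_def)
  have "f (f w) = (f \<otimes>\<^bsub>E\<^esub> f) w" using w by (simp add: endo_ring_simps)
  then show "v \<in> carrier V \<and> f v = v" using w V.endo_closed[OF f_carrier] by (simp add: f_idem)
next
  assume "v \<in> carrier V \<and> f v = v"
  then show "v \<in> block" unfolding block_def by (metis imageI)
qed

lemma f_closed: "v \<in> carrier V \<Longrightarrow> f v \<in> block"
  by (auto simp: block_def)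

lemma f_act_stab:
  assumes "g \<in> stab" "v \<in> carrier V"
  shows "f (act g v) = act g (f v)"
proof -
  have g: "g \<in> carrier S" "cnj g f = f" using assms by (auto simp: stab_def)
  have "cnj g f (act g v) = act g (f (act (inv g) (act g v)))"
    using g assms by (intro cnj_apply) auto
  then show ?thesis using g assms by simp
qed

lemma f_act_off_stab:
  assumes g: "g \<in> carrier S" "g \<notin> stab" and v: "v \<in> block"
  shows "f (act g v) = \<one>\<^bsub>V\<^esub>"
proof -
  have vc: "v \<in> carrier V" "f v = v" using v mem_block_iff by auto
  have cg: "cnj g f \<in> conjs" using g by (auto simp: conjs_def)
  have "cnj g f (act g v) = act g (f (act (inv g) (act g v)))"
    using g vc by (intro cnj_apply) auto
  then have 1: "cnj g f (act g v) = act g v" using g vc by simp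
  have "f \<noteq> cnj g f" using g by (auto simp: stab_def)
  then have "f \<otimes>\<^bsub>E\<^esub> cnj g f = \<zero>\<^bsub>E\<^esub>" using conjs_orthogonal[OF f_conjs cg] by blast
  then have "(f \<otimes>\<^bsub>E\<^esub> cnj g f) (act g v) = \<one>\<^bsub>V\<^esub>" using g vc by (simp add: endo_ring_simps)
  then show ?thesis using 1 g vc by (simp add: endo_ring_simps)
qed

text \<open>If \<open>W\<close> is a stabilizer-invariant subgroup of the block, the vectors all of whose translates have their
  block component in \<open>W\<close> form an invariant subgroup of \<open>V\<close>, so \<open>W\<close> is trivial or the whole block.\<close>

lemma stab_action: "irreducible_action (S\<lparr>carrier := stab\<rparr>) (V\<lparr>carrier := block\<rparr>) act"
proof -
  interpret SU: group "S\<lparr>carrier := stab\<rparr>" by (rule subgroup_imp_group[OF stab_subgroup])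
  interpret VB: group "V\<lparr>carrier := block\<rparr>" by (rule V.subgroup_imp_group[OF block_subgroup])
  have stabS: "stab \<subseteq> carrier S" by (rule subgroup.subset[OF stab_subgroup])
  have act_block: "act g v \<in> block" if "g \<in> stab" "v \<in> block" for g v
    using that f_act_stab[of g v] stabS by (auto simp: mem_block_iff)
  have "linear_action (S\<lparr>carrier := stab\<rparr>) (V\<lparr>carrier := block\<rparr>) act"
  proof (unfold_locales, goal_cases)
    case (1 x y)
    then show ?case using block_subset V.m_comm by auto
  next
    case (2 g)
    then have "g \<in> carrier S" using stabS by auto
    then show ?case using 2 act_hom[of g] act_block block_subset by (auto simp: hom_def subset_iff)
  next
    case (3 g h v)
    then have "g \<in> carrier S" "h \<in> carrier S" "v \<in> carrier V" using stabS block_subset by auto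
    then show ?case using act_mult[of g h v] by simp
  next
    case (4 v)
    then show ?case using block_subset act_one by auto
  next
    case 5
    then show ?case using stabS finite_S finite_subset by auto
  next
    case 6
    then show ?case using block_subset finite_V finite_subset by auto
  qed
  then interpret L: linear_action "S\<lparr>carrier := stab\<rparr>" "V\<lparr>carrier := block\<rparr>" act .
  show ?thesis
  proof unfold_locales
    show "carrier (V\<lparr>carrier := block\<rparr>) \<noteq> {\<one>\<^bsub>V\<lparr>carrier := block\<rparr>\<^esub>}"
    proof
      assume "carrier (V\<lparr>carrier := block\<rparr>) = {\<one>\<^bsub>V\<lparr>carrier := block\<rparr>\<^esub>}"
      then have "block = {\<one>\<^bsub>V\<^esub>}" by simp
      have "f = \<zero>\<^bsub>E\<^esub>"
      proof (rule V.endo_ring_ext)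
        fix v assume "v \<in> carrier V"
        then show "f v = \<zero>\<^bsub>E\<^esub> v"
          using f_closed[of v] \<open>block = {\<one>\<^bsub>V\<^esub>}\<close> by (simp add: endo_ring_simps)
      qed auto
      then show False using f_nz by simp
    qed
    show "solvable (S\<lparr>carrier := stab\<rparr>)" by (rule solvable_restrict[OF stab_subgroup solvable_S])
    fix W assume "L.invariant W"
    then have sW': "subgroup W (V\<lparr>carrier := block\<rparr>)" and iW: "\<And>g w. g \<in> stab \<Longrightarrow> w \<in> W \<Longrightarrow> act g w \<in> W"
      by (auto simp: L.invariant_def)
    have sW: "subgroup W V" by (rule V.incl_subgroup[OF block_subgroup sW'])
    have WB: "W \<subseteq> block" using subgroup.subset[OF sW'] by simp
    define W' where "W' = {v \<in> carrier V. \<forall>g\<in>carrier S. f (act g v) \<in> W}"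
    have act_mult': "act g (v \<otimes>\<^bsub>V\<^esub> w) = act g v \<otimes>\<^bsub>V\<^esub> act g w"
      if "g \<in> carrier S" "v \<in> carrier V" "w \<in> carrier V" for g v w
      using act_hom[of g] that by (auto simp: hom_def)
    have act_inv': "act g (inv\<^bsub>V\<^esub> v) = inv\<^bsub>V\<^esub> (act g v)" if "g \<in> carrier S" "v \<in> carrier V" for g v
      using group_hom.hom_inv[of V V "act g" v] act_hom[of g] that
      by (simp add: group_hom_def group_hom_axioms_def)
    have act_one': "act g \<one>\<^bsub>V\<^esub> = \<one>\<^bsub>V\<^esub>" if "g \<in> carrier S" for g
      using act_hom[OF that] hom_one V.is_group by blast
    have "invariant W'"
      unfolding invariant_def
    proof (intro conjI ballI)
      show "subgroup W' V"
      proof (rule V.subgroupI)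
        show "W' \<subseteq> carrier V" by (auto simp: W'_def)
        have "\<one>\<^bsub>V\<^esub> \<in> W'" using subgroup.one_closed[OF sW]
          by (simp add: W'_def act_one' V.endo_one[OF f_carrier])
        then show "W' \<noteq> {}" by blast
      next
        fix a assume "a \<in> W'"
        then show "inv\<^bsub>V\<^esub> a \<in> W'"
          using subgroup.m_inv_closed[OF sW] by (simp add: W'_def act_inv' V.endo_inv[OF f_carrier])
      next
        fix a b assume "a \<in> W'" "b \<in> W'"
        then show "a \<otimes>\<^bsub>V\<^esub> b \<in> W'"
          using subgroup.m_closed[OF sW] by (simp add: W'_def act_mult' V.endo_mult[OF f_carrier])
      qed
      fix g w assume g: "g \<in> carrier S" and w: "w \<in> W'"
      then have "act h (act g w) = act (h \<otimes> g) w" if "h \<in> carrier S" for h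
        using that by (simp add: act_mult W'_def)
      then show "act g w \<in> W'" using g w by (simp add: W'_def)
    qed
    then have "W' = {\<one>\<^bsub>V\<^esub>} \<or> W' = carrier V" by (rule irreducible)
    then show "W = {\<one>\<^bsub>V\<lparr>carrier := block\<rparr>\<^esub>} \<or> W = carrier (V\<lparr>carrier := block\<rparr>)"
    proof
      assume W': "W' = {\<one>\<^bsub>V\<^esub>}"
      have "w \<in> W'" if w: "w \<in> W" for w
      proof -
        have wb: "w \<in> block" "w \<in> carrier V" using w WB block_subset by auto
        have "f (act g w) \<in> W" if g: "g \<in> carrier S" for g
        proof (cases "g \<in> stab")
          case True
          then have "act g w \<in> W" using iW w by blast
          moreover from this have "f (act g w) = act g w" using WB mem_block_iff by blast
          ultimately show ?thesis by simp
        next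
          case False
          then show ?thesis using f_act_off_stab[OF g False wb(1)] subgroup.one_closed[OF sW] by simp
        qed
        then show ?thesis using wb by (simp add: W'_def)
      qed
      then have "W = {\<one>\<^bsub>V\<^esub>}" using W' subgroup.one_closed[OF sW] by blast
      then show ?thesis by simp
    next
      assume W': "W' = carrier V"
      have "v \<in> W" if v: "v \<in> block" for v
      proof -
        have vc: "v \<in> carrier V" "f v = v" using v mem_block_iff by auto
        then have "f (act \<one> v) \<in> W" using W' unfolding W'_def by blast
        then show ?thesis using vc by (simp add: act_one)
      qed
      then show ?thesis using WB by auto
    qed
  qed
qed

lemma card_conj_image:
  assumes "e \<in> conjs"
  shows "card (e ` carrier V) = card block"
proof -
  obtain g where g: "g \<in> carrier S" "e = cnj g f" using assms by (auto simp: conjs_def)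
  have surj: "act (inv g) ` carrier V = carrier V"
  proof
    show "act (inv g) ` carrier V \<subseteq> carrier V" using g by auto
    show "carrier V \<subseteq> act (inv g) ` carrier V"
    proof
      fix v assume "v \<in> carrier V"
      then show "v \<in> act (inv g) ` carrier V" using g by (intro image_eqI[of _ _ "act g v"]) auto
    qed
  qed
  have "e ` carrier V = (\<lambda>v. act g (f (act (inv g) v))) ` carrier V"
    using g by (intro image_cong) (auto simp: cnj_apply)
  also have "\<dots> = act g ` f ` act (inv g) ` carrier V" by (simp add: image_image)
  finally have "e ` carrier V = act g ` block" by (simp add: surj block_def)
  moreover have "inj_on (act g) block"
    using g block_subset by (intro inj_on_inverseI[of _ "act (inv g)"]) auto
  ultimately show ?thesis by (simp add: card_image)
qed

lemma card_sum_image: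
  assumes e: "e \<in> carrier E" "e \<otimes>\<^bsub>E\<^esub> e = e" and s: "s \<in> carrier E" "s \<otimes>\<^bsub>E\<^esub> s = s"
    and es: "e \<otimes>\<^bsub>E\<^esub> s = \<zero>\<^bsub>E\<^esub>" "s \<otimes>\<^bsub>E\<^esub> e = \<zero>\<^bsub>E\<^esub>"
  shows "card ((e \<oplus>\<^bsub>E\<^esub> s) ` carrier V) = card (e ` carrier V) * card (s ` carrier V)"
proof -
  have cl: "e v \<in> carrier V" "s v \<in> carrier V" if "v \<in> carrier V" for v
    using that V.endo_closed e s by auto
  have ee: "e (e v) = e v" and ss: "s (s v) = s v" and es': "e (s v) = \<one>\<^bsub>V\<^esub>" and se: "s (e v) = \<one>\<^bsub>V\<^esub>"
    if "v \<in> carrier V" for v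
    using fun_cong[OF e(2), of v] fun_cong[OF s(2), of v] fun_cong[OF es(1), of v] fun_cong[OF es(2), of v] that
    by (auto simp: endo_ring_simps)
  have "bij_betw (\<lambda>(x, y). x \<otimes>\<^bsub>V\<^esub> y) (e ` carrier V \<times> s ` carrier V) ((e \<oplus>\<^bsub>E\<^esub> s) ` carrier V)"
  proof (rule bij_betw_imageI)
    have proj: "e (e v \<otimes>\<^bsub>V\<^esub> s w) = e v" "s (e v \<otimes>\<^bsub>V\<^esub> s w) = s w" if "v \<in> carrier V" "w \<in> carrier V" for v w
      using that cl by (simp_all add: V.endo_mult[OF e(1)] V.endo_mult[OF s(1)] ee ss es' se)
    show "inj_on (\<lambda>(x, y). x \<otimes>\<^bsub>V\<^esub> y) (e ` carrier V \<times> s ` carrier V)"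
      by (rule inj_onI) (use proj in \<open>clarsimp, metis\<close>)
    show "(\<lambda>(x, y). x \<otimes>\<^bsub>V\<^esub> y) ` (e ` carrier V \<times> s ` carrier V) = (e \<oplus>\<^bsub>E\<^esub> s) ` carrier V"
    proof (intro equalityI subsetI)
      fix z assume "z \<in> (\<lambda>(x, y). x \<otimes>\<^bsub>V\<^esub> y) ` (e ` carrier V \<times> s ` carrier V)"
      then obtain v w where vw: "v \<in> carrier V" "w \<in> carrier V" "z = e v \<otimes>\<^bsub>V\<^esub> s w" by auto
      have "(e \<oplus>\<^bsub>E\<^esub> s) z = e z \<otimes>\<^bsub>V\<^esub> s z" using vw cl by (simp add: endo_ring_simps)
      also have "\<dots> = z" using proj[OF vw(1,2)] vw(3) by simp
      finally show "z \<in> (e \<oplus>\<^bsub>E\<^esub> s) ` carrier V" using vw cl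
        by (intro image_eqI[of _ _ z]) auto
    next
      fix z assume "z \<in> (e \<oplus>\<^bsub>E\<^esub> s) ` carrier V"
      then show "z \<in> (\<lambda>(x, y). x \<otimes>\<^bsub>V\<^esub> y) ` (e ` carrier V \<times> s ` carrier V)"
        by (auto simp: endo_ring_simps)
    qed
  qed
  then have "card ((e \<oplus>\<^bsub>E\<^esub> s) ` carrier V) = card (e ` carrier V \<times> s ` carrier V)"
    using bij_betw_same_card by fastforce
  then show ?thesis by (simp add: card_cartesian_product)
qed

text \<open>By \<open>sum_conjs\<close>, \<open>V\<close> is the direct sum of the images of the conjugates of \<open>f\<close>.\<close>

lemma card_V_block: "card (carrier V) = card block ^ card conjs"
proof -
  have "J \<subseteq> conjs \<Longrightarrow> (let s = finsum E (\<lambda>e. e) J in s \<in> carrier E \<and> s \<otimes>\<^bsub>E\<^esub> s = s \<and>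
      card (s ` carrier V) = card block ^ card J \<and>
      (\<forall>d\<in>conjs - J. s \<otimes>\<^bsub>E\<^esub> d = \<zero>\<^bsub>E\<^esub> \<and> d \<otimes>\<^bsub>E\<^esub> s = \<zero>\<^bsub>E\<^esub>))" if "finite J" for J
    using that
  proof (induction J)
    case empty
    have "\<zero>\<^bsub>E\<^esub> ` carrier V = {\<one>\<^bsub>V\<^esub>}" by (auto simp: endo_ring_simps intro!: image_eqI[of _ _ "\<one>\<^bsub>V\<^esub>"])
    then show ?case by (simp add: Let_def)
  next
    case (insert e J)
    define s where "s = finsum E (\<lambda>e. e) J"
    have s: "s \<in> carrier E" "s \<otimes>\<^bsub>E\<^esub> s = s" "card (s ` carrier V) = card block ^ card J"
      "\<And>d. d \<in> conjs - J \<Longrightarrow> s \<otimes>\<^bsub>E\<^esub> d = \<zero>\<^bsub>E\<^esub> \<and> d \<otimes>\<^bsub>E\<^esub> s = \<zero>\<^bsub>E\<^esub>"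
      using insert by (auto simp: Let_def s_def)
    have e: "e \<in> conjs" "e \<in> carrier E" using insert.prems by auto
    have ins: "finsum E (\<lambda>e. e) (insert e J) = e \<oplus>\<^bsub>E\<^esub> s"
      unfolding s_def using insert e by (intro E.finsum_insert) auto
    have es: "e \<otimes>\<^bsub>E\<^esub> s = \<zero>\<^bsub>E\<^esub>" "s \<otimes>\<^bsub>E\<^esub> e = \<zero>\<^bsub>E\<^esub>" using s(4)[of e] e insert.hyps by auto
    have ee: "e \<otimes>\<^bsub>E\<^esub> e = e" by (rule conjs_idem[OF e(1)])
    have "(e \<oplus>\<^bsub>E\<^esub> s) \<otimes>\<^bsub>E\<^esub> (e \<oplus>\<^bsub>E\<^esub> s) = e \<oplus>\<^bsub>E\<^esub> s"
      using e s es ee by (simp add: E.l_distr E.r_distr)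
    moreover have "card ((e \<oplus>\<^bsub>E\<^esub> s) ` carrier V) = card block ^ card (insert e J)"
      using card_sum_image[OF e(2) ee s(1,2) es] card_conj_image[OF e(1)] s(3) insert.hyps by simp
    moreover have "(e \<oplus>\<^bsub>E\<^esub> s) \<otimes>\<^bsub>E\<^esub> d = \<zero>\<^bsub>E\<^esub> \<and> d \<otimes>\<^bsub>E\<^esub> (e \<oplus>\<^bsub>E\<^esub> s) = \<zero>\<^bsub>E\<^esub>"
      if d: "d \<in> conjs - insert e J" for d
    proof -
      have "e \<otimes>\<^bsub>E\<^esub> d = \<zero>\<^bsub>E\<^esub>" "d \<otimes>\<^bsub>E\<^esub> e = \<zero>\<^bsub>E\<^esub>" using conjs_orthogonal e d by auto
      moreover have "d \<in> carrier E" using d by auto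
      ultimately show ?thesis using s(1) s(4)[of d] d e by (simp add: E.l_distr E.r_distr)
    qed
    ultimately show ?case unfolding ins Let_def using e s by simp
  qed
  from this[OF finite_conjs] have "card (\<one>\<^bsub>E\<^esub> ` carrier V) = card block ^ card conjs"
    by (simp add: Let_def sum_conjs)
  moreover have "\<one>\<^bsub>E\<^esub> ` carrier V = carrier V" by (auto simp: endo_ring_simps)
  ultimately show ?thesis by simp
qed

text \<open>As \<open>S\<close> permutes the blocks transitively, an element all of whose conjugates fix one block
  pointwise fixes everything.\<close>

lemma act_kernel_if_conjugates_fix_block:
  assumes x: "x \<in> carrier S" and fx: "\<And>h v. h \<in> carrier S \<Longrightarrow> v \<in> block \<Longrightarrow> act (inv h \<otimes> x \<otimes> h) v = v"
  shows "x \<in> act_kernel"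
proof -
  have "rep x \<otimes>\<^bsub>E\<^esub> e = e" if e: "e \<in> conjs" for e
  proof -
    obtain h where h: "h \<in> carrier S" "e = cnj h f" using e by (auto simp: conjs_def)
    have "rep (inv h \<otimes> x \<otimes> h) \<otimes>\<^bsub>E\<^esub> f = f"
    proof (rule V.endo_ring_ext)
      fix v assume v: "v \<in> carrier V"
      then show "(rep (inv h \<otimes> x \<otimes> h) \<otimes>\<^bsub>E\<^esub> f) v = f v"
        using fx[OF h(1) f_closed[OF v]] V.endo_closed[OF f_carrier v]
        by (simp add: endo_ring_simps rep_def)
    qed (use x h in auto)
    then have "rep h \<otimes>\<^bsub>E\<^esub> (rep (inv h \<otimes> x \<otimes> h) \<otimes>\<^bsub>E\<^esub> f) \<otimes>\<^bsub>E\<^esub> rep (inv h) = e"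
      by (simp add: h cnj_def)
    then show ?thesis using h x by (simp add: rep_mult cnj_def E.m_assoc)
  qed
  then have "finsum E (\<lambda>e. rep x \<otimes>\<^bsub>E\<^esub> e) conjs = finsum E (\<lambda>e. e) conjs"
    by (intro E.finsum_cong') auto
  moreover have "rep x \<otimes>\<^bsub>E\<^esub> finsum E (\<lambda>e. e) conjs = finsum E (\<lambda>e. rep x \<otimes>\<^bsub>E\<^esub> e) conjs"
    using x by (intro E.finsum_rdistr[OF finite_conjs]) auto
  ultimately have "rep x = \<one>\<^bsub>E\<^esub>" using x by (simp add: sum_conjs)
  then show ?thesis using x by (simp add: act_kernel_iff)
qed

text \<open>A power \<open>m\<close> bounded in terms of the number \<open>k\<close> of blocks takes \<open>S\<close> into the stabilizer, where the bounds
  for the block apply; supermultiplicativity absorbs \<open>m\<close> when \<open>M\<close> becomes \<open>M k\<close>.\<close>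

lemma linear_bound_induced:
  assumes "linear_bound p (S\<lparr>carrier := stab\<rparr>) (V\<lparr>carrier := block\<rparr>) act"
  shows "linear_bound p S V act"
proof -
  let ?U = "S\<lparr>carrier := stab\<rparr>"
  obtain q M n w where qM: "p \<le> q" "1 \<le> M" "card block = q ^ M" "1 \<le> n" "n \<le> q ^ 2 * quasipoly M ^ 8"
      and n: "\<And>g v. g \<in> stab \<Longrightarrow> v \<in> block \<Longrightarrow> act (g [^]\<^bsub>?U\<^esub> n) v = v"
      and w: "1 \<le> w" "w \<le> quasipoly (quasipoly M ^ 8)"
        "\<And>g v. g \<in> derived ?U (derived ?U (power_subgroup ?U w)) \<Longrightarrow> v \<in> block \<Longrightarrow> act g v = v"
    using assms by (auto simp: linear_bound_def)
  define k where "k = card conjs"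
  have k1: "k \<ge> 1" using finite_conjs f_conjs card_gt_0_iff unfolding k_def by (metis One_nat_def Suc_leI empty_iff)
  obtain m where m: "m \<ge> 1" "m \<le> quasipoly k" "\<And>g. g \<in> carrier S \<Longrightarrow> g [^] m \<in> stab"
    using solvable_index_exponent[OF solvable_S finite_S stab_subgroup] card_conjs by (auto simp: k_def)
  have qk: "quasipoly k * quasipoly M \<le> quasipoly (M * k)"
    using quasipoly_mult_le[OF k1 qM(2)] by (simp add: mult.commute)
  have qk8: "m * quasipoly M ^ 8 \<le> quasipoly (M * k) ^ 8"
  proof -
    have "m \<le> quasipoly k ^ 8" using m(2) quasipoly_pos[OF k1] self_le_power[of "quasipoly k" 8] by simp
    then have "m * quasipoly M ^ 8 \<le> quasipoly k ^ 8 * quasipoly M ^ 8" by simp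
    also have "\<dots> = (quasipoly k * quasipoly M) ^ 8" by (simp add: power_mult_distrib)
    also have "\<dots> \<le> quasipoly (M * k) ^ 8" using qk by (intro power_mono) auto
    finally show ?thesis .
  qed
  show ?thesis
    unfolding linear_bound_def
  proof (intro exI conjI ballI)
    show "p \<le> q" by (rule qM)
    show "1 \<le> M * k" using qM(2) k1 by simp
    show "card (carrier V) = q ^ (M * k)" by (simp add: card_V_block qM(3) k_def power_mult)
    show "1 \<le> m * n" using m qM by simp
    have "m * n \<le> m * (q ^ 2 * quasipoly M ^ 8)" using qM by simp
    also have "\<dots> = q ^ 2 * (m * quasipoly M ^ 8)" by simp
    also have "\<dots> \<le> q ^ 2 * quasipoly (M * k) ^ 8" using qk8 by (rule mult_left_mono) simp
    finally show "m * n \<le> q ^ 2 * quasipoly (M * k) ^ 8" .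
    show "1 \<le> m * w" using m w by simp
    have "m \<le> quasipoly m" by (rule le_quasipoly)
    then have "m * w \<le> quasipoly m * quasipoly (quasipoly M ^ 8)" using w(2) by (rule mult_mono) auto
    also have "\<dots> \<le> quasipoly (m * quasipoly M ^ 8)"
      using m(1) quasipoly_pos[OF qM(2)] by (intro quasipoly_mult_le) simp_all
    also have "\<dots> \<le> quasipoly (quasipoly (M * k) ^ 8)" by (rule quasipoly_mono[OF qk8])
    finally show "m * w \<le> quasipoly (quasipoly (M * k) ^ 8)" .
  next
    fix g v assume g: "g \<in> carrier S" and v: "v \<in> carrier V"
    have "g [^] (m * n) \<in> act_kernel"
    proof (rule act_kernel_if_conjugates_fix_block)
      fix h v assume h: "h \<in> carrier S" and v: "v \<in> block"
      have "inv h \<otimes> g [^] (m * n) \<otimes> h = (inv h \<otimes> g \<otimes> h) [^] (m * n)"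
        using conj_pow[of "inv h" g "m * n"] g h by simp
      also have "\<dots> = ((inv h \<otimes> g \<otimes> h) [^] m) [^]\<^bsub>?U\<^esub> n"
        using g h by (simp add: nat_pow_pow flip: nat_pow_consistent)
      finally show "act (inv h \<otimes> g [^] (m * n) \<otimes> h) v = v"
        using n[OF m(3) v] g h by simp
    qed (use g in simp)
    then show "act (g [^] (m * n)) v = v" using v by (simp add: act_kernel_def)
  next
    fix g v assume g: "g \<in> derived S (derived S (power_subgroup S (m * w)))" and v: "v \<in> carrier V"
    let ?P = "power_subgroup ?U w"
    have PU: "?P \<subseteq> stab" and sub: "power_subgroup S (m * w) \<subseteq> ?P"
      using power_subgroup_restrict_mono[OF stab_subgroup m(3)] by auto
    have d1: "derived ?U ?P = derived S ?P" by (rule derived_consistent[OF PU stab_subgroup])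
    have "derived S ?P \<subseteq> stab" by (rule derived_incl[OF PU stab_subgroup])
    then have d2: "derived ?U (derived S ?P) = derived S (derived S ?P)"
      by (rule derived_consistent[OF _ stab_subgroup])
    have dd: "derived S (derived S (power_subgroup S (m * w))) \<subseteq> derived ?U (derived ?U ?P)"
      unfolding d1 d2 by (intro mono_derived sub)
    have nor: "derived S (derived S (power_subgroup S (m * w))) \<lhd> S"
      by (intro second_derived_normal power_subgroup_normal)
    have "g \<in> act_kernel"
    proof (rule act_kernel_if_conjugates_fix_block)
      fix h v assume h: "h \<in> carrier S" and v: "v \<in> block"
      have "inv h \<otimes> g \<otimes> h \<in> derived S (derived S (power_subgroup S (m * w)))"
        using normal_conj(2)[OF nor h g] .
      then show "act (inv h \<otimes> g \<otimes> h) v = v" using dd w(3) v by blast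
    qed (use g normal_subset[OF nor] in blast)
    then show "act g v = v" using v by (simp add: act_kernel_def)
  qed
qed

end

section \<open>Actions whose double commutant is a field\<close>

lemma (in group) commutator_pow_mod:
  assumes A: "A \<lhd> G" and x: "x \<in> carrier G" and y: "y \<in> carrier G"
    and c: "x \<in> centralizer_mod A {commutator x y}"
  shows "\<exists>a\<in>A. commutator (x [^] (n::nat)) y = a \<otimes> commutator x y [^] n"
proof (induction n)
  case 0
  then show ?case using y subgroup.one_closed[OF normal_imp_subgroup[OF A]] by (intro bexI[of _ \<one>]) auto
next
  case (Suc n)
  interpret A: normal A G by (rule A)
  let ?c = "commutator x y"
  have cc: "?c \<in> carrier G" using x y by simp
  obtain a where a: "a \<in> A" "commutator (x [^] n) y = a \<otimes> ?c [^] n" using Suc by blast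
  have ac: "a \<in> carrier G" using a(1) A.subset by blast
  have "subgroup (centralizer_mod A {x}) G" using x by (intro centralizer_mod_subgroup[OF A]) auto
  moreover have "?c \<in> centralizer_mod A {x}"
    using centralizer_mod_sym[OF A.subgroup_axioms, of "{x}" "{?c}"] x cc c by simp
  ultimately have "?c [^] n \<in> centralizer_mod A {x}" by (rule subgroup_pow_closed)
  then have "commutator (?c [^] n) x \<in> A" by (simp add: centralizer_mod_def)
  then have d: "commutator x (?c [^] n) \<in> A"
    using A.m_inv_closed[of "commutator (?c [^] n) x"] x cc by (simp add: inv_commutator)
  have "commutator (x [^] Suc n) y = commutator (x \<otimes> x [^] n) y"
    by (simp only: nat_pow_Suc2[OF x])
  also have "\<dots> = x \<otimes> commutator (x [^] n) y \<otimes> inv x \<otimes> ?c"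
    using x y by (simp add: commutator_mult_left)
  also have "\<dots> = (x \<otimes> a \<otimes> inv x) \<otimes> commutator x (?c [^] n) \<otimes> (?c [^] n \<otimes> ?c)"
    using x y ac cc by (simp add: a(2) commutator_def[of x "commutator x y [^] n"] word_simps)
  finally have "commutator (x [^] Suc n) y = ((x \<otimes> a \<otimes> inv x) \<otimes> commutator x (?c [^] n)) \<otimes> ?c [^] Suc n"
    by simp
  moreover have "(x \<otimes> a \<otimes> inv x) \<otimes> commutator x (?c [^] n) \<in> A"
    using d A.inv_op_closed2[OF x a(1)] by blast
  ultimately show ?case by blast
qed

locale field_action = maximal_abelian_action +
  assumes idem_trivial: "e \<in> R \<Longrightarrow> e \<otimes>\<^bsub>E\<^esub> e = e \<Longrightarrow> e = \<zero>\<^bsub>E\<^esub> \<or> e = \<one>\<^bsub>E\<^esub>"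
begin

lemma R_pow: "x \<in> R \<Longrightarrow> x [^]\<^bsub>E\<^esub> (n::nat) \<in> R"
  by (induction n) (auto intro: R_closed)

lemma cnj_pow: "g \<in> carrier S \<Longrightarrow> x \<in> carrier E \<Longrightarrow> cnj g (x [^]\<^bsub>E\<^esub> (n::nat)) = cnj g x [^]\<^bsub>E\<^esub> n"
  by (induction n) (simp_all add: cnj_mult)

text \<open>The common kernel \<open>W\<close> of the nilpotent elements of \<open>R\<close> is invariant.  It is nontrivial: if \<open>y\<close> is a nonzero
  element of \<open>R\<close> with smallest image and \<open>z\<close> is nilpotent, then \<open>z\<close> maps the image of \<open>y\<close> to a proper subgroup of
  itself, so \<open>z y = 0\<close> by minimality.  Hence \<open>W\<close> contains the image of \<open>y\<close>, and irreducibility gives \<open>W = V\<close>.\<close>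

lemma R_nilpotent_zero:
  assumes x: "x \<in> R" and nil: "x [^]\<^bsub>E\<^esub> (n::nat) = \<zero>\<^bsub>E\<^esub>"
  shows "x = \<zero>\<^bsub>E\<^esub>"
proof -
  define J where "J = {x \<in> R. \<exists>n::nat. x [^]\<^bsub>E\<^esub> n = \<zero>\<^bsub>E\<^esub>}"
  define W where "W = {v \<in> carrier V. \<forall>x\<in>J. x v = \<one>\<^bsub>V\<^esub>}"
  have JR: "x \<in> carrier E" if "x \<in> J" for x using that by (simp add: J_def)
  have cnjJ: "cnj g x \<in> J" if gS: "g \<in> carrier S" and xJ: "x \<in> J" for g x
  proof -
    obtain n :: nat where n: "x \<in> R" "x [^]\<^bsub>E\<^esub> n = \<zero>\<^bsub>E\<^esub>" using xJ unfolding J_def by blast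
    then have "cnj g x [^]\<^bsub>E\<^esub> n = \<zero>\<^bsub>E\<^esub>" using gS cnj_pow[of g x n] by simp
    then show ?thesis using R_cnj[OF gS n(1)] by (auto simp: J_def)
  qed
  have "invariant W"
    unfolding invariant_def
  proof (intro conjI ballI)
    show "subgroup W V"
    proof (rule V.subgroupI)
      show "W \<subseteq> carrier V" by (auto simp: W_def)
      have "\<one>\<^bsub>V\<^esub> \<in> W" using V.endo_one JR by (auto simp: W_def)
      then show "W \<noteq> {}" by blast
    next
      fix a assume a: "a \<in> W"
      have "x (inv\<^bsub>V\<^esub> a) = \<one>\<^bsub>V\<^esub>" if "x \<in> J" for x
      proof -
        have "x a = \<one>\<^bsub>V\<^esub>" "a \<in> carrier V" using a that by (auto simp: W_def)
        then show ?thesis using V.endo_inv[OF JR[OF that], of a] by simp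
      qed
      then show "inv\<^bsub>V\<^esub> a \<in> W" using a by (simp add: W_def)
    next
      fix a b assume ab: "a \<in> W" "b \<in> W"
      have "x (a \<otimes>\<^bsub>V\<^esub> b) = \<one>\<^bsub>V\<^esub>" if "x \<in> J" for x
      proof -
        have "x a = \<one>\<^bsub>V\<^esub>" "x b = \<one>\<^bsub>V\<^esub>" "a \<in> carrier V" "b \<in> carrier V"
          using ab that by (auto simp: W_def)
        then show ?thesis using V.endo_mult[OF JR[OF that], of a b] by simp
      qed
      then show "a \<otimes>\<^bsub>V\<^esub> b \<in> W" using ab by (simp add: W_def)
    qed
    fix g w assume g: "g \<in> carrier S" and w: "w \<in> W"
    have "y (act g w) = \<one>\<^bsub>V\<^esub>" if y: "y \<in> J" for y
    proof -
      have yJ: "cnj (inv g) y \<in> J" using cnjJ g y by simp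
      have "act g (cnj (inv g) y w) = act g (act (inv g) (y (act g w)))"
        using g w JR[OF y] by (subst cnj_apply) (auto simp: W_def)
      then have "y (act g w) = act g (cnj (inv g) y w)"
        using g w V.endo_closed[OF JR[OF y], of "act g w"] by (simp add: W_def)
      also have "\<dots> = act g \<one>\<^bsub>V\<^esub>" using w yJ by (simp add: W_def)
      also have "\<dots> = \<one>\<^bsub>V\<^esub>" using act_hom[OF g] hom_one V.is_group by blast
      finally show ?thesis .
    qed
    then show "act g w \<in> W" using g w by (simp add: W_def)
  qed
  moreover have "W \<noteq> {\<one>\<^bsub>V\<^esub>}"
  proof -
    have "\<exists>y. y \<in> R \<and> y \<noteq> \<zero>\<^bsub>E\<^esub>" using one_neq_zero_E R_closed(4) by blast
    then obtain y where y: "y \<in> R" "y \<noteq> \<zero>\<^bsub>E\<^esub>"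
        and ymin: "\<And>z. z \<in> R \<Longrightarrow> z \<noteq> \<zero>\<^bsub>E\<^esub> \<Longrightarrow> card (y ` carrier V) \<le> card (z ` carrier V)"
      using ex_has_least_nat[of "\<lambda>y. y \<in> R \<and> y \<noteq> \<zero>\<^bsub>E\<^esub>" _ "\<lambda>y. card (y ` carrier V)"] by blast
    have yc: "y \<in> carrier E" using y by simp
    have kill: "z \<otimes>\<^bsub>E\<^esub> y = \<zero>\<^bsub>E\<^esub>" if z: "z \<in> J" for z
    proof (rule ccontr)
      assume nz: "z \<otimes>\<^bsub>E\<^esub> y \<noteq> \<zero>\<^bsub>E\<^esub>"
      obtain n :: nat where n: "z \<in> R" "z [^]\<^bsub>E\<^esub> n = \<zero>\<^bsub>E\<^esub>" using z unfolding J_def by blast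
      have zc: "z \<in> carrier E" using n by simp
      have "card (y ` carrier V) \<le> card ((z \<otimes>\<^bsub>E\<^esub> y) ` carrier V)"
        by (rule ymin[OF R_closed(1)[OF n(1) y(1)] nz])
      moreover have "(z \<otimes>\<^bsub>E\<^esub> y) ` carrier V \<subseteq> y ` carrier V"
      proof -
        have "(y \<otimes>\<^bsub>E\<^esub> z) ` carrier V \<subseteq> y ` carrier V"
          using V.endo_closed[OF zc] by (auto simp: endo_ring_simps)
        then show ?thesis by (simp add: R_comm[OF y(1) n(1)])
      qed
      ultimately have "(z \<otimes>\<^bsub>E\<^esub> y) ` carrier V = y ` carrier V"
        using finite_V by (intro card_seteq) auto
      moreover have "(z \<otimes>\<^bsub>E\<^esub> y) ` carrier V = z ` y ` carrier V"
        by (auto simp: endo_ring_simps image_image)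
      ultimately have zy: "z ` y ` carrier V = y ` carrier V" by simp
      have ycl: "y ` carrier V \<subseteq> carrier V" using V.endo_closed[OF yc] by auto
      have "(z [^]\<^bsub>E\<^esub> m) ` y ` carrier V = y ` carrier V" for m :: nat
      proof (induction m)
        case 0
        have "\<one>\<^bsub>E\<^esub> ` y ` carrier V = (\<lambda>v. v) ` y ` carrier V"
          using ycl by (intro image_cong) (auto simp: endo_ring_simps)
        then show ?case by simp
      next
        case (Suc m)
        have "(z [^]\<^bsub>E\<^esub> Suc m) ` y ` carrier V = (z [^]\<^bsub>E\<^esub> m) ` z ` y ` carrier V"
          unfolding image_image[of "z [^]\<^bsub>E\<^esub> m" z] using ycl
          by (intro image_cong) (auto simp: endo_ring_simps(2))
        then show ?case using zy Suc by simp
      qed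
      from this[of n] have "\<zero>\<^bsub>E\<^esub> ` y ` carrier V = y ` carrier V" using n(2) by simp
      moreover have "\<zero>\<^bsub>E\<^esub> ` y ` carrier V \<subseteq> {\<one>\<^bsub>V\<^esub>}" using ycl by (auto simp: endo_ring_simps)
      ultimately have y1: "y ` carrier V \<subseteq> {\<one>\<^bsub>V\<^esub>}" by simp
      have "y = \<zero>\<^bsub>E\<^esub>"
      proof (rule V.endo_ring_ext[OF yc])
        fix v assume "v \<in> carrier V"
        then show "y v = \<zero>\<^bsub>E\<^esub> v" using y1 by (auto simp: endo_ring_simps)
      qed auto
      then show False using y(2) by simp
    qed
    have "\<exists>v\<in>carrier V. y v \<noteq> \<one>\<^bsub>V\<^esub>"
    proof (rule ccontr)
      assume y1: "\<not> ?thesis"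
      have "y = \<zero>\<^bsub>E\<^esub>"
      proof (rule V.endo_ring_ext[OF yc])
        fix v assume "v \<in> carrier V"
        then show "y v = \<zero>\<^bsub>E\<^esub> v" using y1 by (auto simp: endo_ring_simps)
      qed auto
      then show False using y(2) by simp
    qed
    then obtain v where v: "v \<in> carrier V" "y v \<noteq> \<one>\<^bsub>V\<^esub>" by blast
    have "y v \<in> W"
      unfolding W_def
    proof (intro CollectI conjI ballI)
      show "y v \<in> carrier V" by (rule V.endo_closed[OF yc v(1)])
      fix z assume "z \<in> J"
      then have "(z \<otimes>\<^bsub>E\<^esub> y) v = \<zero>\<^bsub>E\<^esub> v" using kill by simp
      then show "z (y v) = \<one>\<^bsub>V\<^esub>" using v by (simp add: endo_ring_simps)
    qed
    then show ?thesis using v by blast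
  qed
  ultimately have W: "W = carrier V" using irreducible by blast
  have xJ: "x \<in> J" using x nil by (auto simp: J_def)
  show ?thesis
  proof (rule V.endo_ring_ext)
    fix v assume "v \<in> carrier V"
    then show "x v = \<zero>\<^bsub>E\<^esub> v" using W xJ by (auto simp: W_def endo_ring_simps)
  qed (use x in auto)
qed

abbreviation K :: "('c \<Rightarrow> 'c) ring" where "K \<equiv> E\<lparr>carrier := R\<rparr>"

text \<open>Some power of each element is idempotent, hence \<open>0\<close> or \<open>1\<close>; the first is excluded for nonzero elements
  because they are not nilpotent.\<close>

lemma field_K: "field K"
proof -
  have "subcring R E" by (rule E.subcringI[OF R_subring R_comm])
  moreover have "R \<subseteq> carrier E" by auto
  ultimately interpret K: cring K using E.subcring_iff[of R] by blast
  show ?thesis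
  proof (rule K.cring_fieldI2)
    show "\<zero>\<^bsub>K\<^esub> \<noteq> \<one>\<^bsub>K\<^esub>" using one_neq_zero_E by simp
    fix a assume "a \<in> carrier K" "a \<noteq> \<zero>\<^bsub>K\<^esub>"
    then have a: "a \<in> R" "a \<noteq> \<zero>\<^bsub>E\<^esub>" by auto
    obtain n :: nat where n: "n \<ge> 1" "a [^]\<^bsub>E\<^esub> n \<otimes>\<^bsub>E\<^esub> a [^]\<^bsub>E\<^esub> n = a [^]\<^bsub>E\<^esub> n"
      using E.finite_idempotent_power[OF finite_E, of a] a by auto
    have "a [^]\<^bsub>E\<^esub> n \<noteq> \<zero>\<^bsub>E\<^esub>" using R_nilpotent_zero a by blast
    then have "a [^]\<^bsub>E\<^esub> n = \<one>\<^bsub>E\<^esub>" using idem_trivial[OF R_pow[OF a(1)] n(2)] by blast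
    moreover have "a [^]\<^bsub>E\<^esub> n = a \<otimes>\<^bsub>E\<^esub> a [^]\<^bsub>E\<^esub> (n - 1)"
      using n(1) a(1) E.nat_pow_Suc2[of a "n - 1"] by simp
    ultimately show "\<exists>b\<in>carrier K. a \<otimes>\<^bsub>K\<^esub> b = \<one>\<^bsub>K\<^esub>"
      using R_pow[OF a(1)] by (intro bexI[of _ "a [^]\<^bsub>E\<^esub> (n - 1)"]) auto
  qed
qed

sublocale K: field K by (rule field_K)

definition q :: nat where "q = card R"

lemma finite_R: "finite R"
  using finite_E R_carrier finite_subset[of R "carrier E"] by blast

lemma q_ge_2: "q \<ge> 2"
proof -
  have "card {\<zero>\<^bsub>E\<^esub>, \<one>\<^bsub>E\<^esub>} \<le> q"
    unfolding q_def using R_closed finite_R by (intro card_mono) auto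
  then show ?thesis using one_neq_zero_E by simp
qed

lemma R_inverse:
  assumes "x \<in> R" "x \<noteq> \<zero>\<^bsub>E\<^esub>"
  obtains y where "y \<in> R" "y \<otimes>\<^bsub>E\<^esub> x = \<one>\<^bsub>E\<^esub>" "x \<otimes>\<^bsub>E\<^esub> y = \<one>\<^bsub>E\<^esub>"
proof -
  have "x \<in> Units K" using assms K.field_Units by auto
  then show thesis using that by (auto simp: Units_def)
qed

text \<open>The multiplications by \<open>0, \<dots>, p - 1\<close> are \<open>p\<close> different elements of \<open>R\<close>.\<close>

lemma char_le_q:
  assumes p: "prime p" and exp: "\<And>v. v \<in> carrier V \<Longrightarrow> v [^]\<^bsub>V\<^esub> p = \<one>\<^bsub>V\<^esub>"
  shows "p \<le> q"
proof -
  define h where "h = (\<lambda>n::nat. \<lambda>v\<in>carrier V. v [^]\<^bsub>V\<^esub> n)"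
  have hc: "h n \<in> carrier E" for n
    by (auto simp: h_def endo_ring_simps hom_def V.pow_mult_distrib V.m_comm)
  have comm: "h n \<otimes>\<^bsub>E\<^esub> x = x \<otimes>\<^bsub>E\<^esub> h n" if x: "x \<in> carrier E" for n x
  proof (rule V.endo_ring_ext)
    fix v assume v: "v \<in> carrier V"
    have "x (v [^]\<^bsub>V\<^esub> n) = x v [^]\<^bsub>V\<^esub> n"
      by (induction n) (use x v in \<open>simp_all add: V.endo_one V.endo_mult V.endo_closed\<close>)
    then show "(h n \<otimes>\<^bsub>E\<^esub> x) v = (x \<otimes>\<^bsub>E\<^esub> h n) v"
      using v V.endo_closed[OF x v] by (simp add: h_def endo_ring_simps(2))
  qed (use x hc in auto)
  have hR: "h n \<in> R" for n
    using hc comm unfolding R_def commutant_def by blast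
  obtain v where v: "v \<in> carrier V" "v \<noteq> \<one>\<^bsub>V\<^esub>" using nontrivial V.one_closed by blast
  have "V.ord v dvd p" using exp[OF v(1)] V.pow_eq_id[OF v(1)] by simp
  then have ord: "V.ord v = p" using p v V.ord_eq_1[OF v(1)] by (metis prime_nat_iff)
  have "inj_on h {..<p}"
  proof (rule inj_onI)
    fix i j assume ij: "i \<in> {..<p}" "j \<in> {..<p}" "h i = h j"
    have "h i v = h j v" by (simp add: ij(3))
    then have "v [^]\<^bsub>V\<^esub> i = v [^]\<^bsub>V\<^esub> j" using v by (simp add: h_def)
    then have "v [^]\<^bsub>V\<^esub> int i = v [^]\<^bsub>V\<^esub> int j" by (simp add: int_pow_int)
    then have "int p dvd int j - int i" using V.int_pow_eq[OF v(1)] ord by simp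
    then have "i \<noteq> j \<Longrightarrow> int p \<le> \<bar>int j - int i\<bar>"
      using dvd_imp_le_int[of "int j - int i" "int p"] by simp
    moreover have "i < p" "j < p" using ij(1,2) by auto
    ultimately show "i = j" by linarith
  qed
  then have "card {..<p} \<le> card R" using hR finite_R by (intro card_inj_on_le) auto
  then show ?thesis by (simp add: q_def)
qed

definition R_submodule :: "'c set \<Rightarrow> bool" where
  "R_submodule W \<longleftrightarrow> subgroup W V \<and> (\<forall>x\<in>R. \<forall>w\<in>W. x w \<in> W)"

lemma R_submodule_extend:
  assumes W: "R_submodule W" and v: "v \<in> carrier V" "v \<notin> W"
  defines "W' \<equiv> (\<lambda>(w, x). w \<otimes>\<^bsub>V\<^esub> x v) ` (W \<times> R)"
  shows "R_submodule W'" and "card W' = card W * q" and "insert v W \<subseteq> W'"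
    and "\<And>Y. R_submodule Y \<Longrightarrow> insert v W \<subseteq> Y \<Longrightarrow> W' \<subseteq> Y"
proof -
  have sW: "subgroup W V" and RW: "\<And>x w. x \<in> R \<Longrightarrow> w \<in> W \<Longrightarrow> x w \<in> W"
    using W by (auto simp: R_submodule_def)
  interpret W: subgroup W V by (rule sW)
  have Wc: "w \<in> carrier V" if "w \<in> W" for w using that W.subset by blast
  have xv: "x v \<in> carrier V" if "x \<in> R" for x using that v V.endo_closed by auto
  have addv: "(x \<oplus>\<^bsub>E\<^esub> y) v = x v \<otimes>\<^bsub>V\<^esub> y v" for x y using v by (simp add: endo_ring_simps)
  have multv: "(x \<otimes>\<^bsub>E\<^esub> y) v = x (y v)" for x y using v by (simp add: endo_ring_simps)
  have negv: "(\<ominus>\<^bsub>E\<^esub> x) v = inv\<^bsub>V\<^esub> (x v)" if x: "x \<in> R" for x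
  proof -
    have "(\<ominus>\<^bsub>E\<^esub> x \<oplus>\<^bsub>E\<^esub> x) v = \<one>\<^bsub>V\<^esub>" using x v by (simp add: E.l_neg endo_ring_simps(4))
    then have "(\<ominus>\<^bsub>E\<^esub> x) v \<otimes>\<^bsub>V\<^esub> x v = \<one>\<^bsub>V\<^esub>" by (simp add: addv)
    then show ?thesis using V.inv_equality[of "(\<ominus>\<^bsub>E\<^esub> x) v" "x v"] xv x R_closed(3) by simp
  qed
  have memW': "w \<otimes>\<^bsub>V\<^esub> x v \<in> W'" if "w \<in> W" "x \<in> R" for w x
    using that by (auto simp: W'_def)
  show "R_submodule W'"
    unfolding R_submodule_def
  proof (intro conjI ballI)
    show "subgroup W' V"
    proof (rule V.subgroupI)
      show "W' \<subseteq> carrier V" using Wc xv by (auto simp: W'_def)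
      have "\<one>\<^bsub>V\<^esub> \<otimes>\<^bsub>V\<^esub> \<zero>\<^bsub>E\<^esub> v \<in> W'" using W.one_closed R_closed(5) by (rule memW')
      then show "W' \<noteq> {}" by blast
    next
      fix a assume "a \<in> W'"
      then obtain w x where a: "w \<in> W" "x \<in> R" "a = w \<otimes>\<^bsub>V\<^esub> x v" by (auto simp: W'_def)
      have "inv\<^bsub>V\<^esub> a = inv\<^bsub>V\<^esub> w \<otimes>\<^bsub>V\<^esub> (\<ominus>\<^bsub>E\<^esub> x) v" using a Wc xv by (simp add: negv V.inv_mult)
      then show "inv\<^bsub>V\<^esub> a \<in> W'" using memW'[of "inv\<^bsub>V\<^esub> w" "\<ominus>\<^bsub>E\<^esub> x"] a R_closed(3) W.m_inv_closed by simp
    next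
      fix a b assume "a \<in> W'" "b \<in> W'"
      then obtain w x u y where ab: "w \<in> W" "x \<in> R" "a = w \<otimes>\<^bsub>V\<^esub> x v" "u \<in> W" "y \<in> R" "b = u \<otimes>\<^bsub>V\<^esub> y v"
        by (auto simp: W'_def)
      have "a \<otimes>\<^bsub>V\<^esub> b = (w \<otimes>\<^bsub>V\<^esub> u) \<otimes>\<^bsub>V\<^esub> (x \<oplus>\<^bsub>E\<^esub> y) v"
        using ab Wc xv by (simp add: addv V.m_ac)
      then show "a \<otimes>\<^bsub>V\<^esub> b \<in> W'" using memW'[of "w \<otimes>\<^bsub>V\<^esub> u" "x \<oplus>\<^bsub>E\<^esub> y"] ab R_closed(2) W.m_closed by simp
    qed
    fix y a assume y: "y \<in> R" and "a \<in> W'"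
    then obtain w x where a: "w \<in> W" "x \<in> R" "a = w \<otimes>\<^bsub>V\<^esub> x v" by (auto simp: W'_def)
    have "y a = y w \<otimes>\<^bsub>V\<^esub> (y \<otimes>\<^bsub>E\<^esub> x) v"
      using a y Wc xv by (simp add: V.endo_mult multv)
    then show "y a \<in> W'" using memW'[of "y w" "y \<otimes>\<^bsub>E\<^esub> x"] a y RW R_closed(1) by simp
  qed
  have "inj_on (\<lambda>(w, x). w \<otimes>\<^bsub>V\<^esub> x v) (W \<times> R)"
  proof (rule inj_onI, clarify)
    fix w x u y assume a: "w \<in> W" "x \<in> R" "u \<in> W" "y \<in> R" "w \<otimes>\<^bsub>V\<^esub> x v = u \<otimes>\<^bsub>V\<^esub> y v"
    have "x = y"
    proof (rule ccontr)
      assume "x \<noteq> y"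
      let ?z = "x \<oplus>\<^bsub>E\<^esub> \<ominus>\<^bsub>E\<^esub> y"
      have zR: "?z \<in> R" using a R_closed by blast
      have "?z \<noteq> \<zero>\<^bsub>E\<^esub>"
        using \<open>x \<noteq> y\<close> a E.minus_equality[of x "\<ominus>\<^bsub>E\<^esub> y"] by (metis E.a_inv_closed E.minus_minus R_carrier)
      then obtain z' where z': "z' \<in> R" "z' \<otimes>\<^bsub>E\<^esub> ?z = \<one>\<^bsub>E\<^esub>" using R_inverse[OF zR] by metis
      have "?z v = inv\<^bsub>V\<^esub> w \<otimes>\<^bsub>V\<^esub> (w \<otimes>\<^bsub>V\<^esub> x v) \<otimes>\<^bsub>V\<^esub> inv\<^bsub>V\<^esub> (y v)"
        using a(1-4) Wc xv by (simp add: addv negv V.inv_mult_cancel)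
      also have "\<dots> = inv\<^bsub>V\<^esub> w \<otimes>\<^bsub>V\<^esub> u"
        unfolding a(5) using a(1-4) Wc xv by (simp add: V.m_assoc)
      finally have "?z v \<in> W" using a by simp
      then have "z' (?z v) \<in> W" using z'(1) RW by blast
      moreover have "z' (?z v) = v" using multv[of z' ?z] z'(2) v by (simp add: endo_ring_simps(3))
      ultimately show False using v by simp
    qed
    then show "w = u \<and> x = y" using a Wc xv by simp
  qed
  then show "card W' = card W * q" by (simp add: W'_def card_image card_cartesian_product q_def)
  show "insert v W \<subseteq> W'"
  proof (intro insert_subsetI subsetI)
    have "\<one>\<^bsub>V\<^esub> \<otimes>\<^bsub>V\<^esub> \<one>\<^bsub>E\<^esub> v = v" using v by (simp add: endo_ring_simps(3))
    then show "v \<in> W'" using memW'[OF W.one_closed R_closed(4)] by simp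
  next
    fix w assume w: "w \<in> W"
    have "w \<otimes>\<^bsub>V\<^esub> \<zero>\<^bsub>E\<^esub> v = w" using v w Wc by (simp add: endo_ring_simps(4))
    then show "w \<in> W'" using memW'[OF w R_closed(5)] by simp
  qed
  fix Y assume "R_submodule Y" "insert v W \<subseteq> Y"
  then show "W' \<subseteq> Y" by (auto simp: W'_def R_submodule_def subset_iff intro!: subgroup.m_closed[of Y V])
qed

text \<open>A basis of \<open>V\<close> over \<open>R\<close>, in the form that counting needs: two linear maps that agree on \<open>B\<close> agree on a
  submodule containing \<open>B\<close>, and hence everywhere.\<close>

lemma basis_exists:
  obtains B where "B \<subseteq> carrier V" "finite B" "card (carrier V) = q ^ card B"
    "\<And>Y. R_submodule Y \<Longrightarrow> B \<subseteq> Y \<Longrightarrow> carrier V \<subseteq> Y"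
proof -
  have ex: "\<exists>B. B \<subseteq> carrier V \<and> B \<inter> W = {} \<and> finite B \<and> card (carrier V) = card W * q ^ card B \<and>
      (\<forall>Y. R_submodule Y \<longrightarrow> W \<union> B \<subseteq> Y \<longrightarrow> carrier V \<subseteq> Y)" if "R_submodule W" for W
    using that
  proof (induction "card (carrier V) - card W" arbitrary: W rule: less_induct)
    case less
    then have sW: "subgroup W V" by (simp add: R_submodule_def)
    show ?case
    proof (cases "W = carrier V")
      case True
      then show ?thesis by (intro exI[of _ "{}"]) auto
    next
      case False
      then obtain v where v: "v \<in> carrier V" "v \<notin> W" using subgroup.subset[OF sW] by blast
      define W' where "W' = (\<lambda>(w, x). w \<otimes>\<^bsub>V\<^esub> x v) ` (W \<times> R)"
      note ext = R_submodule_extend[OF less.prems v, folded W'_def]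
      have sW': "W' \<subseteq> carrier V" using ext(1) subgroup.subset unfolding R_submodule_def by blast
      have fW: "finite W" using subgroup.subset[OF sW] finite_V finite_subset by blast
      have "card W < card W'" using ext(3) v sW' finite_V finite_subset by (intro psubset_card_mono) auto
      moreover have "card W' \<le> card (carrier V)" using sW' finite_V card_mono by blast
      ultimately have "card (carrier V) - card W' < card (carrier V) - card W" by linarith
      from less.hyps[OF this ext(1)] obtain B where B: "B \<subseteq> carrier V" "finite B" "B \<inter> W' = {}"
          "card (carrier V) = card W' * q ^ card B" "\<forall>Y. R_submodule Y \<longrightarrow> W' \<union> B \<subseteq> Y \<longrightarrow> carrier V \<subseteq> Y" by blast
      show ?thesis
      proof (intro exI[of _ "insert v B"] conjI allI impI)
        show "insert v B \<subseteq> carrier V" "finite (insert v B)" "insert v B \<inter> W = {}" using B v ext(3) by auto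
        have "v \<notin> B" using B(3) ext(3) by blast
        then show "card (carrier V) = card W * q ^ card (insert v B)"
          using B(2,4) by (simp add: ext(2))
        fix Y assume Y: "R_submodule Y" "W \<union> insert v B \<subseteq> Y"
        then have "W' \<subseteq> Y" using ext(4)[of Y] by blast
        then show "carrier V \<subseteq> Y" using B(5) Y by blast
      qed
    qed
  qed
  have "R_submodule {\<one>\<^bsub>V\<^esub>}"
    using V.triv_subgroup V.endo_one by (auto simp: R_submodule_def)
  from ex[OF this] obtain B where B: "B \<subseteq> carrier V" "finite B" "card (carrier V) = q ^ card B"
      "\<forall>Y. R_submodule Y \<longrightarrow> {\<one>\<^bsub>V\<^esub>} \<union> B \<subseteq> Y \<longrightarrow> carrier V \<subseteq> Y" by auto
  have "carrier V \<subseteq> Y" if "R_submodule Y" "B \<subseteq> Y" for Y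
    using B(4) that subgroup.one_closed[of Y V] by (auto simp: R_submodule_def)
  then show thesis using that B by blast
qed

end

section \<open>Class two subgroups over the field\<close>

locale field_pair_action = field_action +
  fixes D
  assumes D_normal: "D \<lhd> S" and A_D: "A \<subseteq> D" and D_C: "D \<subseteq> C"
    and D_abelian: "D \<subseteq> centralizer_mod A D"
    and D_max: "\<And>B. B \<lhd> S \<Longrightarrow> D \<subseteq> B \<Longrightarrow> B \<subseteq> C \<Longrightarrow> B \<subseteq> centralizer_mod A B \<Longrightarrow> B = D"
begin

lemma D_carrier [simp]: "d \<in> D \<Longrightarrow> d \<in> carrier S"
  using normal_subset[OF D_normal] by blast

lemma subgroups: "subgroup A S" "subgroup C S" "subgroup D S" "subgroup act_kernel S"
  using A_normal C_normal D_normal act_kernel_normal normal_imp_subgroup by auto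

lemma fins: "finite A" "finite C" "finite D" "finite act_kernel"
  using subgroups finite_S finite_subset subgroup.subset by metis+

text \<open>Otherwise there is a normal subgroup \<open>F\<close> of \<open>S\<close> strictly above \<open>A\<close> that lies in \<open>C\<close>, centralizes \<open>D\<close> and is
  abelian modulo \<open>A\<close>.  Then \<open>D F\<close> is abelian modulo \<open>A\<close>, so \<open>F \<subseteq> D\<close> by maximality of \<open>D\<close>.  But then \<open>F\<close>
  is abelian, against the maximality of \<open>A\<close>.\<close>

lemma kernel_C: "C \<inter> centralizer_mod act_kernel D = A"
proof -
  define B where "B = C \<inter> centralizer_mod act_kernel D"
  have cD: "centralizer_mod act_kernel D \<lhd> S"
    using normal_conj(1)[OF D_normal] by (intro centralizer_mod_normal[OF act_kernel_normal]) auto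
  have B: "B \<lhd> S" unfolding B_def by (rule normal_Int[OF C_normal cD])
  have AcD: "A \<subseteq> centralizer_mod act_kernel D"
    by (rule centralizer_mod_sym[OF subgroups(4)]) (use D_C in \<open>auto simp: C_def\<close>)
  have AB: "A \<subseteq> B" using A_subset_C AcD by (auto simp: B_def)
  have "B = A"
  proof (rule ccontr)
    assume "B \<noteq> A"
    then have "A \<subset> B" using AB by blast
    then obtain F where F: "F \<lhd> S" "A \<subset> F" "F \<subseteq> B" "F \<subseteq> centralizer_mod A F"
      using solvable_abelian_normal_step[OF solvable_S A_normal B] by metis
    have sub: "D \<subseteq> carrier S" "F \<subseteq> carrier S" using D_normal F normal_subset by auto
    have DF: "D <#> F \<subseteq> carrier S" by (rule set_mult_closed[OF sub])
    note nm = normal_set_mult[OF D_normal F(1)]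
    have "F \<subseteq> centralizer_mod act_kernel D" using F(3) by (simp add: B_def)
    then have FD: "F \<subseteq> centralizer_mod A D" using centralizer_mod_mono[OF kernel_A] by blast
    then have DFc: "D \<subseteq> centralizer_mod A F" by (rule centralizer_mod_sym[OF subgroups(1) sub(2,1)])
    have 1: "D <#> F \<subseteq> centralizer_mod A D"
      by (rule set_mult_subset[OF centralizer_mod_subgroup[OF A_normal sub(1)] D_abelian FD])
    have 2: "D <#> F \<subseteq> centralizer_mod A F"
      by (rule set_mult_subset[OF centralizer_mod_subgroup[OF A_normal sub(2)] DFc F(4)])
    have "D <#> F \<subseteq> centralizer_mod A (D <#> F)"
      using set_mult_subset[OF centralizer_mod_subgroup[OF A_normal DF]]
        centralizer_mod_sym[OF subgroups(1) DF sub(1) 1] centralizer_mod_sym[OF subgroups(1) DF sub(2) 2] by blast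
    moreover have "D <#> F \<subseteq> C"
      by (rule set_mult_subset[OF subgroups(2) D_C]) (use F(3) in \<open>auto simp: B_def\<close>)
    ultimately have "D <#> F = D" by (intro D_max nm)
    then have "F \<subseteq> D" using nm(3) by simp
    then have "F \<subseteq> centralizer_mod act_kernel F"
      using F(3) centralizer_mod_antimono[of F D act_kernel] by (auto simp: B_def)
    then have "F = A" using A_max[OF F(1)] F(2) by blast
    then show False using F(2) by blast
  qed
  then show ?thesis by (simp add: B_def)
qed

definition t :: nat where "t = card D div card A"

lemma card_A_pos: "card A > 0"
  using fins subgroup.one_closed[OF subgroups(1)] card_gt_0_iff by blast

lemma card_D: "card D = t * card A"
  unfolding t_def by (rule card_subgroup_dvd[OF subgroups(3,1) A_D])

lemma t_pos: "t \<ge> 1"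
proof -
  have "card D > 0" using fins subgroup.one_closed[OF subgroups(3)] card_gt_0_iff by blast
  then show ?thesis using card_D by (cases t) auto
qed

lemma transversal:
  obtains T where "T \<subseteq> D" "finite T" "card T = t"
    "\<And>d e. d \<in> T \<Longrightarrow> e \<in> T \<Longrightarrow> d \<noteq> e \<Longrightarrow> inv d \<otimes> e \<notin> A"
    "\<And>d. d \<in> D \<Longrightarrow> \<exists>e\<in>T. A #> d = A #> e"
proof -
  obtain T where T: "T \<subseteq> D" "inj_on (\<lambda>d. A #> d) T" "(\<lambda>d. A #> d) ` D = (\<lambda>d. A #> d) ` T"
    by (meson subset_image_inj order_refl)
  have "card T = t"
  proof -
    have "card ((\<lambda>d. A #> d) ` D) * card A = t * card A"
      using card_coset_image[OF subgroups(3,1) A_D] card_D by simp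
    then show ?thesis using T card_A_pos by (simp add: card_image)
  qed
  moreover have "inv d \<otimes> e \<notin> A" if de: "d \<in> T" "e \<in> T" "d \<noteq> e" for d e
  proof
    assume a: "inv d \<otimes> e \<in> A"
    have c: "d \<in> carrier S" "e \<in> carrier S" using de T(1) by auto
    have "d \<otimes> (inv d \<otimes> e) \<otimes> inv d \<in> A" by (rule normal_conj(1)[OF A_normal c(1) a])
    then have "e \<otimes> inv d \<in> A" using c by (simp add: word_simps)
    then have "A #> e = A #> d" using coset_eq_iff[OF subgroups(1)] c by simp
    then show False using T(2) de by (auto dest: inj_onD)
  qed
  moreover have "\<exists>e\<in>T. A #> d = A #> e" if "d \<in> D" for d
    using that T(3) by blast
  moreover have "finite T" using T(1) fins(3) by (rule finite_subset)
  ultimately show thesis using that[of T] T(1) by simp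
qed

text \<open>Conjugation by \<open>h \<in> D\<close> multiplies the operator of \<open>d \<in> D\<close> by the scalar \<open>[h, d]\<close>.  As only \<open>A\<close>
  centralizes \<open>D\<close>, some \<open>h\<close> gives different scalars for two terms of a linear relation, and subtracting a
  multiple of the relation from its conjugate shortens it.\<close>

lemma rep_linear_independent:
  assumes T: "T \<subseteq> D" "finite T" "\<And>d e. d \<in> T \<Longrightarrow> e \<in> T \<Longrightarrow> d \<noteq> e \<Longrightarrow> inv d \<otimes> e \<notin> A"
    and k: "k \<in> T \<rightarrow> R" and sum: "finsum E (\<lambda>d. k d \<otimes>\<^bsub>E\<^esub> rep d) T = \<zero>\<^bsub>E\<^esub>" and d: "d \<in> T"
  shows "k d = \<zero>\<^bsub>E\<^esub>"
  using k sum d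
proof (induction "card {d \<in> T. k d \<noteq> \<zero>\<^bsub>E\<^esub>}" arbitrary: k d rule: less_induct)
  case less
  have Tc: "d \<in> carrier S" "d \<in> D" if "d \<in> T" for d using that T(1) by auto
  have kR: "k d \<in> R" "k d \<in> carrier E" if "d \<in> T" for d
    using funcset_mem[OF less.prems(1) that] by simp_all
  show ?case
  proof (rule ccontr)
    assume nz: "k d \<noteq> \<zero>\<^bsub>E\<^esub>"
    show False
    proof (cases "\<exists>e\<in>T. e \<noteq> d \<and> k e \<noteq> \<zero>\<^bsub>E\<^esub>")
      case False
      have "finsum E (\<lambda>e. k e \<otimes>\<^bsub>E\<^esub> rep e) T = finsum E (\<lambda>e. if d = e then k e \<otimes>\<^bsub>E\<^esub> rep e else \<zero>\<^bsub>E\<^esub>) T"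
        using False kR Tc by (intro E.finsum_cong') auto
      also have "\<dots> = k d \<otimes>\<^bsub>E\<^esub> rep d"
        using less.prems(3) T(2) kR Tc by (intro E.finsum_singleton) auto
      finally have "k d \<otimes>\<^bsub>E\<^esub> rep d = \<zero>\<^bsub>E\<^esub>" using less.prems(2) by simp
      then have "k d \<otimes>\<^bsub>E\<^esub> rep d \<otimes>\<^bsub>E\<^esub> rep (inv d) = \<zero>\<^bsub>E\<^esub>" using Tc[OF less.prems(3)] by simp
      then show False using nz kR[OF less.prems(3)] Tc[OF less.prems(3)] by (simp add: E.m_assoc)
    next
      case True
      then obtain e where e: "e \<in> T" "e \<noteq> d" "k e \<noteq> \<zero>\<^bsub>E\<^esub>" by blast
      note dT = less.prems(3)
      define x where "x = inv d \<otimes> e"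
      have xA: "x \<notin> A" unfolding x_def using T(3)[OF dT e(1)] e(2) by auto
      have xD: "x \<in> D" unfolding x_def
        using Tc[OF dT] Tc[OF e(1)] subgroups(3) by (simp add: subgroup.m_closed subgroup.m_inv_closed)
      then have "x \<notin> centralizer_mod act_kernel D" using kernel_C xA D_C by blast
      then obtain h where h: "h \<in> D" "commutator x h \<notin> act_kernel"
        using xD by (auto simp: centralizer_mod_def)
      have hc: "h \<in> carrier S" "h \<in> C" using h D_C by auto
      define l where "l = (\<lambda>d. rep (commutator h d))"
      have hA: "commutator h d \<in> A" if "d \<in> T" for d
        using D_abelian h(1) Tc[OF that] by (auto simp: centralizer_mod_def subset_iff)
      have lR: "l d \<in> R" "l d \<in> carrier E" if "d \<in> T" for d
        using rep_A_R[OF hA[OF that]] by (auto simp: l_def)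
      have lrep: "l d \<otimes>\<^bsub>E\<^esub> rep d = rep h \<otimes>\<^bsub>E\<^esub> rep d \<otimes>\<^bsub>E\<^esub> rep (inv h)" if dt: "d \<in> T" for d
      proof -
        have "l d \<otimes>\<^bsub>E\<^esub> rep d = rep (commutator h d \<otimes> d)"
          unfolding l_def using Tc[OF dt] hc by (intro rep_mult[symmetric]) auto
        then show ?thesis using Tc[OF dt] hc by (simp add: commutator_eq_conj_mult rep_mult)
      qed
      define k' where "k' = (\<lambda>d'. k d' \<otimes>\<^bsub>E\<^esub> (l d' \<oplus>\<^bsub>E\<^esub> \<ominus>\<^bsub>E\<^esub> l d))"
      have k'R: "k' \<in> T \<rightarrow> R" unfolding k'_def using kR(1) lR(1) dT by (intro funcsetI R_closed) auto
      have nl: "\<ominus>\<^bsub>E\<^esub> l d \<in> R" using lR(1)[OF dT] R_closed(3) by blast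
      have term': "k' e \<otimes>\<^bsub>E\<^esub> rep e = (rep h \<otimes>\<^bsub>E\<^esub> (k e \<otimes>\<^bsub>E\<^esub> rep e) \<otimes>\<^bsub>E\<^esub> rep (inv h))
            \<oplus>\<^bsub>E\<^esub> (\<ominus>\<^bsub>E\<^esub> l d) \<otimes>\<^bsub>E\<^esub> (k e \<otimes>\<^bsub>E\<^esub> rep e)" if eT: "e \<in> T" for e
      proof -
        have c: "k e \<in> carrier E" "l e \<in> carrier E" "\<ominus>\<^bsub>E\<^esub> l d \<in> carrier E" "rep e \<in> carrier E"
          using kR lR eT dT Tc by auto
        have hk: "k e \<otimes>\<^bsub>E\<^esub> rep h = rep h \<otimes>\<^bsub>E\<^esub> k e" using C_commutes_R[OF hc(2) kR(1)[OF eT]] by simp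
        have "k' e \<otimes>\<^bsub>E\<^esub> rep e = k e \<otimes>\<^bsub>E\<^esub> (l e \<otimes>\<^bsub>E\<^esub> rep e) \<oplus>\<^bsub>E\<^esub> (k e \<otimes>\<^bsub>E\<^esub> (\<ominus>\<^bsub>E\<^esub> l d)) \<otimes>\<^bsub>E\<^esub> rep e"
          unfolding k'_def using c by (simp add: E.l_distr E.r_distr E.m_assoc)
        also have "k e \<otimes>\<^bsub>E\<^esub> (\<ominus>\<^bsub>E\<^esub> l d) = (\<ominus>\<^bsub>E\<^esub> l d) \<otimes>\<^bsub>E\<^esub> k e" by (rule R_comm[OF kR(1)[OF eT] nl])
        also have "k e \<otimes>\<^bsub>E\<^esub> (l e \<otimes>\<^bsub>E\<^esub> rep e) = (k e \<otimes>\<^bsub>E\<^esub> rep h) \<otimes>\<^bsub>E\<^esub> rep e \<otimes>\<^bsub>E\<^esub> rep (inv h)"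
          using c hc by (simp add: lrep[OF eT] E.m_assoc)
        also have "\<dots> = rep h \<otimes>\<^bsub>E\<^esub> (k e \<otimes>\<^bsub>E\<^esub> rep e) \<otimes>\<^bsub>E\<^esub> rep (inv h)"
          unfolding hk using c hc by (simp add: E.m_assoc)
        finally show ?thesis using c by (simp add: E.m_assoc)
      qed
      have kc: "(\<lambda>e. k e \<otimes>\<^bsub>E\<^esub> rep e) \<in> T \<rightarrow> carrier E" using kR Tc by auto
      have "finsum E (\<lambda>e. k' e \<otimes>\<^bsub>E\<^esub> rep e) T
          = finsum E (\<lambda>e. (rep h \<otimes>\<^bsub>E\<^esub> (k e \<otimes>\<^bsub>E\<^esub> rep e) \<otimes>\<^bsub>E\<^esub> rep (inv h))
            \<oplus>\<^bsub>E\<^esub> (\<ominus>\<^bsub>E\<^esub> l d) \<otimes>\<^bsub>E\<^esub> (k e \<otimes>\<^bsub>E\<^esub> rep e)) T"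
        using kR Tc lR dT hc by (intro E.finsum_cong' term') auto
      also have "\<dots> = finsum E (\<lambda>e. rep h \<otimes>\<^bsub>E\<^esub> (k e \<otimes>\<^bsub>E\<^esub> rep e) \<otimes>\<^bsub>E\<^esub> rep (inv h)) T
            \<oplus>\<^bsub>E\<^esub> finsum E (\<lambda>e. (\<ominus>\<^bsub>E\<^esub> l d) \<otimes>\<^bsub>E\<^esub> (k e \<otimes>\<^bsub>E\<^esub> rep e)) T"
        using kR Tc lR dT hc by (intro E.finsum_addf) auto
      also have "finsum E (\<lambda>e. (\<ominus>\<^bsub>E\<^esub> l d) \<otimes>\<^bsub>E\<^esub> (k e \<otimes>\<^bsub>E\<^esub> rep e)) T
            = (\<ominus>\<^bsub>E\<^esub> l d) \<otimes>\<^bsub>E\<^esub> finsum E (\<lambda>e. k e \<otimes>\<^bsub>E\<^esub> rep e) T"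
        using nl kc by (intro E.finsum_rdistr[symmetric] T(2)) auto
      also have "finsum E (\<lambda>e. rep h \<otimes>\<^bsub>E\<^esub> (k e \<otimes>\<^bsub>E\<^esub> rep e) \<otimes>\<^bsub>E\<^esub> rep (inv h)) T
            = finsum E (\<lambda>e. rep h \<otimes>\<^bsub>E\<^esub> (k e \<otimes>\<^bsub>E\<^esub> rep e)) T \<otimes>\<^bsub>E\<^esub> rep (inv h)"
        using hc kR Tc by (intro E.finsum_ldistr[symmetric] T(2)) auto
      also have "finsum E (\<lambda>e. rep h \<otimes>\<^bsub>E\<^esub> (k e \<otimes>\<^bsub>E\<^esub> rep e)) T
            = rep h \<otimes>\<^bsub>E\<^esub> finsum E (\<lambda>e. k e \<otimes>\<^bsub>E\<^esub> rep e) T"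
        using hc kc by (intro E.finsum_rdistr[symmetric] T(2)) auto
      finally have sum': "finsum E (\<lambda>e. k' e \<otimes>\<^bsub>E\<^esub> rep e) T = \<zero>\<^bsub>E\<^esub>"
        using less.prems(2) hc nl by simp
      have k'd: "k' d = \<zero>\<^bsub>E\<^esub>" unfolding k'_def using lR[OF dT] kR[OF dT] by (simp add: E.r_neg)
      have "{d \<in> T. k' d \<noteq> \<zero>\<^bsub>E\<^esub>} \<subset> {d \<in> T. k d \<noteq> \<zero>\<^bsub>E\<^esub>}"
      proof
        show "{d \<in> T. k' d \<noteq> \<zero>\<^bsub>E\<^esub>} \<subseteq> {d \<in> T. k d \<noteq> \<zero>\<^bsub>E\<^esub>}"
          using lR dT by (auto simp: k'_def)
        show "{d \<in> T. k' d \<noteq> \<zero>\<^bsub>E\<^esub>} \<noteq> {d \<in> T. k d \<noteq> \<zero>\<^bsub>E\<^esub>}" using k'd nz dT by blast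
      qed
      then have "card {d \<in> T. k' d \<noteq> \<zero>\<^bsub>E\<^esub>} < card {d \<in> T. k d \<noteq> \<zero>\<^bsub>E\<^esub>}"
        using T(2) by (intro psubset_card_mono) auto
      then have "k' e = \<zero>\<^bsub>E\<^esub>" using less.hyps k'R sum' e(1) by blast
      then have "k e \<otimes>\<^bsub>E\<^esub> (l e \<oplus>\<^bsub>E\<^esub> \<ominus>\<^bsub>E\<^esub> l d) = \<zero>\<^bsub>E\<^esub>" by (simp add: k'_def)
      moreover have "l e \<oplus>\<^bsub>E\<^esub> \<ominus>\<^bsub>E\<^esub> l d \<in> R" using lR(1)[OF e(1)] nl R_closed(2) by blast
      ultimately have "l e \<oplus>\<^bsub>E\<^esub> \<ominus>\<^bsub>E\<^esub> l d = \<zero>\<^bsub>E\<^esub>"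
        using K.integral[of "k e" "l e \<oplus>\<^bsub>E\<^esub> \<ominus>\<^bsub>E\<^esub> l d"] kR(1)[OF e(1)] e(3) by simp
      then have le: "l e = l d"
        using lR[OF e(1)] lR[OF dT] E.r_right_minus_eq by (simp add: a_minus_def)
      have c: "d \<in> carrier S" "e \<in> carrier S" "x \<in> carrier S" using Tc dT e xD by auto
      have "e = d \<otimes> x" unfolding x_def using c by (simp add: word_simps)
      then have "commutator h e = commutator h d \<otimes> (d \<otimes> commutator h x \<otimes> inv d)"
        using c hc by (simp add: commutator_mult_right)
      then have "l e = l d \<otimes>\<^bsub>E\<^esub> rep (d \<otimes> commutator h x \<otimes> inv d)"
        unfolding l_def using c hc by (simp add: rep_mult)
      moreover have "inv (commutator h d) \<in> carrier S" using c hc by simp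
      ultimately have "rep (inv (commutator h d)) \<otimes>\<^bsub>E\<^esub> l d
          = rep (inv (commutator h d)) \<otimes>\<^bsub>E\<^esub> (l d \<otimes>\<^bsub>E\<^esub> rep (d \<otimes> commutator h x \<otimes> inv d))"
        using le by simp
      then have "rep (d \<otimes> commutator h x \<otimes> inv d) = \<one>\<^bsub>E\<^esub>"
        unfolding l_def using c hc by simp
      then have "d \<otimes> commutator h x \<otimes> inv d \<in> act_kernel" using c hc by (simp add: act_kernel_iff)
      then have "inv d \<otimes> (d \<otimes> commutator h x \<otimes> inv d) \<otimes> d \<in> act_kernel"
        using normal_conj(2)[OF act_kernel_normal c(1)] by blast
      then have "commutator h x \<in> act_kernel" using c hc by (simp add: word_simps)
      then have "inv (commutator h x) \<in> act_kernel" using subgroup.m_inv_closed[OF subgroups(4)] by blast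
      then show False using h(2) c hc by (simp add: inv_commutator)
    qed
  qed
qed

text \<open>The operators of representatives of \<open>D / A\<close> are independent elements of the algebra of \<open>R\<close>-linear maps on \<open>V\<close>,
  whose dimension is the square of that of \<open>V\<close>.\<close>

lemma t_le:
  assumes B: "B \<subseteq> carrier V" "finite B" "card (carrier V) = q ^ card B"
    "\<And>Y. R_submodule Y \<Longrightarrow> B \<subseteq> Y \<Longrightarrow> carrier V \<subseteq> Y"
  shows "t \<le> card B * card B"
proof -
  obtain T where T: "T \<subseteq> D" "finite T" "card T = t"
    "\<And>d e. d \<in> T \<Longrightarrow> e \<in> T \<Longrightarrow> d \<noteq> e \<Longrightarrow> inv d \<otimes> e \<notin> A"
    using transversal by metis
  have Tc: "d \<in> carrier S" "d \<in> C" if "d \<in> T" for d using that T(1) D_C by auto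
  define lin where "lin = (\<lambda>k. finsum E (\<lambda>d. k d \<otimes>\<^bsub>E\<^esub> rep d) T)"
  have tc: "(\<lambda>d. k d \<otimes>\<^bsub>E\<^esub> rep d) \<in> T \<rightarrow> carrier E" if "k \<in> T \<rightarrow> R" for k
    using Tc funcset_mem[OF that] by (intro funcsetI E.m_closed) simp_all
  have linc: "lin k \<in> carrier E" if "k \<in> T \<rightarrow> R" for k
    unfolding lin_def by (rule E.finsum_closed[OF tc[OF that]])
  have lincomm: "lin k \<otimes>\<^bsub>E\<^esub> x = x \<otimes>\<^bsub>E\<^esub> lin k" if k: "k \<in> T \<rightarrow> R" and x: "x \<in> R" for k x
  proof -
    have eq: "(k d \<otimes>\<^bsub>E\<^esub> rep d) \<otimes>\<^bsub>E\<^esub> x = x \<otimes>\<^bsub>E\<^esub> (k d \<otimes>\<^bsub>E\<^esub> rep d)" if d: "d \<in> T" for d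
    proof -
      have c: "k d \<in> R" "k d \<in> carrier E" "rep d \<in> carrier E" "x \<in> carrier E"
        using funcset_mem[OF k d] x Tc[OF d] by simp_all
      have "(k d \<otimes>\<^bsub>E\<^esub> rep d) \<otimes>\<^bsub>E\<^esub> x = (k d \<otimes>\<^bsub>E\<^esub> x) \<otimes>\<^bsub>E\<^esub> rep d"
        using c C_commutes_R[OF Tc(2)[OF d] x] by (simp add: E.m_assoc)
      also have "k d \<otimes>\<^bsub>E\<^esub> x = x \<otimes>\<^bsub>E\<^esub> k d" by (rule R_comm[OF c(1) x])
      finally show ?thesis using c by (simp add: E.m_assoc)
    qed
    have "lin k \<otimes>\<^bsub>E\<^esub> x = finsum E (\<lambda>d. (k d \<otimes>\<^bsub>E\<^esub> rep d) \<otimes>\<^bsub>E\<^esub> x) T"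
      unfolding lin_def using x by (intro E.finsum_ldistr[OF T(2) _ tc[OF k]]) auto
    also have "\<dots> = finsum E (\<lambda>d. x \<otimes>\<^bsub>E\<^esub> (k d \<otimes>\<^bsub>E\<^esub> rep d)) T"
      using eq tc[OF k] x by (intro E.finsum_cong') auto
    also have "\<dots> = x \<otimes>\<^bsub>E\<^esub> lin k"
      unfolding lin_def using x by (intro E.finsum_rdistr[OF T(2) _ tc[OF k], symmetric]) auto
    finally show ?thesis .
  qed
  define \<Phi> where "\<Phi> = (\<lambda>k. \<lambda>b\<in>B. lin k b)"
  \<comment> \<open>A linear combination of the operators is determined by its values on the basis.\<close>
  have "inj_on \<Phi> (T \<rightarrow>\<^sub>E R)"
  proof (rule inj_onI)
    fix k k' assume k: "k \<in> T \<rightarrow>\<^sub>E R" and k': "k' \<in> T \<rightarrow>\<^sub>E R" and eq: "\<Phi> k = \<Phi> k'"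
    have kf: "k \<in> T \<rightarrow> R" "k' \<in> T \<rightarrow> R" using k k' by auto
    define Y where "Y = {v \<in> carrier V. lin k v = lin k' v}"
    note lc = linc[OF kf(1)] linc[OF kf(2)]
    have "R_submodule Y"
      unfolding R_submodule_def
    proof (intro conjI ballI)
      show "subgroup Y V"
      proof (rule V.subgroupI)
        show "Y \<subseteq> carrier V" by (auto simp: Y_def)
        have "\<one>\<^bsub>V\<^esub> \<in> Y" using lc by (simp add: Y_def V.endo_one)
        then show "Y \<noteq> {}" by blast
      qed (use lc in \<open>auto simp: Y_def V.endo_inv V.endo_mult\<close>)
      fix x w assume x: "x \<in> R" and w: "w \<in> Y"
      have wc: "w \<in> carrier V" "lin k w = lin k' w" using w by (auto simp: Y_def)
      have *: "lin j (x w) = x (lin j w)" if "j \<in> T \<rightarrow> R" for j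
        using fun_cong[OF lincomm[OF that x], of w] wc by (simp add: endo_ring_simps(2))
      show "x w \<in> Y"
        unfolding Y_def using *[OF kf(1)] *[OF kf(2)] wc V.endo_closed[of x w] x by simp
    qed
    moreover have "B \<subseteq> Y"
    proof
      fix b assume b: "b \<in> B"
      have "\<Phi> k b = \<Phi> k' b" by (simp add: eq)
      then show "b \<in> Y" using b B(1) by (auto simp: \<Phi>_def Y_def)
    qed
    ultimately have "carrier V \<subseteq> Y" by (rule B(4))
    then have lineq: "lin k = lin k'"
      by (intro V.endo_ring_ext[OF lc]) (auto simp: Y_def)
    define d where "d = (\<lambda>i. k i \<oplus>\<^bsub>E\<^esub> \<ominus>\<^bsub>E\<^esub> \<one>\<^bsub>E\<^esub> \<otimes>\<^bsub>E\<^esub> k' i)"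
    have dR: "d \<in> T \<rightarrow> R" unfolding d_def using kf by (intro funcsetI R_closed) auto
    have "finsum E (\<lambda>i. d i \<otimes>\<^bsub>E\<^esub> rep i) T
        = finsum E (\<lambda>i. k i \<otimes>\<^bsub>E\<^esub> rep i \<oplus>\<^bsub>E\<^esub> \<ominus>\<^bsub>E\<^esub> \<one>\<^bsub>E\<^esub> \<otimes>\<^bsub>E\<^esub> (k' i \<otimes>\<^bsub>E\<^esub> rep i)) T"
    proof (rule E.finsum_cong'[OF refl])
      show "(\<lambda>i. k i \<otimes>\<^bsub>E\<^esub> rep i \<oplus>\<^bsub>E\<^esub> \<ominus>\<^bsub>E\<^esub> \<one>\<^bsub>E\<^esub> \<otimes>\<^bsub>E\<^esub> (k' i \<otimes>\<^bsub>E\<^esub> rep i)) \<in> T \<rightarrow> carrier E"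
        using tc[OF kf(1)] tc[OF kf(2)] by auto
      fix i assume i: "i \<in> T"
      have "k i \<in> carrier E" "k' i \<in> carrier E" using funcset_mem[OF kf(1) i] funcset_mem[OF kf(2) i] by simp_all
      then show "d i \<otimes>\<^bsub>E\<^esub> rep i = k i \<otimes>\<^bsub>E\<^esub> rep i \<oplus>\<^bsub>E\<^esub> \<ominus>\<^bsub>E\<^esub> \<one>\<^bsub>E\<^esub> \<otimes>\<^bsub>E\<^esub> (k' i \<otimes>\<^bsub>E\<^esub> rep i)"
        using Tc[OF i] by (simp add: d_def E.l_distr E.m_assoc)
    qed
    also have "\<dots> = lin k \<oplus>\<^bsub>E\<^esub> finsum E (\<lambda>i. \<ominus>\<^bsub>E\<^esub> \<one>\<^bsub>E\<^esub> \<otimes>\<^bsub>E\<^esub> (k' i \<otimes>\<^bsub>E\<^esub> rep i)) T"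
      unfolding lin_def using tc[OF kf(1)] tc[OF kf(2)] by (intro E.finsum_addf) auto
    also have "finsum E (\<lambda>i. \<ominus>\<^bsub>E\<^esub> \<one>\<^bsub>E\<^esub> \<otimes>\<^bsub>E\<^esub> (k' i \<otimes>\<^bsub>E\<^esub> rep i)) T = \<ominus>\<^bsub>E\<^esub> \<one>\<^bsub>E\<^esub> \<otimes>\<^bsub>E\<^esub> lin k'"
      unfolding lin_def by (intro E.finsum_rdistr[OF T(2) _ tc[OF kf(2)], symmetric]) auto
    also have "lin k \<oplus>\<^bsub>E\<^esub> \<ominus>\<^bsub>E\<^esub> \<one>\<^bsub>E\<^esub> \<otimes>\<^bsub>E\<^esub> lin k' = \<zero>\<^bsub>E\<^esub>"
      using lc by (simp add: lineq E.l_minus E.r_neg)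
    finally have s0: "finsum E (\<lambda>i. d i \<otimes>\<^bsub>E\<^esub> rep i) T = \<zero>\<^bsub>E\<^esub>" .
    show "k = k'"
    proof (rule PiE_ext[OF k k'])
      fix i assume i: "i \<in> T"
      have ki: "k i \<in> carrier E" "k' i \<in> carrier E"
        using funcset_mem[OF kf(1) i] funcset_mem[OF kf(2) i] by simp_all
      have "d i = \<zero>\<^bsub>E\<^esub>" by (rule rep_linear_independent[OF T(1,2,4) dR s0 i])
      then have "k i \<ominus>\<^bsub>E\<^esub> k' i = \<zero>\<^bsub>E\<^esub>" using ki by (simp add: d_def a_minus_def E.l_minus)
      then show "k i = k' i" using ki by simp
    qed
  qed
  moreover have "\<Phi> ` (T \<rightarrow>\<^sub>E R) \<subseteq> B \<rightarrow>\<^sub>E carrier V"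
  proof (rule image_subsetI)
    fix k assume "k \<in> T \<rightarrow>\<^sub>E R"
    then have "lin k \<in> carrier E" by (intro linc) auto
    then show "\<Phi> k \<in> B \<rightarrow>\<^sub>E carrier V" using B(1) V.endo_closed by (auto simp: \<Phi>_def)
  qed
  ultimately have "card (T \<rightarrow>\<^sub>E R) \<le> card (B \<rightarrow>\<^sub>E carrier V)"
    using B(2) finite_V by (intro card_inj_on_le finite_PiE) auto
  then have "q ^ t \<le> q ^ (card B * card B)"
    using T(2,3) B(2,3) by (simp add: card_PiE q_def power_mult)
  then show ?thesis using q_ge_2 by simp
qed

end

section \<open>The order of a soluble group over the field\<close>

context field_pair_action
begin

lemma card_roots_le: "n \<noteq> 0 \<Longrightarrow> card {x \<in> R. x [^]\<^bsub>E\<^esub> (n::nat) = \<one>\<^bsub>E\<^esub>} \<le> n"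
  using K.num_roots_le_deg[of n] finite_R by (simp flip: E.nat_pow_consistent)

text \<open>The automorphisms of \<open>D\<close> induced by \<open>C\<close> fix \<open>A\<close> and the \<open>t\<close>-th powers of elements of \<open>D\<close>.
  So the image of \<open>x \<in> D\<close> is determined by a coset of \<open>A\<close> and a \<open>t\<close>-th root of unity in the
  field \<open>R\<close>.\<close>

lemma card_images_under_C:
  assumes x: "x \<in> D"
  shows "card ((\<lambda>c. rep (c \<otimes> x \<otimes> inv c)) ` C) \<le> t * t" and "finite ((\<lambda>c. rep (c \<otimes> x \<otimes> inv c)) ` C)"
proof -
  show fin: "finite ((\<lambda>c. rep (c \<otimes> x \<otimes> inv c)) ` C)" using fins by simp
  obtain T where T: "T \<subseteq> D" "finite T" "card T = t" "\<And>d. d \<in> D \<Longrightarrow> \<exists>e\<in>T. A #> d = A #> e"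
    using transversal by metis
  define z where "z = rep (x [^] t)"
  define N where "N = (\<lambda>d. {rep y |y. y \<in> D \<and> A #> y = A #> d \<and> rep y [^]\<^bsub>E\<^esub> t = z})"
  have xt: "x [^] t \<in> A"
    unfolding t_def using normal_conj(1)[OF A_normal]
    by (intro pow_index_in_subgroup[OF fins(3) subgroups(3,1) A_D _ x]) auto
  have zE: "z \<in> carrier E" using x by (simp add: z_def)
  have sub: "(\<lambda>c. rep (c \<otimes> x \<otimes> inv c)) ` C \<subseteq> (\<Union>d\<in>T. N d)"
  proof (rule image_subsetI)
    fix c assume c: "c \<in> C"
    let ?y = "c \<otimes> x \<otimes> inv c"
    have cc: "c \<in> carrier S" "x \<in> carrier S" using c x by auto
    have yD: "?y \<in> D" using normal_conj(1)[OF D_normal cc(1) x] .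
    obtain d where d: "d \<in> T" "A #> ?y = A #> d" using T(4)[OF yD] by (elim bexE)
    have "commutator c (x [^] t) \<in> act_kernel" using c xt unfolding C_def centralizer_mod_def by blast
    then have com: "rep c \<otimes>\<^bsub>E\<^esub> z = z \<otimes>\<^bsub>E\<^esub> rep c" 
      using commutator_in_kernel_iff[of c "x [^] t"] cc unfolding z_def by blast
    have "rep ?y [^]\<^bsub>E\<^esub> t = rep (?y [^] t)" using cc rep_pow[of ?y t] by simp
    also have "\<dots> = rep (c \<otimes> x [^] t \<otimes> inv c)" using conj_pow[OF cc, of t] by simp
    also have "\<dots> = rep c \<otimes>\<^bsub>E\<^esub> z \<otimes>\<^bsub>E\<^esub> rep (inv c)" using cc by (simp add: rep_mult z_def)
    also have "\<dots> = z" unfolding com using cc zE by (simp add: E.m_assoc)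
    finally have "rep ?y \<in> N d" using yD d unfolding N_def by blast
    then show "rep ?y \<in> (\<Union>d\<in>T. N d)" using d by blast
  qed
  have Nle: "card (N d) \<le> t \<and> finite (N d)" for d
  proof (cases "N d = {}")
    case False
    then obtain y0 where y0: "y0 \<in> D" "A #> y0 = A #> d" "rep y0 [^]\<^bsub>E\<^esub> t = z" by (auto simp: N_def)
    have y0c: "y0 \<in> carrier S" "y0 \<in> C" using y0 D_C by auto
    let ?Z = "{k \<in> R. k [^]\<^bsub>E\<^esub> t = \<one>\<^bsub>E\<^esub>}"
    have "N d \<subseteq> (\<lambda>k. k \<otimes>\<^bsub>E\<^esub> rep y0) ` ?Z"
    proof
      fix r assume "r \<in> N d"
      then obtain y where y: "y \<in> D" "A #> y = A #> d" "rep y [^]\<^bsub>E\<^esub> t = z" "r = rep y" by (auto simp: N_def)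
      let ?a = "y \<otimes> inv y0"
      have yc: "y \<in> carrier S" using y by simp
      have a: "?a \<in> A" using coset_eq_iff[OF subgroups(1) yc y0c(1)] y(2) y0(2) by simp
      let ?k = "rep ?a"
      have kR: "?k \<in> R" "?k \<in> carrier E" using rep_A_R[OF a] by auto
      have yk: "rep y = ?k \<otimes>\<^bsub>E\<^esub> rep y0"
      proof -
        have "y = ?a \<otimes> y0" using yc y0c by (simp add: word_simps)
        then show ?thesis using rep_mult[of ?a y0] yc y0c by simp
      qed
      have "?k \<otimes>\<^bsub>E\<^esub> rep y0 = rep y0 \<otimes>\<^bsub>E\<^esub> ?k" using C_commutes_R[OF y0c(2) kR(1)] by simp
      then have "(?k \<otimes>\<^bsub>E\<^esub> rep y0) [^]\<^bsub>E\<^esub> t = ?k [^]\<^bsub>E\<^esub> t \<otimes>\<^bsub>E\<^esub> rep y0 [^]\<^bsub>E\<^esub> t"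
        using E.pow_mult_distrib kR y0c by simp
      then have kz: "?k [^]\<^bsub>E\<^esub> t \<otimes>\<^bsub>E\<^esub> z = z" using yk y(3) y0(3) by simp
      have "?k [^]\<^bsub>E\<^esub> t \<otimes>\<^bsub>E\<^esub> z \<otimes>\<^bsub>E\<^esub> rep (inv (x [^] t)) = z \<otimes>\<^bsub>E\<^esub> rep (inv (x [^] t))" by (simp add: kz)
      then have "?k [^]\<^bsub>E\<^esub> t = \<one>\<^bsub>E\<^esub>" using kR x by (simp add: E.m_assoc z_def)
      then show "r \<in> (\<lambda>k. k \<otimes>\<^bsub>E\<^esub> rep y0) ` ?Z" using kR y(4) yk by blast
    qed
    moreover have fZ: "finite ?Z" using finite_R by simp
    ultimately have "card (N d) \<le> card ?Z" "finite (N d)"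
      using surj_card_le finite_surj by blast+
    moreover have "card ?Z \<le> t" using t_pos by (intro card_roots_le) auto
    ultimately show ?thesis by linarith
  qed simp
  have "card ((\<lambda>c. rep (c \<otimes> x \<otimes> inv c)) ` C) \<le> card (\<Union>d\<in>T. N d)"
    using sub Nle T(2) by (intro card_mono) auto
  also have "\<dots> \<le> (\<Sum>d\<in>T. card (N d))" by (rule card_UN_le[OF T(2)])
  also have "\<dots> \<le> t * t" using sum_bounded_above[of T "\<lambda>d. card (N d)" t] Nle T(3) by simp
  finally show "card ((\<lambda>c. rep (c \<otimes> x \<otimes> inv c)) ` C) \<le> t * t" .
qed

text \<open>Since \<open>C / A\<close> acts faithfully on \<open>D\<close>, an element is determined modulo \<open>A\<close> by the images of at most \<open>log t\<close>
  generators of \<open>D\<close> modulo \<open>A\<close>.\<close>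

lemma card_C_le: "card C \<le> (t * t) ^ floor_log t * card A"
proof -
  obtain X where X: "X \<subseteq> D" "finite X" "card A * 2 ^ card X \<le> card D"
      "\<And>Y. subgroup Y S \<Longrightarrow> A \<subseteq> Y \<Longrightarrow> X \<subseteq> Y \<Longrightarrow> D \<subseteq> Y"
    using small_generating_set[OF finite_S subgroups(3,1) A_D] by metis
  have "2 ^ card X \<le> t" using X(3) card_D card_A_pos by (simp add: mult.commute)
  then have Xt: "card X \<le> floor_log t" by (rule le_floor_log)
  define F where "F = (\<lambda>c. \<lambda>x\<in>X. rep (c \<otimes> x \<otimes> inv c))"
  have sep: "inv g \<otimes> h \<in> A" if g: "g \<in> C" and h: "h \<in> C" and FF: "F g = F h" for g h
  proof -
    let ?w = "inv g \<otimes> h"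
    have c: "g \<in> carrier S" "h \<in> carrier S" using g h by auto
    have wC: "?w \<in> C" using g h subgroups(2) by (simp add: subgroup.m_closed subgroup.m_inv_closed)
    have wX: "commutator x ?w \<in> act_kernel" if x: "x \<in> X" for x
    proof -
      have xc: "x \<in> carrier S" using x X(1) by auto
      have "F g x = F h x" by (simp add: FF)
      then have e: "rep g \<otimes>\<^bsub>E\<^esub> rep x \<otimes>\<^bsub>E\<^esub> rep (inv g) = rep h \<otimes>\<^bsub>E\<^esub> rep x \<otimes>\<^bsub>E\<^esub> rep (inv h)"
        using x c xc by (simp add: F_def rep_mult)
      have "rep x \<otimes>\<^bsub>E\<^esub> rep ?w = rep (inv g) \<otimes>\<^bsub>E\<^esub> (rep g \<otimes>\<^bsub>E\<^esub> rep x \<otimes>\<^bsub>E\<^esub> rep (inv g)) \<otimes>\<^bsub>E\<^esub> rep h"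
        using c xc by (simp add: rep_mult E.m_assoc)
      also have "\<dots> = rep ?w \<otimes>\<^bsub>E\<^esub> rep x"
        unfolding e using c xc by (simp add: rep_mult E.m_assoc)
      finally show ?thesis using commutator_in_kernel_iff[of x ?w] c xc by blast
    qed
    have wc: "?w \<in> carrier S" using c by simp
    let ?K = "centralizer_mod act_kernel {?w}"
    have "subgroup ?K S" using wc by (intro centralizer_mod_subgroup[OF act_kernel_normal]) auto
    moreover have "A \<subseteq> ?K"
    proof (rule centralizer_mod_sym[OF subgroups(4)])
      show "{?w} \<subseteq> carrier S" using wc by blast
      show "A \<subseteq> carrier S" by (rule subgroup.subset[OF subgroups(1)])
      show "{?w} \<subseteq> centralizer_mod act_kernel A" using wC unfolding C_def by blast
    qed
    moreover have "X \<subseteq> ?K" using wX X(1) by (auto simp: centralizer_mod_def)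
    ultimately have "D \<subseteq> ?K" by (rule X(4))
    then have "{?w} \<subseteq> centralizer_mod act_kernel D"
      using centralizer_mod_sym[OF subgroups(4) subgroup.subset[OF subgroups(3)], of "{?w}"] wc by simp
    then show ?thesis using wC kernel_C by blast
  qed
  have "card C \<le> card (F ` C) * card A"
    by (rule card_le_card_image_mult[OF fins(2) subgroups(2,1) A_subset_C sep])
  also have "card (F ` C) \<le> card (\<Pi>\<^sub>E x\<in>X. (\<lambda>c. rep (c \<otimes> x \<otimes> inv c)) ` C)"
  proof (rule card_mono)
    show "finite (\<Pi>\<^sub>E x\<in>X. (\<lambda>c. rep (c \<otimes> x \<otimes> inv c)) ` C)" using X(2) fins by (intro finite_PiE) auto
    show "F ` C \<subseteq> (\<Pi>\<^sub>E x\<in>X. (\<lambda>c. rep (c \<otimes> x \<otimes> inv c)) ` C)" by (auto simp: F_def)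
  qed
  also have "\<dots> = (\<Prod>x\<in>X. card ((\<lambda>c. rep (c \<otimes> x \<otimes> inv c)) ` C))" by (rule card_PiE[OF X(2)])
  also have "\<dots> \<le> (t * t) ^ card X"
    using prod_mono[of X "\<lambda>x. card ((\<lambda>c. rep (c \<otimes> x \<otimes> inv c)) ` C)" "\<lambda>_. t * t"] card_images_under_C X(1)
    by auto
  also have "\<dots> \<le> (t * t) ^ floor_log t" using Xt t_pos by (intro power_increasing) auto
  finally show ?thesis by simp
qed

text \<open>The multiplicative group of the field \<open>R\<close> is cyclic, so the automorphisms induced by \<open>S\<close> are
  power maps on it.\<close>

lemma generator:
  obtains \<gamma> where "\<gamma> \<in> R" "\<gamma> \<noteq> \<zero>\<^bsub>E\<^esub>" "\<And>x. x \<in> R \<Longrightarrow> x \<noteq> \<zero>\<^bsub>E\<^esub> \<Longrightarrow> \<exists>i::nat. x = \<gamma> [^]\<^bsub>E\<^esub> i"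
proof -
  obtain a where a: "a \<in> carrier (mult_of K)" "carrier (mult_of K) = {a [^]\<^bsub>K\<^esub> i |i::nat. i \<in> UNIV}"
    using K.finite_field_mult_group_has_gen finite_R by auto
  show thesis
  proof (rule that[of a])
    show "a \<in> R" "a \<noteq> \<zero>\<^bsub>E\<^esub>" using a(1) by auto
    fix x assume "x \<in> R" "x \<noteq> \<zero>\<^bsub>E\<^esub>"
    then have "x \<in> carrier (mult_of K)" by simp
    then obtain i :: nat where "x = a [^]\<^bsub>K\<^esub> i" using a(2) by blast
    then show "\<exists>i::nat. x = a [^]\<^bsub>E\<^esub> i" by (auto simp flip: E.nat_pow_consistent)
  qed
qed

lemma mem_C_if_fixes_generator:
  assumes g: "\<gamma> \<in> R" "\<And>x. x \<in> R \<Longrightarrow> x \<noteq> \<zero>\<^bsub>E\<^esub> \<Longrightarrow> \<exists>i::nat. x = \<gamma> [^]\<^bsub>E\<^esub> i"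
    and s: "s \<in> carrier S" "cnj s \<gamma> = \<gamma>"
  shows "s \<in> C"
proof (rule mem_C_if_commutes_R[OF s(1)])
  fix x assume x: "x \<in> R"
  have "cnj s x = x"
  proof (cases "x = \<zero>\<^bsub>E\<^esub>")
    case False
    then obtain i :: nat where "x = \<gamma> [^]\<^bsub>E\<^esub> i" using g(2) x by blast
    then show ?thesis using cnj_pow[OF s(1), of \<gamma> i] g(1) s(2) by simp
  qed (use s in simp)
  then show "rep s \<otimes>\<^bsub>E\<^esub> x = x \<otimes>\<^bsub>E\<^esub> rep s" using cnj_eq_iff_commute[OF s(1)] x by simp
qed

text \<open>Power maps commute with one another and are determined by the image of a generator.\<close>

lemma S_mod_C: "carrier S \<subseteq> centralizer_mod C (carrier S)" and card_S_le: "card (carrier S) \<le> q * card C"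
proof -
  obtain \<gamma> where \<gamma>: "\<gamma> \<in> R" "\<gamma> \<noteq> \<zero>\<^bsub>E\<^esub>" "\<And>x. x \<in> R \<Longrightarrow> x \<noteq> \<zero>\<^bsub>E\<^esub> \<Longrightarrow> \<exists>i::nat. x = \<gamma> [^]\<^bsub>E\<^esub> i"
    using generator by metis
  have \<gamma>E: "\<gamma> \<in> carrier E" using \<gamma> by simp
  have pw: "\<exists>i::nat. cnj s \<gamma> = \<gamma> [^]\<^bsub>E\<^esub> i" if s: "s \<in> carrier S" for s
  proof (rule \<gamma>(3)[OF R_cnj[OF s \<gamma>(1)]])
    show "cnj s \<gamma> \<noteq> \<zero>\<^bsub>E\<^esub>"
    proof
      assume "cnj s \<gamma> = \<zero>\<^bsub>E\<^esub>"
      then have "cnj (inv s) (cnj s \<gamma>) = \<zero>\<^bsub>E\<^esub>" using s by simp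
      then show False using s \<gamma> by simp
    qed
  qed
  have comm: "cnj s (cnj u \<gamma>) = cnj u (cnj s \<gamma>)" if s: "s \<in> carrier S" and u: "u \<in> carrier S" for s u
  proof -
    obtain i j :: nat where ij: "cnj s \<gamma> = \<gamma> [^]\<^bsub>E\<^esub> i" "cnj u \<gamma> = \<gamma> [^]\<^bsub>E\<^esub> j" using pw s u by blast
    have "cnj s (cnj u \<gamma>) = \<gamma> [^]\<^bsub>E\<^esub> (i * j)" "cnj u (cnj s \<gamma>) = \<gamma> [^]\<^bsub>E\<^esub> (j * i)"
      using s u \<gamma>E by (simp_all add: ij cnj_pow E.nat_pow_pow)
    then show ?thesis by (simp add: mult.commute)
  qed
  have "commutator s u \<in> C" if s: "s \<in> carrier S" and u: "u \<in> carrier S" for s u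
  proof (rule mem_C_if_fixes_generator[OF \<gamma>(1,3)])
    have "cnj (commutator s u) \<gamma> = cnj s (cnj u (cnj (inv s) (cnj (inv u) \<gamma>)))"
      using s u \<gamma>E by (simp add: commutator_def cnj_cnj word_simps)
    also have "\<dots> = \<gamma>" using comm[of "inv s" "inv u"] s u \<gamma>E by simp
    finally show "cnj (commutator s u) \<gamma> = \<gamma>" .
  qed (use s u in auto)
  then show "carrier S \<subseteq> centralizer_mod C (carrier S)" by (auto simp: centralizer_mod_def)
  have "inv g \<otimes> h \<in> C" if g: "g \<in> carrier S" and h: "h \<in> carrier S" and e: "cnj g \<gamma> = cnj h \<gamma>" for g h
  proof (rule mem_C_if_fixes_generator[OF \<gamma>(1,3)])
    have "cnj (inv g \<otimes> h) \<gamma> = cnj (inv g) (cnj h \<gamma>)" using g h \<gamma>E by (simp add: cnj_cnj)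
    also have "\<dots> = \<gamma>" using g \<gamma>E by (simp flip: e)
    finally show "cnj (inv g \<otimes> h) \<gamma> = \<gamma>" .
  qed (use g h in auto)
  then have "card (carrier S) \<le> card ((\<lambda>g. cnj g \<gamma>) ` carrier S) * card C"
    using normal_subset[OF C_normal]
    by (intro card_le_card_image_mult[OF finite_S subgroup_self subgroups(2)]) auto
  also have "card ((\<lambda>g. cnj g \<gamma>) ` carrier S) \<le> q"
    unfolding q_def using R_cnj[OF _ \<gamma>(1)] finite_R by (intro card_mono) auto
  finally show "card (carrier S) \<le> q * card C" by simp
qed

lemma card_A_le: "card A \<le> q * card act_kernel"
proof -
  have "card A \<le> card (rep ` A) * card act_kernel"
    by (rule card_le_card_image_mult[OF fins(1) subgroups(1,4) kernel_A]) (simp add: rep_eq_iff)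
  also have "card (rep ` A) \<le> q"
    unfolding q_def using rep_A_R finite_R by (intro card_mono) auto
  finally show ?thesis by simp
qed

text \<open>The orders of \<open>S / C\<close>, \<open>C / A\<close> and \<open>A\<close> modulo the kernel bound the order, and hence the exponent, of the
  image of \<open>S\<close>.  The bound on \<open>w\<close> must avoid \<open>q\<close>, so only \<open>C / A\<close> may enter it.  A power \<open>j\<close> bounded in
  terms of \<open>b = \<bar>C / A\<bar>\<close> takes \<open>S\<close> into the centralizer \<open>W\<close> of \<open>C / A\<close>.  Since \<open>S / C\<close> is abelian, a commutator
  \<open>[x, y]\<close> of elements of \<open>W\<close> lies in \<open>C\<close>, whence \<open>[x\<^sup>b, y] = [x, y]\<^sup>b = 1\<close> modulo \<open>A\<close>.  So \<open>S\<^bsup>j b\<^esup>\<close> is abelian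
  modulo \<open>A\<close>, and \<open>A\<close> is abelian modulo the kernel.\<close>

lemma linear_bound_field:
  assumes p: "prime p" and exp: "\<And>v. v \<in> carrier V \<Longrightarrow> v [^]\<^bsub>V\<^esub> p = \<one>\<^bsub>V\<^esub>"
  shows "linear_bound p S V act"
proof -
  obtain B where B: "B \<subseteq> carrier V" "finite B" "card (carrier V) = q ^ card B"
      "\<And>Y. R_submodule Y \<Longrightarrow> B \<subseteq> Y \<Longrightarrow> carrier V \<subseteq> Y"
    using basis_exists by metis
  define m where "m = card B"
  have m1: "m \<ge> 1"
  proof (rule ccontr)
    assume "\<not> m \<ge> 1"
    then have "card (carrier V) = 1" using B(3) by (simp add: m_def)
    then obtain v where "carrier V = {v}" by (auto simp: card_1_singleton_iff)
    then show False using nontrivial V.one_closed by auto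
  qed
  define b where "b = card C div card A"
  have tm: "t \<le> m * m" unfolding m_def by (rule t_le[OF B])
  have cC: "card C = b * card A" unfolding b_def by (rule card_subgroup_dvd[OF subgroups(2,1) A_subset_C])
  have "card C > 0" using fins subgroup.one_closed[OF subgroups(2)] card_gt_0_iff by blast
  then have b1: "b \<ge> 1" using cC by (cases b) auto
  have "b * card A \<le> (t * t) ^ floor_log t * card A" using card_C_le cC by simp
  then have "b \<le> (t * t) ^ floor_log t" using card_A_pos by simp
  also have "\<dots> \<le> (m ^ 4) ^ floor_log t"
  proof (rule power_mono)
    have "t * t \<le> (m * m) * (m * m)" using tm by (intro mult_mono) auto
    then show "t * t \<le> m ^ 4" by (simp add: power4_eq_xxxx mult.assoc)
  qed simp
  \<comment> \<open>The constant 8 in the bounds is 4 * 2: one factor from \<open>t * t \<le> m ^ 4\<close>, the other from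
    \<open>log (m * m) \<le> 2 * (1 + log m)\<close>.\<close>
  also have "\<dots> \<le> (m ^ 4) ^ (2 * (1 + floor_log m))"
  proof (rule power_increasing)
    have "m \<le> 2 * 2 ^ floor_log m" by (rule floor_log_exp2_ge)
    then have "m * m \<le> (2 * 2 ^ floor_log m) * (2 * 2 ^ floor_log m)" by (intro mult_mono) auto
    also have "\<dots> = 2 ^ (2 * (1 + floor_log m))" by (simp only: power_even_eq power2_eq_square) simp
    finally have "floor_log (m * m) \<le> floor_log (2 ^ (2 * (1 + floor_log m)))" by (rule floor_log_le_iff)
    then have "floor_log (m * m) \<le> 2 * (1 + floor_log m)" unfolding floor_log_power .
    then show "floor_log t \<le> 2 * (1 + floor_log m)" using floor_log_le_iff[OF tm] by linarith
  qed (use m1 in simp)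
  also have "\<dots> = quasipoly m ^ 8"
  proof -
    have "4 * (2 * (1 + floor_log m)) = (1 + floor_log m) * 8" by simp
    then show ?thesis by (simp only: quasipoly_def flip: power_mult)
  qed
  finally have bm: "b \<le> quasipoly m ^ 8" .
  define n where "n = card (carrier S) div card act_kernel"
  have cS: "card (carrier S) = n * card act_kernel"
    unfolding n_def by (rule card_subgroup_dvd[OF subgroup_self subgroups(4) subgroup.subset[OF subgroups(4)]])
  have "card (carrier S) > 0" using finite_S card_gt_0_iff by blast
  then have n1: "n \<ge> 1" using cS by (cases n) auto
  have kpos: "card act_kernel > 0" using fins subgroup.one_closed[OF subgroups(4)] card_gt_0_iff by blast
  have "n * card act_kernel \<le> q * (b * card A)" using card_S_le cS cC by simp
  also have "\<dots> \<le> q * (b * (q * card act_kernel))" using card_A_le by simp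
  also have "\<dots> = (q ^ 2 * b) * card act_kernel" by (simp add: power2_eq_square)
  finally have "n \<le> q ^ 2 * b" using kpos by simp
  then have nle: "n \<le> q ^ 2 * quasipoly m ^ 8" using bm by (meson le_trans mult_le_mono2)
  have nk: "g [^] n \<in> act_kernel" if "g \<in> carrier S" for g
    unfolding n_def using normal_conj(1)[OF act_kernel_normal] that subgroup.subset[OF subgroups(4)]
    by (intro pow_index_in_subgroup[OF finite_S subgroup_self subgroups(4)]) auto
  define W where "W = centralizer_mod A C"
  have W_normal: "W \<lhd> S"
    unfolding W_def using normal_conj(1)[OF C_normal] by (intro centralizer_mod_normal[OF A_normal]) auto
  have sW: "subgroup W S" by (rule normal_imp_subgroup[OF W_normal])
  have Wc: "W \<subseteq> carrier S" by (rule normal_subset[OF W_normal])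
  define j where "j = card (carrier S) div card W"
  have cj: "card (carrier S) = j * card W"
    unfolding j_def by (rule card_subgroup_dvd[OF subgroup_self sW Wc])
  have Wpos: "card W > 0"
    using finite_S Wc finite_subset subgroup.one_closed[OF sW] card_gt_0_iff by blast
  have j1: "j \<ge> 1" using cj \<open>card (carrier S) > 0\<close> by (cases j) auto
  have "card (carrier S) \<le> b ^ floor_log b * card (carrier S \<inter> W)"
    unfolding b_def W_def
    using normal_conj(1)[OF A_normal] normal_conj(1)[OF C_normal] normal_subset[OF C_normal]
    by (intro index_centralizer_mod_le[OF finite_S subgroup_self subgroups(1,2) A_subset_C]) auto
  then have "j * card W \<le> b ^ floor_log b * card W" using cj Wc by (simp add: Int_absorb1)
  then have "j \<le> b ^ floor_log b" using Wpos by simp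
  then have jb: "j * b \<le> quasipoly b" by (simp add: quasipoly_def)
  have jW: "g [^] j \<in> W" if "g \<in> carrier S" for g
    unfolding j_def using normal_conj(1)[OF W_normal] that Wc
    by (intro pow_index_in_subgroup[OF finite_S subgroup_self sW]) auto
  have WbW: "x [^] b \<in> centralizer_mod A W" if x: "x \<in> W" for x
    unfolding centralizer_mod_def
  proof (intro CollectI conjI ballI)
    have xc: "x \<in> carrier S" using x Wc by blast
    show "x [^] b \<in> carrier S" using xc by simp
    fix y assume y: "y \<in> W"
    have yc: "y \<in> carrier S" using y Wc by blast
    have cC': "commutator x y \<in> C" using S_mod_C xc yc by (auto simp: centralizer_mod_def)
    then have "x \<in> centralizer_mod A {commutator x y}" using x by (simp add: W_def centralizer_mod_def)
    from commutator_pow_mod[OF A_normal xc yc this, of b]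
    obtain a where a: "a \<in> A" "commutator (x [^] b) y = a \<otimes> commutator x y [^] b" by blast
    have "commutator x y [^] b \<in> A"
      unfolding b_def using normal_conj(1)[OF A_normal]
      by (intro pow_index_in_subgroup[OF fins(2) subgroups(2,1) A_subset_C _ cC']) auto
    then show "commutator (x [^] b) y \<in> A" using a subgroup.m_closed[OF subgroups(1)] by simp
  qed
  define P where "P = power_subgroup S (j * b)"
  have cAW: "subgroup (centralizer_mod A W) S" by (rule centralizer_mod_subgroup[OF A_normal Wc])
  have PW: "P \<subseteq> W" "P \<subseteq> centralizer_mod A W"
  proof -
    have eq: "g [^] (j * b) = (g [^] j) [^] b" if "g \<in> carrier S" for g
      using nat_pow_pow[OF that] by simp
    show "P \<subseteq> W"
      unfolding P_def using subgroup_pow_closed[OF sW jW] by (intro power_subgroup_subset[OF sW]) (simp add: eq)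
    show "P \<subseteq> centralizer_mod A W"
      unfolding P_def using WbW[OF jW] by (intro power_subgroup_subset[OF cAW]) (simp add: eq)
  qed
  then have "P \<subseteq> centralizer_mod A P" using centralizer_mod_antimono by blast
  then have "derived S P \<subseteq> A" using derived_subset_iff[OF subgroups(1)] PW(1) Wc by blast
  then have "derived S (derived S P) \<subseteq> derived S A" by (rule mono_derived)
  also have "\<dots> \<subseteq> act_kernel"
    using derived_subset_iff[OF subgroups(4)] A_abelian subgroup.subset[OF subgroups(1)] by blast
  finally have dd: "derived S (derived S P) \<subseteq> act_kernel" .
  show ?thesis
    unfolding linear_bound_def
  proof (intro exI conjI ballI)
    show "p \<le> q" by (rule char_le_q[OF p exp])
    show "1 \<le> m" "card (carrier V) = q ^ m" using m1 B(3) by (auto simp: m_def)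
    show "1 \<le> n" "n \<le> q\<^sup>2 * quasipoly m ^ 8" by (rule n1, rule nle)
    show "1 \<le> j * b" using j1 b1 by simp
    show "j * b \<le> quasipoly (quasipoly m ^ 8)" using jb quasipoly_mono[OF bm] by linarith
  next
    fix g v assume "g \<in> carrier S" "v \<in> carrier V"
    then show "act (g [^] n) v = v" using nk by (auto simp: act_kernel_def)
  next
    fix g v assume "g \<in> derived S (derived S (power_subgroup S (j * b)))" "v \<in> carrier V"
    then show "act g v = v" using dd by (auto simp: act_kernel_def P_def)
  qed
qed

end

section \<open>Irreducible actions of soluble groups\<close>

text \<open>If the image of a minimal idempotent is smaller than \<open>V\<close>, it is a block and the induction hypothesis
  applies to it.  Otherwise the only idempotents of \<open>R\<close> are \<open>0\<close> and \<open>1\<close>.\<close>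

theorem solvable_linear_bound:
  assumes "irreducible_action S V act" and p: "prime p"
    and exp: "\<And>v. v \<in> carrier V \<Longrightarrow> v [^]\<^bsub>V\<^esub> p = \<one>\<^bsub>V\<^esub>"
  shows "linear_bound p S V act"
  using assms(1) exp
proof (induction "card (carrier V)" arbitrary: S V rule: less_induct)
  case less
  interpret irreducible_action S V act by (rule less.prems)
  define good where "good = (\<lambda>A. A \<lhd> S \<and> act_kernel \<subseteq> A \<and> A \<subseteq> centralizer_mod act_kernel A)"
  have finite_good: "finite {A. good A}"
  proof (rule finite_subset)
    show "{A. good A} \<subseteq> Pow (carrier S)" using normal_subset unfolding good_def by blast
  qed (use finite_S in simp)
  have "good act_kernel"
    using act_kernel_normal commutator_in_normal[OF act_kernel_normal] normal_subset[OF act_kernel_normal]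
    by (auto simp: good_def centralizer_mod_def subset_iff)
  then obtain A where "A \<in> {A. good A}" "\<forall>B\<in>{A. good A}. A \<le> B \<longrightarrow> A = B"
    using finite_has_maximal[OF finite_good] by blast
  then have A: "good A" "\<And>B. good B \<Longrightarrow> A \<subseteq> B \<Longrightarrow> B = A" by auto
  interpret maximal_abelian_action S V act A
  proof (intro maximal_abelian_action.intro maximal_abelian_action_axioms.intro irreducible_action_axioms)
    show "A \<lhd> S" "act_kernel \<subseteq> A" "A \<subseteq> centralizer_mod act_kernel A"
      using A(1) unfolding good_def by blast+
    fix B assume B: "B \<lhd> S" "A \<subseteq> B" "B \<subseteq> centralizer_mod act_kernel B"
    then have "good B" using A(1) unfolding good_def by blast
    then show "B = A" using A(2) B(2) by blast
  qed
  obtain f where f: "f \<in> R" "f \<otimes>\<^bsub>E\<^esub> f = f" "f \<noteq> \<zero>\<^bsub>E\<^esub>"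
      "\<And>e. e \<in> R \<Longrightarrow> e \<otimes>\<^bsub>E\<^esub> e = e \<Longrightarrow> e \<noteq> \<zero>\<^bsub>E\<^esub> \<Longrightarrow> card (f ` carrier V) \<le> card (e ` carrier V)"
    using ex_has_least_nat[of "\<lambda>f. f \<in> R \<and> f \<otimes>\<^bsub>E\<^esub> f = f \<and> f \<noteq> \<zero>\<^bsub>E\<^esub>" "\<one>\<^bsub>E\<^esub>" "\<lambda>f. card (f ` carrier V)"]
      R_closed(4) one_neq_zero_E by auto
  interpret minimal_idempotent_action S V act A f
  proof
    fix e assume "e \<in> R" "e \<otimes>\<^bsub>E\<^esub> e = e" "e \<noteq> \<zero>\<^bsub>E\<^esub>"
    then show "card (f ` carrier V) \<le> card (e ` carrier V)" by (rule f(4))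
  qed (rule f)+
  have eq_one: "e = \<one>\<^bsub>E\<^esub>" if e: "e \<in> carrier E" "e \<otimes>\<^bsub>E\<^esub> e = e" "card (carrier V) \<le> card (e ` carrier V)" for e
  proof (rule V.endo_ring_ext[OF e(1)])
    have "e ` carrier V \<subseteq> carrier V" using V.endo_closed[OF e(1)] by auto
    then have im: "e ` carrier V = carrier V" using e(3) finite_V by (intro card_seteq) auto
    fix v assume v: "v \<in> carrier V"
    then obtain w where w: "w \<in> carrier V" "v = e w" using im by blast
    have "e v = (e \<otimes>\<^bsub>E\<^esub> e) w" using w by (simp add: endo_ring_simps)
    then have "e v = v" unfolding e(2) using w by simp
    then show "e v = \<one>\<^bsub>E\<^esub> v" using v by (simp add: endo_ring_simps)
  qed simp
  show ?case
  proof (cases "card block < card (carrier V)")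
    case True
    have "v [^]\<^bsub>V\<lparr>carrier := block\<rparr>\<^esub> p = \<one>\<^bsub>V\<lparr>carrier := block\<rparr>\<^esub>" if "v \<in> carrier (V\<lparr>carrier := block\<rparr>)" for v
      using less.prems(2)[of v] that block_subset by (auto simp flip: V.nat_pow_consistent)
    then have "linear_bound p (S\<lparr>carrier := stab\<rparr>) (V\<lparr>carrier := block\<rparr>) act"
      using True by (intro less.hyps stab_action) auto
    then show ?thesis by (rule linear_bound_induced)
  next
    case False
    then have big: "card (carrier V) \<le> card (f ` carrier V)" by (simp add: block_def)
    interpret field_action S V act A
    proof
      fix e assume e: "e \<in> R" "e \<otimes>\<^bsub>E\<^esub> e = e"
      show "e = \<zero>\<^bsub>E\<^esub> \<or> e = \<one>\<^bsub>E\<^esub>"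
        using eq_one[of e] f(4)[OF e] big e by (cases "e = \<zero>\<^bsub>E\<^esub>") auto
    qed
    define good' where "good' = (\<lambda>B. B \<lhd> S \<and> A \<subseteq> B \<and> B \<subseteq> C \<and> B \<subseteq> centralizer_mod A B)"
    have finite_good': "finite {B. good' B}"
    proof (rule finite_subset)
      show "{B. good' B} \<subseteq> Pow (carrier S)" using normal_subset unfolding good'_def by blast
    qed (use finite_S in simp)
    have "good' A"
      using A_normal A_subset_C commutator_in_normal[OF A_normal] normal_subset[OF A_normal]
      by (auto simp: good'_def centralizer_mod_def subset_iff)
    then obtain D where "D \<in> {B. good' B}" "\<forall>B\<in>{B. good' B}. D \<le> B \<longrightarrow> D = B"
      using finite_has_maximal[OF finite_good'] by blast
    then have D: "good' D" "\<And>B. good' B \<Longrightarrow> D \<subseteq> B \<Longrightarrow> B = D" by auto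
    interpret field_pair_action S V act A D
    proof (intro field_pair_action.intro field_pair_action_axioms.intro field_action_axioms)
      show "D \<lhd> S" "A \<subseteq> D" "D \<subseteq> C" "D \<subseteq> centralizer_mod A D"
        using D(1) unfolding good'_def by blast+
      fix B assume B: "B \<lhd> S" "D \<subseteq> B" "B \<subseteq> C" "B \<subseteq> centralizer_mod A B"
      then have "good' B" using D(1) unfolding good'_def by blast
      then show "B = D" using D(2) B(2) by blast
    qed
    show ?thesis by (rule linear_bound_field[OF p less.prems(2)])
  qed
qed

section \<open>Chief factors and fixed points\<close>

context group
begin

lemma coprime_pow_mem:
  assumes H: "subgroup H G" and x: "x \<in> carrier G" and m: "x [^] (m::nat) \<in> H" and n: "x [^] (n::nat) \<in> H"
    and cop: "coprime m n"
  shows "x \<in> H"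
proof (cases "m = 0")
  case True
  then have "n = 1" using cop by simp
  then show ?thesis using n x by simp
next
  case False
  then obtain a b where ab: "m * a = n * b + gcd m n" using bezout_nat by blast
  then have "x [^] (m * a) = x [^] (n * b) \<otimes> x" using cop x by simp
  then have "x = inv ((x [^] n) [^] b) \<otimes> (x [^] m) [^] a" using x by (simp add: nat_pow_pow inv_mult_cancel)
  moreover have "inv ((x [^] n) [^] b) \<otimes> (x [^] m) [^] a \<in> H"
    using subgroup_pow_closed[OF H m] subgroup_pow_closed[OF H n] H
    by (simp add: subgroup.m_closed subgroup.m_inv_closed)
  ultimately show ?thesis by simp
qed

lemma cauchy_element:
  assumes fin: "finite (carrier G)" and p: "prime p" and dvd: "p dvd order G"
  shows "\<exists>x\<in>carrier G. x \<noteq> \<one> \<and> x [^] p = \<one>"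
proof -
  obtain m where m: "order G = p ^ 1 * m" using dvd by auto
  obtain H where H: "subgroup H G" "card H = p ^ 1" using sylow_thm[OF p is_group m fin] by blast
  have "card H > 1" using H(2) prime_gt_1_nat[OF p] by simp
  have fH: "finite H" using H fin finite_subset subgroup.subset by metis
  obtain x where x: "x \<in> H" "x \<noteq> \<one>"
  proof -
    have "\<not> H \<subseteq> {\<one>}" using \<open>card H > 1\<close> card_mono[of "{\<one>}" H] by auto
    then show thesis using that by blast
  qed
  interpret GH: group "G\<lparr>carrier := H\<rparr>" by (rule subgroup_imp_group[OF H(1)])
  have "x [^]\<^bsub>G\<lparr>carrier := H\<rparr>\<^esub> p = \<one>" using GH.pow_order_eq_1[of x] x H(2) by (simp add: order_def)
  then have "x [^] p = \<one>" by (simp flip: nat_pow_consistent)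
  then show ?thesis using x subgroup.subset[OF H(1)] by blast
qed

lemma coset_pow_mult:
  assumes N: "N \<lhd> G" and x: "x \<in> carrier G" and y: "y \<in> carrier G" and c: "commutator x y \<in> N"
  shows "N #> (x \<otimes> y) [^] (n::nat) = N #> (x [^] n \<otimes> y [^] n)"
proof -
  interpret N: normal N G by (rule N)
  interpret Q: group "G Mod N" by (rule N.factorgroup_is_group)
  have "(x \<otimes> y) \<otimes> inv (y \<otimes> x) \<in> N" using c x y by (simp add: commutator_def word_simps)
  then have "N #> (x \<otimes> y) = N #> (y \<otimes> x)" using coset_eq_iff[OF N.subgroup_axioms] x y by simp
  then have com: "(N #> x) <#> (N #> y) = (N #> y) <#> (N #> x)" using x y by (simp add: N.rcos_sum)
  have cc: "N #> x \<in> carrier (G Mod N)" "N #> y \<in> carrier (G Mod N)" using x y by (auto simp: carrier_FactGroup)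
  have "N #> (x \<otimes> y) [^] n = (N #> (x \<otimes> y)) [^]\<^bsub>G Mod N\<^esub> n" using N.FactGroup_pow[of "x \<otimes> y" n] x y by simp
  also have "N #> (x \<otimes> y) = (N #> x) \<otimes>\<^bsub>G Mod N\<^esub> (N #> y)" using x y by (simp add: N.rcos_sum)
  also have "((N #> x) \<otimes>\<^bsub>G Mod N\<^esub> (N #> y)) [^]\<^bsub>G Mod N\<^esub> n
      = (N #> x) [^]\<^bsub>G Mod N\<^esub> n \<otimes>\<^bsub>G Mod N\<^esub> (N #> y) [^]\<^bsub>G Mod N\<^esub> n"
    using com cc by (intro Q.pow_mult_distrib) auto
  also have "\<dots> = N #> (x [^] n \<otimes> y [^] n)"
    using x y N.FactGroup_pow[of x n] N.FactGroup_pow[of y n] by (simp add: N.rcos_sum)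
  finally show ?thesis .
qed

lemma mem_coset_eq:
  assumes "subgroup N G" "x \<in> carrier G" "y \<in> carrier G" "N #> x = N #> y" "y \<in> N"
  shows "x \<in> N"
proof -
  have "x \<otimes> inv y \<in> N" using coset_eq_iff assms by blast
  then have "x \<otimes> inv y \<otimes> y \<in> N" using assms subgroup.m_closed by metis
  then show ?thesis using assms by (simp add: word_simps)
qed

text \<open>Modulo \<open>N\<close> the group \<open>M\<close> is abelian, so that taking powers is a homomorphism.\<close>

lemma roots_mod_normal:
  assumes N: "N \<lhd> G" and M: "M \<lhd> G" and ab: "M \<subseteq> centralizer_mod N M" and NM: "N \<subseteq> M"
  shows "{x \<in> M. x [^] (n::nat) \<in> N} \<lhd> G"
  unfolding normal_inv_iff
proof (intro conjI ballI)
  interpret N: normal N G by (rule N)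
  interpret M: normal M G by (rule M)
  show "subgroup {x \<in> M. x [^] n \<in> N} G"
  proof (rule subgroupI)
    show "{x \<in> M. x [^] n \<in> N} \<subseteq> carrier G" using M.subset by blast
    have "\<one> \<in> {x \<in> M. x [^] n \<in> N}" by simp
    then show "{x \<in> M. x [^] n \<in> N} \<noteq> {}" by blast
  next
    fix a assume "a \<in> {x \<in> M. x [^] n \<in> N}"
    then show "inv a \<in> {x \<in> M. x [^] n \<in> N}" using M.subset by (auto simp: nat_pow_inv subset_iff)
  next
    fix a b assume a: "a \<in> {x \<in> M. x [^] n \<in> N}" and b: "b \<in> {x \<in> M. x [^] n \<in> N}"
    have c: "a \<in> carrier G" "b \<in> carrier G" using a b M.subset by auto
    have "commutator a b \<in> N" using a b ab by (auto simp: centralizer_mod_def)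
    then have "N #> (a \<otimes> b) [^] n = N #> (a [^] n \<otimes> b [^] n)" by (rule coset_pow_mult[OF N c])
    moreover have "a [^] n \<otimes> b [^] n \<in> N" using a b by simp
    ultimately have "(a \<otimes> b) [^] n \<in> N"
      using mem_coset_eq[OF N.subgroup_axioms, of "(a \<otimes> b) [^] n" "a [^] n \<otimes> b [^] n"] c by blast
    then show "a \<otimes> b \<in> {x \<in> M. x [^] n \<in> N}" using a b by simp
  qed
  fix g h assume g: "g \<in> carrier G" and h: "h \<in> {x \<in> M. x [^] n \<in> N}"
  then have "(g \<otimes> h \<otimes> inv g) [^] n \<in> N"
    using conj_pow[OF g, of h n] normal_conj(1)[OF N g, of "h [^] n"] M.subset by auto
  then show "g \<otimes> h \<otimes> inv g \<in> {x \<in> M. x [^] n \<in> N}" using normal_conj(1)[OF M g] h by simp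
qed

definition chief :: "'a set \<Rightarrow> 'a set \<Rightarrow> bool" where
  "chief L M \<longleftrightarrow> L \<lhd> G \<and> M \<lhd> G \<and> L \<subset> M \<and> (\<forall>X. X \<lhd> G \<longrightarrow> L \<subseteq> X \<longrightarrow> X \<subseteq> M \<longrightarrow> X = L \<or> X = M)"

lemma chief_above:
  assumes fin: "finite (carrier G)" and L: "L \<lhd> G" and N: "N \<lhd> G" and LN: "L \<subset> N"
  obtains M where "chief L M" "M \<subseteq> N"
proof -
  obtain M where M: "M \<lhd> G" "L \<subset> M" "M \<subseteq> N"
      "\<And>X. X \<lhd> G \<Longrightarrow> L \<subset> X \<Longrightarrow> X \<subseteq> N \<Longrightarrow> card M \<le> card X"
  proof -
    have "N \<lhd> G \<and> L \<subset> N \<and> N \<subseteq> N" using N LN by blast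
    from ex_has_least_nat[of "\<lambda>M. M \<lhd> G \<and> L \<subset> M \<and> M \<subseteq> N", OF this, of card]
    show thesis using that by blast
  qed
  have "X = L \<or> X = M" if X: "X \<lhd> G" "L \<subseteq> X" "X \<subseteq> M" for X
  proof (cases "X = L")
    case False
    then have "card M \<le> card X" using M(3,4) X by blast
    moreover have "finite M" using fin normal_subset[OF M(1)] finite_subset by blast
    ultimately show ?thesis using X(3) card_seteq by blast
  qed simp
  then show thesis using that M L by (auto simp: chief_def)
qed

text \<open>Orbits of \<open>F\<close> with more than one element have length divisible by \<open>p\<close>, so the number of fixed points is
  divisible by \<open>p\<close>, and \<open>\<one>\<close> is not the only one.\<close>

lemma p_group_fixed_point:
  assumes fin: "finite (carrier G)" and p: "prime p" and F: "subgroup F G" "card F = p ^ a"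
    and V: "V \<lhd> G" "p dvd card V"
  shows "\<exists>v\<in>V. v \<noteq> \<one> \<and> (\<forall>g\<in>F. commutator g v = \<one>)"
proof -
  interpret F: subgroup F G by (rule F)
  interpret V: normal V G by (rule V)
  have fF: "finite F" and fV: "finite V" using fin F.subset V.subset finite_subset by blast+
  define orb where "orb = (\<lambda>v. (\<lambda>g. g \<otimes> v \<otimes> inv g) ` F)"
  define fx where "fx = {v \<in> V. \<forall>g\<in>F. g \<otimes> v \<otimes> inv g = v}"
  have Vc: "v \<in> carrier G" if "v \<in> V" for v using that V.subset by blast
  have Fc: "v \<in> carrier G" if "v \<in> F" for v using that F.subset by blast
  have orbV: "orb v \<subseteq> V" if "v \<in> V" for v using that V.inv_op_closed2 Fc by (auto simp: orb_def)
  have self: "v \<in> orb v" if "v \<in> V" for v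
    unfolding orb_def using Vc[OF that] F.one_closed by (intro image_eqI[of _ _ \<one>]) auto
  have orb_sub: "orb w \<subseteq> orb v" if v: "v \<in> V" and w: "w \<in> orb v" for v w
  proof
    fix x assume "x \<in> orb w"
    then obtain g h where gh: "g \<in> F" "h \<in> F" "x = h \<otimes> w \<otimes> inv h" "w = g \<otimes> v \<otimes> inv g"
      using w by (auto simp: orb_def)
    then have "x = (h \<otimes> g) \<otimes> v \<otimes> inv (h \<otimes> g)" using Fc Vc[OF v] by (simp add: word_simps)
    then show "x \<in> orb v" unfolding orb_def using gh by blast
  qed
  have orb_sym: "v \<in> orb w" if v: "v \<in> V" and w: "w \<in> orb v" for v w
  proof -
    obtain g where g: "g \<in> F" "w = g \<otimes> v \<otimes> inv g" using w by (auto simp: orb_def)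
    then have "v = inv g \<otimes> w \<otimes> inv (inv g)" using Fc Vc[OF v] by (simp add: word_simps)
    then show ?thesis unfolding orb_def using g by blast
  qed
  have orb_eq: "orb w = orb v" if "v \<in> V" "w \<in> orb v" for v w
    using orb_sub[OF that] orb_sub[of w v] orb_sym[OF that] orbV[OF that(1)] that(2) by blast
  have dvd: "p dvd card (orb v)" if v: "v \<in> V - fx" for v
  proof -
    define St where "St = {g \<in> F. g \<otimes> v \<otimes> inv g = v}"
    have vc: "v \<in> carrier G" using v Vc by blast
    have eq: "g \<otimes> v \<otimes> inv g = v \<longleftrightarrow> g \<otimes> v = v \<otimes> g" if "g \<in> carrier G" for g
      using inv_solve_right[of v "g \<otimes> v" g] that vc by auto
    have St: "subgroup St G"
    proof (rule subgroupI)
      show "St \<subseteq> carrier G" using Fc by (auto simp: St_def)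
      have "\<one> \<in> St" using vc by (simp add: St_def)
      then show "St \<noteq> {}" by blast
    next
      fix g assume g: "g \<in> St"
      then have gc: "g \<in> carrier G" "g \<otimes> v = v \<otimes> g" using eq Fc by (auto simp: St_def)
      have "inv g \<otimes> v \<otimes> inv (inv g) = inv g \<otimes> (v \<otimes> g)" using gc(1) vc by (simp add: m_assoc)
      also have "\<dots> = v" unfolding gc(2)[symmetric] using gc(1) vc by (simp add: inv_mult_cancel)
      finally show "inv g \<in> St" using g by (simp add: St_def)
    next
      fix g h assume g: "g \<in> St" and h: "h \<in> St"
      have c: "g \<in> carrier G" "h \<in> carrier G" using g h Fc by (auto simp: St_def)
      then have "(g \<otimes> h) \<otimes> v \<otimes> inv (g \<otimes> h) = g \<otimes> (h \<otimes> v \<otimes> inv h) \<otimes> inv g"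
        using vc by (simp add: word_simps)
      then show "g \<otimes> h \<in> St" using g h by (simp add: St_def)
    qed
    have StF: "St \<subseteq> F" by (auto simp: St_def)
    \<comment> \<open>Inverses turn the left cosets of the stabilizer, which parametrize the orbit, into right cosets.\<close>
    have "card ((\<lambda>g. inv g \<otimes> v \<otimes> inv (inv g)) ` F) = card ((\<lambda>g. St #> g) ` F)"
    proof (rule card_image_same_fibres[OF fF])
      fix g h assume g: "g \<in> F" and h: "h \<in> F"
      have gc: "g \<in> carrier G" "h \<in> carrier G" using g h Fc by auto
      have "inv g \<otimes> v \<otimes> inv (inv g) = inv h \<otimes> v \<otimes> inv (inv h) \<longleftrightarrow>
          g \<otimes> (inv g \<otimes> v \<otimes> inv (inv g)) \<otimes> inv g = g \<otimes> (inv h \<otimes> v \<otimes> inv (inv h)) \<otimes> inv g"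
      proof -
        define a b where "a = inv g \<otimes> v \<otimes> inv (inv g)" and "b = inv h \<otimes> v \<otimes> inv (inv h)"
        have "a \<in> carrier G" "b \<in> carrier G" using gc vc by (auto simp: a_def b_def)
        then have "a = b \<longleftrightarrow> g \<otimes> a \<otimes> inv g = g \<otimes> b \<otimes> inv g" using gc by (simp add: m_assoc)
        then show ?thesis by (simp only: a_def b_def)
      qed
      also have "\<dots> \<longleftrightarrow> v = (g \<otimes> inv h) \<otimes> v \<otimes> inv (g \<otimes> inv h)"
        using gc vc by (simp add: word_simps)
      also have "\<dots> \<longleftrightarrow> g \<otimes> inv h \<in> St" using g h by (auto simp: St_def)
      finally show "inv g \<otimes> v \<otimes> inv (inv g) = inv h \<otimes> v \<otimes> inv (inv h) \<longleftrightarrow> St #> g = St #> h"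
        using coset_eq_iff[OF St gc] by simp
    qed
    moreover have "(\<lambda>g. inv g \<otimes> v \<otimes> inv (inv g)) ` F = orb v"
    proof
      show "(\<lambda>g. inv g \<otimes> v \<otimes> inv (inv g)) ` F \<subseteq> orb v" unfolding orb_def using F.m_inv_closed by blast
      show "orb v \<subseteq> (\<lambda>g. inv g \<otimes> v \<otimes> inv (inv g)) ` F"
      proof
        fix x assume "x \<in> orb v"
        then obtain g where "g \<in> F" "x = g \<otimes> v \<otimes> inv g" by (auto simp: orb_def)
        then show "x \<in> (\<lambda>g. inv g \<otimes> v \<otimes> inv (inv g)) ` F" using Fc by (intro image_eqI[of _ _ "inv g"]) auto
      qed
    qed
    ultimately have "card (orb v) * card St = p ^ a"
      using card_coset_image[OF F(1) St StF] F(2) by simp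
    then have "card (orb v) dvd p ^ a" by (metis dvd_triv_left)
    then obtain i where i: "card (orb v) = p ^ i" using p divides_primepow_nat by blast
    have "i \<noteq> 0"
    proof
      assume "i = 0"
      then have "card (orb v) = 1" using i by simp
      then obtain x where "orb v = {x}" by (auto simp: card_1_singleton_iff)
      then have "x = v" using self[of v] v by simp
      then have "g \<otimes> v \<otimes> inv g = v" if "g \<in> F" for g
        using \<open>orb v = {x}\<close> that unfolding orb_def by blast
      then have "v \<in> fx" using v unfolding fx_def by simp
      then show False using v by blast
    qed
    then show ?thesis using i by simp
  qed
  have fxV: "fx \<subseteq> V" by (auto simp: fx_def)
  have un: "\<Union> (orb ` (V - fx)) = V - fx"
  proof
    show "V - fx \<subseteq> \<Union> (orb ` (V - fx))" using self by blast
    show "\<Union> (orb ` (V - fx)) \<subseteq> V - fx"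
    proof
      fix x assume "x \<in> \<Union> (orb ` (V - fx))"
      then obtain v where v: "v \<in> V" "v \<notin> fx" "x \<in> orb v" by blast
      have "x \<notin> fx"
      proof
        assume "x \<in> fx"
        then have "orb x \<subseteq> {x}" unfolding fx_def orb_def by auto
        then have "v = x" using orb_sym[OF v(1,3)] by blast
        then show False using v \<open>x \<in> fx\<close> by blast
      qed
      then show "x \<in> V - fx" using orbV v by blast
    qed
  qed
  have "p dvd card (\<Union> (orb ` (V - fx)))"
  proof (rule dvd_partition)
    show "finite (\<Union> (orb ` (V - fx)))" using un fV by simp
    show "\<forall>c\<in>orb ` (V - fx). p dvd card c" using dvd by blast
    show "\<forall>c1\<in>orb ` (V - fx). \<forall>c2\<in>orb ` (V - fx). c1 \<noteq> c2 \<longrightarrow> c1 \<inter> c2 = {}"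
    proof (intro ballI impI)
      fix c1 c2 assume "c1 \<in> orb ` (V - fx)" "c2 \<in> orb ` (V - fx)" and ne: "c1 \<noteq> c2"
      then obtain v w where vw: "v \<in> V" "w \<in> V" "c1 = orb v" "c2 = orb w" by blast
      have False if "x \<in> orb v" "x \<in> orb w" for x
        using orb_eq[OF vw(1) that(1)] orb_eq[OF vw(2) that(2)] ne vw(3,4) by simp
      then show "c1 \<inter> c2 = {}" unfolding vw(3,4) by blast
    qed
  qed
  moreover have "card V = card fx + card (V - fx)" 
    using card_Diff_subset[of fx V] fxV finite_subset[OF fxV fV] card_mono[OF fV fxV] by simp
  ultimately have "p dvd card fx" using V(2) un dvd_add_left_iff[of p "card (V - fx)" "card fx"] by simp
  moreover have "\<one> \<in> fx" using Fc by (auto simp: fx_def)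
  moreover have "finite fx" using fxV fV finite_subset by blast
  ultimately have "\<not> fx \<subseteq> {\<one>}"
  proof -
    have False if "fx \<subseteq> {\<one>}"
    proof -
      have "fx = {\<one>}" using that \<open>\<one> \<in> fx\<close> by blast
      then show False using \<open>p dvd card fx\<close> p by simp
    qed
    then show ?thesis by blast
  qed
  then obtain v where v: "v \<in> fx" "v \<noteq> \<one>" by blast
  have "commutator g v = \<one>" if "g \<in> F" for g
    using v that Fc Vc by (auto simp: commutator_def fx_def)
  then show ?thesis using v fxV by blast
qed

end

section \<open>Self-centralizing minimal normal subgroups\<close>

lemma (in comm_group) hom_finprod:
  assumes h: "h \<in> hom G G" and "finite A" "f \<in> A \<rightarrow> carrier G"
  shows "h (finprod G f A) = finprod G (\<lambda>x. h (f x)) A"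
  using assms(2,3)
proof (induction A)
  case empty
  show ?case using hom_one[OF h is_group is_group] by simp
next
  case (insert a A)
  have cl: "(\<lambda>x. h (f x)) \<in> A \<rightarrow> carrier G" "h (f a) \<in> carrier G" "f \<in> A \<rightarrow> carrier G" "f a \<in> carrier G"
    using insert.prems h by (auto simp: hom_def)
  have "h (finprod G f (insert a A)) = h (f a \<otimes> finprod G f A)"
    using insert.hyps cl by simp
  also have "\<dots> = h (f a) \<otimes> h (finprod G f A)"
    using h cl by (auto simp: hom_def)
  also have "\<dots> = finprod G (\<lambda>x. h (f x)) (insert a A)"
    using insert cl by simp
  finally show ?case .
qed

context group
begin

lemma abelian_imp_comm_group:
  assumes V: "subgroup V G" and ab: "V \<subseteq> centralizer_mod {\<one>} V"
  shows "comm_group (G\<lparr>carrier := V\<rparr>)"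
proof (rule group.group_comm_groupI[OF subgroup_imp_group[OF V]])
  fix x y assume "x \<in> carrier (G\<lparr>carrier := V\<rparr>)" "y \<in> carrier (G\<lparr>carrier := V\<rparr>)"
  then have xy: "x \<in> V" "y \<in> V" "x \<in> carrier G" "y \<in> carrier G" using subgroup.subset[OF V] by auto
  then have "commutator x y = \<one>" using ab by (auto simp: centralizer_mod_def)
  then have "commutator x y \<otimes> (y \<otimes> x) = y \<otimes> x" using xy by simp
  then show "x \<otimes>\<^bsub>G\<lparr>carrier := V\<rparr>\<^esub> y = y \<otimes>\<^bsub>G\<lparr>carrier := V\<rparr>\<^esub> x"
    using xy by (simp add: commutator_def word_simps)
qed

text \<open>The map \<open>u \<mapsto> [c, u]\<close> is a cocycle of \<open>U / V\<close> with values in \<open>V\<close>.  As \<open>\<bar>U / V\<bar>\<close> is prime to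
  the exponent of \<open>V\<close>, averaging over \<open>U / V\<close> makes it a coboundary.\<close>

lemma cocycle_averaging:
  assumes fin: "finite (carrier G)" and p: "prime p"
    and V: "V \<lhd> G" and ab: "V \<subseteq> centralizer_mod {\<one>} V" and exp: "\<And>v. v \<in> V \<Longrightarrow> v [^] p = \<one>"
    and U: "U \<lhd> G" "V \<subseteq> U" and cop: "coprime p (card U div card V)"
    and c: "c \<in> centralizer_mod {\<one>} V" and cU: "\<And>u. u \<in> U \<Longrightarrow> commutator c u \<in> V"
  shows "\<exists>w\<in>V. \<forall>u\<in>U. commutator c u = commutator w u"
proof -
  interpret V: normal V G by (rule V)
  interpret U: normal U G by (rule U)
  have sV: "subgroup V G" and sU: "subgroup U G" by (rule V.subgroup_axioms, rule U.subgroup_axioms)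
  let ?V = "G\<lparr>carrier := V\<rparr>"
  interpret V': comm_group ?V by (rule abelian_imp_comm_group[OF sV ab])
  have cc: "c \<in> carrier G" using c by (simp add: centralizer_mod_def)
  have Vc: "v \<in> carrier G" if "v \<in> V" for v using that V.subset by blast
  have Uc: "v \<in> carrier G" if "v \<in> U" for v using that U.subset by blast
  have Vcomm: "v \<otimes> w = w \<otimes> v" if "v \<in> V" "w \<in> V" for v w using V'.m_comm that by simp
  define \<delta> where "\<delta> = (\<lambda>u. commutator c u)"
  have \<delta>V: "\<delta> u \<in> V" if "u \<in> U" for u using cU that by (simp add: \<delta>_def)
  have \<delta>_mult: "\<delta> (u \<otimes> u') = \<delta> u \<otimes> (u \<otimes> \<delta> u' \<otimes> inv u)" if "u \<in> U" "u' \<in> U" for u u'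
    using that Uc cc by (simp add: \<delta>_def commutator_mult_right)
  have \<delta>_coset: "\<delta> u = \<delta> u'" if u: "u \<in> U" "u' \<in> U" "V #> u = V #> u'" for u u'
  proof -
    have v: "u \<otimes> inv u' \<in> V" using coset_eq_iff[OF sV] u Uc by simp
    have "\<delta> u = \<delta> ((u \<otimes> inv u') \<otimes> u')" using u Uc by (simp add: word_simps)
    also have "\<dots> = \<delta> (u \<otimes> inv u') \<otimes> ((u \<otimes> inv u') \<otimes> \<delta> u' \<otimes> inv (u \<otimes> inv u'))"
      using v U(2) u by (intro \<delta>_mult) auto
    also have "\<delta> (u \<otimes> inv u') = \<one>" using c v by (auto simp: \<delta>_def centralizer_mod_def)
    also have "(u \<otimes> inv u') \<otimes> \<delta> u' \<otimes> inv (u \<otimes> inv u') = \<delta> u'"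
      using Vcomm[OF v \<delta>V[OF u(2)]] v Vc \<delta>V[OF u(2)] by (simp add: m_assoc)
    finally show ?thesis using \<delta>V[OF u(2)] Vc by simp
  qed
  define I where "I = (\<lambda>u. V #> u) ` U"
  have finU: "finite U" using fin U.subset finite_subset by blast
  have finI: "finite I" using finU by (simp add: I_def)
  define d where "d = (\<lambda>X. \<delta> (SOME u. u \<in> U \<and> V #> u = X))"
  have d: "d (V #> u) = \<delta> u" if u: "u \<in> U" for u
  proof -
    have "(SOME u'. u' \<in> U \<and> V #> u' = V #> u) \<in> U \<and> V #> (SOME u'. u' \<in> U \<and> V #> u' = V #> u) = V #> u"
      by (rule someI[of "\<lambda>u'. u' \<in> U \<and> V #> u' = V #> u" u]) (simp add: u)
    then show ?thesis unfolding d_def using \<delta>_coset u by blast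
  qed
  have dV: "d \<in> I \<rightarrow> carrier ?V" using d \<delta>V by (auto simp: I_def)
  \<comment> \<open>The product of all values of the cocycle; the identity \<open>t * s = p * y + 1\<close> below inverts the index \<open>t\<close> modulo
    the exponent \<open>p\<close>.\<close>
  define w where "w = finprod ?V d I"
  have wV: "w \<in> V" unfolding w_def using V'.finprod_closed[OF dV] by simp
  define t where "t = card I"
  have cardV: "card V > 0" using fin V.subset finite_subset V.one_closed card_gt_0_iff by blast
  have "t = card U div card V"
    using card_coset_image[OF sU sV U(2)] cardV unfolding t_def I_def
    by (metis nonzero_mult_div_cancel_right less_numeral_extra(3))
  then have "coprime t p" using cop by (simp add: coprime_commute)
  moreover have "t \<noteq> 0" 
  proof -
    have "I \<noteq> {}" using U.one_closed unfolding I_def by blast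
    then show ?thesis using finI by (simp add: t_def)
  qed
  ultimately obtain s y where sy: "t * s = p * y + 1" using bezout_nat[of t p] by auto
  have key: "u \<otimes> w \<otimes> inv u = inv (\<delta> u) [^] t \<otimes> w" if u: "u \<in> U" for u
  proof -
    have uc: "u \<in> carrier G" using u Uc by simp
    define \<mu> where "\<mu> = (\<lambda>X. (V #> u) <#> X)"
    have \<mu>: "\<mu> (V #> x) = V #> (u \<otimes> x)" if "x \<in> U" for x
      using that uc Uc by (simp add: \<mu>_def V.rcos_sum)
    have \<mu>I: "\<mu> ` I \<subseteq> I" using \<mu> u by (auto simp: I_def)
    have inj: "inj_on \<mu> I"
    proof (rule inj_onI)
      fix X Y assume "X \<in> I" "Y \<in> I" and e: "\<mu> X = \<mu> Y"
      then obtain x y where xy: "x \<in> U" "y \<in> U" "X = V #> x" "Y = V #> y" by (auto simp: I_def)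
      have xyc: "x \<in> carrier G" "y \<in> carrier G" using xy Uc by auto
      have "V #> (u \<otimes> x) = V #> (u \<otimes> y)" using e xy \<mu> by simp
      then have "(u \<otimes> x) \<otimes> inv (u \<otimes> y) \<in> V" using coset_eq_iff[OF sV] uc xyc by simp
      then have "inv u \<otimes> ((u \<otimes> x) \<otimes> inv (u \<otimes> y)) \<otimes> u \<in> V" using V.inv_op_closed1[OF uc] by simp
      then have "x \<otimes> inv y \<in> V" using uc xyc by (simp add: word_simps)
      then show "X = Y" using coset_eq_iff[OF sV] xyc xy by simp
    qed
    have \<mu>im: "\<mu> ` I = I" by (rule endo_inj_surj[OF finI \<mu>I inj])
    define \<phi> where "\<phi> = (\<lambda>v. u \<otimes> v \<otimes> inv u)"
    have "\<phi> \<in> hom ?V ?V"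
      using V.inv_op_closed2[OF uc] uc Vc by (auto simp: hom_def \<phi>_def word_simps)
    then have "\<phi> w = finprod ?V (\<lambda>X. \<phi> (d X)) I"
      unfolding w_def by (rule V'.hom_finprod[OF _ finI dV])
    also have "\<dots> = finprod ?V (\<lambda>X. inv (\<delta> u) \<otimes>\<^bsub>?V\<^esub> d (\<mu> X)) I"
    proof (rule V'.finprod_cong'[OF refl])
      show "(\<lambda>X. inv (\<delta> u) \<otimes>\<^bsub>?V\<^esub> d (\<mu> X)) \<in> I \<rightarrow> carrier ?V"
        using \<delta>V[OF u] dV \<mu>I by (auto simp: Pi_iff image_subset_iff)
      fix X assume "X \<in> I"
      then obtain x where x: "x \<in> U" "X = V #> x" by (auto simp: I_def)
      have "d (\<mu> X) = \<delta> u \<otimes> \<phi> (\<delta> x)" using x u by (simp add: \<mu> d \<delta>_mult \<phi>_def)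
      moreover have "\<phi> (\<delta> x) \<in> carrier G" using uc Vc[OF \<delta>V[OF x(1)]] by (simp add: \<phi>_def)
      ultimately show "\<phi> (d X) = inv (\<delta> u) \<otimes>\<^bsub>?V\<^esub> d (\<mu> X)"
        using x Vc[OF \<delta>V[OF u]] by (simp add: d inv_mult_cancel)
    qed
    also have "\<dots> = finprod ?V (\<lambda>X. inv (\<delta> u)) I \<otimes>\<^bsub>?V\<^esub> finprod ?V (\<lambda>X. d (\<mu> X)) I"
      using \<delta>V[OF u] dV \<mu>I by (intro V'.finprod_multf) (auto simp: Pi_iff image_subset_iff)
    also have "finprod ?V (\<lambda>X. inv (\<delta> u)) I = inv (\<delta> u) [^]\<^bsub>?V\<^esub> t"
      unfolding t_def using \<delta>V[OF u] by (intro V'.finprod_const) simp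
    also have "finprod ?V (\<lambda>X. d (\<mu> X)) I = finprod ?V d (\<mu> ` I)"
      using dV \<mu>im inj by (intro V'.finprod_reindex[symmetric]) auto
    also have "\<dots> = w" by (simp add: \<mu>im w_def)
    finally show ?thesis by (simp add: \<phi>_def flip: nat_pow_consistent)
  qed
  define w0 where "w0 = w [^] s"
  have w0V: "w0 \<in> V" unfolding w0_def by (rule subgroup_pow_closed[OF sV wV])
  have "commutator c u = commutator w0 u" if u: "u \<in> U" for u
  proof -
    have uc: "u \<in> carrier G" and wc: "w \<in> carrier G" "w0 \<in> carrier G" and dc: "\<delta> u \<in> carrier G"
      using u Uc wV w0V Vc \<delta>V by auto
    have iV: "inv (\<delta> u) \<in> V" using \<delta>V[OF u] by simp
    have "u \<otimes> w0 \<otimes> inv u = (u \<otimes> w \<otimes> inv u) [^] s" unfolding w0_def by (rule conj_pow[OF uc wc(1)])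
    also have "\<dots> = (inv (\<delta> u) [^] t) [^] s \<otimes> w0"
      unfolding key[OF u] w0_def
      using Vcomm[OF subgroup_pow_closed[OF sV iV] wV] wc dc by (intro pow_mult_distrib) auto
    also have "(inv (\<delta> u) [^] t) [^] s = (inv (\<delta> u) [^] p) [^] y \<otimes> inv (\<delta> u)"
    proof -
      have "(inv (\<delta> u) [^] t) [^] s = inv (\<delta> u) [^] (p * y + 1)" using dc nat_pow_pow[of "inv (\<delta> u)" t s] sy by simp
      also have "\<dots> = inv (\<delta> u) [^] (p * y) \<otimes> inv (\<delta> u)" by simp
      also have "inv (\<delta> u) [^] (p * y) = (inv (\<delta> u) [^] p) [^] y" using dc nat_pow_pow[of "inv (\<delta> u)" p y] by simp
      finally show ?thesis .
    qed
    also have "\<dots> = inv (\<delta> u)" using exp[OF iV] dc by simp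
    finally have e: "u \<otimes> w0 \<otimes> inv u = inv (\<delta> u) \<otimes> w0" .
    have "commutator w0 u = w0 \<otimes> inv (u \<otimes> w0 \<otimes> inv u)"
      using uc wc by (simp add: commutator_def word_simps)
    also have "\<dots> = w0 \<otimes> inv w0 \<otimes> \<delta> u" unfolding e using wc dc by (simp add: word_simps)
    also have "\<dots> = commutator c u" using wc dc by (simp add: \<delta>_def)
    finally show ?thesis by simp
  qed
  then show ?thesis using w0V by blast
qed

text \<open>Here \<open>V\<close> is the only minimal normal subgroup, and an elementary abelian \<open>p\<close>-group.  Let \<open>C\<close> be its
  centralizer.  If some normal subgroup \<open>U\<close> above \<open>V\<close> has \<open>U / V\<close> elementary abelian for a prime other than
  \<open>p\<close>, then \<open>C \<inter> U = V\<close>, and averaging shows that each \<open>c \<in> C\<close> induces on \<open>U\<close> the same automorphism as some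
  \<open>w \<in> V\<close>; as the centralizer of \<open>U\<close> is trivial, \<open>c = w\<close>.  If there is no such \<open>U\<close>, the group \<open>F\<close> of all
  elements that centralize the chief factors above \<open>V\<close> turns out to be a \<open>p\<close>-group.  So it has nontrivial
  fixed points in \<open>V\<close>, and centralizes \<open>V\<close> by minimality.  This is impossible, since \<open>D \<subseteq> F\<close>.\<close>

lemma self_centralizing_if_not_centralized:
  assumes sol: "solvable G" and fin: "finite (carrier G)"
    and V: "chief {\<one>} V" and D: "D \<lhd> G"
    and above: "\<And>L M d m. chief L M \<Longrightarrow> L \<noteq> {\<one>} \<Longrightarrow> d \<in> D \<Longrightarrow> m \<in> M \<Longrightarrow> commutator d m \<in> L"
    and not_cent: "\<not> D \<subseteq> centralizer_mod {\<one>} V"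
  shows "\<exists>p::nat. prime p \<and> (\<forall>v\<in>V. v [^] p = \<one>) \<and> V \<subseteq> centralizer_mod {\<one>} V \<and> centralizer_mod {\<one>} V = V"
proof -
  have nV: "V \<lhd> G" and V1: "{\<one>} \<subset> V" and Vmin: "\<And>X. X \<lhd> G \<Longrightarrow> X \<subseteq> V \<Longrightarrow> X = {\<one>} \<or> X = V"
    using V subgroup.one_closed[OF normal_imp_subgroup] by (fastforce simp: chief_def)+
  interpret V: normal V G by (rule nV)
  have Vc: "v \<in> carrier G" if "v \<in> V" for v using that V.subset by blast
  have one_in: "\<one> \<in> X" if "X \<lhd> G" for X using subgroup.one_closed[OF normal_imp_subgroup[OF that]] .
  have Dc: "d \<in> carrier G" if "d \<in> D" for d using that normal_subset[OF D] by blast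
  note one = one_is_normal
  \<comment> \<open>\<open>V\<close> is the only minimal normal subgroup: modulo any other one it is centralized by \<open>D\<close>.\<close>
  have uniq: "V \<subseteq> W" if W: "W \<lhd> G" "W \<noteq> {\<one>}" for W
  proof (rule ccontr)
    assume nle: "\<not> V \<subseteq> W"
    interpret W: normal W G by (rule W)
    have int: "V \<inter> W = {\<one>}" using Vmin[OF normal_Int[OF nV W(1)]] nle by blast
    note nm = normal_set_mult[OF nV W(1)]
    have "chief W (V <#> W)"
      unfolding chief_def
    proof (intro conjI allI impI)
      show "W \<lhd> G" "V <#> W \<lhd> G" by (rule W, rule nm)
      show "W \<subset> V <#> W" using nm nle by blast
      fix X assume X: "X \<lhd> G" "W \<subseteq> X" "X \<subseteq> V <#> W"
      show "X = W \<or> X = V <#> W"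
      proof (cases "V \<subseteq> X")
        case True
        then have "V <#> W \<subseteq> X" using X by (intro set_mult_subset normal_imp_subgroup)
        then show ?thesis using X by blast
      next
        case False
        then have XV: "X \<inter> V = {\<one>}" using Vmin[OF normal_Int[OF X(1) nV]] by blast
        have "x \<in> W" if x: "x \<in> X" for x
        proof -
          obtain v w where vw: "v \<in> V" "w \<in> W" "x = v \<otimes> w" using x X(3) by (auto simp: set_mult_def)
          have c: "v \<in> carrier G" "w \<in> carrier G" using vw Vc W.subset by auto
          have "x \<otimes> inv w \<in> X" using x vw X W.m_inv_closed subgroup.m_closed[OF normal_imp_subgroup[OF X(1)]] by blast
          then have "v \<in> X" using vw c by (simp add: m_assoc)
          then have "v = \<one>" using XV vw(1) by blast
          then show "x \<in> W" using vw c by simp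
        qed
        then show ?thesis using X by blast
      qed
    qed
    then have "commutator d v \<in> W" if "d \<in> D" "v \<in> V" for d v
      using above[OF _ W(2) that(1)] that nm(2) by blast
    moreover have "commutator d v \<in> V" if "d \<in> D" "v \<in> V" for d v
      using commutator_in_normal[OF nV Dc Vc] that by blast
    ultimately have "D \<subseteq> centralizer_mod {\<one>} V" using int Dc by (auto simp: centralizer_mod_def)
    then show False using not_cent by blast
  qed
  obtain E where E: "E \<lhd> G" "{\<one>} \<subset> E" "E \<subseteq> V" "E \<subseteq> centralizer_mod {\<one>} E"
    using solvable_abelian_normal_step[OF sol one nV V1] by metis
  then have EV: "E = V" using Vmin by blast
  then have ab: "V \<subseteq> centralizer_mod {\<one>} V" using E by simp
  obtain v0 where v0: "v0 \<in> V" "v0 \<noteq> \<one>" using V1 by blast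
  have "ord v0 \<noteq> 1" using ord_eq_1[OF Vc[OF v0(1)]] v0(2) by simp
  then obtain p where p: "prime p" "p dvd ord v0" using prime_factor_nat by blast
  have exp: "v [^] p = \<one>" if v: "v \<in> V" for v
  proof -
    have n: "{x \<in> V. x [^] p \<in> {\<one>}} \<lhd> G" using V1 by (intro roots_mod_normal[OF one nV ab]) auto
    obtain k where k: "ord v0 = p * k" using p(2) by blast
    have "ord v0 \<noteq> 0" using ord_ge_1[OF fin Vc[OF v0(1)]] by simp
    then have "k \<noteq> 0" "\<not> p * k dvd k" using k p(1) prime_gt_1_nat[OF p(1)] by (auto dest: dvd_imp_le)
    then have "v0 [^] k \<noteq> \<one>" using pow_eq_id[OF Vc[OF v0(1)]] k by simp
    moreover have "(v0 [^] k) [^] p = \<one>"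
      using Vc[OF v0(1)] k pow_ord_eq_1[OF Vc[OF v0(1)]] by (simp add: nat_pow_pow mult.commute)
    ultimately have "{x \<in> V. x [^] p \<in> {\<one>}} \<noteq> {\<one>}"
      using subgroup_pow_closed[OF V.subgroup_axioms v0(1), of k] by auto
    then have "{x \<in> V. x [^] p \<in> {\<one>}} = V" using Vmin[OF n] by blast
    then show ?thesis using v by blast
  qed
  define C where "C = centralizer_mod {\<one>} V"
  have C: "C \<lhd> G" unfolding C_def using V.inv_op_closed2 Vc by (intro centralizer_mod_normal[OF one]) auto
  have VC: "V \<subseteq> C" using ab by (simp add: C_def)
  have Cc: "x \<in> carrier G" if "x \<in> C" for x using that normal_subset[OF C] by blast
  have Ccomm: "commutator x v = \<one>" "commutator v x = \<one>" if xC: "x \<in> C" and vV: "v \<in> V" for x v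
  proof -
    show 1: "commutator x v = \<one>" using xC vV unfolding C_def centralizer_mod_def by blast
    show "commutator v x = \<one>" using inv_commutator[OF Cc[OF xC] Vc[OF vV]] 1 by simp
  qed
  have "C = V"
  proof (cases "\<exists>q U. prime q \<and> q \<noteq> p \<and> U \<lhd> G \<and> V \<subset> U \<and> (\<forall>u\<in>U. u [^] q \<in> V) \<and> U \<subseteq> centralizer_mod V U")
    case True
    then obtain q U where q: "prime q" "q \<noteq> p" and U: "U \<lhd> G" "V \<subset> U"
        and Uq: "\<And>u. u \<in> U \<Longrightarrow> u [^] q \<in> V" and Uab: "U \<subseteq> centralizer_mod V U" by blast
    interpret U: normal U G by (rule U)
    have Uc: "x \<in> carrier G" if "x \<in> U" for x using that U.subset by blast
    have cop: "coprime p q" using p q primes_coprime by metis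
    \<comment> \<open>The group \<open>C \<inter> U\<close> is abelian, because its commutators have order dividing both \<open>p\<close> and \<open>q\<close>.  Its elements
      of order dividing \<open>q\<close> form a normal subgroup that does not contain \<open>V\<close>.\<close>
    define U1 where "U1 = C \<inter> U"
    have U1: "U1 \<lhd> G" unfolding U1_def by (rule normal_Int[OF C U(1)])
    have U1c: "commutator x y = \<one>" if x: "x \<in> U1" and y: "y \<in> U1" for x y
    proof -
      have xy: "x \<in> C" "x \<in> U" "y \<in> C" "y \<in> U" "x \<in> carrier G" "y \<in> carrier G"
        using x y Cc by (auto simp: U1_def)
      have cV: "commutator x y \<in> V" using Uab xy by (auto simp: centralizer_mod_def)
      have "x \<in> centralizer_mod {\<one>} {commutator x y}" using Ccomm(1)[OF xy(1) cV] xy by (simp add: centralizer_mod_def)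
      then have "commutator (x [^] q) y = commutator x y [^] q"
        using commutator_pow_mod[OF one xy(5,6), of q] xy by auto
      moreover have "commutator (x [^] q) y = \<one>" using Ccomm(2)[OF xy(3) Uq[OF xy(2)]] .
      ultimately have "commutator x y [^] q \<in> {\<one>}" by simp
      moreover have "commutator x y [^] p \<in> {\<one>}" using exp[OF cV] by simp
      ultimately show ?thesis
        using coprime_pow_mem[OF triv_subgroup, of "commutator x y" p q] xy cop by simp
    qed
    have U1ab: "U1 \<subseteq> centralizer_mod {\<one>} U1" using U1c Cc by (auto simp: centralizer_mod_def U1_def)
    define W where "W = {x \<in> U1. x [^] q \<in> {\<one>}}"
    have nW: "W \<lhd> G" unfolding W_def using one_in[OF U1] by (intro roots_mod_normal[OF one U1 U1ab]) auto
    have "W = {\<one>}"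
    proof (rule ccontr)
      assume "W \<noteq> {\<one>}"
      then have "V \<subseteq> W" by (rule uniq[OF nW])
      then have "v0 [^] q \<in> {\<one>}" using v0 by (auto simp: W_def)
      then show False using coprime_pow_mem[OF triv_subgroup, of v0 p q] exp[OF v0(1)] v0 Vc cop by simp
    qed
    have "U1 = V"
    proof
      show "V \<subseteq> U1" using VC U by (auto simp: U1_def)
      show "U1 \<subseteq> V"
      proof
        fix x assume x: "x \<in> U1"
        have xc: "x \<in> carrier G" "x \<in> U" using x Cc by (auto simp: U1_def)
        have "(x [^] p) [^] q = (x [^] q) [^] p" using xc by (simp add: nat_pow_pow mult.commute)
        also have "\<dots> = \<one>" by (rule exp[OF Uq[OF xc(2)]])
        finally have "x [^] p \<in> W"
          using subgroup_pow_closed[OF normal_imp_subgroup[OF U1] x] by (simp add: W_def)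
        then have "x [^] p \<in> V" using \<open>W = {\<one>}\<close> by simp
        then show "x \<in> V" using coprime_pow_mem[OF V.subgroup_axioms xc(1) _ Uq[OF xc(2)] cop] by blast
      qed
    qed
    have copidx: "coprime p (card U div card V)"
    proof (rule ccontr)
      assume "\<not> coprime p (card U div card V)"
      then have pd: "p dvd card U div card V" using p(1) prime_imp_coprime_nat by blast
      let ?U = "G\<lparr>carrier := U\<rparr>"
      interpret GU: group ?U by (rule subgroup_imp_group[OF U.subgroup_axioms])
      have "V \<lhd> ?U" using normal_restrict_supergroup[OF U.subgroup_axioms nV] U(2) by blast
      then interpret VU: normal V ?U .
      interpret Q: group "?U Mod V" by (rule VU.factorgroup_is_group)
      have finU: "finite U" using fin U.subset finite_subset by blast
      have carr: "carrier (?U Mod V) = (\<lambda>u. V #> u) ` U" by (simp add: carrier_FactGroup)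
      have "card V > 0" using fin V.subset finite_subset V.one_closed card_gt_0_iff by blast
      then have "order (?U Mod V) = card U div card V"
        using card_coset_image[OF U.subgroup_axioms V.subgroup_axioms] U(2)
        by (metis carr order_def nonzero_mult_div_cancel_right less_numeral_extra(3) psubset_imp_subset)
      then obtain X where X: "X \<in> carrier (?U Mod V)" "X \<noteq> V" "X [^]\<^bsub>?U Mod V\<^esub> p = V"
        using Q.cauchy_element[OF _ p(1)] pd finU carr by auto
      obtain u where u: "u \<in> U" "X = V #> u" using X(1) carr by blast
      have "V #> (u [^] p) = V" using X(3) VU.FactGroup_pow[of u p] u by (simp flip: nat_pow_consistent)
      then have "u [^] p \<in> V" using rcos_self[OF _ V.subgroup_axioms, of "u [^] p"] Uc[OF u(1)] by simp
      then have "u \<in> V" by (rule coprime_pow_mem[OF V.subgroup_axioms Uc[OF u(1)] _ Uq[OF u(1)] cop])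
      then show False using X(2) u coset_join2[OF Uc[OF u(1)] V.subgroup_axioms] by simp
    qed
    \<comment> \<open>By uniqueness of \<open>V\<close>, a nontrivial centralizer of \<open>U\<close> would contain \<open>V\<close>, and \<open>U\<close> would lie in \<open>C\<close>.\<close>
    define N where "N = centralizer_mod {\<one>} U"
    have nN: "N \<lhd> G" unfolding N_def using U.inv_op_closed2 Uc by (intro centralizer_mod_normal[OF one]) auto
    have N1: "N = {\<one>}"
    proof (rule ccontr)
      assume "N \<noteq> {\<one>}"
      then have "V \<subseteq> centralizer_mod {\<one>} U" using uniq[OF nN] by (simp add: N_def)
      then have "U \<subseteq> C" unfolding C_def
        by (rule centralizer_mod_sym[OF triv_subgroup V.subset U.subset])
      then have "U1 = U" by (auto simp: U1_def)
      then show False using \<open>U1 = V\<close> U(2) by simp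
    qed
    show "C = V"
    proof
      show "C \<subseteq> V"
      proof
        fix c assume c: "c \<in> C"
        have "commutator c u \<in> U1" if "u \<in> U" for u
          using commutator_in_normal[OF C Cc[OF c] Uc[OF that]] commutator_in_normal[OF U(1) Cc[OF c] Uc[OF that]] c that
          by (simp add: U1_def)
        then have "\<exists>w\<in>V. \<forall>u\<in>U. commutator c u = commutator w u"
          using c U(2) unfolding \<open>U1 = V\<close> C_def
          by (intro cocycle_averaging[OF fin p(1) nV ab exp U(1) _ copidx]) auto
        then obtain w where w: "w \<in> V" "\<And>u. u \<in> U \<Longrightarrow> commutator c u = commutator w u" by blast
        have wc: "w \<in> carrier G" "c \<in> carrier G" using w Vc c Cc by auto
        have "commutator (inv w \<otimes> c) u = \<one>" if u: "u \<in> U" for u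
        proof -
          have "commutator (inv w \<otimes> c) u = inv w \<otimes> (commutator c u \<otimes> inv (commutator w u)) \<otimes> w"
            using wc Uc[OF u] by (simp add: commutator_def word_simps)
          then show ?thesis using wc Uc[OF u] by (simp add: w(2)[OF u])
        qed
        then have "inv w \<otimes> c \<in> N" using wc by (simp add: N_def centralizer_mod_def)
        then have "inv w \<otimes> c = \<one>" using N1 by blast
        then have "w \<otimes> (inv w \<otimes> c) = w" using wc by simp
        then show "c \<in> V" using w wc by (simp add: inv_mult_cancel)
      qed
    qed (rule VC)
  next
    case False
    then have no_U: "U = V" if "prime q" "q \<noteq> p" "U \<lhd> G" "V \<subseteq> U" "\<And>u. u \<in> U \<Longrightarrow> u [^] q \<in> V"
        "U \<subseteq> centralizer_mod V U" for q U
      using that by blast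
    define F where "F = {g \<in> carrier G. \<forall>L M. chief L M \<longrightarrow> V \<subseteq> L \<longrightarrow> g \<in> centralizer_mod L M}"
    have nc: "centralizer_mod L M \<lhd> G" if "chief L M" for L M
    proof -
      have LM: "L \<lhd> G" "M \<lhd> G" using that by (auto simp: chief_def)
      show ?thesis
        using normal_conj(1)[OF LM(2)] by (intro centralizer_mod_normal[OF LM(1) normal_subset[OF LM(2)]]) auto
    qed
    have F: "F \<lhd> G"
      unfolding normal_inv_iff
    proof (intro conjI ballI)
      show "subgroup F G"
      proof (rule subgroupI)
        show "F \<subseteq> carrier G" by (auto simp: F_def)
        have "\<one> \<in> F" using one_in[OF nc] by (simp add: F_def)
        then show "F \<noteq> {}" by blast
      next
        fix a assume "a \<in> F"
        then show "inv a \<in> F" using subgroup.m_inv_closed[OF normal_imp_subgroup[OF nc]] by (simp add: F_def)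
      next
        fix a b assume "a \<in> F" "b \<in> F"
        then show "a \<otimes> b \<in> F" using subgroup.m_closed[OF normal_imp_subgroup[OF nc]] by (simp add: F_def)
      qed
      fix g h assume "g \<in> carrier G" "h \<in> F"
      then show "g \<otimes> h \<otimes> inv g \<in> F" using normal_conj(1)[OF nc] by (simp add: F_def)
    qed
    interpret F: normal F G by (rule F)
    have Fc: "x \<in> carrier G" if "x \<in> F" for x using that F.subset by blast
    have DF: "D \<subseteq> F"
    proof
      fix d assume d: "d \<in> D"
      have "commutator d m \<in> L" if "chief L M" "V \<subseteq> L" "m \<in> M" for L M m
      proof (rule above[OF that(1) _ d that(3)])
        show "L \<noteq> {\<one>}" using V1 that(2) by blast
      qed
      then show "d \<in> F" using Dc[OF d] unfolding F_def centralizer_mod_def by blast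
    qed
    have VF: "V \<subseteq> F"
    proof
      fix v assume v: "v \<in> V"
      have "commutator v m \<in> L" if LM: "chief L M" "V \<subseteq> L" "m \<in> M" for L M m
      proof -
        have "L \<lhd> G" "m \<in> carrier G" using LM normal_subset[of M] by (auto simp: chief_def)
        then show ?thesis using commutator_in_normal[of L v m] v Vc LM(2) by blast
      qed
      then show "v \<in> F" using Vc[OF v] unfolding F_def centralizer_mod_def by blast
    qed
    \<comment> \<open>\<open>F\<close> acts trivially on all chief factors above \<open>V\<close>, so its upper central series modulo \<open>V\<close>
      ends in \<open>F\<close>.\<close>
    define Z where "Z = (\<lambda>i. ((\<lambda>X. F \<inter> centralizer_mod X F) ^^ i) V)"
    have Z0: "Z 0 = V" and ZS: "Z (Suc i) = F \<inter> centralizer_mod (Z i) F" for i by (auto simp: Z_def)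
    have nZ: "Z i \<lhd> G" for i
    proof (induction i)
      case (Suc i)
      then show ?case unfolding ZS using F.inv_op_closed2 F.subset
        by (intro normal_Int[OF F] centralizer_mod_normal) auto
    qed (simp add: Z0 nV)
    have ZF: "Z i \<subseteq> F" for i by (cases i) (auto simp: Z0 ZS VF)
    have Zmono: "Z i \<subseteq> Z (Suc i)" for i
    proof
      fix x assume x: "x \<in> Z i"
      then have xF: "x \<in> F" "x \<in> carrier G" using ZF Fc by blast+
      have "commutator x y \<in> Z i" if "y \<in> F" for y
        using commutator_in_normal[OF nZ xF(2) Fc[OF that]] x by blast
      then show "x \<in> Z (Suc i)" using xF by (simp add: ZS centralizer_mod_def)
    qed
    have VZ: "V \<subseteq> Z i" for i
    proof (induction i)
      case (Suc i)
      then show ?case using Zmono[of i] by blast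
    qed (simp add: Z0)
    have grow: "Z i \<subset> Z (Suc i)" if "Z i \<noteq> F" for i
    proof -
      have "Z i \<subset> F" using ZF[of i] that by blast
      then obtain M where M: "chief (Z i) M" "M \<subseteq> F" by (rule chief_above[OF fin nZ F])
      have Mc: "M \<subseteq> carrier G" using M F.subset by blast
      have "F \<subseteq> centralizer_mod (Z i) M" using M(1) VZ[of i] unfolding F_def by blast
      then have "M \<subseteq> centralizer_mod (Z i) F"
        by (rule centralizer_mod_sym[OF normal_imp_subgroup[OF nZ] F.subset Mc])
      then have "M \<subseteq> Z (Suc i)" using M(2) by (simp add: ZS)
      then show ?thesis using M(1) unfolding chief_def by blast
    qed
    have finZ: "finite (Z i)" for i
      by (rule finite_subset[OF subset_trans[OF ZF F.subset] fin])
    have "\<exists>r. Z r = F"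
    proof (rule ccontr)
      assume "\<nexists>r. Z r = F"
      then have "card (Z i) < card (Z (Suc i))" for i
        using grow finZ by (intro psubset_card_mono) auto
      then have "strict_mono (\<lambda>i. card (Z i))" by (simp add: strict_mono_Suc_iff)
      then have "Suc (order G) \<le> card (Z (Suc (order G)))" by (rule strict_mono_imp_increasing)
      moreover have "card (Z (Suc (order G))) \<le> order G"
        unfolding order_def using fin normal_subset[OF nZ] by (rule card_mono)
      ultimately show False by simp
    qed
    then obtain r where r: "Z r = F" by blast
    have Z1ab: "U \<subseteq> centralizer_mod V U" if "U \<subseteq> Z 1" for U
      using that ZS[of 0] Z0 centralizer_mod_antimono[of U F V] by auto
    \<comment> \<open>The first term above \<open>V\<close> is a \<open>p\<close>-group modulo \<open>V\<close>: a prime \<open>q\<close> other than \<open>p\<close> would give a forbidden \<open>U\<close>.\<close>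
    have cop_step: "x \<in> V" if "coprime s p" "x \<in> Z 1" "x [^] s \<in> V" for s x
      using that
    proof (induction s rule: less_induct)
      case (less s)
      have xc: "x \<in> carrier G" using less.prems(2) ZF[of 1] Fc by blast
      show ?case
      proof (cases "s = 1")
        case True
        then show ?thesis using less.prems xc by simp
      next
        case False
        then obtain q where q: "prime q" "q dvd s" using prime_factor_nat by blast
        have "q \<noteq> p" using less.prems(1) q p(1) by (metis coprime_absorb_right not_prime_unit)
        obtain k where k: "s = q * k" using q by blast
        have "s \<noteq> 0" using less.prems(1) prime_gt_1_nat[OF p(1)] by (cases s) auto
        then have ks: "k < s" "k \<noteq> 0" using k prime_gt_1_nat[OF q(1)] by auto
        define U where "U = {u \<in> Z 1. u [^] q \<in> V}"
        have "U \<lhd> G" unfolding U_def by (rule roots_mod_normal[OF nV nZ Z1ab VZ]) simp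
        moreover have "V \<subseteq> U" using VZ[of 1] subgroup_pow_closed[OF V.subgroup_axioms] by (auto simp: U_def)
        ultimately have "U = V"
          by (intro no_U[OF q(1) \<open>q \<noteq> p\<close>] Z1ab) (auto simp: U_def)
        have "(x [^] k) [^] q \<in> V" using less.prems(3) xc k by (simp add: nat_pow_pow mult.commute)
        then have "x [^] k \<in> U"
          using subgroup_pow_closed[OF normal_imp_subgroup[OF nZ] less.prems(2)] by (simp add: U_def)
        then show ?thesis
          using less.IH[OF ks(1)] less.prems(1,2) \<open>U = V\<close> k by simp
      qed
    qed
    have dec: "\<exists>e y. n = p ^ e * y \<and> coprime y p" if n0: "n \<noteq> 0" for n :: nat
    proof -
      obtain y where "n = p ^ multiplicity p n * y" "\<not> p dvd y"
        using multiplicity_decompose'[of n p] n0 prime_gt_1_nat[OF p(1)] by auto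
      moreover from this have "coprime y p" using prime_imp_coprime_nat[OF p(1), of y] by (simp add: coprime_commute)
      ultimately show ?thesis by blast
    qed
    have pow_card: "x [^] card X = \<one>" if X: "subgroup X G" and x: "x \<in> X" for x X
    proof -
      have "x [^] (card X div card {\<one>}) \<in> {\<one>}"
        using subgroup.subset[OF X] subgroup.one_closed[OF X] finite_subset[OF _ fin] x
        by (intro pow_index_in_subgroup[OF _ X triv_subgroup]) auto
      then show ?thesis by simp
    qed
    have "card (Z 1) \<noteq> 0" using finZ[of 1] one_in[OF nZ[of 1]] by auto
    then obtain e y where ey: "card (Z 1) = p ^ e * y" "coprime y p" using dec by blast
    have Z1p: "x [^] (p ^ e) \<in> V" if x: "x \<in> Z 1" for x
    proof (rule cop_step[OF ey(2)])
      show "x [^] (p ^ e) \<in> Z 1" by (rule subgroup_pow_closed[OF normal_imp_subgroup[OF nZ] x])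
      have "(x [^] (p ^ e)) [^] y = x [^] card (Z 1)" using Fc[OF subsetD[OF ZF x]] ey(1) by (simp add: nat_pow_pow)
      then show "(x [^] (p ^ e)) [^] y \<in> V" using pow_card[OF normal_imp_subgroup[OF nZ] x] by simp
    qed
    \<comment> \<open>The exponent of one upper central factor divides that of the factor below it.\<close>
    have Zp: "\<forall>x\<in>Z (Suc i). x [^] (p ^ e) \<in> Z i" for i
    proof (induction i)
      case 0
      then show ?case using Z1p by (simp add: Z0)
    next
      case (Suc i)
      show ?case
      proof
        fix x assume x: "x \<in> Z (Suc (Suc i))"
        have xF: "x \<in> F" "x \<in> carrier G" using subsetD[OF ZF x] Fc by auto
        have sZ: "subgroup (Z j) G" for j by (rule normal_imp_subgroup[OF nZ])
        have "commutator (x [^] (p ^ e)) y \<in> Z i" if y: "y \<in> F" for y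
        proof -
          have yc: "y \<in> carrier G" using y Fc by blast
          have c: "commutator x y \<in> Z (Suc i)" using x y unfolding ZS[of "Suc i"] centralizer_mod_def by blast
          then have "commutator (commutator x y) x \<in> Z i" using xF unfolding ZS[of i] centralizer_mod_def by blast
          then have "inv (commutator (commutator x y) x) \<in> Z i" using subgroup.m_inv_closed[OF sZ] by blast
          then have "x \<in> centralizer_mod (Z i) {commutator x y}"
            using xF yc by (simp add: centralizer_mod_def inv_commutator)
          from commutator_pow_mod[OF nZ xF(2) yc this, of "p ^ e"]
          obtain a where "a \<in> Z i" "commutator (x [^] (p ^ e)) y = a \<otimes> commutator x y [^] (p ^ e)" by blast
          moreover have "commutator x y [^] (p ^ e) \<in> Z i" using Suc c by blast
          ultimately show ?thesis using subgroup.m_closed[OF sZ] by simp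
        qed
        then show "x [^] (p ^ e) \<in> Z (Suc i)"
          using subgroup_pow_closed[OF F.subgroup_axioms xF(1)] xF by (simp add: ZS[of i] centralizer_mod_def)
      qed
    qed
    have Fp: "x [^] ((p ^ e) ^ i * p) = \<one>" if "x \<in> Z i" for x i
      using that
    proof (induction i arbitrary: x)
      case 0
      then show ?case using exp by (simp add: Z0)
    next
      case (Suc i)
      have "x \<in> carrier G" using Fc[OF subsetD[OF ZF Suc.prems]] .
      then have "x [^] ((p ^ e) ^ Suc i * p) = (x [^] (p ^ e)) [^] ((p ^ e) ^ i * p)" by (simp add: nat_pow_pow mult.assoc)
      moreover have "x [^] (p ^ e) \<in> Z i" using Zp Suc.prems by blast
      ultimately show ?case using Suc.IH by simp
    qed
    have finF: "finite F" using finZ[of r] r by simp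
    have "F \<noteq> {}" using F.one_closed by blast
    then have "card F \<noteq> 0" using finF by simp
    then obtain a y where ay: "card F = p ^ a * y" "coprime y p" using dec by blast
    have "y = 1"
    proof (rule ccontr)
      assume "y \<noteq> 1"
      then obtain q where q: "prime q" "q dvd y" using prime_factor_nat by blast
      have "q \<noteq> p" using ay(2) q coprime_common_divisor_nat[of y p p] prime_gt_1_nat[OF p(1)] by auto
      then have cop: "coprime q ((p ^ e) ^ r * p)" using q p by (simp add: primes_coprime)
      interpret GF: group "G\<lparr>carrier := F\<rparr>" by (rule subgroup_imp_group[OF F.subgroup_axioms])
      obtain x where x: "x \<in> F" "x \<noteq> \<one>" "x [^] q = \<one>"
        using GF.cauchy_element[OF _ q(1)] finF q(2) ay(1) by (auto simp: order_def simp flip: nat_pow_consistent)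
      then have "x \<in> {\<one>}"
        using coprime_pow_mem[OF triv_subgroup Fc[OF x(1)] _ _ cop] Fp[of x r] r by simp
      then show False using x(2) by simp
    qed
    then have cF: "card F = p ^ a" using ay by simp
    have "p dvd card V"
    proof (rule ccontr)
      assume "\<not> p dvd card V"
      then have "coprime p (card V)" using p(1) prime_imp_coprime_nat by blast
      then show False
        using coprime_pow_mem[OF triv_subgroup Vc[OF v0(1)], of p "card V"] exp[OF v0(1)]
          pow_card[OF V.subgroup_axioms v0(1)] v0(2) by simp
    qed
    from p_group_fixed_point[OF fin p(1) F.subgroup_axioms cF nV this]
    obtain v where v: "v \<in> V" "v \<noteq> \<one>" "\<And>g. g \<in> F \<Longrightarrow> commutator g v = \<one>" by blast
    have cF: "centralizer_mod {\<one>} F \<lhd> G"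
      using F.inv_op_closed2 Fc by (intro centralizer_mod_normal[OF one]) auto
    have "commutator v g = \<one>" if "g \<in> F" for g
      using inv_commutator[OF Fc[OF that] Vc[OF v(1)]] v(3)[OF that] by simp
    then have "v \<in> V \<inter> centralizer_mod {\<one>} F" using v Vc by (simp add: centralizer_mod_def)
    then have "V \<inter> centralizer_mod {\<one>} F \<noteq> {\<one>}" using v(2) by blast
    then have "V \<inter> centralizer_mod {\<one>} F = V" using Vmin[OF normal_Int[OF nV cF]] by blast
    then have "V \<subseteq> centralizer_mod {\<one>} F" by blast
    then have "F \<subseteq> centralizer_mod {\<one>} V" by (rule centralizer_mod_sym[OF triv_subgroup V.subset F.subset])
    then show ?thesis using DF not_cent by blast
  qed
  then have "centralizer_mod {\<one>} V = V" by (simp add: C_def)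
  then show ?thesis using p(1) exp ab by (intro exI[of _ p]) simp
qed

end

section \<open>Minimal normal subgroups under polynomial index growth\<close>

lemma quasipoly_le_powr:
  assumes "M \<ge> 1"
  shows "real (quasipoly M) \<le> real M powr (1 + log 2 (real M))"
proof -
  have "floor_log M = nat \<lfloor>log 2 (real M)\<rfloor>" using assms by (simp add: floor_log_altdef)
  moreover have "log 2 (real M) \<ge> 0" using assms by simp
  ultimately have "real (floor_log M) \<le> log 2 (real M)" by linarith
  then have "real M powr real (1 + floor_log M) \<le> real M powr (1 + log 2 (real M))"
    using assms by (intro powr_mono) auto
  then show ?thesis using assms by (simp only: quasipoly_def of_nat_power powr_realpow) (simp add: powr_realpow)?
qed

text \<open>Taking logarithms, \<open>M log q \<le> \<alpha> (3 log q + 8 log f(M))\<close> with \<open>log f(M) = O((log M)\<^sup>2)\<close>.  So \<open>M\<close> cannot be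
  large, whatever \<open>q\<close> is.\<close>

lemma dimension_bound:
  fixes \<alpha> :: real
  shows "\<exists>M0::nat. \<forall>q M n p. p \<le> q \<longrightarrow> 2 \<le> q \<longrightarrow> 1 \<le> M \<longrightarrow> n \<le> q ^ 2 * quasipoly M ^ 8 \<longrightarrow>
           real (q ^ M) \<le> real (n * p) powr \<alpha> \<longrightarrow> 1 \<le> n * p \<longrightarrow> M \<le> M0"
proof -
  define a where "a = max \<alpha> 1"
  have a1: "a \<ge> 1" "\<alpha> \<le> a" by (auto simp: a_def)
  \<comment> \<open>One half of \<open>M log q\<close> absorbs the term \<open>3 a log q\<close>, which is why \<open>M0\<close> is also at least \<open>6 a\<close>; the other
    half has to be compared with the logarithm of the quasi-polynomial.\<close>
  have "\<forall>\<^sub>F x in at_top. a * (8 * (1 + ln x / ln 2) * ln x) < (x / 2) * ln (2::real)"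
    by real_asymp
  then obtain X where X: "\<And>x. x \<ge> X \<Longrightarrow> a * (8 * (1 + ln x / ln 2) * ln x) < (x / 2) * ln (2::real)"
    by (auto simp: eventually_at_top_linorder)
  define M0 where "M0 = nat \<lceil>max X (6 * a)\<rceil>"
  show ?thesis
  proof (intro exI[of _ M0] allI impI)
    fix q M n p :: nat
    assume pq: "p \<le> q" and q2: "2 \<le> q" and M1: "1 \<le> M" and n: "n \<le> q ^ 2 * quasipoly M ^ 8"
      and le: "real (q ^ M) \<le> real (n * p) powr \<alpha>" and np1: "1 \<le> n * p"
    show "M \<le> M0"
    proof (rule ccontr)
      assume "\<not> M \<le> M0"
      then have "real M > max X (6 * a)" unfolding M0_def by linarith
      then have MX: "real M \<ge> X" "real M \<ge> 6 * a" by auto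
      have qp: "quasipoly M \<ge> 1" by (rule quasipoly_pos[OF M1])
      define Q where "Q = real (quasipoly M)"
      have Q1: "Q \<ge> 1" using qp by (simp add: Q_def)
      have "n * p \<le> (q ^ 2 * quasipoly M ^ 8) * q" using n pq by (rule mult_le_mono)
      then have "real (n * p) \<le> real ((q ^ 2 * quasipoly M ^ 8) * q)" by (rule of_nat_mono)
      also have "\<dots> = real q ^ 3 * Q ^ 8" by (simp add: Q_def power3_eq_cube power2_eq_square)
      finally have npb: "real (n * p) \<le> real q ^ 3 * Q ^ 8" .
      have np1': "1 \<le> real (n * p)" using np1 by (metis of_nat_1 of_nat_mono)
      have "real (q ^ M) \<le> real (n * p) powr a"
        using le powr_mono[OF a1(2) np1'] by linarith
      then have "ln (real (q ^ M)) \<le> ln (real (n * p) powr a)"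
        using q2 by (intro ln_mono) auto
      then have "real M * ln (real q) \<le> a * ln (real (n * p))"
        using q2 np1' by (simp add: ln_realpow ln_powr)
      also have "\<dots> \<le> a * ln (real q ^ 3 * Q ^ 8)"
        using a1 npb np1' by (intro mult_left_mono ln_mono) auto
      also have "ln (real q ^ 3 * Q ^ 8) = 3 * ln (real q) + 8 * ln Q"
        using q2 Q1 by (simp add: ln_mult ln_realpow)
      finally have main: "real M * ln (real q) \<le> 3 * a * ln (real q) + a * (8 * ln Q)"
        by (simp add: algebra_simps)
      have lq: "ln (real q) \<ge> ln 2" "ln (2::real) > 0" using q2 by auto
      have "3 * a * ln (real q) \<le> (real M / 2) * ln (real q)"
        using MX(2) lq by (intro mult_right_mono) linarith+
      then have "(real M / 2) * ln (real q) \<le> a * (8 * ln Q)" using main by (simp add: field_simps)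
      moreover have "(real M / 2) * ln 2 \<le> (real M / 2) * ln (real q)"
        using lq by (intro mult_left_mono) auto
      ultimately have A: "(real M / 2) * ln 2 \<le> a * (8 * ln Q)" by linarith
      have "ln Q \<le> ln (real M powr (1 + log 2 (real M)))"
        using quasipoly_le_powr[OF M1] Q1 unfolding Q_def by (intro ln_mono) auto
      also have "\<dots> = (1 + ln (real M) / ln 2) * ln (real M)"
        using M1 by (simp add: ln_powr log_def)
      finally have "a * (8 * ln Q) \<le> a * (8 * ((1 + ln (real M) / ln 2) * ln (real M)))"
        using a1 by (intro mult_left_mono) auto
      also have "\<dots> = a * (8 * (1 + ln (real M) / ln 2) * ln (real M))" by (simp only: mult.assoc)
      finally show False using A X[OF MX(1)] by linarith
    qed
  qed
qed

text \<open>A common multiple of the exponents \<open>w\<close> that \<open>linear_bound\<close> provides for those dimensions \<open>M\<close> that are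
  compatible with polynomial index growth of degree \<open>\<alpha>\<close>.\<close>

definition PIG_exponent :: "real \<Rightarrow> nat \<Rightarrow> bool" where
  "PIG_exponent \<alpha> N \<longleftrightarrow> N \<ge> 1 \<and>
     (\<forall>q M n p w. p \<le> q \<longrightarrow> 2 \<le> q \<longrightarrow> 1 \<le> M \<longrightarrow> n \<le> q ^ 2 * quasipoly M ^ 8 \<longrightarrow>
        real (q ^ M) \<le> real (n * p) powr \<alpha> \<longrightarrow> 1 \<le> n * p \<longrightarrow>
        1 \<le> w \<longrightarrow> w \<le> quasipoly (quasipoly M ^ 8) \<longrightarrow> w dvd N)"

lemma PIG_exponent_exists: "\<exists>N. PIG_exponent \<alpha> N"
proof -
  obtain M0 where M0: "\<And>q M n p :: nat. p \<le> q \<Longrightarrow> 2 \<le> q \<Longrightarrow> 1 \<le> M \<Longrightarrow> n \<le> q ^ 2 * quasipoly M ^ 8 \<Longrightarrow>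
      real (q ^ M) \<le> real (n * p) powr \<alpha> \<Longrightarrow> 1 \<le> n * p \<Longrightarrow> M \<le> M0"
    using dimension_bound[of \<alpha>] by blast
  define N :: nat where "N = fact (quasipoly (quasipoly M0 ^ 8))"
  have "w dvd N" if "1 \<le> w" "w \<le> quasipoly (quasipoly M ^ 8)" "M \<le> M0" for w M
  proof -
    have "quasipoly M ^ 8 \<le> quasipoly M0 ^ 8" using quasipoly_mono[OF that(3)] by (intro power_mono) auto
    then have "w \<le> quasipoly (quasipoly M0 ^ 8)" using quasipoly_mono that(2) le_trans by blast
    then show ?thesis unfolding N_def using that(1) by (intro dvd_fact)
  qed
  then have "PIG_exponent \<alpha> N" unfolding PIG_exponent_def using M0 by (auto simp: N_def)
  then show ?thesis by blast
qed

context group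
begin

lemma power_subgroup_dvd_mono:
  assumes "w dvd n"
  shows "power_subgroup G n \<subseteq> power_subgroup G w"
proof -
  obtain k where k: "n = w * k" using assms by blast
  show ?thesis
  proof (rule power_subgroup_subset[OF normal_imp_subgroup[OF power_subgroup_normal]])
    fix x assume x: "x \<in> carrier G"
    have "(x [^] w) [^] k \<in> power_subgroup G w"
      by (rule subgroup_pow_closed[OF normal_imp_subgroup[OF power_subgroup_normal] pow_in_power_subgroup[OF x]])
    then show "x [^] n \<in> power_subgroup G w" using x k by (simp add: nat_pow_pow)
  qed
qed

lemma conjugation_irreducible_action:
  assumes sol: "solvable G" and fin: "finite (carrier G)" and V: "chief {\<one>} V"
    and ab: "V \<subseteq> centralizer_mod {\<one>} V"
  shows "irreducible_action G (G\<lparr>carrier := V\<rparr>) (\<lambda>g v. g \<otimes> v \<otimes> inv g)"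
proof -
  have nV: "V \<lhd> G" and V1: "{\<one>} \<subset> V" using V by (auto simp: chief_def)
  interpret V: normal V G by (rule nV)
  have Vc: "v \<in> carrier G" if "v \<in> V" for v using that V.subset by blast
  interpret V': comm_group "G\<lparr>carrier := V\<rparr>" by (rule abelian_imp_comm_group[OF V.subgroup_axioms ab])
  have "linear_action G (G\<lparr>carrier := V\<rparr>) (\<lambda>g v. g \<otimes> v \<otimes> inv g)"
  proof (intro linear_action.intro linear_action_axioms.intro)
    fix g assume g: "g \<in> carrier G"
    then show "(\<lambda>v. g \<otimes> v \<otimes> inv g) \<in> hom (G\<lparr>carrier := V\<rparr>) (G\<lparr>carrier := V\<rparr>)"
      using V.inv_op_closed2[OF g] Vc by (auto simp: hom_def word_simps)
  next
    fix g h v assume "g \<in> carrier G" "h \<in> carrier G" "v \<in> carrier (G\<lparr>carrier := V\<rparr>)"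
    then show "g \<otimes> h \<otimes> v \<otimes> inv (g \<otimes> h) = g \<otimes> (h \<otimes> v \<otimes> inv h) \<otimes> inv g" using Vc by (simp add: word_simps)
  next
    fix v assume "v \<in> carrier (G\<lparr>carrier := V\<rparr>)"
    then show "\<one> \<otimes> v \<otimes> inv \<one> = v" using Vc by simp
  next
    show "finite (carrier (G\<lparr>carrier := V\<rparr>))" using finite_subset[OF V.subset fin] by simp
  qed (rule is_group, rule V'.comm_group_axioms, rule fin)
  then interpret L: linear_action G "G\<lparr>carrier := V\<rparr>" "\<lambda>g v. g \<otimes> v \<otimes> inv g" .
  show ?thesis
  proof (intro irreducible_action.intro irreducible_action_axioms.intro L.linear_action_axioms)
    show "carrier (G\<lparr>carrier := V\<rparr>) \<noteq> {\<one>\<^bsub>G\<lparr>carrier := V\<rparr>\<^esub>}" using V1 by auto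
    show "solvable G" by (rule sol)
    fix W assume "L.invariant W"
    then have W: "subgroup W (G\<lparr>carrier := V\<rparr>)" and inv: "\<And>g w. g \<in> carrier G \<Longrightarrow> w \<in> W \<Longrightarrow> g \<otimes> w \<otimes> inv g \<in> W"
      by (auto simp: L.invariant_def)
    have "W \<lhd> G" unfolding normal_inv_iff using incl_subgroup[OF V.subgroup_axioms W] inv by blast
    moreover have "W \<subseteq> V" using subgroup.subset[OF W] by simp
    moreover have "{\<one>} \<subseteq> W" using subgroup.one_closed[OF W] by simp
    ultimately show "W = {\<one>\<^bsub>G\<lparr>carrier := V\<rparr>\<^esub>} \<or> W = carrier (G\<lparr>carrier := V\<rparr>)"
      using V by (simp add: chief_def)
  qed
qed

text \<open>Otherwise \<open>V\<close> is its own centralizer, so that the exponent of \<open>G\<close> divides \<open>n p\<close>, where \<open>n\<close> is an exponent for the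
  action on \<open>V\<close>.  Polynomial index growth then bounds \<open>\<bar>V\<bar>\<close> by \<open>(n p)\<^sup>\<alpha>\<close>, and \<open>N\<close> was chosen for this case.\<close>

theorem minimal_normal_centralized:
  assumes sol: "solvable G" and fin: "finite (carrier G)" and N: "PIG_exponent \<alpha> N"
    and pig: "\<And>n. n \<ge> 1 \<Longrightarrow> power_subgroup G n = {\<one>} \<Longrightarrow> real (order G) \<le> real n powr \<alpha>"
    and V: "chief {\<one>} V"
    and above: "\<And>L M d m. chief L M \<Longrightarrow> L \<noteq> {\<one>} \<Longrightarrow> d \<in> derived G (derived G (power_subgroup G N))
       \<Longrightarrow> m \<in> M \<Longrightarrow> commutator d m \<in> L"
  shows "derived G (derived G (power_subgroup G N)) \<subseteq> centralizer_mod {\<one>} V"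
proof (rule ccontr)
  define D where "D = derived G (derived G (power_subgroup G N))"
  assume "\<not> derived G (derived G (power_subgroup G N)) \<subseteq> centralizer_mod {\<one>} V"
  then have nc: "\<not> D \<subseteq> centralizer_mod {\<one>} V" by (simp add: D_def)
  have D: "D \<lhd> G" unfolding D_def by (intro second_derived_normal power_subgroup_normal)
  obtain p :: nat where p: "prime p" "\<And>v. v \<in> V \<Longrightarrow> v [^] p = \<one>" "V \<subseteq> centralizer_mod {\<one>} V" "centralizer_mod {\<one>} V = V"
    using self_centralizing_if_not_centralized[OF sol fin V D _ nc] above unfolding D_def by blast
  have nV: "V \<lhd> G" using V by (simp add: chief_def)
  have Vc: "v \<in> carrier G" if "v \<in> V" for v using that normal_subset[OF nV] by blast
  let ?act = "\<lambda>g v. g \<otimes> v \<otimes> inv g"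
  have "linear_bound p G (G\<lparr>carrier := V\<rparr>) ?act"
    using p(2) by (intro solvable_linear_bound conjugation_irreducible_action[OF sol fin V p(3)] p(1))
      (auto simp flip: nat_pow_consistent)
  then obtain q M n w where pq: "p \<le> q" and M: "1 \<le> M" and cV: "card V = q ^ M" and n1: "1 \<le> n"
      and n: "n \<le> q ^ 2 * quasipoly M ^ 8" "\<And>g v. g \<in> carrier G \<Longrightarrow> v \<in> V \<Longrightarrow> ?act (g [^] n) v = v"
      and w: "1 \<le> w" "w \<le> quasipoly (quasipoly M ^ 8)"
        "\<And>g v. g \<in> derived G (derived G (power_subgroup G w)) \<Longrightarrow> v \<in> V \<Longrightarrow> ?act g v = v"
    unfolding linear_bound_def by auto
  have comm1: "commutator g v = \<one>" if "?act g v = v" "g \<in> carrier G" "v \<in> V" for g v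
    using that Vc by (simp add: commutator_def)
  have "g [^] (n * p) = \<one>" if g: "g \<in> carrier G" for g
  proof -
    have "g [^] n \<in> centralizer_mod {\<one>} V" using n(2)[OF g] comm1 g by (simp add: centralizer_mod_def)
    then have "(g [^] n) [^] p = \<one>" using p(2,4) by simp
    then show ?thesis using g by (simp add: nat_pow_pow)
  qed
  then have "power_subgroup G (n * p) \<subseteq> {\<one>}" by (intro power_subgroup_subset[OF triv_subgroup]) simp
  then have "power_subgroup G (n * p) = {\<one>}"
    using subgroup.one_closed[OF normal_imp_subgroup[OF power_subgroup_normal]] by blast
  moreover have np: "1 \<le> n * p" using n1 prime_gt_1_nat[OF p(1)] by simp
  ultimately have oG: "real (order G) \<le> real (n * p) powr \<alpha>" using pig by blast
  have "q ^ M \<le> order G" unfolding order_def cV[symmetric] using fin normal_subset[OF nV] by (rule card_mono)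
  then have "real (q ^ M) \<le> real (n * p) powr \<alpha>" using oG by (meson of_nat_mono order_trans)
  moreover have "2 \<le> q" using pq prime_ge_2_nat[OF p(1)] by linarith
  ultimately have "w dvd N" using N pq M n(1) np w(1,2) unfolding PIG_exponent_def by blast
  then have "power_subgroup G N \<subseteq> power_subgroup G w" by (rule power_subgroup_dvd_mono)
  then have DD: "D \<subseteq> derived G (derived G (power_subgroup G w))" unfolding D_def by (intro mono_derived)
  have "D \<subseteq> centralizer_mod {\<one>} V"
  proof
    fix d assume d: "d \<in> D"
    then have dc: "d \<in> carrier G" using normal_subset[OF D] by blast
    have "commutator d v = \<one>" if "v \<in> V" for v using comm1[OF w(3)] d DD that dc by blast
    then show "d \<in> centralizer_mod {\<one>} V" using dc by (simp add: centralizer_mod_def)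
  qed
  then show False using nc by blast
qed

end

section \<open>Profinite groups as compact groups with a base of open normal subgroups\<close>

lemma compact_directed_Inter_nonempty:
  assumes "compact_space T" and ne: "\<N> \<noteq> {}" and cl: "\<And>A. A \<in> \<N> \<Longrightarrow> closedin T A \<and> A \<noteq> {}"
    and dir: "\<And>A B. A \<in> \<N> \<Longrightarrow> B \<in> \<N> \<Longrightarrow> \<exists>C\<in>\<N>. C \<subseteq> A \<inter> B"
  shows "\<Inter>\<N> \<noteq> {}"
proof -
  have "\<exists>C\<in>\<N>. C \<subseteq> \<Inter>\<F>" if "finite \<F>" "\<F> \<subseteq> \<N>" for \<F>
    using that
  proof (induction \<F>)
    case empty
    then show ?case using ne by auto
  next
    case (insert A \<F>)
    then obtain C where "C \<in> \<N>" "C \<subseteq> \<Inter>\<F>" by auto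
    then show ?case using dir[of A C] insert.prems by (simp) (meson inf_le1 inf_le2 subset_trans le_inf_iff)
  qed
  then have "\<Inter>\<F> \<noteq> {}" if "finite \<F>" "\<F> \<subseteq> \<N>" for \<F> using that cl by (metis subset_empty)
  then have "(\<forall>C\<in>\<N>. closedin T C) \<and> (\<forall>\<F>. finite \<F> \<and> \<F> \<subseteq> \<N> \<longrightarrow> \<Inter>\<F> \<noteq> {})"
    using cl by simp
  then show ?thesis using assms(1)[unfolded compact_space_fip, rule_format, of \<N>] by simp
qed

lemma topological_group_right_translation:
  assumes "topological_group G T" "g \<in> carrier G"
  shows "continuous_map T T (\<lambda>x. x \<otimes>\<^bsub>G\<^esub> g)"
proof -
  have tg: "topspace T = carrier G" "continuous_map (prod_topology T T) T (\<lambda>(x, y). x \<otimes>\<^bsub>G\<^esub> y)"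
    using assms by (auto simp: topological_group_def)
  have "continuous_map T (prod_topology T T) (\<lambda>x. (x, g))"
    using assms(2) tg(1) by (simp add: continuous_map_pairedI)
  from continuous_map_compose[OF this tg(2)] show ?thesis by (simp add: o_def)
qed

context group
begin

text \<open>Such a set and its complement are unions of cosets of \<open>L\<close>, which are open.\<close>

lemma openin_if_coset_invariant:
  assumes tg: "topological_group G T" and L: "subgroup L G" "openin T L"
    and S: "S \<subseteq> carrier G" "\<And>l s. l \<in> L \<Longrightarrow> s \<in> S \<Longrightarrow> l \<otimes> s \<in> S"
  shows "openin T S" and "closedin T S"
proof -
  have top: "topspace T = carrier G" using tg by (simp add: topological_group_def)
  have op: "openin T X" if X: "X \<subseteq> carrier G" "\<And>l s. l \<in> L \<Longrightarrow> s \<in> X \<Longrightarrow> l \<otimes> s \<in> X" for X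
  proof (subst openin_subopen, intro ballI)
    fix x assume x: "x \<in> X"
    then have xc: "x \<in> carrier G" using X by blast
    let ?U = "{y \<in> topspace T. y \<otimes> inv x \<in> L}"
    have "openin T ?U"
      by (rule openin_continuous_map_preimage[OF topological_group_right_translation[OF tg] L(2)]) (use xc in simp)
    moreover have "x \<in> ?U" using xc subgroup.one_closed[OF L(1)] by (simp add: top)
    moreover have "?U \<subseteq> X"
    proof
      fix y assume y: "y \<in> ?U"
      then have "(y \<otimes> inv x) \<otimes> x \<in> X" using X(2) x by blast
      then show "y \<in> X" using y xc by (simp add: top m_assoc)
    qed
    ultimately show "\<exists>U. openin T U \<and> x \<in> U \<and> U \<subseteq> X" by blast
  qed
  show "openin T S" by (rule op[OF S])
  have "openin T (carrier G - S)"
  proof (rule op)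
    fix l s assume l: "l \<in> L" and s: "s \<in> carrier G - S"
    have lc: "l \<in> carrier G" using l subgroup.subset[OF L(1)] by blast
    have "inv l \<otimes> (l \<otimes> s) \<in> S" if "l \<otimes> s \<in> S" using S(2) that l subgroup.m_inv_closed[OF L(1)] by blast
    then show "l \<otimes> s \<in> carrier G - S" using s lc by (auto simp: inv_mult_cancel)
  qed blast
  then show "closedin T S" using S(1) by (simp add: closedin_def top)
qed

end

text \<open>What is needed of a profinite group: a filter base of open normal subgroups with trivial
  intersection in a compact group.\<close>

lemma pro_imp_compact_open_base:
  assumes "pro C G T"
  shows "topological_group G T" and "compact_space T"
    and "\<exists>\<N>. \<N> \<noteq> {} \<and> \<Inter>\<N> = {\<one>\<^bsub>G\<^esub>} \<and> (\<forall>A\<in>\<N>. \<forall>B\<in>\<N>. \<exists>D\<in>\<N>. D \<subseteq> A \<inter> B) \<and>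
      (\<forall>N\<in>\<N>. N \<lhd> G \<and> openin T N \<and>
        (\<exists>(F :: nat monoid) h. group F \<and> finite (carrier F) \<and> C F \<and> h \<in> hom G F \<and> kernel G F h = N))"
proof -
  show tg: "topological_group G T" using assms by (simp add: pro_def)
  then interpret G: group G by (simp add: topological_group_def)
  have top: "topspace T = carrier G" using tg by (simp add: topological_group_def)
  obtain I :: "'a set set" and r and F :: "'a set \<Rightarrow> nat monoid" and \<phi> and f
    where sys: "inverse_system I r F \<phi>" and fin: "\<And>i. i \<in> I \<Longrightarrow> finite (carrier (F i)) \<and> C (F i)"
      and f: "f \<in> iso G (inverse_limit I r F \<phi>)" "homeomorphic_map T (inverse_limit_topology I r F \<phi>) f"
    using assms unfolding pro_def by blast
  interpret S: inverse_system I r F \<phi> by (rule sys)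
  define P where "P = product_topology (\<lambda>i. discrete_topology (carrier (F i))) I"
  define L where "L = carrier (inverse_limit I r F \<phi>)"
  have Leq: "L = {x \<in> (\<Pi>\<^sub>E i\<in>I. carrier (F i)). \<forall>(i, j)\<in>r. \<phi> i j (x j) = x i}"
    by (simp add: L_def inverse_limit_def product_group_def)
  have rI: "r \<subseteq> I \<times> I" using S.partial_order by (auto simp: partial_order_on_def preorder_on_def refl_on_def)
  have topP: "topspace P = (\<Pi>\<^sub>E i\<in>I. carrier (F i))" by (simp add: P_def)
  have proj: "continuous_map P (discrete_topology (carrier (F i))) (\<lambda>x. x i)" if "i \<in> I" for i
    unfolding P_def by (rule continuous_map_product_projection[OF that])
  have "compact_space P"
    unfolding P_def using fin by (simp add: compact_space_product_topology compact_space_discrete_topology)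
  moreover have "closedin P L"
  proof -
    have cl: "closedin P {x \<in> topspace P. \<phi> i j (x j) = x i}" if ij: "(i, j) \<in> r" for i j
    proof -
      have I: "i \<in> I" "j \<in> I" using rI ij by auto
      have "openin P {x \<in> topspace P. \<phi> i j (x j) \<noteq> x i}"
      proof (subst openin_subopen, intro ballI)
        fix x assume x: "x \<in> {x \<in> topspace P. \<phi> i j (x j) \<noteq> x i}"
        let ?U = "{y \<in> topspace P. y i \<in> {x i}} \<inter> {y \<in> topspace P. y j \<in> {x j}}"
        have "x i \<in> carrier (F i)" "x j \<in> carrier (F j)" using x I by (auto simp: topP)
        then have "openin P ?U"
          by (intro openin_Int openin_continuous_map_preimage[OF proj] I) auto
        then show "\<exists>U. openin P U \<and> x \<in> U \<and> U \<subseteq> {x \<in> topspace P. \<phi> i j (x j) \<noteq> x i}"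
          using x by (intro exI[of _ ?U]) auto
      qed
      moreover have "{x \<in> topspace P. \<phi> i j (x j) = x i} = topspace P - {x \<in> topspace P. \<phi> i j (x j) \<noteq> x i}" by blast
      ultimately show ?thesis by (metis (no_types, lifting) closedin_diff closedin_topspace)
    qed
    have "L = topspace P \<inter> \<Inter>((\<lambda>(i, j). {x \<in> topspace P. \<phi> i j (x j) = x i}) ` r)"
      by (auto simp: Leq topP)
    moreover have "closedin P (\<Inter>(insert (topspace P) ((\<lambda>(i, j). {x \<in> topspace P. \<phi> i j (x j) = x i}) ` r)))"
      using cl by (intro closedin_Inter) auto
    ultimately show ?thesis by simp
  qed
  ultimately have "compactin P L" by (rule closedin_compact_space)
  then have "compact_space (inverse_limit_topology I r F \<phi>)"
    unfolding inverse_limit_topology_def P_def[symmetric] L_def[symmetric] by (rule compact_space_subtopology)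
  then show "compact_space T"
    using homeomorphic_compact_space[OF homeomorphic_map_imp_homeomorphic_space[OF f(2)]] by simp
  have fL: "f g \<in> L" if "g \<in> carrier G" for g using f(1) that by (auto simp: iso_def hom_def L_def)
  have fF: "f g i \<in> carrier (F i)" if "g \<in> carrier G" "i \<in> I" for g i
    using fL[OF that(1)] that(2) by (auto simp: Leq)
  have fcomp: "\<phi> i j (f g j) = f g i" if "g \<in> carrier G" "(i, j) \<in> r" for g i j
    using fL[OF that(1)] that(2) by (auto simp: Leq)
  have fcont: "continuous_map T P f"
    using homeomorphic_imp_continuous_map[OF f(2)]
    by (auto simp: inverse_limit_topology_def P_def dest: continuous_map_into_fulltopology)
  have fhom: "(\<lambda>g. f g i) \<in> hom G (F i)" if i: "i \<in> I" for i
  proof (rule homI)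
    fix g h assume gh: "g \<in> carrier G" "h \<in> carrier G"
    have "f (g \<otimes>\<^bsub>G\<^esub> h) = f g \<otimes>\<^bsub>inverse_limit I r F \<phi>\<^esub> f h" using f(1) gh by (auto simp: iso_def hom_def)
    then show "f (g \<otimes>\<^bsub>G\<^esub> h) i = f g i \<otimes>\<^bsub>F i\<^esub> f h i" using i by (simp add: inverse_limit_def product_group_def)
  qed (use fF i in auto)
  define N where "N = (\<lambda>i. kernel G (F i) (\<lambda>g. f g i))"
  have Nn: "N i \<lhd> G" if "i \<in> I" for i
  proof -
    interpret group_hom G "F i" "\<lambda>g. f g i"
      using S.groups[OF that] fhom[OF that] by (simp add: group_hom_def group_hom_axioms_def)
    show ?thesis unfolding N_def by (rule normal_kernel)
  qed
  have No: "openin T (N i)" if i: "i \<in> I" for i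
  proof -
    have c: "continuous_map T (discrete_topology (carrier (F i))) (\<lambda>g. f g i)"
      using continuous_map_compose[OF fcont proj[OF i]] by (simp add: o_def)
    have "openin T {g \<in> topspace T. f g i \<in> {\<one>\<^bsub>F i\<^esub>}}"
      using S.groups[OF i] by (intro openin_continuous_map_preimage[OF c]) (simp add: group.is_monoid)
    moreover have "{g \<in> topspace T. f g i \<in> {\<one>\<^bsub>F i\<^esub>}} = N i" by (auto simp: N_def kernel_def top)
    ultimately show ?thesis by simp
  qed
  have mono: "N k \<subseteq> N i" if "(i, k) \<in> r" for i k
  proof
    fix g assume g: "g \<in> N k"
    have ik: "i \<in> I" "k \<in> I" using rI that by auto
    have gc: "g \<in> carrier G" "f g k = \<one>\<^bsub>F k\<^esub>" using g by (auto simp: N_def kernel_def)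
    have "f g i = \<phi> i k \<one>\<^bsub>F k\<^esub>" using fcomp[OF gc(1) that] gc(2) by simp
    also have "\<dots> = \<one>\<^bsub>F i\<^esub>" using hom_one[OF S.homs[OF that]] S.groups ik by blast
    finally show "g \<in> N i" using gc by (simp add: N_def kernel_def)
  qed
  have "\<Inter>(N ` I) = {\<one>\<^bsub>G\<^esub>}"
  proof
    show "{\<one>\<^bsub>G\<^esub>} \<subseteq> \<Inter>(N ` I)"
      using subgroup.one_closed[OF normal_imp_subgroup[OF Nn]] by auto
    show "\<Inter>(N ` I) \<subseteq> {\<one>\<^bsub>G\<^esub>}"
    proof
      fix g assume g: "g \<in> \<Inter>(N ` I)"
      then have gi: "g \<in> carrier G" "\<And>i. i \<in> I \<Longrightarrow> f g i = \<one>\<^bsub>F i\<^esub>"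
        using S.nonempty by (auto simp: N_def kernel_def)
      have o: "f \<one>\<^bsub>G\<^esub> i = \<one>\<^bsub>F i\<^esub>" if "i \<in> I" for i
        using hom_one[OF fhom[OF that] G.is_group S.groups[OF that]] by simp
      have "f g = f \<one>\<^bsub>G\<^esub>"
      proof (rule PiE_ext)
        show "f g \<in> (\<Pi>\<^sub>E i\<in>I. carrier (F i))" "f \<one>\<^bsub>G\<^esub> \<in> (\<Pi>\<^sub>E i\<in>I. carrier (F i))"
          using fL[OF gi(1)] fL[OF G.one_closed] by (auto simp: Leq)
      qed (simp add: gi o)
      moreover have "inj_on f (carrier G)" using f(1) by (auto simp: iso_def bij_betw_def)
      ultimately show "g \<in> {\<one>\<^bsub>G\<^esub>}" using gi(1) by (auto dest: inj_onD)
    qed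
  qed
  moreover have "\<exists>D\<in>N ` I. D \<subseteq> A \<inter> B" if AB: "A \<in> N ` I" "B \<in> N ` I" for A B
  proof -
    obtain i j where ij: "i \<in> I" "j \<in> I" "A = N i" "B = N j" using AB by blast
    then obtain k where "k \<in> I" "(i, k) \<in> r" "(j, k) \<in> r" using S.directed by blast
    then show ?thesis using mono ij by blast
  qed
  moreover have "N i \<lhd> G \<and> openin T (N i) \<and>
      (\<exists>(F :: nat monoid) h. group F \<and> finite (carrier F) \<and> C F \<and> h \<in> hom G F \<and> kernel G F h = N i)" if "i \<in> I" for i
    using Nn[OF that] No[OF that] S.groups[OF that] fin[OF that] fhom[OF that]
    by (auto simp: N_def intro!: exI[of _ "F i"] exI[of _ "\<lambda>g. f g i"])
  ultimately show "\<exists>\<N>. \<N> \<noteq> {} \<and> \<Inter>\<N> = {\<one>\<^bsub>G\<^esub>} \<and> (\<forall>A\<in>\<N>. \<forall>B\<in>\<N>. \<exists>D\<in>\<N>. D \<subseteq> A \<inter> B) \<and>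
      (\<forall>N\<in>\<N>. N \<lhd> G \<and> openin T N \<and>
        (\<exists>(F :: nat monoid) h. group F \<and> finite (carrier F) \<and> C F \<and> h \<in> hom G F \<and> kernel G F h = N))"
    using S.nonempty by (intro exI[of _ "N ` I"]) auto
qed

text \<open>The quotients by the members of \<open>\<N>\<close>, ordered by reverse inclusion, form the inverse system.  A compatible
  family of cosets has a common element by compactness, which makes the natural map surjective, and a
  continuous bijection from a compact space to a Hausdorff space is a homeomorphism.\<close>

lemma proI:
  fixes G :: "('a, 'm) monoid_scheme"
  assumes tg: "topological_group G T" and comp: "compact_space T"
    and ne: "\<N> \<noteq> {}" and int: "\<Inter>\<N> = {\<one>\<^bsub>G\<^esub>}"
    and dir: "\<And>A B. A \<in> \<N> \<Longrightarrow> B \<in> \<N> \<Longrightarrow> \<exists>D\<in>\<N>. D \<subseteq> A \<inter> B"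
    and op: "\<And>N. N \<in> \<N> \<Longrightarrow> openin T N"
    and quot: "\<And>N. N \<in> \<N> \<Longrightarrow> \<exists>(F :: nat monoid) h. group F \<and> finite (carrier F) \<and> C F \<and> h \<in> hom G F \<and>
        h ` carrier G = carrier F \<and> kernel G F h = N"
  shows "pro C G T"
proof -
  interpret G: group G using tg by (simp add: topological_group_def)
  have top: "topspace T = carrier G" using tg by (simp add: topological_group_def)
  define Q where "Q = (\<lambda>N (F :: nat monoid, h). group F \<and> finite (carrier F) \<and> C F \<and> h \<in> hom G F \<and>
        h ` carrier G = carrier F \<and> kernel G F h = N)"
  have "\<forall>N\<in>\<N>. \<exists>p. Q N p"
  proof
    fix N assume "N \<in> \<N>"
    then obtain F :: "nat monoid" and h where "group F \<and> finite (carrier F) \<and> C F \<and> h \<in> hom G F \<and>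
        h ` carrier G = carrier F \<and> kernel G F h = N" using quot by blast
    then show "\<exists>p. Q N p" by (intro exI[of _ "(F, h)"]) (simp add: Q_def)
  qed
  from bchoice[OF this] obtain c where c: "\<And>N. N \<in> \<N> \<Longrightarrow> Q N (c N)" by blast
  define F where "F = (\<lambda>N. fst (c N))"
  define h where "h = (\<lambda>N. snd (c N))"
  have Fh: "group (F N :: nat monoid)" "finite (carrier (F N))" "C (F N)" "h N \<in> hom G (F N)"
      "h N ` carrier G = carrier (F N)" "kernel G (F N) (h N) = N" if "N \<in> \<N>" for N
    using c[OF that] by (auto simp: Q_def F_def h_def split: prod.splits)
  have gh: "group_hom G (F N) (h N)" if "N \<in> \<N>" for N
    using Fh that by (simp add: group_hom_def group_hom_axioms_def G.is_group)
  have sub: "subgroup N G" if "N \<in> \<N>" for N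
    using group_hom.subgroup_kernel[OF gh[OF that]] Fh(6)[OF that] by simp
  have hc: "h N g \<in> carrier (F N)" if "N \<in> \<N>" "g \<in> carrier G" for N g
    using Fh(4)[OF that(1)] that(2) by (auto simp: hom_def)
  have h_eq: "h N g = h N g' \<longleftrightarrow> g \<otimes>\<^bsub>G\<^esub> inv\<^bsub>G\<^esub> g' \<in> N"
    if N: "N \<in> \<N>" and g: "g \<in> carrier G" "g' \<in> carrier G" for N g g'
  proof -
    interpret group_hom G "F N" "h N" by (rule gh[OF N])
    have "g \<otimes>\<^bsub>G\<^esub> inv\<^bsub>G\<^esub> g' \<in> kernel G (F N) (h N) \<longleftrightarrow> h N g \<otimes>\<^bsub>F N\<^esub> inv\<^bsub>F N\<^esub> (h N g') = \<one>\<^bsub>F N\<^esub>"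
      using g by (simp add: kernel_def)
    also have "\<dots> \<longleftrightarrow> h N g = h N g'"
      using H.inv_solve_right[of "\<one>\<^bsub>F N\<^esub>" "h N g" "h N g'"] g by auto
    finally show ?thesis unfolding Fh(6)[OF N] by blast
  qed
  define r where "r = {(N, M). N \<in> \<N> \<and> M \<in> \<N> \<and> M \<subseteq> N}"
  define \<phi> where "\<phi> = (\<lambda>N M y. h N (inv_into (carrier G) (h M) y))"
  have \<phi>: "\<phi> N M (h M g) = h N g" if "(N, M) \<in> r" "g \<in> carrier G" for N M g
  proof -
    have NM: "N \<in> \<N>" "M \<in> \<N>" "M \<subseteq> N" using that by (auto simp: r_def)
    let ?g = "inv_into (carrier G) (h M) (h M g)"
    have "?g \<in> carrier G" "h M ?g = h M g"
      using inv_into_into[of "h M g" "h M" "carrier G"] f_inv_into_f[of "h M g" "h M" "carrier G"] that(2) by auto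
    then show ?thesis unfolding \<phi>_def using h_eq[OF NM(2)] h_eq[OF NM(1)] NM(3) that(2) by blast
  qed
  have rep: "\<exists>g\<in>carrier G. y = h N g" if "N \<in> \<N>" "y \<in> carrier (F N)" for N y
    using Fh(5)[OF that(1)] that(2) by blast
  have sys: "inverse_system \<N> r F \<phi>"
  proof (rule inverse_system.intro)
    show "\<N> \<noteq> {}" by (rule ne)
    show "partial_order_on \<N> r"
      by (auto simp: partial_order_on_def preorder_on_def refl_on_def trans_def antisym_def r_def)
    show "\<exists>k\<in>\<N>. (i, k) \<in> r \<and> (j, k) \<in> r" if "i \<in> \<N>" "j \<in> \<N>" for i j
      using dir[OF that] that by (auto simp: r_def)
    show "group (F i)" if "i \<in> \<N>" for i by (rule Fh(1)[OF that])
    show "\<phi> i j \<in> hom (F j) (F i)" if ij: "(i, j) \<in> r" for i j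
    proof (rule homI)
      have I: "i \<in> \<N>" "j \<in> \<N>" using ij by (auto simp: r_def)
      fix x assume "x \<in> carrier (F j)"
      then obtain g where g: "g \<in> carrier G" "x = h j g" using rep[OF I(2)] by blast
      then show "\<phi> i j x \<in> carrier (F i)" using \<phi>[OF ij] hc[OF I(1)] by simp
      fix y assume "y \<in> carrier (F j)"
      then obtain k where k: "k \<in> carrier G" "y = h j k" using rep[OF I(2)] by blast
      have "x \<otimes>\<^bsub>F j\<^esub> y = h j (g \<otimes>\<^bsub>G\<^esub> k)" using g k Fh(4)[OF I(2)] by (simp add: hom_mult)
      then show "\<phi> i j (x \<otimes>\<^bsub>F j\<^esub> y) = \<phi> i j x \<otimes>\<^bsub>F i\<^esub> \<phi> i j y"
        using g k Fh(4)[OF I(1)] by (simp add: \<phi>[OF ij] hom_mult)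
    qed
    show "\<phi> i i x = x" if "i \<in> \<N>" "x \<in> carrier (F i)" for i x
      using rep[OF that] \<phi>[of i i] that(1) by (auto simp: r_def)
    show "\<phi> i j (\<phi> j k x) = \<phi> i k x" if "(i, j) \<in> r" "(j, k) \<in> r" "x \<in> carrier (F k)" for i j k x
    proof -
      have "(i, k) \<in> r" "k \<in> \<N>" using that by (auto simp: r_def)
      then show ?thesis using rep[OF _ that(3)] \<phi> that(1,2) by fastforce
    qed
  qed
  define L where "L = carrier (inverse_limit \<N> r F \<phi>)"
  have Leq: "L = {x \<in> (\<Pi>\<^sub>E i\<in>\<N>. carrier (F i)). \<forall>(i, j)\<in>r. \<phi> i j (x j) = x i}"
    by (simp add: L_def inverse_limit_def product_group_def)
  define f where "f = (\<lambda>g. \<lambda>N\<in>\<N>. h N g)"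
  have fL: "f g \<in> L" if "g \<in> carrier G" for g
    using \<phi>[OF _ that] hc[OF _ that] by (auto simp: Leq f_def r_def)
  have finj: "inj_on f (carrier G)"
  proof (rule inj_onI)
    fix g k assume g: "g \<in> carrier G" "k \<in> carrier G" and e: "f g = f k"
    have "g \<otimes>\<^bsub>G\<^esub> inv\<^bsub>G\<^esub> k \<in> N" if "N \<in> \<N>" for N
      using h_eq[OF that g] fun_cong[OF e, of N] that by (simp add: f_def)
    then have "g \<otimes>\<^bsub>G\<^esub> inv\<^bsub>G\<^esub> k = \<one>\<^bsub>G\<^esub>" using int by blast
    then show "g = k" using G.inv_solve_right[of "\<one>\<^bsub>G\<^esub>" g k] g by simp
  qed
  have fsurj: "f ` carrier G = L"
  proof
    show "f ` carrier G \<subseteq> L" using fL by blast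
    show "L \<subseteq> f ` carrier G"
    proof
      fix x assume x: "x \<in> L"
      define A where "A = (\<lambda>N. {g \<in> carrier G. h N g = x N})"
      have "\<Inter>(A ` \<N>) \<noteq> {}"
      proof (rule compact_directed_Inter_nonempty[OF comp])
        show "A ` \<N> \<noteq> {}" using ne by simp
      next
        fix B assume "B \<in> A ` \<N>"
        then obtain N where N: "N \<in> \<N>" "B = A N" by blast
        have "closedin T (A N)"
        proof (rule G.openin_if_coset_invariant(2)[OF tg sub[OF N(1)] op[OF N(1)]])
          fix l s assume l: "l \<in> N" and s: "s \<in> A N"
          have lc: "l \<in> carrier G" "s \<in> carrier G" using l s subgroup.subset[OF sub[OF N(1)]] by (auto simp: A_def)
          have "h N (l \<otimes>\<^bsub>G\<^esub> s) = h N s"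
            using h_eq[OF N(1), of "l \<otimes>\<^bsub>G\<^esub> s" s] lc l by (simp add: G.m_assoc)
          then show "l \<otimes>\<^bsub>G\<^esub> s \<in> A N" using s lc by (simp add: A_def)
        qed (auto simp: A_def)
        moreover have "A N \<noteq> {}"
        proof -
          have "x N \<in> carrier (F N)" using x N(1) by (auto simp: Leq)
          then show ?thesis using rep[OF N(1)] by (force simp: A_def)
        qed
        ultimately show "closedin T B \<and> B \<noteq> {}" using N by simp
      next
        fix B D assume "B \<in> A ` \<N>" "D \<in> A ` \<N>"
        then obtain N M where NM: "N \<in> \<N>" "M \<in> \<N>" "B = A N" "D = A M" by blast
        obtain Q where Q: "Q \<in> \<N>" "Q \<subseteq> N \<inter> M" using dir NM by blast
        have "A Q \<subseteq> A N'" if "N' \<in> \<N>" "Q \<subseteq> N'" for N'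
        proof
          fix g assume g: "g \<in> A Q"
          have rr: "(N', Q) \<in> r" using that Q by (simp add: r_def)
          then have "x N' = \<phi> N' Q (x Q)" using x by (auto simp: Leq)
          then show "g \<in> A N'" using g \<phi>[OF rr] by (simp add: A_def) (metis)
        qed
        then show "\<exists>E\<in>A ` \<N>. E \<subseteq> B \<inter> D" using Q NM by blast
      qed
      then obtain g where g: "g \<in> \<Inter>(A ` \<N>)" by blast
      then have gc: "g \<in> carrier G" using ne by (auto simp: A_def)
      have "f g = x"
      proof (rule PiE_ext)
        show "f g \<in> (\<Pi>\<^sub>E i\<in>\<N>. carrier (F i))" "x \<in> (\<Pi>\<^sub>E i\<in>\<N>. carrier (F i))"
          using fL[OF gc] x by (auto simp: Leq)
        fix N assume "N \<in> \<N>"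
        then show "f g N = x N" using g by (auto simp: f_def A_def)
      qed
      then show "x \<in> f ` carrier G" using gc by blast
    qed
  qed
  have fiso: "f \<in> iso G (inverse_limit \<N> r F \<phi>)"
  proof -
    have "f \<in> hom G (inverse_limit \<N> r F \<phi>)"
    proof (rule homI)
      fix g k assume g: "g \<in> carrier G" "k \<in> carrier G"
      have "h N (g \<otimes>\<^bsub>G\<^esub> k) = h N g \<otimes>\<^bsub>F N\<^esub> h N k" if "N \<in> \<N>" for N
        using Fh(4)[OF that] g by (simp add: hom_mult)
      then show "f (g \<otimes>\<^bsub>G\<^esub> k) = f g \<otimes>\<^bsub>inverse_limit \<N> r F \<phi>\<^esub> f k"
        by (auto simp: f_def inverse_limit_def product_group_def intro!: restrict_ext)
    qed (use fL in \<open>simp add: L_def\<close>)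
    then show ?thesis using finj fsurj by (simp add: iso_def bij_betw_def L_def)
  qed
  let ?P = "product_topology (\<lambda>i. discrete_topology (carrier (F i))) \<N>"
  have comp_cont: "continuous_map T (discrete_topology (carrier (F N))) (h N)" if N: "N \<in> \<N>" for N
    unfolding continuous_map_def
  proof (intro conjI allI impI)
    show "h N \<in> topspace T \<rightarrow> topspace (discrete_topology (carrier (F N)))" using hc[OF N] by (simp add: top)
    fix U
    show "openin T {x \<in> topspace T. h N x \<in> U}"
    proof (rule G.openin_if_coset_invariant(1)[OF tg sub[OF N] op[OF N]])
      fix l s assume l: "l \<in> N" and s: "s \<in> {x \<in> topspace T. h N x \<in> U}"
      have lc: "l \<in> carrier G" "s \<in> carrier G" using l s subgroup.subset[OF sub[OF N]] by (auto simp: top)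
      have "h N (l \<otimes>\<^bsub>G\<^esub> s) = h N s"
        using h_eq[OF N, of "l \<otimes>\<^bsub>G\<^esub> s" s] lc l by (simp add: G.m_assoc)
      then show "l \<otimes>\<^bsub>G\<^esub> s \<in> {x \<in> topspace T. h N x \<in> U}" using s lc by (simp add: top)
    qed (auto simp: top)
  qed
  have "continuous_map T ?P f"
    unfolding continuous_map_componentwise
  proof (intro conjI ballI)
    show "f ` topspace T \<subseteq> extensional \<N>" by (auto simp: f_def)
    fix N assume N: "N \<in> \<N>"
    then have "(\<lambda>x. f x N) = h N" by (simp add: f_def)
    then show "continuous_map T (discrete_topology (carrier (F N))) (\<lambda>x. f x N)" using comp_cont[OF N] by simp
  qed
  then have cont: "continuous_map T (inverse_limit_topology \<N> r F \<phi>) f"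
    unfolding inverse_limit_topology_def L_def[symmetric] using fL
    by (intro continuous_map_into_subtopology) (auto simp: top)
  have "homeomorphic_map T (inverse_limit_topology \<N> r F \<phi>) f"
  proof (rule continuous_imp_homeomorphic_map[OF cont comp])
    show "Hausdorff_space (inverse_limit_topology \<N> r F \<phi>)"
      unfolding inverse_limit_topology_def
      by (intro Hausdorff_space_subtopology) (simp add: Hausdorff_space_product_topology)
    have "topspace (inverse_limit_topology \<N> r F \<phi>) = L"
      unfolding inverse_limit_topology_def L_def[symmetric] by (auto simp: Leq)
    then show "f ` topspace T = topspace (inverse_limit_topology \<N> r F \<phi>)" using fsurj by (simp add: top)
    show "inj_on f (topspace T)" using finj by (simp add: top)
  qed
  then show ?thesis
    unfolding pro_def using tg sys Fh(2,3) fiso by blast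
qed

section \<open>Chief factors of soluble profinite groups\<close>

lemma card_image_le_fibres:
  assumes fin: "finite (G ` A)" and fib: "\<And>x y. x \<in> A \<Longrightarrow> y \<in> A \<Longrightarrow> G x = G y \<Longrightarrow> F x = F y"
  shows "card (F ` A) \<le> card (G ` A)" and "finite (F ` A)"
proof -
  have "F x = F (inv_into A G (G x))" if "x \<in> A" for x
    using fib[of x "inv_into A G (G x)"] that inv_into_into[of "G x" G A] f_inv_into_f[of "G x" G A] by simp
  then have "F ` A = (\<lambda>y. F (inv_into A G y)) ` G ` A" by (auto simp: image_image)
  then show "card (F ` A) \<le> card (G ` A)" "finite (F ` A)" using fin card_image_le[of "G ` A"] by simp_all
qed

context group_hom
begin

lemma commutator_hom:
  "x \<in> carrier G \<Longrightarrow> y \<in> carrier G \<Longrightarrow> h (G.commutator x y) = H.commutator (h x) (h y)"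
  by (simp add: G.commutator_def H.commutator_def)

lemma power_subgroup_image:
  assumes surj: "h ` carrier G = carrier H"
  shows "power_subgroup H n = h ` power_subgroup G n"
proof -
  have "(\<lambda>x. x [^]\<^bsub>H\<^esub> n) ` carrier H = h ` (\<lambda>x. x [^] n) ` carrier G"
    unfolding surj[symmetric] image_image by (intro image_cong) (simp_all add: hom_nat_pow)
  then show ?thesis
    unfolding power_subgroup_def using generate_img[OF G.pow_set_carrier] by simp
qed

lemma preimage_normal:
  assumes X: "X \<lhd> H"
  shows "{g \<in> carrier G. h g \<in> X} \<lhd> G"
  unfolding G.normal_inv_iff
proof (intro conjI ballI)
  interpret X: normal X H by (rule X)
  show "subgroup {g \<in> carrier G. h g \<in> X} G"
  proof (rule G.subgroupI)
    have "\<one> \<in> {g \<in> carrier G. h g \<in> X}" by simp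
    then show "{g \<in> carrier G. h g \<in> X} \<noteq> {}" by blast
  qed auto
  fix x g assume "x \<in> carrier G" "g \<in> {g \<in> carrier G. h g \<in> X}"
  then show "x \<otimes> g \<otimes> inv x \<in> {g \<in> carrier G. h g \<in> X}" using X.inv_op_closed2[of "h x" "h g"] by simp
qed

lemma lower_central_series_image:
  assumes surj: "h ` carrier G = carrier H"
  shows "lower_central_series G n \<subseteq> carrier G \<and> lower_central_series H n = h ` lower_central_series G n"
proof (induction n)
  case (Suc n)
  let ?S = "\<Union>x\<in>lower_central_series G n. \<Union>y\<in>carrier G. {x \<otimes> y \<otimes> inv x \<otimes> inv y}"
  have sub: "?S \<subseteq> carrier G" using Suc by auto
  have "(\<Union>x\<in>h ` lower_central_series G n. \<Union>y\<in>h ` carrier G. {x \<otimes>\<^bsub>H\<^esub> y \<otimes>\<^bsub>H\<^esub> inv\<^bsub>H\<^esub> x \<otimes>\<^bsub>H\<^esub> inv\<^bsub>H\<^esub> y})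
      = (\<Union>x\<in>lower_central_series G n. \<Union>y\<in>carrier G. {h (x \<otimes> y \<otimes> inv x \<otimes> inv y)})"
  proof -
    have "{h x \<otimes>\<^bsub>H\<^esub> h y \<otimes>\<^bsub>H\<^esub> inv\<^bsub>H\<^esub> (h x) \<otimes>\<^bsub>H\<^esub> inv\<^bsub>H\<^esub> (h y)} = {h (x \<otimes> y \<otimes> inv x \<otimes> inv y)}"
      if "x \<in> lower_central_series G n" "y \<in> carrier G" for x y
      using that Suc by (simp add: subset_iff)
    then show ?thesis by (simp add: image_image)
  qed
  also have "\<dots> = h ` ?S" by (simp add: image_UN)
  finally show ?case using Suc generate_img[OF sub] G.generate_incl[OF sub] surj by simp
qed (simp add: surj)

end

text \<open>Transporting the quotient along an enumeration of the cosets gives a group of natural numbers, as the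
  members of an inverse system have to be.\<close>

lemma (in group) finite_quotient_nat:
  assumes N: "N \<lhd> G" and fin: "finite ((\<lambda>g. N #> g) ` carrier G)"
  shows "\<exists>(F :: nat monoid) h. group F \<and> finite (carrier F) \<and> h \<in> hom G F \<and> h ` carrier G = carrier F \<and> kernel G F h = N"
proof -
  interpret N: normal N G by (rule N)
  let ?Q = "G Mod N"
  interpret Q: group ?Q by (rule N.factorgroup_is_group)
  have finQ: "finite (carrier ?Q)" using fin by (simp add: carrier_FactGroup)
  obtain b :: "'a set \<Rightarrow> nat" where b: "inj_on b (carrier ?Q)" using finite_imp_inj_to_nat_seg[OF finQ] by blast
  define i where "i = inv_into (carrier ?Q) b"
  have i: "i (b X) = X" if "X \<in> carrier ?Q" for X using b that by (simp add: i_def)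
  define F0 :: "nat monoid" where "F0 = \<lparr>carrier = UNIV, monoid.mult = (\<lambda>x y. b (i x \<otimes>\<^bsub>?Q\<^esub> i y)), one = b \<one>\<^bsub>?Q\<^esub>\<rparr>"
  define F where "F = F0 \<lparr>carrier := b ` carrier ?Q, one := b \<one>\<^bsub>?Q\<^esub>\<rparr>"
  have "b \<in> hom ?Q F0" by (intro homI) (simp_all add: F0_def i del: mult_FactGroup)
  then have F: "group F" unfolding F_def by (rule Q.hom_imp_img_group)
  have bF: "b \<in> hom ?Q F" by (intro homI) (simp_all add: F_def F0_def i del: mult_FactGroup)
  let ?h = "\<lambda>g. b (N #> g)"
  have h: "?h \<in> hom G F" using Group.hom_compose[OF N.r_coset_hom_Mod bF] by (simp add: o_def)
  have one: "b \<one>\<^bsub>?Q\<^esub> = \<one>\<^bsub>F\<^esub>" by (simp add: F_def)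
  have "kernel G F ?h = N"
  proof -
    have "?h g = \<one>\<^bsub>F\<^esub> \<longleftrightarrow> g \<in> N" if g: "g \<in> carrier G" for g
    proof -
      have c: "N #> g \<in> carrier ?Q" "N \<in> carrier ?Q" using g Q.one_closed by (auto simp: carrier_FactGroup)
      have "?h g = \<one>\<^bsub>F\<^esub> \<longleftrightarrow> N #> g = N" using inj_on_eq_iff[OF b c] one by simp
      also have "\<dots> \<longleftrightarrow> g \<in> N" using coset_join1[OF _ g N.subgroup_axioms] coset_join2[OF g N.subgroup_axioms] g by blast
      finally show ?thesis .
    qed
    then show ?thesis using N.subset by (auto simp: kernel_def)
  qed
  moreover have "?h ` carrier G = carrier F" by (auto simp: F_def carrier_FactGroup)
  moreover have "finite (carrier F)" using finQ by (simp add: F_def)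
  ultimately show ?thesis using F h by blast
qed

locale soluble_profinite = group +
  fixes T \<N>
  assumes tg: "topological_group G T" and comp: "compact_space T"
    and base_nonempty: "\<N> \<noteq> {}" and base_Inter: "\<Inter>\<N> = {\<one>}"
    and base_directed: "\<And>A B. A \<in> \<N> \<Longrightarrow> B \<in> \<N> \<Longrightarrow> \<exists>D\<in>\<N>. D \<subseteq> A \<inter> B"
    and base_normal: "\<And>N. N \<in> \<N> \<Longrightarrow> N \<lhd> G" and base_open: "\<And>N. N \<in> \<N> \<Longrightarrow> openin T N"
    and base_quotient: "\<And>N. N \<in> \<N> \<Longrightarrow> \<exists>(F :: nat monoid) h. group F \<and> finite (carrier F) \<and> solvable F \<and>
        h \<in> hom G F \<and> kernel G F h = N"
begin

definition open_normal :: "'a set \<Rightarrow> bool" where "open_normal L \<longleftrightarrow> L \<lhd> G \<and> openin T L"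

definition idx :: "'a set \<Rightarrow> nat" where "idx L = card ((\<lambda>g. L #> g) ` carrier G)"

lemma top: "topspace T = carrier G"
  using tg by (simp add: topological_group_def)

lemma open_supergroup:
  assumes L: "open_normal L" and M: "subgroup M G" "L \<subseteq> M"
  shows "openin T M" "closedin T M"
proof -
  have s: "subgroup L G" using L normal_imp_subgroup by (auto simp: open_normal_def)
  show "openin T M" "closedin T M"
    using openin_if_coset_invariant[OF tg s, of M] L M subgroup.subset[OF M(1)] subgroup.m_closed[OF M(1)]
    by (auto simp: open_normal_def)
qed

lemma open_normal_super: "open_normal L \<Longrightarrow> M \<lhd> G \<Longrightarrow> L \<subseteq> M \<Longrightarrow> open_normal M"
  using open_supergroup(1)[OF _ normal_imp_subgroup] unfolding open_normal_def by blast

lemma open_normal_Int: "open_normal L \<Longrightarrow> open_normal M \<Longrightarrow> open_normal (L \<inter> M)"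
  by (simp add: open_normal_def normal_Int openin_Int)

lemma open_normal_carrier: "open_normal (carrier G)"
  using normal_self openin_topspace[of T] by (simp add: open_normal_def top)

lemma base_open_normal: "N \<in> \<N> \<Longrightarrow> open_normal N"
  by (simp add: open_normal_def base_normal base_open)

text \<open>The sets \<open>N - W\<close> are closed and directed, with empty intersection; so one of them is empty.\<close>

lemma base_below:
  assumes W: "openin T W" "\<one> \<in> W"
  obtains N where "N \<in> \<N>" "N \<subseteq> W"
proof -
  have "\<exists>N\<in>\<N>. N \<subseteq> W"
  proof (rule ccontr)
    assume none: "\<not> ?thesis"
    have "\<Inter>((\<lambda>N. N - W) ` \<N>) \<noteq> {}"
    proof (rule compact_directed_Inter_nonempty[OF comp])
      show "(\<lambda>N. N - W) ` \<N> \<noteq> {}" using base_nonempty by simp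
    next
      fix A assume "A \<in> (\<lambda>N. N - W) ` \<N>"
      then obtain N where N: "N \<in> \<N>" "A = N - W" by blast
      have "closedin T N" by (rule open_supergroup(2)[OF base_open_normal[OF N(1)] normal_imp_subgroup[OF base_normal[OF N(1)]]]) simp
      then show "closedin T A \<and> A \<noteq> {}" using none N W(1) by (auto intro: closedin_diff)
    next
      fix A B assume "A \<in> (\<lambda>N. N - W) ` \<N>" "B \<in> (\<lambda>N. N - W) ` \<N>"
      then obtain M N where MN: "M \<in> \<N>" "N \<in> \<N>" "A = M - W" "B = N - W" by blast
      then obtain D where "D \<in> \<N>" "D \<subseteq> M \<inter> N" using base_directed by blast
      then show "\<exists>C\<in>(\<lambda>N. N - W) ` \<N>. C \<subseteq> A \<inter> B" using MN by (intro bexI[of _ "D - W"]) auto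
    qed
    then obtain g where g: "\<And>N. N \<in> \<N> \<Longrightarrow> g \<in> N - W" by blast
    then have "g \<in> \<Inter>\<N>" by blast
    then have "g = \<one>" using base_Inter by simp
    then show False using g W(2) base_nonempty by blast
  qed
  then show thesis using that by blast
qed

lemma open_normal_below:
  assumes L: "open_normal L"
  obtains N where "N \<in> \<N>" "N \<subseteq> L"
  using base_below[of L] L subgroup.one_closed[OF normal_imp_subgroup] by (auto simp: open_normal_def)

lemma finite_cosets:
  assumes L: "open_normal L"
  shows "finite ((\<lambda>g. L #> g) ` carrier G)"
proof -
  obtain N where N: "N \<in> \<N>" "N \<subseteq> L" by (rule open_normal_below[OF L])
  obtain F :: "nat monoid" and h where F: "group F" "finite (carrier F)" "h \<in> hom G F" "kernel G F h = N"
    using base_quotient[OF N(1)] by blast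
  interpret h: group_hom G F h using F is_group by (simp add: group_hom_def group_hom_axioms_def)
  have sL: "subgroup L G" using L normal_imp_subgroup by (auto simp: open_normal_def)
  show ?thesis
  proof (rule card_image_le_fibres(2))
    show "finite (h ` carrier G)" using F(2) by (rule finite_subset[rotated]) auto
    fix x y assume xy: "x \<in> carrier G" "y \<in> carrier G" "h x = h y"
    then have "x \<otimes> inv y \<in> kernel G F h" by (simp add: kernel_def)
    then show "L #> x = L #> y" using coset_eq_iff[OF sL xy(1,2)] F(4) N(2) by blast
  qed
qed

lemma coset_hom:
  assumes "open_normal L"
  shows "group_hom G (G Mod L) (\<lambda>g. L #> g)"
proof -
  interpret normal L G using assms by (simp add: open_normal_def)
  show ?thesis using factorgroup_is_group r_coset_hom_Mod is_group by (simp add: group_hom_def group_hom_axioms_def)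
qed

lemma coset_mem_iff:
  assumes L: "open_normal L" and M: "subgroup M G" "L \<subseteq> M" and g: "g \<in> carrier G"
  shows "L #> g \<in> (\<lambda>g. L #> g) ` M \<longleftrightarrow> g \<in> M"
proof
  assume "L #> g \<in> (\<lambda>g. L #> g) ` M"
  then obtain m where m: "m \<in> M" "L #> g = L #> m" by blast
  have mc: "m \<in> carrier G" using m subgroup.subset[OF M(1)] by blast
  have sL: "subgroup L G" using L normal_imp_subgroup unfolding open_normal_def by blast
  have "g \<otimes> inv m \<in> L" using coset_eq_iff[OF sL g mc] m(2) by blast
  then have "(g \<otimes> inv m) \<otimes> m \<in> M" using subgroup.m_closed[OF M(1) _ m(1)] M(2) by blast
  then show "g \<in> M" using g mc by (simp add: m_assoc)
qed blast

lemma coset_one_iff: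
  assumes L: "open_normal L" and g: "g \<in> carrier G"
  shows "L #> g = L \<longleftrightarrow> g \<in> L"
proof -
  have sL: "subgroup L G" using L normal_imp_subgroup by (auto simp: open_normal_def)
  show ?thesis using coset_join1[OF _ g sL] coset_join2[OF g sL] by blast
qed

lemma solvable_quotient:
  assumes L: "open_normal L"
  shows "solvable (G Mod L)"
proof -
  interpret q: group_hom G "G Mod L" "\<lambda>g. L #> g" by (rule coset_hom[OF L])
  obtain N where N: "N \<in> \<N>" "N \<subseteq> L" by (rule open_normal_below[OF L])
  obtain F :: "nat monoid" and h where F: "group F" "solvable F" "h \<in> hom G F" "kernel G F h = N"
    using base_quotient[OF N(1)] by blast
  interpret h: group_hom G F h using F is_group by (simp add: group_hom_def group_hom_axioms_def)
  obtain n where n: "(derived F ^^ n) (carrier F) = {\<one>\<^bsub>F\<^esub>}"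
    using h.H.solvable_iff_trivial_derived_seq F(2) by blast
  have "h ` ((derived G ^^ n) (carrier G)) = (derived F ^^ n) (h ` carrier G)"
    using h.exp_of_derived_img[of "carrier G" n] by simp
  also have "\<dots> \<subseteq> (derived F ^^ n) (carrier F)"
    by (rule h.H.mono_exp_of_derived) auto
  also have "\<dots> = {\<one>\<^bsub>F\<^esub>}" by (rule n)
  finally have "(derived G ^^ n) (carrier G) \<subseteq> kernel G F h"
    using exp_of_derived_in_carrier[of "carrier G" n] by (auto simp: kernel_def)
  then have dL: "(derived G ^^ n) (carrier G) \<subseteq> L" using F(4) N(2) by blast
  have "(derived (G Mod L) ^^ n) (carrier (G Mod L)) = (\<lambda>g. L #> g) ` ((derived G ^^ n) (carrier G))"
    unfolding carrier_FactGroup by (rule q.exp_of_derived_img) simp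
  also have "\<dots> \<subseteq> {\<one>\<^bsub>G Mod L\<^esub>}"
    using dL coset_one_iff[OF L] exp_of_derived_in_carrier[of "carrier G" n] by (auto simp: subset_iff)
  finally have "(derived (G Mod L) ^^ n) (carrier (G Mod L)) = {\<one>\<^bsub>G Mod L\<^esub>}"
    using subgroup.one_closed[OF q.H.exp_of_derived_is_subgroup[OF q.H.subgroup_self], of n] by blast
  then show ?thesis using q.H.solvable_iff_trivial_derived_seq by blast
qed

lemma eq_if_idx_le:
  assumes A: "open_normal A" and B: "subgroup B G" "A \<subseteq> B" and le: "idx A \<le> idx B"
  shows "A = B"
proof -
  have sA: "subgroup A G" using A normal_imp_subgroup by (auto simp: open_normal_def)
  define r where "r = (\<lambda>X. B #> (SOME g. g \<in> carrier G \<and> A #> g = X))"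
  have r: "r (A #> g) = B #> g" if g: "g \<in> carrier G" for g
  proof -
    let ?g = "SOME g'. g' \<in> carrier G \<and> A #> g' = A #> g"
    have g': "?g \<in> carrier G \<and> A #> ?g = A #> g"
      by (rule someI[of "\<lambda>g'. g' \<in> carrier G \<and> A #> g' = A #> g" g]) (simp add: g)
    then have "?g \<otimes> inv g \<in> B" using coset_eq_iff[OF sA _ g, of ?g] B(2) by blast
    then show ?thesis unfolding r_def using coset_eq_iff[OF B(1) _ g, of ?g] g' by blast
  qed
  have im: "r ` (\<lambda>g. A #> g) ` carrier G = (\<lambda>g. B #> g) ` carrier G"
    unfolding image_image by (intro image_cong refl r)
  have ir: "inj_on r ((\<lambda>g. A #> g) ` carrier G)"
  proof (rule eq_card_imp_inj_on[OF finite_cosets[OF A]])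
    show "card (r ` (\<lambda>g. A #> g) ` carrier G) = card ((\<lambda>g. A #> g) ` carrier G)"
      using card_image_le[OF finite_cosets[OF A], of r] le unfolding im idx_def by simp
  qed
  have inj: "A #> x = A #> y" if xy: "x \<in> carrier G" "y \<in> carrier G" "B #> x = B #> y" for x y
    by (rule inj_onD[OF ir]) (use xy r in simp_all)
  have "b \<in> A" if b: "b \<in> B" for b
  proof -
    have bc: "b \<in> carrier G" using b subgroup.subset[OF B(1)] by blast
    have "B #> b = B #> \<one>" using coset_eq_iff[OF B(1) bc, of \<one>] b bc by simp
    then have "A #> b = A #> \<one>" using inj bc by blast
    then show ?thesis using coset_eq_iff[OF sA bc, of \<one>] bc by simp
  qed
  then show ?thesis using B(2) by blast
qed

text \<open>By induction on the index of \<open>L\<close>.  In \<open>G / L\<close> the image of \<open>M\<close> is a minimal normal subgroup, and the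
  chief factors above it lift to chief factors of \<open>G\<close> over open normal subgroups of smaller index, which
  are centralized by hypothesis.\<close>

lemma chief_factors_centralized:
  assumes N: "PIG_exponent \<alpha> N"
    and pig: "\<And>L n. open_normal L \<Longrightarrow> n \<ge> 1 \<Longrightarrow>
      real (card (carrier ((G Mod L) Mod power_subgroup (G Mod L) n))) \<le> real n powr \<alpha>"
    and H: "power_subgroup G N \<subseteq> H" "H \<subseteq> carrier G" "\<And>L. open_normal L \<Longrightarrow> H \<subseteq> power_subgroup G N <#> L"
    and L: "open_normal L" and LM: "chief L M" and d: "d \<in> derived G (derived G H)" and m: "m \<in> M"
  shows "commutator d m \<in> L"
  using L LM d m
proof (induction "idx L" arbitrary: L M d m rule: less_induct)
  case less
  note L = less.prems(1) and LM = less.prems(2)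
  let ?Q = "G Mod L" and ?h = "\<lambda>g. L #> g" and ?P = "power_subgroup G N"
  have nL: "L \<lhd> G" and nM: "M \<lhd> G" and LsM: "L \<subset> M" using LM by (auto simp: chief_def)
  have sL: "subgroup L G" and sM: "subgroup M G" using nL nM normal_imp_subgroup by auto
  interpret q: group_hom G ?Q ?h by (rule coset_hom[OF L])
  have surj: "?h ` carrier G = carrier ?Q" by (simp add: carrier_FactGroup)
  have finQ: "finite (carrier ?Q)" using finite_cosets[OF L] by (simp add: carrier_FactGroup)
  have Pc: "?P \<subseteq> carrier G" by (rule normal_subset[OF power_subgroup_normal])
  define D where "D = derived ?Q (derived ?Q (power_subgroup ?Q N))"
  have Deq: "D = ?h ` derived G (derived G ?P)"
    unfolding D_def q.power_subgroup_image[OF surj] q.derived_img[OF Pc]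
    by (rule q.derived_img[OF derived_in_carrier[OF Pc]])
  have "D \<subseteq> q.H.centralizer_mod {\<one>\<^bsub>?Q\<^esub>} (?h ` M)"
    unfolding D_def
  proof (rule q.H.minimal_normal_centralized[OF solvable_quotient[OF L] finQ N])
    fix n :: nat assume n: "n \<ge> 1" "power_subgroup ?Q n = {\<one>\<^bsub>?Q\<^esub>}"
    have "carrier (?Q Mod {\<one>\<^bsub>?Q\<^esub>}) = (\<lambda>X. {X}) ` carrier ?Q"
      unfolding carrier_FactGroup[of ?Q] by (intro image_cong refl) (auto simp: r_coset_def simp del: mult_FactGroup one_FactGroup)
    then have "card (carrier (?Q Mod {\<one>\<^bsub>?Q\<^esub>})) = order ?Q"
      by (simp add: card_image order_def)
    then show "real (order ?Q) \<le> real n powr \<alpha>" using pig[OF L n(1)] n(2) by simp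
  next
    show "q.H.chief {\<one>\<^bsub>?Q\<^esub>} (?h ` M)"
      unfolding q.H.chief_def
    proof (intro conjI allI impI)
      show "{\<one>\<^bsub>?Q\<^esub>} \<lhd> ?Q" by (rule q.H.one_is_normal)
      show nV: "?h ` M \<lhd> ?Q"
        by (rule normal.surj_hom_normal_subgroup[OF nM q.group_hom_axioms surj])
      obtain x where x: "x \<in> M" "x \<notin> L" using LsM by blast
      then have "?h x \<noteq> L" using coset_one_iff[OF L] normal_subset[OF nM] by blast
      then have "\<not> ?h ` M \<subseteq> {\<one>\<^bsub>?Q\<^esub>}" using x(1) by auto
      then show "{\<one>\<^bsub>?Q\<^esub>} \<subset> ?h ` M" using subgroup.one_closed[OF normal_imp_subgroup[OF nV]] by blast
      fix X assume X: "X \<lhd> ?Q" "{\<one>\<^bsub>?Q\<^esub>} \<subseteq> X" "X \<subseteq> ?h ` M"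
      define Y where "Y = {g \<in> carrier G. ?h g \<in> X}"
      have "Y \<lhd> G" unfolding Y_def by (rule q.preimage_normal[OF X(1)])
      moreover have "L \<subseteq> Y"
      proof
        fix g assume g: "g \<in> L"
        then have gc: "g \<in> carrier G" using normal_subset[OF nL] by blast
        then have "?h g = L" using coset_one_iff[OF L] g by blast
        then show "g \<in> Y" using X(2) gc by (simp add: Y_def)
      qed
      moreover have "Y \<subseteq> M"
      proof
        fix g assume g: "g \<in> Y"
        then have "?h g \<in> ?h ` M" using X(3) unfolding Y_def by blast
        moreover have "g \<in> carrier G" using g unfolding Y_def by blast
        ultimately show "g \<in> M" using coset_mem_iff[OF L sM] LsM by blast
      qed
      ultimately have "Y = L \<or> Y = M" using LM by (simp add: chief_def)
      moreover have "X = ?h ` Y"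
      proof
        show "?h ` Y \<subseteq> X" by (auto simp: Y_def)
        show "X \<subseteq> ?h ` Y"
        proof
          fix x assume x: "x \<in> X"
          then have "x \<in> ?h ` carrier G" unfolding surj using q.H.normal_subset[OF X(1)] by (rule subsetD[rotated])
          then obtain g where "g \<in> carrier G" "x = ?h g" by (rule imageE)
          then show "x \<in> ?h ` Y" using x by (simp add: Y_def)
        qed
      qed
      moreover have "?h ` L = {\<one>\<^bsub>?Q\<^esub>}"
      proof -
        have "?h g = L" if g: "g \<in> L" for g using coset_one_iff[OF L] normal_subset[OF nL] g by blast
        then have "?h ` L = (\<lambda>_. L) ` L" by (rule image_cong[OF refl])
        also have "\<dots> = {L}" using subgroup.one_closed[OF sL] by blast
        finally show ?thesis by simp
      qed
      ultimately show "X = {\<one>\<^bsub>?Q\<^esub>} \<or> X = ?h ` M" by auto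
    qed
  next
    fix L' M' d' m'
    assume c: "q.H.chief L' M'" "L' \<noteq> {\<one>\<^bsub>?Q\<^esub>}" and d': "d' \<in> derived ?Q (derived ?Q (power_subgroup ?Q N))"
      and m': "m' \<in> M'"
    have nL': "L' \<lhd> ?Q" and nM': "M' \<lhd> ?Q" and LM': "L' \<subset> M'" using c by (auto simp: q.H.chief_def)
    define l where "l = {g \<in> carrier G. ?h g \<in> L'}"
    define k where "k = {g \<in> carrier G. ?h g \<in> M'}"
    have nl: "l \<lhd> G" and nk: "k \<lhd> G" unfolding l_def k_def by (intro q.preimage_normal nL' nM')+
    have one': "\<one>\<^bsub>?Q\<^esub> \<in> L'" using subgroup.one_closed[OF normal_imp_subgroup[OF nL']] .
    have Ll: "L \<subseteq> l"
    proof
      fix g assume g: "g \<in> L"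
      then have gc: "g \<in> carrier G" using normal_subset[OF nL] by blast
      then have "?h g = L" using coset_one_iff[OF L] g by blast
      then show "g \<in> l" using one' gc by (simp add: l_def)
    qed
    have ol: "open_normal l" by (rule open_normal_super[OF L nl Ll])
    have lift: "\<exists>g\<in>carrier G. X = ?h g" if X: "X \<in> carrier ?Q" for X
      by (rule imageE[OF X[folded surj]]) (rule bexI)
    have L'c: "L' \<subseteq> carrier ?Q" "M' \<subseteq> carrier ?Q" using nL' nM' q.H.normal_subset by auto
    have Lne: "L \<noteq> l"
    proof
      assume "L = l"
      have triv: "X = \<one>\<^bsub>?Q\<^esub>" if X: "X \<in> L'" for X
      proof -
        obtain g where g: "g \<in> carrier G" "X = ?h g" by (rule bexE[OF lift[OF subsetD[OF L'c(1) X]]])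
        have "g \<in> l" using X g by (simp add: l_def)
        then have "g \<in> L" using \<open>L = l\<close> by simp
        then show ?thesis using g coset_one_iff[OF L g(1)] by simp
      qed
      have "L' \<subseteq> {\<one>\<^bsub>?Q\<^esub>}" by (rule subsetI, rule singleton_iff[THEN iffD2], rule triv)
      then have "L' = {\<one>\<^bsub>?Q\<^esub>}" using one' by blast
      then show False using c(2) by contradiction
    qed
    have idx: "idx l < idx L"
    proof (rule ccontr)
      assume "\<not> idx l < idx L"
      then have "L = l" by (intro eq_if_idx_le[OF L normal_imp_subgroup[OF nl] Ll]) simp
      then show False using Lne by blast
    qed
    have ch: "chief l k"
      unfolding chief_def
    proof (intro conjI allI impI)
      show "l \<lhd> G" "k \<lhd> G" by (rule nl, rule nk)
      have "l \<subseteq> k" unfolding l_def k_def using LM' by blast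
      obtain X where X: "X \<in> M'" "X \<notin> L'" using LM' by blast
      moreover obtain g where "g \<in> carrier G" "X = ?h g" by (rule bexE[OF lift[OF subsetD[OF L'c(2) X(1)]]])
      ultimately have "g \<in> k" "g \<notin> l" by (simp_all add: l_def k_def)
      then show "l \<subset> k" using \<open>l \<subseteq> k\<close> by blast
      fix X assume X: "X \<lhd> G" "l \<subseteq> X" "X \<subseteq> k"
      have LX: "L \<subseteq> X" using Ll X(2) by blast
      have nX: "?h ` X \<lhd> ?Q" by (rule normal.surj_hom_normal_subgroup[OF X(1) q.group_hom_axioms surj])
      have "L' \<subseteq> ?h ` X"
      proof
        fix Y assume Y: "Y \<in> L'"
        obtain g where g: "g \<in> carrier G" "Y = ?h g" by (rule bexE[OF lift[OF subsetD[OF L'c(1) Y]]])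
        then have "g \<in> l" using Y by (simp add: l_def)
        then have "g \<in> X" by (rule subsetD[OF X(2)])
        then show "Y \<in> ?h ` X" unfolding g(2) by (rule imageI)
      qed
      moreover have "?h ` X \<subseteq> M'" using X(3) unfolding k_def by (intro image_subsetI) (drule subsetD, assumption, simp)
      ultimately have "?h ` X = L' \<or> ?h ` X = M'" using c(1) nX by (simp add: q.H.chief_def)
      moreover have "X = {g \<in> carrier G. ?h g \<in> ?h ` X}"
      proof (rule Set.set_eqI)
        fix g
        show "g \<in> X \<longleftrightarrow> g \<in> {g \<in> carrier G. ?h g \<in> ?h ` X}"
        proof (cases "g \<in> carrier G")
          case True
          then show ?thesis using coset_mem_iff[OF L normal_imp_subgroup[OF X(1)] LX True] by simp
        next
          case False
          then have "g \<notin> X" using normal_subset[OF X(1)] by (rule contra_subsetD[rotated])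
          then show ?thesis using False by simp
        qed
      qed
      ultimately show "X = l \<or> X = k" unfolding l_def k_def by metis
    qed
    obtain e where e: "e \<in> derived G (derived G ?P)" "d' = ?h e" by (rule imageE[OF d'[folded D_def, unfolded Deq]]) 
    have eH: "e \<in> derived G (derived G H)" by (rule subsetD[OF mono_derived[OF mono_derived[OF H(1)]] e(1)])
    obtain x where x: "x \<in> carrier G" "m' = ?h x" by (rule bexE[OF lift[OF subsetD[OF L'c(2) m']]])
    then have xk: "x \<in> k" using m' by (simp add: k_def)
    have "commutator e x \<in> l" by (rule less.hyps[OF idx ol ch eH xk])
    moreover have "e \<in> carrier G" by (rule subsetD[OF derived_in_carrier[OF derived_in_carrier[OF Pc]] e(1)])
    ultimately show "q.H.commutator d' m' \<in> L'"
      using q.commutator_hom[of e x] x e by (simp add: l_def)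
  qed
  moreover have "?h ` H \<subseteq> ?h ` ?P"
  proof (rule image_subsetI)
    fix x assume "x \<in> H"
    then obtain a b where ab: "a \<in> ?P" "b \<in> L" "x = a \<otimes> b" using H(3)[OF L] by (auto simp: set_mult_def)
    have c: "a \<in> carrier G" "b \<in> carrier G" using ab Pc normal_subset[OF nL] by auto
    have "x \<otimes> inv a \<in> L" using normal_conj(1)[OF nL c(1) ab(2)] ab(3) by simp
    moreover have "x \<in> carrier G" using c ab(3) by simp
    ultimately have "?h x = ?h a" using coset_eq_iff[OF sL _ c(1)] by blast
    then show "?h x \<in> ?h ` ?P" using ab(1) by simp
  qed
  then have "derived ?Q (derived ?Q (?h ` H)) \<subseteq> D"
    unfolding D_def q.power_subgroup_image[OF surj] by (intro q.H.mono_derived)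
  then have "?h ` derived G (derived G H) \<subseteq> D"
    using q.derived_img[OF H(2)] q.derived_img[OF derived_in_carrier[OF H(2)]] by simp
  ultimately have "q.H.commutator (?h d) (?h m) = \<one>\<^bsub>?Q\<^esub>"
    using less.prems(3,4) by (auto simp: q.H.centralizer_mod_def)
  moreover have c: "d \<in> carrier G" "m \<in> carrier G"
    using less.prems(3,4) derived_in_carrier[OF derived_in_carrier[OF H(2)]] normal_subset[OF nM] by auto
  ultimately have "?h (commutator d m) = L" using q.commutator_hom[OF c] by simp
  then show ?case using coset_one_iff[OF L] c by simp
qed

end

section \<open>The pronilpotent kernel of the action on chief factors\<close>

lemma (in group) normal_Inter:
  assumes ne: "\<K> \<noteq> {}" and n: "\<And>X. X \<in> \<K> \<Longrightarrow> X \<lhd> G"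
  shows "\<Inter>\<K> \<lhd> G"
  unfolding normal_inv_iff
proof (intro conjI ballI)
  show "subgroup (\<Inter>\<K>) G" by (rule subgroups_Inter[OF normal_imp_subgroup[OF n] ne])
  fix x h assume x: "x \<in> carrier G" and h: "h \<in> \<Inter>\<K>"
  show "x \<otimes> h \<otimes> inv x \<in> \<Inter>\<K>"
  proof
    fix X assume X: "X \<in> \<K>"
    then have "h \<in> X" using h by (rule InterD[rotated])
    then show "x \<otimes> h \<otimes> inv x \<in> X" by (rule normal_conj(1)[OF n[OF X] x])
  qed
qed

lemma (in group) metabelian_quotient:
  assumes K: "K \<lhd> G" and d: "derived G (derived G (carrier G)) \<subseteq> K"
  shows "metabelian (G Mod K)"
proof -
  interpret K: normal K G by (rule K)
  let ?Q = "G Mod K"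
  interpret q: group_hom G ?Q "\<lambda>g. K #> g"
    using K.factorgroup_is_group K.r_coset_hom_Mod is_group by (simp add: group_hom_def group_hom_axioms_def)
  let ?D = "derived ?Q (carrier ?Q)"
  have c: "derived G (carrier G) \<subseteq> carrier G" by (rule derived_in_carrier) simp
  have D: "?D = (\<lambda>g. K #> g) ` derived G (carrier G)"
    unfolding carrier_FactGroup by (rule q.derived_img) simp
  have "derived ?Q ?D = (\<lambda>g. K #> g) ` derived G (derived G (carrier G))"
    unfolding D by (rule q.derived_img[OF c])
  also have "\<dots> \<subseteq> {\<one>\<^bsub>?Q\<^esub>}"
  proof (rule image_subsetI)
    fix g assume "g \<in> derived G (derived G (carrier G))"
    then have "g \<in> K" by (rule subsetD[OF d])
    then show "K #> g \<in> {\<one>\<^bsub>?Q\<^esub>}" using coset_join2[OF subsetD[OF K.subset] K.subgroup_axioms] by simp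
  qed
  finally have "derived ?Q ?D \<subseteq> {\<one>\<^bsub>?Q\<^esub>}" .
  then have "?D \<subseteq> q.H.centralizer_mod {\<one>\<^bsub>?Q\<^esub>} ?D"
    using q.H.derived_subset_iff[OF q.H.triv_subgroup q.H.derived_in_carrier[of "carrier ?Q"]] by blast
  then show ?thesis
    unfolding metabelian_def
    using q.H.abelian_imp_comm_group[OF q.H.derived_is_subgroup[of "carrier ?Q"]] q.H.is_group by blast
qed

lemma (in group) topological_subgroup:
  assumes tg: "topological_group G T" and K: "subgroup K G"
  shows "topological_group (G\<lparr>carrier := K\<rparr>) (subtopology T K)"
  unfolding topological_group_def
proof (intro conjI)
  have Kc: "K \<subseteq> carrier G" by (rule subgroup.subset[OF K])
  have T: "topspace T = carrier G" "continuous_map (prod_topology T T) T (\<lambda>(x, y). x \<otimes> y)" "continuous_map T T (\<lambda>x. inv x)"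
    using tg unfolding topological_group_def by blast+
  show "group (G\<lparr>carrier := K\<rparr>)" by (rule subgroup_imp_group[OF K])
  show top: "topspace (subtopology T K) = carrier (G\<lparr>carrier := K\<rparr>)" using Kc T(1) by (simp add: Int_absorb1)
  show "continuous_map (prod_topology (subtopology T K) (subtopology T K)) (subtopology T K)
      (\<lambda>(x, y). x \<otimes>\<^bsub>G\<lparr>carrier := K\<rparr>\<^esub> y)"
  proof (rule continuous_map_into_subtopology)
    show "continuous_map (prod_topology (subtopology T K) (subtopology T K)) T (\<lambda>(x, y). x \<otimes>\<^bsub>G\<lparr>carrier := K\<rparr>\<^esub> y)"
      unfolding subtopology_Times[symmetric] using continuous_map_from_subtopology[OF T(2)] by simp
    show "(\<lambda>(x, y). x \<otimes>\<^bsub>G\<lparr>carrier := K\<rparr>\<^esub> y) \<in> topspace (prod_topology (subtopology T K) (subtopology T K)) \<rightarrow> K"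
      using subgroup.m_closed[OF K] by (auto simp: top)
  qed
  show "continuous_map (subtopology T K) (subtopology T K) (\<lambda>x. inv\<^bsub>G\<lparr>carrier := K\<rparr>\<^esub> x)"
  proof (rule continuous_map_eq)
    show "continuous_map (subtopology T K) (subtopology T K) (\<lambda>x. inv x)"
      by (rule continuous_map_into_subtopology[OF continuous_map_from_subtopology[OF T(3)]])
        (use subgroup.m_inv_closed[OF K] in \<open>auto simp: top\<close>)
    show "inv x = inv\<^bsub>G\<lparr>carrier := K\<rparr>\<^esub> x" if x: "x \<in> topspace (subtopology T K)" for x
      using x by (intro m_inv_consistent[OF K, symmetric]) (simp add: top)
  qed
qed

context soluble_profinite
begin

lemma idx_mono:
  assumes L: "open_normal L" and M: "subgroup M G" "L \<subseteq> M"
  shows "idx M \<le> idx L"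
  unfolding idx_def
proof (rule card_image_le_fibres(1)[OF finite_cosets[OF L]])
  fix x y assume xy: "x \<in> carrier G" "y \<in> carrier G" "L #> x = L #> y"
  have "subgroup L G" using L normal_imp_subgroup unfolding open_normal_def by blast
  then have "x \<otimes> inv y \<in> L" using coset_eq_iff[OF _ xy(1,2)] xy(3) by blast
  then show "M #> x = M #> y" using coset_eq_iff[OF M(1) xy(1,2)] M(2) by blast
qed

text \<open>The quotient of \<open>G / L\<close> by its power subgroup is \<open>G\<close> modulo the product of \<open>L\<close> with the power
  subgroup of \<open>G\<close>.\<close>

lemma idx_power_subgroup_le:
  assumes L: "open_normal L"
  shows "idx (power_subgroup G n <#> L) \<le> card (carrier ((G Mod L) Mod power_subgroup (G Mod L) n))"
proof -
  let ?Q = "G Mod L" and ?h = "\<lambda>g. L #> g" and ?P = "power_subgroup G n"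
  interpret q: group_hom G ?Q ?h by (rule coset_hom[OF L])
  have nL: "L \<lhd> G" using L by (simp add: open_normal_def)
  have surj: "?h ` carrier G = carrier ?Q" by (simp add: carrier_FactGroup)
  have PL: "?P <#> L \<lhd> G" "?P \<subseteq> ?P <#> L" "L \<subseteq> ?P <#> L"
    by (rule normal_set_mult[OF power_subgroup_normal nL])+
  have sPL: "subgroup (?P <#> L) G" by (rule normal_imp_subgroup[OF PL(1)])
  let ?R = "power_subgroup ?Q n"
  have R: "?R = ?h ` ?P" by (rule q.power_subgroup_image[OF surj])
  have sR: "subgroup ?R ?Q" by (rule normal_imp_subgroup[OF q.H.power_subgroup_normal])
  have im: "carrier (?Q Mod ?R) = (\<lambda>g. ?R #>\<^bsub>?Q\<^esub> ?h g) ` carrier G"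
    unfolding carrier_FactGroup[of ?Q] surj[symmetric] image_image ..
  show ?thesis
    unfolding idx_def im
  proof (rule card_image_le_fibres(1))
    have "(\<lambda>g. ?R #>\<^bsub>?Q\<^esub> ?h g) ` carrier G = (\<lambda>X. ?R #>\<^bsub>?Q\<^esub> X) ` ?h ` carrier G" by (simp only: image_image)
    then show "finite ((\<lambda>g. ?R #>\<^bsub>?Q\<^esub> ?h g) ` carrier G)" using finite_cosets[OF L] by simp
    fix x y assume xy: "x \<in> carrier G" "y \<in> carrier G" "?R #>\<^bsub>?Q\<^esub> ?h x = ?R #>\<^bsub>?Q\<^esub> ?h y"
    have "?h x \<otimes>\<^bsub>?Q\<^esub> inv\<^bsub>?Q\<^esub> ?h y \<in> ?R"
      using q.H.coset_eq_iff[OF sR q.hom_closed[OF xy(1)] q.hom_closed[OF xy(2)]] xy(3) by blast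
    moreover have "?h (x \<otimes> inv y) = ?h x \<otimes>\<^bsub>?Q\<^esub> inv\<^bsub>?Q\<^esub> ?h y"
      using q.hom_mult[OF xy(1) inv_closed[OF xy(2)]] q.hom_inv[OF xy(2)] by (rule trans[OF _ arg_cong])
    ultimately have "?h (x \<otimes> inv y) \<in> ?h ` (?P <#> L)" using image_mono[OF PL(2), of ?h] unfolding R by (metis subsetD)
    then have "x \<otimes> inv y \<in> ?P <#> L"
      by (rule iffD1[OF coset_mem_iff[OF L sPL PL(3) m_closed[OF xy(1) inv_closed[OF xy(2)]]]])
    then show "?P <#> L #> x = ?P <#> L #> y" using coset_eq_iff[OF sPL xy(1,2)] by blast
  qed
qed

text \<open>The indices of the open subgroups \<open>G\<^sup>n L\<close> are bounded, so one of these subgroups has largest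
  index; it is contained in all the others, which makes it the closure of \<open>G\<^sup>n\<close>.\<close>

lemma power_subgroup_closure_open:
  assumes bound: "\<And>L. open_normal L \<Longrightarrow> idx (power_subgroup G n <#> L) \<le> b"
  obtains H where "open_normal H" "power_subgroup G n \<subseteq> H" "\<And>L. open_normal L \<Longrightarrow> H \<subseteq> power_subgroup G n <#> L"
proof -
  let ?P = "power_subgroup G n"
  have PL: "?P <#> L \<lhd> G" "?P \<subseteq> ?P <#> L" "L \<subseteq> ?P <#> L" if L: "open_normal L" for L
    using normal_set_mult[OF power_subgroup_normal, of L n] L unfolding open_normal_def by blast+
  have oPL: "open_normal (?P <#> L)" if L: "open_normal L" for L by (rule open_normal_super[OF L PL(1)[OF L] PL(3)[OF L]])
  have "\<exists>L. open_normal L \<and> (\<forall>M. open_normal M \<longrightarrow> idx (?P <#> M) \<le> idx (?P <#> L))"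
    using open_normal_carrier bound by (intro ex_has_greatest_nat[where b = "Suc b"]) (auto simp: less_Suc_eq_le)
  then obtain L where L: "open_normal L" and max: "\<And>M. open_normal M \<Longrightarrow> idx (?P <#> M) \<le> idx (?P <#> L)" by blast
  have "?P <#> L \<subseteq> ?P <#> M" if M: "open_normal M" for M
  proof -
    have LM: "open_normal (M \<inter> L)" by (rule open_normal_Int[OF M L])
    have mono: "?P <#> (M \<inter> L) \<subseteq> ?P <#> L" "?P <#> (M \<inter> L) \<subseteq> ?P <#> M" unfolding set_mult_def by blast+
    have "?P <#> (M \<inter> L) = ?P <#> L"
      by (rule eq_if_idx_le[OF oPL[OF LM] normal_imp_subgroup[OF PL(1)[OF L]] mono(1)])
        (rule max[OF LM, THEN order_trans], simp)
    then show ?thesis using mono(2) by simp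
  qed
  then show thesis using that[OF oPL[OF L] PL(2)[OF L]] by blast
qed

text \<open>Descend along a chief series from \<open>G\<close> to \<open>L\<close>: since \<open>K\<close> centralizes each factor, the lower central series
  of \<open>K\<close> moves down at least one step at a time.\<close>

lemma lower_central_series_le_open:
  assumes K: "subgroup K G" and cent: "\<And>L M. open_normal L \<Longrightarrow> chief L M \<Longrightarrow> K \<subseteq> centralizer_mod L M"
    and L: "open_normal L"
  shows "\<exists>n. lower_central_series (G\<lparr>carrier := K\<rparr>) n \<subseteq> L"
proof -
  let ?\<gamma> = "lower_central_series (G\<lparr>carrier := K\<rparr>)"
  have Kc: "K \<subseteq> carrier G" by (rule subgroup.subset[OF K])
  have gen: "generate (G\<lparr>carrier := K\<rparr>) S = generate G S" if S: "S \<subseteq> K" for S by (rule generate_consistent[OF S K])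
  have \<gamma>_sub: "?\<gamma> n \<subseteq> K \<and> ?\<gamma> (Suc n) = generate G (\<Union>x\<in>?\<gamma> n. \<Union>y\<in>K. {commutator x y})" for n
  proof (induction n)
    case 0
    have "(\<Union>x\<in>K. \<Union>y\<in>K. {x \<otimes> y \<otimes> inv\<^bsub>G\<lparr>carrier := K\<rparr>\<^esub> x \<otimes> inv\<^bsub>G\<lparr>carrier := K\<rparr>\<^esub> y}) = (\<Union>x\<in>K. \<Union>y\<in>K. {commutator x y})"
      using m_inv_consistent[OF K] by (simp add: commutator_def)
    moreover have "(\<Union>x\<in>K. \<Union>y\<in>K. {commutator x y}) \<subseteq> K"
      using subgroup.m_closed[OF K] subgroup.m_inv_closed[OF K] by (auto simp: commutator_def)
    ultimately show ?case using gen by simp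
  next
    case (Suc n)
    have "(\<Union>x\<in>?\<gamma> n. \<Union>y\<in>K. {commutator x y}) \<subseteq> K"
      using subgroup.m_closed[OF K] subgroup.m_inv_closed[OF K] Suc by (auto simp: commutator_def)
    then have sub: "?\<gamma> (Suc n) \<subseteq> K" using Suc generate_subgroup_incl[OF _ K] by simp
    have "(\<Union>x\<in>?\<gamma> (Suc n). \<Union>y\<in>K. {x \<otimes> y \<otimes> inv\<^bsub>G\<lparr>carrier := K\<rparr>\<^esub> x \<otimes> inv\<^bsub>G\<lparr>carrier := K\<rparr>\<^esub> y})
        = (\<Union>x\<in>?\<gamma> (Suc n). \<Union>y\<in>K. {commutator x y})"
      by (intro SUP_cong refl) (use m_inv_consistent[OF K] sub in \<open>simp add: commutator_def subset_iff\<close>)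
    moreover have "(\<Union>x\<in>?\<gamma> (Suc n). \<Union>y\<in>K. {commutator x y}) \<subseteq> K"
    proof (intro UN_least subsetI)
      fix x y z assume x: "x \<in> ?\<gamma> (Suc n)" and y: "y \<in> K" and z: "z \<in> {commutator x y}"
      have "x \<in> K" by (rule subsetD[OF sub x])
      then show "z \<in> K" using y z subgroup.m_closed[OF K] subgroup.m_inv_closed[OF K] by (simp add: commutator_def)
    qed
    ultimately have "?\<gamma> (Suc (Suc n)) = generate G (\<Union>x\<in>?\<gamma> (Suc n). \<Union>y\<in>K. {commutator x y})"
      by (subst lower_central_series.simps(2)) (simp add: gen del: lower_central_series.simps)
    then show ?case using sub by blast
  qed
  have nL: "L \<lhd> G" using L by (simp add: open_normal_def)
  have "\<exists>n. ?\<gamma> n \<subseteq> L" if M: "M \<lhd> G" "L \<subseteq> M" "?\<gamma> n \<subseteq> M" for M n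
    using M
  proof (induction "idx L - idx M" arbitrary: M n rule: less_induct)
    case less
    note M = less.prems
    show ?case
    proof (cases "M = L")
      case True
      then show ?thesis using M(3) by blast
    next
      case False
      then have "\<exists>X. (X \<lhd> G \<and> L \<subseteq> X \<and> X \<subset> M) \<and> (\<forall>Y. Y \<lhd> G \<and> L \<subseteq> Y \<and> Y \<subset> M \<longrightarrow> idx X \<le> idx Y)"
        using nL M(2) by (intro ex_has_least_nat[where k = L]) blast
      then obtain X where X: "X \<lhd> G" "L \<subseteq> X" "X \<subset> M"
          and least: "\<And>Y. Y \<lhd> G \<Longrightarrow> L \<subseteq> Y \<Longrightarrow> Y \<subset> M \<Longrightarrow> idx X \<le> idx Y" by blast
      have oX: "open_normal X" by (rule open_normal_super[OF L X(1,2)])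
      have ch: "chief X M"
        unfolding chief_def
      proof (intro conjI allI impI)
        fix Y assume Y: "Y \<lhd> G" "X \<subseteq> Y" "Y \<subseteq> M"
        show "Y = X \<or> Y = M"
        proof (cases "Y = M")
          case False
          then have "Y \<subset> M" using Y(3) by blast
          then have "idx X \<le> idx Y" by (intro least Y(1) order_trans[OF X(2) Y(2)])
          then have "X = Y" by (rule eq_if_idx_le[OF oX normal_imp_subgroup[OF Y(1)] Y(2)])
          then show ?thesis by simp
        qed simp
      qed (rule X(1) M(1) X(3))+
      have sX: "subgroup X G" by (rule normal_imp_subgroup[OF X(1)])
      have "(\<Union>x\<in>?\<gamma> n. \<Union>y\<in>K. {commutator x y}) \<subseteq> X"
      proof (intro UN_least subsetI)
        fix x y z assume x: "x \<in> ?\<gamma> n" and y: "y \<in> K" and z: "z \<in> {commutator x y}"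
        have xM: "x \<in> M" by (rule subsetD[OF M(3) x])
        have "y \<in> centralizer_mod X M" by (rule subsetD[OF cent[OF oX ch] y])
        then have "commutator y x \<in> X" using xM unfolding centralizer_mod_def by blast
        then have "inv (commutator y x) \<in> X" by (rule subgroup.m_inv_closed[OF sX])
        moreover have "x \<in> carrier G" "y \<in> carrier G" using xM y Kc normal_subset[OF M(1)] by blast+
        ultimately show "z \<in> X" using z by (simp add: inv_commutator)
      qed
      then have "?\<gamma> (Suc n) \<subseteq> X" unfolding conjunct2[OF \<gamma>_sub] by (rule generate_subgroup_incl[OF _ sX])
      moreover have "idx M < idx X"
      proof (rule ccontr)
        assume "\<not> idx M < idx X"
        then have "X = M" by (intro eq_if_idx_le[OF oX normal_imp_subgroup[OF M(1)]] psubset_imp_subset X(3)) simp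
        then show False using X(3) by simp
      qed
      moreover have "idx X \<le> idx L" by (rule idx_mono[OF L sX X(2)])
      ultimately show ?thesis by (intro less.hyps[of X "Suc n"] X(1,2)) simp_all
    qed
  qed
  from this[OF normal_self normal_subset[OF nL], of 0] show ?thesis using Kc by simp
qed

lemma pronilpotent_if_centralizes_chief_factors:
  assumes K: "subgroup K G" "closedin T K"
    and cent: "\<And>L M. open_normal L \<Longrightarrow> chief L M \<Longrightarrow> K \<subseteq> centralizer_mod L M"
  shows "pronilpotent (G\<lparr>carrier := K\<rparr>) (subtopology T K)"
proof -
  let ?K = "G\<lparr>carrier := K\<rparr>"
  interpret K: group ?K by (rule subgroup_imp_group[OF K(1)])
  have Kc: "K \<subseteq> carrier G" by (rule subgroup.subset[OF K(1)])
  show ?thesis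
  proof (rule proI[where \<N> = "(\<lambda>L. L \<inter> K) ` {L. open_normal L}"])
    show "topological_group ?K (subtopology T K)" by (rule topological_subgroup[OF tg K(1)])
    show "compact_space (subtopology T K)"
      by (rule compact_space_subtopology[OF closedin_compact_space[OF comp K(2)]])
    show "(\<lambda>L. L \<inter> K) ` {L. open_normal L} \<noteq> {}" using open_normal_carrier by blast
    show "\<Inter>((\<lambda>L. L \<inter> K) ` {L. open_normal L}) = {\<one>\<^bsub>?K\<^esub>}"
    proof (rule equalityI)
      have "\<Inter>((\<lambda>L. L \<inter> K) ` {L. open_normal L}) \<subseteq> \<Inter>\<N>" using base_open_normal by blast
      then show "\<Inter>((\<lambda>L. L \<inter> K) ` {L. open_normal L}) \<subseteq> {\<one>\<^bsub>?K\<^esub>}" unfolding base_Inter by simp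
      have "\<one> \<in> L" if "open_normal L" for L
        using that subgroup.one_closed[OF normal_imp_subgroup] unfolding open_normal_def by blast
      then show "{\<one>\<^bsub>?K\<^esub>} \<subseteq> \<Inter>((\<lambda>L. L \<inter> K) ` {L. open_normal L})" using subgroup.one_closed[OF K(1)] by simp
    qed
  next
    fix A B assume "A \<in> (\<lambda>L. L \<inter> K) ` {L. open_normal L}" "B \<in> (\<lambda>L. L \<inter> K) ` {L. open_normal L}"
    then obtain L M where LM: "open_normal L" "open_normal M" "A = L \<inter> K" "B = M \<inter> K" by blast
    show "\<exists>D\<in>(\<lambda>L. L \<inter> K) ` {L. open_normal L}. D \<subseteq> A \<inter> B"
      using open_normal_Int[OF LM(1,2)] by (intro bexI[of _ "(L \<inter> M) \<inter> K"]) (auto simp: LM(3,4))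
  next
    fix A assume "A \<in> (\<lambda>L. L \<inter> K) ` {L. open_normal L}"
    then obtain L where L: "open_normal L" "A = L \<inter> K" by blast
    have nL: "L \<lhd> G" using L(1) by (simp add: open_normal_def)
    have sL: "subgroup L G" by (rule normal_imp_subgroup[OF nL])
    show "openin (subtopology T K) A"
      unfolding L(2) using L(1) by (simp add: open_normal_def openin_subtopology_Int)
    have nA: "A \<lhd> ?K" unfolding L(2) by (rule normal_Int_subgroup[OF K(1) nL])
    have "finite ((\<lambda>g. A #>\<^bsub>?K\<^esub> g) ` K)"
    proof (rule card_image_le_fibres(2))
      show "finite ((\<lambda>g. L #> g) ` K)" by (rule finite_subset[OF image_mono[OF Kc] finite_cosets[OF L(1)]])
      fix x y assume xy: "x \<in> K" "y \<in> K" "L #> x = L #> y"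
      have c: "x \<in> carrier G" "y \<in> carrier G" using xy Kc by blast+
      have "x \<otimes> inv y \<in> L" using coset_eq_iff[OF sL c] xy(3) by blast
      moreover have "x \<otimes> inv y \<in> K" by (rule subgroup.m_closed[OF K(1) xy(1) subgroup.m_inv_closed[OF K(1) xy(2)]])
      ultimately have "x \<otimes>\<^bsub>?K\<^esub> inv\<^bsub>?K\<^esub> y \<in> A" using m_inv_consistent[OF K(1) xy(2)] L(2) by simp
      then show "A #>\<^bsub>?K\<^esub> x = A #>\<^bsub>?K\<^esub> y"
        using K.coset_eq_iff[OF normal_imp_subgroup[OF nA], of x y] xy(1,2) by simp
    qed
    then have fin: "finite ((\<lambda>g. A #>\<^bsub>?K\<^esub> g) ` carrier ?K)" by simp
    obtain F :: "nat monoid" and h where F: "group F" "finite (carrier F)" "h \<in> hom ?K F"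
        "h ` carrier ?K = carrier F" "kernel ?K F h = A"
      using K.finite_quotient_nat[OF nA fin] by blast
    interpret h: group_hom ?K F h using F K.is_group by (simp add: group_hom_def group_hom_axioms_def)
    obtain n where n: "lower_central_series ?K n \<subseteq> L" using lower_central_series_le_open[OF K(1) cent L(1)] by blast
    have \<gamma>: "lower_central_series ?K n \<subseteq> carrier ?K" "lower_central_series F n = h ` lower_central_series ?K n"
      using h.lower_central_series_image[OF F(4)] by blast+
    have "lower_central_series ?K n \<subseteq> kernel ?K F h" unfolding F(5) L(2) using n \<gamma>(1) by simp
    then have "lower_central_series F n \<subseteq> {\<one>\<^bsub>F\<^esub>}" unfolding \<gamma>(2) kernel_def by blast
    moreover have "\<one>\<^bsub>F\<^esub> \<in> lower_central_series F n" by (cases n) (simp_all add: generate.one)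
    ultimately have "nilpotent_group F" unfolding nilpotent_group_def using F(1) by blast
    then show "\<exists>(F :: nat monoid) h. group F \<and> finite (carrier F) \<and> nilpotent_group F \<and> h \<in> hom ?K F \<and>
        h ` carrier ?K = carrier F \<and> kernel ?K F h = A"
      using F by blast
  qed
qed

lemma pronilpotent_by_metabelian:
  assumes H: "open_normal H"
    and cent: "\<And>L M. open_normal L \<Longrightarrow> chief L M \<Longrightarrow> derived G (derived G H) \<subseteq> centralizer_mod L M"
  shows "\<exists>K. K \<lhd> G\<lparr>carrier := H\<rparr> \<and> closedin (subtopology T H) K \<and>
           pronilpotent (G\<lparr>carrier := K\<rparr>) (subtopology T K) \<and> metabelian (G\<lparr>carrier := H\<rparr> Mod K)"
proof -
  \<comment> \<open>The centralizer of a chief factor \<open>M / L\<close> contains the open subgroup \<open>L\<close>, and is therefore closed.\<close>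
  define \<K> where "\<K> = insert H {centralizer_mod L M | L M. open_normal L \<and> chief L M}"
  define K where "K = \<Inter>\<K>"
  have nH: "H \<lhd> G" using H by (simp add: open_normal_def)
  have sH: "subgroup H G" by (rule normal_imp_subgroup[OF nH])
  have ne: "\<K> \<noteq> {}" by (simp add: \<K>_def)
  have mem: "X \<lhd> G \<and> closedin T X \<and> derived G (derived G H) \<subseteq> X" if X: "X \<in> \<K>" for X
  proof (cases "X = H")
    case True
    have "derived G (derived G H) \<subseteq> H"
      by (rule derived_incl[OF derived_incl[OF order_refl sH] sH])
    then show ?thesis using True nH open_supergroup(2)[OF H sH order_refl] by simp
  next
    case False
    then obtain L M where LM: "open_normal L" "chief L M" "X = centralizer_mod L M" using X unfolding \<K>_def by blast
    have n: "L \<lhd> G" "M \<lhd> G" "L \<subseteq> M" using LM(2) by (auto simp: chief_def)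
    have nX: "X \<lhd> G"
      unfolding LM(3) by (rule centralizer_mod_normal[OF n(1) normal_subset[OF n(2)] normal_conj(1)[OF n(2)]])
    have "L \<subseteq> X"
    proof
      fix l assume l: "l \<in> L"
      have "commutator l m \<in> L" if m: "m \<in> M" for m
        by (rule commutator_in_normal[OF n(1) subsetD[OF normal_subset[OF n(1)] l] subsetD[OF normal_subset[OF n(2)] m] disjI1[OF l]])
      then show "l \<in> X" unfolding LM(3) centralizer_mod_def using l subsetD[OF normal_subset[OF n(1)] l] by blast
    qed
    then have "closedin T X" by (rule open_supergroup(2)[OF LM(1) normal_imp_subgroup[OF nX]])
    then show ?thesis using nX cent[OF LM(1,2)] LM(3) by simp
  qed
  have nK: "K \<lhd> G" unfolding K_def using mem by (intro normal_Inter[OF ne]) blast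
  have KH: "K \<subseteq> H" by (auto simp: K_def \<K>_def)
  have clK: "closedin T K" unfolding K_def using mem by (intro closedin_Inter[OF ne]) blast
  have dK: "derived G (derived G H) \<subseteq> K" unfolding K_def using mem by blast
  have nKH: "K \<lhd> G\<lparr>carrier := H\<rparr>" by (rule normal_restrict_supergroup[OF sH nK KH])
  interpret H: group "G\<lparr>carrier := H\<rparr>" by (rule subgroup_imp_group[OF sH])
  have "derived (G\<lparr>carrier := H\<rparr>) (derived (G\<lparr>carrier := H\<rparr>) (carrier (G\<lparr>carrier := H\<rparr>))) \<subseteq> K"
    using dK derived_consistent[OF order_refl sH] derived_consistent[OF derived_incl[OF order_refl sH] sH] by simp
  then have "metabelian (G\<lparr>carrier := H\<rparr> Mod K)" by (rule H.metabelian_quotient[OF nKH])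
  moreover have "closedin (subtopology T H) K"
    unfolding closedin_subtopology using clK KH by blast
  moreover have "pronilpotent (G\<lparr>carrier := K\<rparr>) (subtopology T K)"
    by (rule pronilpotent_if_centralizes_chief_factors[OF normal_imp_subgroup[OF nK] clK])
      (auto simp: K_def \<K>_def)
  ultimately show ?thesis using nKH by blast
qed

end

theorem corollary1p9:
  fixes G :: "('a, 'm) monoid_scheme" and T :: "'a topology"
  assumes "prosoluble G T"
    and "has_PIG G T"
  shows "\<exists>H K. H \<lhd> G \<and> openin T H \<and>
           K \<lhd> G\<lparr>carrier := H\<rparr> \<and> closedin (subtopology T H) K \<and>
           pronilpotent (G\<lparr>carrier := K\<rparr>) (subtopology T K) \<and>
           metabelian (G\<lparr>carrier := H\<rparr> Mod K)"
proof -
  have tg: "topological_group G T" and comp: "compact_space T"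
    by (rule pro_imp_compact_open_base[OF assms(1)])+
  obtain \<N> where base: "\<N> \<noteq> {}" "\<Inter>\<N> = {\<one>\<^bsub>G\<^esub>}" "\<forall>A\<in>\<N>. \<forall>B\<in>\<N>. \<exists>D\<in>\<N>. D \<subseteq> A \<inter> B"
      "\<forall>N\<in>\<N>. N \<lhd> G \<and> openin T N \<and>
        (\<exists>(F :: nat monoid) h. group F \<and> finite (carrier F) \<and> solvable F \<and> h \<in> hom G F \<and> kernel G F h = N)"
    using pro_imp_compact_open_base(3)[OF assms(1)] by (elim exE conjE)
  interpret G: group G using tg by (simp add: topological_group_def)
  interpret soluble_profinite G T \<N>
  proof (intro soluble_profinite.intro soluble_profinite_axioms.intro G.is_group)
    show "topological_group G T" "compact_space T" "\<N> \<noteq> {}" "\<Inter>\<N> = {\<one>\<^bsub>G\<^esub>}" by (rule tg comp base(1) base(2))+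
    show "\<exists>D\<in>\<N>. D \<subseteq> A \<inter> B" if "A \<in> \<N>" "B \<in> \<N>" for A B by (rule base(3)[rule_format, OF that])
  next
    fix M assume M: "M \<in> \<N>"
    note b = base(4)[rule_format, OF M]
    show "M \<lhd> G" "openin T M" by (rule conjunct1[OF b], rule conjunct1[OF conjunct2[OF b]])
    show "\<exists>(F :: nat monoid) h. group F \<and> finite (carrier F) \<and> solvable F \<and> h \<in> hom G F \<and> kernel G F h = M"
      by (rule conjunct2[OF conjunct2[OF b]])
  qed
  obtain \<alpha> :: real where \<alpha>: "\<forall>N. N \<lhd> G \<and> openin T N \<and> finite (carrier (G Mod N)) \<longrightarrow>
      (\<forall>n :: nat. 1 \<le> n \<longrightarrow> real (card (carrier ((G Mod N) Mod power_subgroup (G Mod N) n))) \<le> real n powr \<alpha>)"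
    using assms(2) unfolding has_PIG_def by blast
  have pig: "real (card (carrier ((G Mod L) Mod power_subgroup (G Mod L) n))) \<le> real n powr \<alpha>"
    if L: "open_normal L" and n: "1 \<le> n" for L n
    using \<alpha>[rule_format, of L n] L n finite_cosets[OF L] by (simp add: open_normal_def carrier_FactGroup[of G])
  obtain N where N: "PIG_exponent \<alpha> N" using PIG_exponent_exists by blast
  have N1: "1 \<le> N" using N by (simp add: PIG_exponent_def)
  have "idx (power_subgroup G N <#>\<^bsub>G\<^esub> L) \<le> nat \<lfloor>real N powr \<alpha>\<rfloor>" if L: "open_normal L" for L
    using order_trans[OF idx_power_subgroup_le[OF L, of N, THEN of_nat_mono] pig[OF L N1]] by (simp add: le_nat_floor)
  from power_subgroup_closure_open[of N, OF this]
  obtain H where H: "open_normal H" "power_subgroup G N \<subseteq> H" "\<And>L. open_normal L \<Longrightarrow> H \<subseteq> power_subgroup G N <#>\<^bsub>G\<^esub> L" by blast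
  have nH: "H \<lhd> G" "openin T H" using H(1) by (simp_all add: open_normal_def)
  have Hc: "H \<subseteq> carrier G" by (rule G.normal_subset[OF nH(1)])
  have "derived G (derived G H) \<subseteq> G.centralizer_mod L M" if LM: "open_normal L" "G.chief L M" for L M
  proof
    fix d assume d: "d \<in> derived G (derived G H)"
    have "d \<in> carrier G" by (rule subsetD[OF G.derived_in_carrier[OF G.derived_in_carrier[OF Hc]] d])
    moreover have "G.commutator d m \<in> L" if m: "m \<in> M" for m
      by (rule chief_factors_centralized[OF N pig H(2) Hc H(3) LM d m])
    ultimately show "d \<in> G.centralizer_mod L M" unfolding G.centralizer_mod_def by blast
  qed
  from pronilpotent_by_metabelian[OF H(1) this] show ?thesis using nH by blast
qed

end
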